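(* Let $\Omega\subset\mathbb{R}^d$ ($d\ge 1$) be a bounded open polyhedral set, $T>0$, $\mathbf F:\mathbb{R}\to\mathbb{R}^d$ a regular (continuously differentiable) flux function and $u_0\in L^1(\Omega)$. Let $(\mathcal M^{(m)})_{m\in\mathbb N}$ be a sequence of meshes of $\Omega$ (each equipped with points $(\mathbf x_K)_{K}$ and a dual mesh $(D_\sigma)_\sigma$) and $(\mathcal T^{(m)})_{m\in\mathbb N}$ a sequence of time discretizations of $(0,T)$, with mesh sizes $h_{\mathcal M^{(m)}}$ and time steps $\delta t_{\mathcal T^{(m)}}$ tending to $0$ as $m\to+\infty$. For each $m$, let $(u_K^n)_{K\in\mathcal M^{(m)},\,0\le n\le N^{(m)}}$ satisfy the finite volume scheme $$\frac{|K|}{t_{n+1}-t_n}(u_K^{n+1}-u_K^n)+\sum_{\sigma\in\mathcal E_K}|\sigma|\,\mathbf F_\sigma^n\cdot\mathbf n_{K,\sigma}=0,\qquad K\in\mathcal M^{(m)},\ 0\le n<N^{(m)},$$ with initial condition $u_K^0=\frac1{|K|}\int_K u_0(\mathbf x)\,d\mathbf x$ for $K\in\mathcal M^{(m)}$, where $\mathbf F_\sigma^n\in\mathbb{R}^d$ is the numerical flux on the face $\sigma$ at step $n$ (the same vector for the two cells sharing $\sigma$; the fluxes on exterior faces are given by some choice of boundary fluxes). Let $u^{(m)}:\Omega\times(0,T)\to\mathbb R$ be the function equal to $u_K^n$ on $K\times(t_n,t_{n+1}]$ for $K\in\mathcal M^{(m)}$, $0\le n<N^{(m)}$. Assume that $(u^{(m)})_{m\in\mathbb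 N}$ converges in $L^1(\Omega\times(0,T))$ to a function $\bar u$, and furthermore that: (i) $(\mathbf F(u^{(m)}))_{m\in\mathbb N}$ converges to $\mathbf F(\bar u)$ in $L^1(\Omega\times(0,T))^d$; (ii) there exists $\theta^\nabla\in\mathbb R_+$ such that $\theta^\nabla_{\mathcal M^{(m)}}\le\theta^\nabla$ for all $m\in\mathbb N$; (iii) there exists a real number $C_F$, depending only on $\mathbf F$ (in particular independent of $m$, $n$ and $\sigma$), such that for all $m\in\mathbb N$, all interior faces $\sigma=K|L$ of $\mathcal M^{(m)}$ and all $0\le n<N^{(m)}$, $$|\mathbf F_\sigma^n-\mathbf F(u_K^n)|\le C_F\,|u_K^n-u_L^n|,\qquad |\mathbf F_\sigma^n-\mathbf F(u_L^n)|\le C_F\,|u_K^n-u_L^n|;$$ (iv) there exist $\theta>0$ and $\mathcal N_{\mathcal E}\in\mathbb N$ such that, for all $m\in\mathbb N$, $\theta_{\mathcal M^{(m)}}\le\theta$ and every cell of $\mathcal M^{(m)}$ has at most $\mathcal N_{\mathcal E}$ faces. Then $\bar u$ is a weak solution of $\partial_t u+\operatorname{div}(\mathbf F(u))=0$ with initial datum $u_0$, in the sense that $$-\int_0^T\!\!\int_\Omega\Bigl(\bar u\,\partial_t\varphi+\mathbf F(\bar u)\cdot\nabla\varphi\Bigr)\,d\mathbf x\,dt=\int_\Omega u_0(\mathbf x)\,\varphi(\mathbf x,0)\,d\mathbf x\qquad\text{for all }\varphi\in C_c^\infty(\Omega\times[0,T)).$$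
   Context: Mesh. A mesh $\mathcal M$ of $\Omega$ is a finite partition of $\Omega$ (up to null sets) into measurable polyhedral sets $K$ (cells); the boundary of each $K$ is a finite union of parts of hyperplanes, the faces of $K$: $\partial K=\cup_{\sigma\in\mathcal E_K}\sigma$, where $\mathcal E_K$ is the set of faces of $K$. $\mathcal E=\cup_K\mathcal E_K$ is the set of all faces and $|\sigma|$ is the $(d-1)$-dimensional measure of $\sigma$. A face is interior ($\sigma\in\mathcal E_{\rm int}$) if it is shared by two distinct cells $K,L$, i.e. $\sigma\in\mathcal E_K\cap\mathcal E_L$, written $\sigma=K|L$; the remaining (exterior) faces $\mathcal E_{\rm ext}=\mathcal E\setminus\mathcal E_{\rm int}$ lie on $\partial\Omega$. $h_K$ is the diameter of $K$ and $h_{\mathcal M}=\max_K h_K$. $\mathbf n_{K,\sigma}$ is the unit normal vector to $\sigma\in\mathcal E_K$ outward $K$. $|A|$ is the Lebesgue measure of $A\subset\mathbb{R}^d$. Each mesh comes with a choice of points $\mathbf x_K\in K$, $K\in\mathcal M$, and with a dual mesh: a partition $\Omega=\cup_{\sigma\in\mathcal E}D_\sigma$ (up to null sets) into measurable sets indexed by the faces, where for $\sigma=K|L$ one has $D_\sigma\subset K\cup L$ and $|D_\sigma|>0$. Regularity parameters: $$\theta^\nabla_{\mathcal M}=\max_{\sigma\in\mathcal E_{\rm int},\,\sigma=K|L}\frac{|\sigma|\,|\mathbf x_L-\mathbf x_K|}{|D_\sigma|},\qquad \theta_{\mathcal M}=\max_{K\in\mathcal M}\max_{\sigma\in\mathcal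 E_K}\frac{|D_\sigma|}{|K|}.$$ Time discretization: $\mathcal T=(t_n)_{0\le n\le N}$ with $0=t_0<t_1<\dots<t_N=T$, and $\delta t_{\mathcal T}=\max_{0\le n<N}(t_{n+1}-t_n)$. For index $m$, the number of steps is $N^{(m)}$; the dependence of $t_n$, $u_K^n$, $\mathbf F_\sigma^n$ on $m$ is omitted in the notation. $C_c^\infty(\Omega\times[0,T))$ denotes smooth functions with compact support in $\Omega\times[0,T)$ (not required to vanish at $t=0$). *)

theory Defs
  imports "HOL-Analysis.Analysis"
begin

text \<open>
  Polyhedral sets: Boolean combinations of half-spaces. This covers open, closed, non-convex and
  disconnected polyhedral sets; such a set is Borel and its boundary is covered by finitely many
  hyperplanes.
\<close>

inductive polyhedral :: "'a::euclidean_space set \<Rightarrow> bool" where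
  half_space: "polyhedral {x. a \<bullet> x \<le> b}"
| compl: "polyhedral S \<Longrightarrow> polyhedral (- S)"
| inter: "polyhedral S \<Longrightarrow> polyhedral S' \<Longrightarrow> polyhedral (S \<inter> S')"


text \<open>
  The \<open>(d-1)\<close>-dimensional Lebesgue measure of a part \<open>S\<close> of a hyperplane is the volume of the
  right cylinder of height \<open>1\<close> over \<open>S\<close>. The choice of the unit normal is irrelevant: it is unique
  up to sign unless \<open>S\<close> has dimension less than \<open>d-1\<close>, and then all these cylinders are null sets.
  For \<open>d = 1\<close> a point has measure \<open>1\<close>.
\<close>

definition unit_normal :: "'a::euclidean_space set \<Rightarrow> 'a \<Rightarrow> bool" where
  "unit_normal S n \<longleftrightarrow> norm n = 1 \<and> (\<forall>x\<in>S. \<forall>y\<in>S. n \<bullet> (x - y) = 0)"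

definition cylinder :: "'a::euclidean_space \<Rightarrow> 'a set \<Rightarrow> 'a set" where
  "cylinder n S = {x + s *\<^sub>R n | x s. x \<in> S \<and> 0 \<le> s \<and> s \<le> 1}"

definition surface_measure :: "'a::euclidean_space set \<Rightarrow> real" where
  "surface_measure S = measure lebesgue (cylinder (SOME n. unit_normal S n) S)"

text \<open>
  At almost every point of the face (for the surface measure), \<open>n\<close> points out of \<open>K\<close> and \<open>- n\<close>
  points into \<open>K\<close>. This determines \<open>n\<close> if the face has positive surface measure; otherwise
  \<open>normal K S\<close> is only ever multiplied by \<open>0\<close>.
\<close>

definition outward_unit_normal :: "'a::euclidean_space set \<Rightarrow> 'a set \<Rightarrow> 'a \<Rightarrow> bool" where
  "outward_unit_normal K S n \<longleftrightarrow>
     unit_normal S n \<and>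
     negligible (cylinder n
       {x \<in> S. \<not> (\<exists>e>0. \<forall>s. 0 < s \<and> s < e \<longrightarrow> x - s *\<^sub>R n \<in> K \<and> x + s *\<^sub>R n \<notin> K)})"

definition normal :: "'a::euclidean_space set \<Rightarrow> 'a set \<Rightarrow> 'a" where
  "normal K S = (SOME n. outward_unit_normal K S n)"


text \<open>Finite partition up to null sets, as an indexed family.\<close>

definition ae_partition :: "'a::euclidean_space set \<Rightarrow> 'i set \<Rightarrow> ('i \<Rightarrow> 'a set) \<Rightarrow> bool" where
  "ae_partition \<Omega> I A \<longleftrightarrow>
     finite I \<and>
     (\<forall>i\<in>I. A i \<in> sets lebesgue) \<and>
     (\<forall>i\<in>I. \<forall>j\<in>I. i \<noteq> j \<longrightarrow> negligible (A i \<inter> A j)) \<and>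
     negligible (sym_diff \<Omega> (\<Union>i\<in>I. A i))"

text \<open>
  \<open>faces M K\<close> is \<open>\<E>\<^sub>K\<close>, \<open>point M K\<close> is \<open>x\<^sub>K\<close> and \<open>dual M \<sigma>\<close> is \<open>D\<^sub>\<sigma>\<close>. Cells and faces are
  identified with the point sets themselves, so that a face is shared by \<open>K\<close> and \<open>L\<close> iff it
  belongs to both \<open>faces M K\<close> and \<open>faces M L\<close>.
\<close>

record 'a mesh =
  cells :: "'a set set"
  faces :: "'a set \<Rightarrow> 'a set set"
  point :: "'a set \<Rightarrow> 'a"
  dual :: "'a set \<Rightarrow> 'a set"

definition all_faces :: "'a mesh \<Rightarrow> 'a set set" where
  "all_faces M = (\<Union>K\<in>cells M. faces M K)"

definition shared_face :: "'a mesh \<Rightarrow> 'a set \<Rightarrow> 'a set \<Rightarrow> 'a set \<Rightarrow> bool" where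
  "shared_face M K L \<sigma> \<longleftrightarrow>
     K \<in> cells M \<and> L \<in> cells M \<and> K \<noteq> L \<and> \<sigma> \<in> faces M K \<and> \<sigma> \<in> faces M L"

definition interior_faces :: "'a mesh \<Rightarrow> 'a set set" where
  "interior_faces M = {\<sigma>. \<exists>K L. shared_face M K L \<sigma>}"

definition exterior_faces :: "'a mesh \<Rightarrow> 'a set set" where
  "exterior_faces M = all_faces M - interior_faces M"

text \<open>
  The faces of a cell overlap only in sets of zero surface measure, as is implicit in the
  decomposition of the boundary into faces.
\<close>

definition is_cell :: "'a::euclidean_space set \<Rightarrow> 'a set set \<Rightarrow> bool" where
  "is_cell K E \<longleftrightarrow>
     polyhedral K \<and> 0 < measure lebesgue K \<and>
     finite E \<and> frontier K = \<Union>E \<and>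
     (\<forall>\<sigma>\<in>E. \<sigma> \<in> sets borel \<and>
        (\<exists>a b. a \<noteq> 0 \<and> \<sigma> \<subseteq> {x. a \<bullet> x = b}) \<and>
        (\<exists>n. outward_unit_normal K \<sigma> n)) \<and>
     (\<forall>\<sigma>\<in>E. \<forall>\<tau>\<in>E. \<sigma> \<noteq> \<tau> \<longrightarrow> surface_measure (\<sigma> \<inter> \<tau>) = 0)"

definition is_mesh :: "'a::euclidean_space set \<Rightarrow> 'a mesh \<Rightarrow> bool" where
  "is_mesh \<Omega> M \<longleftrightarrow>
     ae_partition \<Omega> (cells M) (\<lambda>K. K) \<and>
     (\<forall>K\<in>cells M. K \<subseteq> closure \<Omega> \<and> is_cell K (faces M K) \<and> point M K \<in> K) \<and>
     (\<forall>\<sigma>\<in>exterior_faces M. \<sigma> \<subseteq> frontier \<Omega>) \<and>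
     ae_partition \<Omega> (all_faces M) (dual M) \<and>
     (\<forall>K L \<sigma>. shared_face M K L \<sigma> \<longrightarrow>
        dual M \<sigma> \<subseteq> K \<union> L \<and> 0 < measure lebesgue (dual M \<sigma>))"

definition mesh_size :: "'a::euclidean_space mesh \<Rightarrow> real" where
  "mesh_size M = (MAX K\<in>cells M. diameter K)"

text \<open>
  All quantities below are nonnegative; inserting \<open>0\<close> only matters for a maximum over an empty set
  (for instance, for a mesh without interior faces).
\<close>

definition theta_grad :: "'a::euclidean_space mesh \<Rightarrow> real" where
  "theta_grad M = Max (insert 0
     {surface_measure \<sigma> * norm (point M L - point M K) / measure lebesgue (dual M \<sigma>)
        | K L \<sigma>. shared_face M K L \<sigma>})"

definition theta :: "'a::euclidean_space mesh \<Rightarrow> real" where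
  "theta M = Max (insert 0
     {measure lebesgue (dual M \<sigma>) / measure lebesgue K
        | K \<sigma>. K \<in> cells M \<and> \<sigma> \<in> faces M K})"


definition time_discretization :: "real \<Rightarrow> nat \<Rightarrow> (nat \<Rightarrow> real) \<Rightarrow> bool" where
  "time_discretization T N t \<longleftrightarrow> t 0 = 0 \<and> t N = T \<and> (\<forall>n<N. t n < t (Suc n))"

definition time_step :: "nat \<Rightarrow> (nat \<Rightarrow> real) \<Rightarrow> real" where
  "time_step N t = (MAX n\<in>{..<N}. t (Suc n) - t n)"

text \<open>
  The function equal to \<open>u n K\<close> on \<open>K \<times> (t n, t (Suc n)]\<close>. As cells only form a partition up to
  null sets, this holds outside the null set where two cells overlap.
\<close>

definition step_function ::
  "'a::euclidean_space mesh \<Rightarrow> nat \<Rightarrow> (nat \<Rightarrow> real) \<Rightarrow> (nat \<Rightarrow> 'a set \<Rightarrow> real) \<Rightarrow> 'a \<times> real \<Rightarrow> real"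
where
  "step_function M N t u z =
     (\<Sum>n<N. \<Sum>K\<in>cells M. u n K * indicator (K \<times> {t n<..t (Suc n)}) z)"

definition L1_converges ::
  "'b::euclidean_space set \<Rightarrow> (nat \<Rightarrow> 'b \<Rightarrow> 'c::euclidean_space) \<Rightarrow> ('b \<Rightarrow> 'c) \<Rightarrow> bool" where
  "L1_converges S f g \<longleftrightarrow>
     (\<forall>m. set_integrable lebesgue S (f m)) \<and> set_integrable lebesgue S g \<and>
     (\<lambda>m. LINT z:S|lebesgue. norm (f m z - g z)) \<longlonglongrightarrow> 0"


text \<open>
  \<open>C\<^sup>k\<close> functions on \<open>S\<close>, where derivatives are taken within \<open>S\<close>. It is meant for sets on which
  such derivatives are unique, such as \<open>\<Omega> \<times> [0,T)\<close> with \<open>\<Omega>\<close> open, where the time derivatives at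
  \<open>t = 0\<close> are one-sided.
\<close>

primrec C_k_on :: "nat \<Rightarrow> 'b::euclidean_space set \<Rightarrow> ('b \<Rightarrow> real) \<Rightarrow> bool" where
  "C_k_on 0 S f \<longleftrightarrow> continuous_on S f"
| "C_k_on (Suc k) S f \<longleftrightarrow>
     (\<exists>f'. (\<forall>x\<in>S. (f has_derivative f' x) (at x within S)) \<and> (\<forall>v. C_k_on k S (\<lambda>x. f' x v)))"

definition smooth_compact_support :: "'b::euclidean_space set \<Rightarrow> ('b \<Rightarrow> real) set" where
  "smooth_compact_support S =
     {\<phi>. (\<forall>k. C_k_on k S \<phi>) \<and> (\<exists>C. compact C \<and> C \<subseteq> S \<and> (\<forall>z\<in>S - C. \<phi> z = 0))}"

definition gradient :: "('a::euclidean_space \<Rightarrow> real) \<Rightarrow> 'a \<Rightarrow> 'a" where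
  "gradient f x = (THE g. GDERIV f x :> g)"

end

theory Submission
  imports Defs
begin

text \<open>
  The scheme is multiplied by the time step times \<open>\<phi>(x\<^sub>K, t\<^sub>n\<^sub>+\<^sub>1)\<close>, where \<open>\<phi>\<close> is the
  test function, and summed over cells and steps. Evaluating \<open>\<phi>\<close> at the new time has
  two effects: the value at the final time is zero, and summation by parts pairs each
  \<open>u\<^sub>K\<^sup>n\<close> with the increment of \<open>\<phi>\<close> over the very time slab on which the approximate
  solution equals \<open>u\<^sub>K\<^sup>n\<close> (\<open>scheme_summed\<close>). The time term then converges to the integral
  of the limit function times the time derivative of \<open>\<phi>\<close>, and the initial term to that of
  \<open>u0\<close> times \<open>\<phi>\<close> at time zero, by uniform continuity (\<open>time_term_near\<close>,
  \<open>initial_term_near\<close>).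

  Collected by faces, the flux term is minus the pairing of the numerical fluxes with a
  discrete gradient, equal to \<open>\<bar>\<sigma>\<bar> (\<phi>\<^sub>L - \<phi>\<^sub>K) n\<^sub>K\<^sub>\<sigma> / \<bar>D\<^sub>\<sigma>\<bar>\<close> on the dual cell
  \<open>D\<^sub>\<sigma>\<close>. The bound on the first regularity parameter makes this gradient bounded, but it
  need not converge pointwise. It converges weakly: against a smooth field \<open>p\<close>, one may
  replace the mean of \<open>p\<close> over \<open>D\<^sub>\<sigma>\<close> by its mean over \<open>\<sigma>\<close>, since the weight
  \<open>\<bar>\<sigma>\<bar> \<bar>x\<^sub>L - x\<^sub>K\<bar>\<close> is at most a multiple of \<open>\<bar>D\<^sub>\<sigma>\<bar>\<close>; the face sum is then minus the sum of
  \<open>\<phi>\<^sub>K\<close> times the integral of the divergence of \<open>p\<close> over \<open>K\<close>, by the divergence theorem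
  on each cell (\<open>cell_divergence\<close>), and this tends to minus the integral of \<open>\<phi>\<close> times the
  divergence of \<open>p\<close>, that is, to the integral of the scalar product of the gradient of
  \<open>\<phi>\<close> with \<open>p\<close>. As the discrete gradients are bounded, fields from a dense subset of
  \<open>L\<^sup>1\<close> suffice, and polynomials are dense (\<open>L1_approx_polynomial\<close>).

  It remains to replace the numerical flux by the flux of the approximate solution on
  \<open>D\<^sub>\<sigma>\<close>. The error is a multiple of the sum, over faces and steps, of the time step times
  \<open>\<bar>D\<^sub>\<sigma>\<bar> \<bar>u\<^sub>K\<^sup>n - u\<^sub>L\<^sup>n\<bar>\<close>, and this sum tends to zero (\<open>jumps_le\<close>): the limit function is
  close in \<open>L\<^sup>1\<close> to a continuous function, whose jumps between neighbouring cells are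
  small, and the bounds on \<open>\<bar>D\<^sub>\<sigma>\<bar> / \<bar>K\<bar>\<close> and on the number of faces compare the remaining
  sum with the \<open>L\<^sup>1\<close> distance.

  The divergence theorem is proved line by line. By translation invariance, the integral of
  a function equals the integral of its means over the segments from \<open>x\<close> to \<open>x + w\<close>
  (\<open>integral_lborel_average_along\<close>). On almost every such segment the indicator of a
  polyhedral cell has finitely many jumps, each at a point of exactly one face, so the
  fundamental theorem of calculus yields the values of the integrand at these points. The
  set of starting points whose segment meets a face is an oblique cylinder over that face,
  and a linear change of variables with determinant \<open>\<plusminus> (n \<bullet> w)\<close> straightens it into the
  right cylinder that defines the surface measure (\<open>nn_integral_hit\<close>).
\<close>

section \<open>Linear changes of variables\<close>

text \<open>
  The classical uniqueness argument for Haar measure: the product of the two integrals is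
  rewritten by Fubini and the translation invariance of both measures. The unit ball is used
  because it is symmetric, so that no reflection of it remains.
\<close>

lemma translation_invariant_measure_proportional:
  fixes \<mu> :: "'a::euclidean_space measure" and f :: "'a \<Rightarrow> ennreal"
  assumes sets: "sets \<mu> = sets borel" and sf: "sigma_finite_measure \<mu>"
    and inv: "\<And>a. distr \<mu> borel ((+) a) = \<mu>"
    and f[measurable]: "f \<in> borel_measurable borel"
  shows "(\<integral>\<^sup>+x. f x \<partial>\<mu>) * emeasure lborel (ball (0::'a) 1) = (\<integral>\<^sup>+x. f x \<partial>lborel) * emeasure \<mu> (ball 0 1)"
proof -
  interpret \<mu>: sigma_finite_measure \<mu> by fact
  interpret P: pair_sigma_finite \<mu> lborel ..
  note [measurable_cong] = sets
  let ?g = "indicator (ball (0::'a) 1) :: 'a \<Rightarrow> ennreal"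
  have [measurable]: "ball (0::'a) 1 \<in> sets borel" by simp
  have [measurable]: "(+) a \<in> \<mu> \<rightarrow>\<^sub>M borel" for a
    by measurable
  have shift\<mu>: "(\<integral>\<^sup>+x. h (a + x) \<partial>\<mu>) = (\<integral>\<^sup>+x. h x \<partial>\<mu>)" if [measurable]: "h \<in> borel_measurable borel" for h :: "'a \<Rightarrow> ennreal" and a
    by (subst (2) inv[of a, symmetric], subst nn_integral_distr) auto
  have shiftl: "(\<integral>\<^sup>+x. h (a + x) \<partial>lborel) = (\<integral>\<^sup>+x. h x \<partial>lborel)" if [measurable]: "h \<in> borel_measurable borel" for h :: "'a \<Rightarrow> ennreal" and a
    by (subst (2) lborel_distr_plus[of a, symmetric], subst nn_integral_distr) auto
  have "(\<integral>\<^sup>+x. f x \<partial>\<mu>) * emeasure lborel (ball (0::'a) 1) = (\<integral>\<^sup>+y. (\<integral>\<^sup>+x. f x * ?g y \<partial>\<mu>) \<partial>lborel)"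
    by (simp add: nn_integral_multc nn_integral_cmult_indicator)
  also have "\<dots> = (\<integral>\<^sup>+y. (\<integral>\<^sup>+x. f (y + x) * ?g y \<partial>\<mu>) \<partial>lborel)"
    by (intro nn_integral_cong shift\<mu>[symmetric]) measurable
  also have "\<dots> = (\<integral>\<^sup>+x. (\<integral>\<^sup>+y. f (y + x) * ?g y \<partial>lborel) \<partial>\<mu>)"
    by (rule P.Fubini') measurable
  also have "\<dots> = (\<integral>\<^sup>+x. (\<integral>\<^sup>+y. f y * ?g (y - x) \<partial>lborel) \<partial>\<mu>)"
  proof (rule nn_integral_cong)
    fix x
    show "(\<integral>\<^sup>+y. f (y + x) * ?g y \<partial>lborel) = (\<integral>\<^sup>+y. f y * ?g (y - x) \<partial>lborel)"
      using shiftl[of "\<lambda>y. f y * ?g (y - x)" x] by (simp add: add.commute)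
  qed
  also have "\<dots> = (\<integral>\<^sup>+y. (\<integral>\<^sup>+x. f y * ?g (y - x) \<partial>\<mu>) \<partial>lborel)"
    by (rule P.Fubini'[symmetric]) measurable
  also have "\<dots> = (\<integral>\<^sup>+y. f y * emeasure \<mu> (ball 0 1) \<partial>lborel)"
  proof (rule nn_integral_cong)
    fix y
    have "(\<integral>\<^sup>+x. f y * ?g (y - x) \<partial>\<mu>) = (\<integral>\<^sup>+x. f y * ?g (y - (y + x)) \<partial>\<mu>)"
      by (rule shift\<mu>[symmetric]) measurable
    also have "\<dots> = (\<integral>\<^sup>+x. f y * ?g x \<partial>\<mu>)"
      by (intro nn_integral_cong) (simp add: indicator_def)
    also have "\<dots> = f y * emeasure \<mu> (ball 0 1)"
      by (simp add: nn_integral_cmult sets)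
    finally show "(\<integral>\<^sup>+x. f y * ?g (y - x) \<partial>\<mu>) = f y * emeasure \<mu> (ball 0 1)" .
  qed
  also have "\<dots> = (\<integral>\<^sup>+x. f x \<partial>lborel) * emeasure \<mu> (ball 0 1)"
    by (simp add: nn_integral_multc)
  finally show ?thesis .
qed

lemma ennreal_mult_cancel_rightI:
  fixes a b V :: ennreal
  assumes "a * V = b * V" "V \<noteq> 0" "V \<noteq> \<infinity>"
  shows "a = b"
  using assms by (metis ennreal_mult_divide_eq infinity_ennreal_def)

text \<open>
  For linear maps the factor is the inverse of the absolute value of the determinant.
\<close>

definition rescales :: "('a::euclidean_space \<Rightarrow> 'a) \<Rightarrow> real \<Rightarrow> bool" where
  "rescales L c \<longleftrightarrow> (\<forall>f\<in>borel_measurable borel. (\<integral>\<^sup>+x. f (L x) \<partial>lborel) = ennreal c * (\<integral>\<^sup>+x. f x \<partial>lborel))"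

lemma rescalesD:
  "rescales L c \<Longrightarrow> f \<in> borel_measurable borel \<Longrightarrow> (\<integral>\<^sup>+x. f (L x) \<partial>lborel) = ennreal c * (\<integral>\<^sup>+x. f x \<partial>lborel)"
  by (auto simp: rescales_def)

lemma emeasure_unit_ball_pos_finite:
  "emeasure lborel (ball (0::'a::euclidean_space) 1) \<noteq> 0" "emeasure lborel (ball (0::'a) 1) \<noteq> \<infinity>"
proof -
  show "emeasure lborel (ball (0::'a) 1) \<noteq> \<infinity>"
    using emeasure_lborel_ball_finite[of "0::'a" 1] by auto
  show "emeasure lborel (ball (0::'a) 1) \<noteq> 0"
  proof
    assume "emeasure lborel (ball (0::'a) 1) = 0"
    then have "ball (0::'a) 1 \<in> null_sets lborel" by auto
    then have "negligible (ball (0::'a) 1)"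
      using negligible_iff_null_sets null_sets_completionI by blast
    then show False
      using open_not_negligible[of "ball (0::'a) 1"] by auto
  qed
qed

text \<open>
  The image of Lebesgue measure under a linear bijection is translation invariant, hence a
  multiple of Lebesgue measure; the unit ball shows by which factor.
\<close>

lemma rescales_linear:
  fixes L L' :: "'a::euclidean_space \<Rightarrow> 'a"
  assumes L: "linear L" and L': "linear L'" and inv: "\<And>x. L (L' x) = x"
  obtains c where "c \<ge> 0" "rescales L c"
    "ennreal c * emeasure lborel (ball (0::'a) 1) = emeasure lborel (L -` ball 0 1)"
proof -
  let ?\<mu> = "distr lborel borel L" and ?V = "emeasure lborel (ball (0::'a) 1)"
  have inv': "L' (L x) = x" for x
    using linear_inverse_left[OF L L'] inv by (metis comp_apply id_apply ext)
  have bl: "bounded_linear L" "bounded_linear L'"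
    using L L' by (auto simp: linear_conv_bounded_linear)
  have [measurable]: "L \<in> borel_measurable borel"
    using bl(1) by (intro borel_measurable_continuous_onI linear_continuous_on)
  have vim: "L -` S = L' ` S" for S
    using inv inv' by (auto simp: image_iff) metis
  have fin: "emeasure lborel (L -` ball 0 r) < \<infinity>" for r
  proof -
    have "bounded (L -` ball 0 r)"
      unfolding vim by (rule bounded_linear_image[OF bounded_ball bl(2)])
    then show ?thesis by (rule emeasure_bounded_finite)
  qed
  have em: "emeasure ?\<mu> (ball 0 r) = emeasure lborel (L -` ball 0 r)" for r
    by (simp add: emeasure_distr)
  have "sigma_finite_measure ?\<mu>"
  proof
    show "\<exists>A. countable A \<and> A \<subseteq> sets ?\<mu> \<and> \<Union>A = space ?\<mu> \<and> (\<forall>a\<in>A. emeasure ?\<mu> a \<noteq> \<infinity>)"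
    proof (intro exI conjI)
      let ?A = "range (\<lambda>n::nat. ball (0::'a) (real n))"
      show "countable ?A" "?A \<subseteq> sets ?\<mu>" by auto
      show "\<Union>?A = space ?\<mu>"
        by (auto simp: reals_Archimedean2)
      show "\<forall>a\<in>?A. emeasure ?\<mu> a \<noteq> \<infinity>"
        using fin em by (auto simp: less_top)
    qed
  qed
  moreover have "distr ?\<mu> borel ((+) a) = ?\<mu>" for a
  proof -
    have "distr ?\<mu> borel ((+) a) = distr lborel borel (\<lambda>x. a + L x)"
      by (subst distr_distr) (auto simp: comp_def)
    also have "(\<lambda>x. a + L x) = L \<circ> (+) (L' a)"
      by (auto simp: linear_add[OF L] inv)
    also have "distr lborel borel (L \<circ> (+) (L' a)) = distr (distr lborel borel ((+) (L' a))) borel L"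
      by (subst distr_distr) auto
    also have "\<dots> = ?\<mu>"
      by (simp add: lborel_distr_plus)
    finally show ?thesis .
  qed
  ultimately have *: "(\<integral>\<^sup>+x. f x \<partial>?\<mu>) * ?V = (\<integral>\<^sup>+x. f x \<partial>lborel) * emeasure lborel (L -` ball 0 1)"
    if "f \<in> borel_measurable borel" for f
    using translation_invariant_measure_proportional[of ?\<mu> f] that em by simp
  define C where "C = emeasure lborel (L -` ball 0 1) / ?V"
  have "C \<noteq> \<infinity>"
    using fin[of 1] emeasure_unit_ball_pos_finite[where 'a='a] by (auto simp: C_def ennreal_divide_eq_top_iff)
  then obtain c where c: "c \<ge> 0" "C = ennreal c"
    by (cases C) auto
  have CV: "C * ?V = emeasure lborel (L -` ball 0 1)"
    unfolding C_def using emeasure_unit_ball_pos_finite[where 'a='a]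
    by (simp add: ennreal_divide_times ennreal_divide_self less_top)
  show thesis
  proof (rule that[of c])
    show "rescales L c"
      unfolding rescales_def
    proof
      fix f :: "'a \<Rightarrow> ennreal" assume [measurable]: "f \<in> borel_measurable borel"
      have "(\<integral>\<^sup>+x. f (L x) \<partial>lborel) * ?V = (\<integral>\<^sup>+x. f x \<partial>?\<mu>) * ?V"
        by (subst nn_integral_distr) auto
      also have "\<dots> = (ennreal c * (\<integral>\<^sup>+x. f x \<partial>lborel)) * ?V"
        by (subst *) (auto simp: CV[symmetric] c ac_simps)
      finally show "(\<integral>\<^sup>+x. f (L x) \<partial>lborel) = ennreal c * (\<integral>\<^sup>+x. f x \<partial>lborel)"
        using emeasure_unit_ball_pos_finite by (rule ennreal_mult_cancel_rightI)
    qed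
  qed (use c CV in auto)
qed

lemma rescales_comp:
  assumes "rescales L c" "rescales L' c'" "L \<in> borel_measurable borel" "c \<ge> 0" "c' \<ge> 0"
  shows "rescales (\<lambda>x. L (L' x)) (c * c')"
  unfolding rescales_def
proof
  fix f :: "'a \<Rightarrow> ennreal" assume f[measurable]: "f \<in> borel_measurable borel"
  have "(\<lambda>x. f (L x)) \<in> borel_measurable borel"
    using assms(3) by measurable
  from rescalesD[OF assms(2) this] rescalesD[OF assms(1) f]
  show "(\<integral>\<^sup>+x. f (L (L' x)) \<partial>lborel) = ennreal (c * c') * (\<integral>\<^sup>+x. f x \<partial>lborel)"
    using assms(4,5) by (simp add: ennreal_mult ac_simps)
qed

lemma rescales_unique:
  assumes "rescales L c" "rescales L c'" "c \<ge> 0" "c' \<ge> 0"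
  shows "c = c'"
proof -
  let ?i = "indicator (ball (0::'a) 1) :: 'a \<Rightarrow> ennreal"
  have "ennreal c * (\<integral>\<^sup>+x. ?i x \<partial>lborel) = ennreal c' * (\<integral>\<^sup>+x. ?i x \<partial>lborel)"
    using rescalesD[OF assms(1), of ?i] rescalesD[OF assms(2), of ?i]
    by (metis borel_measurable_indicator borel_open open_ball)
  then have "ennreal c = ennreal c'"
    using emeasure_unit_ball_pos_finite[where 'a='a] by (intro ennreal_mult_cancel_rightI[of "ennreal c" "emeasure lborel (ball (0::'a) 1)" "ennreal c'"]) (simp_all only: nn_integral_indicator sets_lborel borel_open open_ball not_False_eq_True)
  then show ?thesis using assms by simp
qed

lemma rescales_isometry:
  fixes R :: "'a::euclidean_space \<Rightarrow> 'a"
  assumes "linear R" "\<And>x. R (R x) = x" "\<And>x. norm (R x) = norm x"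
  shows "rescales R 1"
proof -
  obtain c where c: "c \<ge> 0" "rescales R c"
    "ennreal c * emeasure lborel (ball (0::'a) 1) = emeasure lborel (R -` ball 0 1)"
    using rescales_linear[OF assms(1,1,2)] by blast
  have "R -` ball 0 1 = ball 0 1"
    using assms(3) by (auto simp: dist_norm)
  then have "ennreal c * emeasure lborel (ball (0::'a) 1) = ennreal 1 * emeasure lborel (ball (0::'a) 1)"
    using c by simp
  then have "ennreal c = ennreal 1"
    using emeasure_unit_ball_pos_finite by (rule ennreal_mult_cancel_rightI)
  then show ?thesis using c by simp
qed

text \<open>
  The rank-one perturbations of the identity: reflections, dilations along one direction and
  shears in the usual sense are all of this form.
\<close>

definition shear :: "'a::euclidean_space \<Rightarrow> 'a \<Rightarrow> 'a \<Rightarrow> 'a" where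
  "shear n w x = x + (n \<bullet> x) *\<^sub>R w"

lemma linear_shear: "linear (shear n w)"
  by (rule linearI) (auto simp: shear_def algebra_simps inner_simps)

lemma borel_measurable_shear[measurable]: "shear n w \<in> borel_measurable borel"
  unfolding shear_def by measurable

lemma rescales_reflection:
  fixes u :: "'a::euclidean_space"
  shows "rescales (shear u (- (2 / (u \<bullet> u)) *\<^sub>R u)) 1"
proof (rule rescales_isometry)
  let ?R = "shear u (- (2 / (u \<bullet> u)) *\<^sub>R u)"
  show "linear ?R" by (rule linear_shear)
  show "?R (?R x) = x" for x
    by (cases "u = 0") (auto simp: shear_def inner_simps algebra_simps)
  show "norm (?R x) = norm x" for x
  proof -
    have "?R x \<bullet> ?R x = x \<bullet> x"
      by (cases "u = 0") (auto simp: shear_def inner_simps algebra_simps power2_eq_square inner_commute[of x u])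
    then show ?thesis by (simp add: norm_eq_sqrt_inner)
  qed
qed

text \<open>
  A shear is conjugate to its inverse, so its factor is its own inverse.
\<close>

lemma rescales_shear_orthogonal:
  fixes n w :: "'a::euclidean_space"
  assumes n: "norm n = 1" and w: "n \<bullet> w = 0"
  shows "rescales (shear n w) 1"
proof -
  have nn: "n \<bullet> n = 1" using n by (simp add: dot_square_norm)
  let ?U = "shear n w" and ?V = "shear n (- w)" and ?R = "shear n (- (2 / (n \<bullet> n)) *\<^sub>R n)"
  have UV: "?U (?V x) = x" for x
    using w by (simp add: shear_def inner_simps algebra_simps)
  obtain c where c: "c \<ge> 0" "rescales ?U c"
    using rescales_linear[OF linear_shear linear_shear, of n w n "- w"] UV by metis
  have R: "rescales ?R 1" by (rule rescales_reflection)
  \<comment> \<open>Conjugation with the reflection along \<open>n\<close> turns the shear into its inverse.\<close>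
  have "rescales (\<lambda>x. ?R (?U (?R x))) (1 * (c * 1))"
    using R c by (intro rescales_comp) auto
  also have "(\<lambda>x. ?R (?U (?R x))) = ?V"
    by (rule ext) (simp add: shear_def nn w inner_simps algebra_simps)
  finally have "rescales ?V c" by simp
  then have "rescales (\<lambda>x. ?U (?V x)) (c * c)"
    using c by (intro rescales_comp) auto
  moreover have "rescales (\<lambda>x. ?U (?V x)) 1"
    by (simp add: UV rescales_def)
  ultimately have "c * c = 1"
    using c by (intro rescales_unique) auto
  then have "c = 1" using c(1) by (metis abs_of_nonneg abs_square_eq_1 power2_eq_square)
  then show ?thesis using c by simp
qed

lemma rescales_dilation_Basis:
  fixes b :: "'a::euclidean_space"
  assumes b: "b \<in> Basis" and \<alpha>: "\<alpha> \<noteq> 0"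
  shows "rescales (shear b ((\<alpha> - 1) *\<^sub>R b)) (1 / \<bar>\<alpha>\<bar>)"
  unfolding rescales_def
proof
  fix f :: "'a \<Rightarrow> ennreal" assume [measurable]: "f \<in> borel_measurable borel"
  define c where "c j = (if j = b then \<alpha> else 1)" for j :: 'a
  have S: "shear b ((\<alpha> - 1) *\<^sub>R b) x = 0 + (\<Sum>j\<in>Basis. (c j * (x \<bullet> j)) *\<^sub>R j)" for x
  proof -
    have "(\<Sum>j\<in>Basis. (c j * (x \<bullet> j)) *\<^sub>R j) = (\<Sum>j\<in>Basis. (x \<bullet> j) *\<^sub>R j + (if j = b then ((\<alpha> - 1) * (x \<bullet> b)) *\<^sub>R b else 0))"
      by (rule sum.cong) (auto simp: c_def algebra_simps)
    also have "\<dots> = x + ((\<alpha> - 1) * (x \<bullet> b)) *\<^sub>R b"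
      using b by (simp add: sum.distrib euclidean_representation)
    finally show ?thesis by (simp add: shear_def inner_commute)
  qed
  have pr: "(\<Prod>j\<in>Basis. \<bar>c j\<bar>) = \<bar>\<alpha>\<bar>"
    using b by (subst prod.remove[of _ b]) (auto simp: c_def intro!: prod.neutral)
  have "(\<integral>\<^sup>+x. f x \<partial>lborel) = (\<integral>\<^sup>+x. f x \<partial>density (distr lborel borel (shear b ((\<alpha> - 1) *\<^sub>R b))) (\<lambda>_. (\<Prod>j\<in>Basis. \<bar>c j\<bar>)))"
    using lborel_affine_euclidean[of c 0] \<alpha> unfolding S[abs_def] by (simp add: c_def)
  also have "\<dots> = \<bar>\<alpha>\<bar> * (\<integral>\<^sup>+x. f (shear b ((\<alpha> - 1) *\<^sub>R b) x) \<partial>lborel)"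
    by (simp add: nn_integral_density nn_integral_distr nn_integral_cmult pr)
  finally have "ennreal (1 / \<bar>\<alpha>\<bar>) * (\<integral>\<^sup>+x. f x \<partial>lborel) = (ennreal (1 / \<bar>\<alpha>\<bar>) * ennreal \<bar>\<alpha>\<bar>) * (\<integral>\<^sup>+x. f (shear b ((\<alpha> - 1) *\<^sub>R b) x) \<partial>lborel)"
    by (simp add: ac_simps)
  also have "ennreal (1 / \<bar>\<alpha>\<bar>) * ennreal \<bar>\<alpha>\<bar> = 1"
    using \<alpha> by (simp flip: ennreal_mult)
  finally show "(\<integral>\<^sup>+x. f (shear b ((\<alpha> - 1) *\<^sub>R b) x) \<partial>lborel) = ennreal (1 / \<bar>\<alpha>\<bar>) * (\<integral>\<^sup>+x. f x \<partial>lborel)"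
    by simp
qed

text \<open>
  A reflection carries the direction of the dilation to a coordinate axis.
\<close>

lemma rescales_dilation:
  fixes n :: "'a::euclidean_space"
  assumes n: "norm n = 1" and \<alpha>: "\<alpha> \<noteq> 0"
  shows "rescales (shear n ((\<alpha> - 1) *\<^sub>R n)) (1 / \<bar>\<alpha>\<bar>)"
proof -
  obtain b :: 'a where b: "b \<in> Basis" using nonempty_Basis by blast
  \<comment> \<open>The reflection along \<open>b - n\<close> exchanges the unit vectors \<open>b\<close> and \<open>n\<close>.\<close>
  define u where "u = b - n"
  let ?R = "shear u (- (2 / (u \<bullet> u)) *\<^sub>R u)" and ?S = "shear b ((\<alpha> - 1) *\<^sub>R b)"
  have nn: "n \<bullet> n = 1" "b \<bullet> b = 1" using n b by (auto simp: dot_square_norm)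
  have uu: "u \<bullet> u = 2 - 2 * (b \<bullet> n)"
    by (simp add: u_def inner_simps nn inner_commute)
  have Rb: "?R b = n"
  proof (cases "u = 0")
    case True then show ?thesis by (simp add: shear_def u_def)
  next
    case False
    then have "u \<bullet> u \<noteq> 0" by simp
    moreover have "u \<bullet> b = (u \<bullet> u) / 2" by (simp add: uu u_def inner_simps nn inner_commute)
    ultimately show ?thesis by (simp add: shear_def u_def)
  qed
  have RR: "?R (?R x) = x" for x
    by (cases "u = 0") (auto simp: shear_def inner_simps algebra_simps)
  have nR: "norm (?R x) = norm x" for x
  proof -
    have "?R x \<bullet> ?R x = x \<bullet> x"
      by (cases "u = 0") (auto simp: shear_def inner_simps algebra_simps power2_eq_square inner_commute[of x u])
    then show ?thesis by (simp add: norm_eq_sqrt_inner)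
  qed
  have bR: "b \<bullet> ?R x = n \<bullet> x" for x
    unfolding Rb[symmetric] by (cases "u = 0") (auto simp: shear_def inner_simps algebra_simps inner_commute)
  have R: "rescales ?R 1" by (rule rescales_reflection)
  have "rescales (\<lambda>x. ?R (?S (?R x))) (1 * (1 / \<bar>\<alpha>\<bar> * 1))"
    using R rescales_dilation_Basis[OF b \<alpha>] by (intro rescales_comp) auto
  moreover have "?R (?S (?R x)) = shear n ((\<alpha> - 1) *\<^sub>R n) x" for x
  proof -
    have "?S (?R x) = ?R x + ((\<alpha> - 1) * (n \<bullet> x)) *\<^sub>R b"
      unfolding shear_def[of b] bR by (simp add: mult.commute)
    then have "?R (?S (?R x)) = ?R (?R x) + ((\<alpha> - 1) * (n \<bullet> x)) *\<^sub>R ?R b"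
      by (simp add: linear_add[OF linear_shear] linear_cmul[OF linear_shear])
    then show ?thesis unfolding RR Rb by (simp add: shear_def[of n] mult.commute)
  qed
  ultimately show ?thesis by simp
qed

text \<open>
  The determinant of a rank-one perturbation, obtained by writing the map as a dilation
  along \<open>n\<close> followed by a shear that is orthogonal to \<open>n\<close>.
\<close>

lemma rescales_shear:
  fixes n w :: "'a::euclidean_space"
  assumes n: "norm n = 1" and \<alpha>: "1 + n \<bullet> w \<noteq> 0"
  shows "rescales (shear n w) (1 / \<bar>1 + n \<bullet> w\<bar>)"
proof -
  define \<alpha> where "\<alpha> = 1 + n \<bullet> w"
  have nn: "n \<bullet> n = 1" using n by (simp add: dot_square_norm)
  define w' where "w' = (1 / \<alpha>) *\<^sub>R (w - (n \<bullet> w) *\<^sub>R n)"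
  have "n \<bullet> w' = 0" by (simp add: w'_def inner_simps nn)
  then have "rescales (\<lambda>x. shear n w' (shear n ((\<alpha> - 1) *\<^sub>R n) x)) (1 * (1 / \<bar>\<alpha>\<bar>))"
    using rescales_shear_orthogonal[OF n] rescales_dilation[OF n, of \<alpha>] \<alpha>
    by (intro rescales_comp) (auto simp: \<alpha>_def)
  moreover have "shear n w' (shear n ((\<alpha> - 1) *\<^sub>R n) x) = shear n w x" for x
  proof -
    have "n \<bullet> shear n ((\<alpha> - 1) *\<^sub>R n) x = \<alpha> * (n \<bullet> x)"
      by (simp add: shear_def inner_simps nn algebra_simps)
    then have "shear n w' (shear n ((\<alpha> - 1) *\<^sub>R n) x) = x + ((\<alpha> - 1) * (n \<bullet> x)) *\<^sub>R n + (n \<bullet> x) *\<^sub>R (\<alpha> *\<^sub>R w')"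
      by (simp add: shear_def mult.commute)
    also have "\<alpha> *\<^sub>R w' = w - (\<alpha> - 1) *\<^sub>R n"
      using \<alpha> by (simp add: w'_def \<alpha>_def)
    finally show ?thesis by (simp add: shear_def algebra_simps)
  qed
  ultimately show ?thesis by (simp add: \<alpha>_def)
qed

section \<open>The measure on a hyperplane\<close>

definition hitting_time :: "'a::euclidean_space \<Rightarrow> real \<Rightarrow> 'a \<Rightarrow> 'a \<Rightarrow> real" where
  "hitting_time n c v x = (c - n \<bullet> x) / (n \<bullet> v)"

text \<open>
  The point where the line through \<open>x\<close> in direction \<open>v\<close> meets the
  hyperplane; for \<open>v = n\<close> this is the orthogonal projection.
\<close>

definition hit :: "'a::euclidean_space \<Rightarrow> real \<Rightarrow> 'a \<Rightarrow> 'a \<Rightarrow> 'a" where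
  "hit n c v x = x + hitting_time n c v x *\<^sub>R v"

text \<open>
  The area measure, defined as in the definition of the surface measure by the volume of
  right cylinders of height one.
\<close>

definition hyperplane_measure :: "'a::euclidean_space \<Rightarrow> real \<Rightarrow> 'a measure" where
  "hyperplane_measure n c =
     distr (density lborel (indicator {x. 0 \<le> n \<bullet> x - c \<and> n \<bullet> x - c \<le> 1})) borel (hit n c n)"

lemma borel_measurable_hit[measurable]:
  "hitting_time n c v \<in> borel_measurable borel" "hit n c v \<in> borel_measurable borel"
  unfolding hit_def hitting_time_def by measurable

lemma sets_slab[measurable]:
  "{x::'a::euclidean_space. 0 \<le> n \<bullet> x - c \<and> n \<bullet> x - c \<le> 1} \<in> sets borel"
  "{x::'a::euclidean_space. 0 \<le> hitting_time n c v x \<and> hitting_time n c v x \<le> 1} \<in> sets borel"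
  by measurable

lemma sets_hyperplane_measure[measurable_cong, simp]: "sets (hyperplane_measure n c) = sets borel"
  by (simp add: hyperplane_measure_def)

lemma space_hyperplane_measure[simp]: "space (hyperplane_measure n c) = UNIV"
  by (simp add: hyperplane_measure_def)

lemma hit_in_hyperplane: "n \<bullet> v \<noteq> 0 \<Longrightarrow> n \<bullet> hit n c v x = c"
  by (simp add: hit_def hitting_time_def inner_simps)

lemma nn_integral_hyperplane_measure:
  assumes [measurable]: "f \<in> borel_measurable borel"
  shows "(\<integral>\<^sup>+y. f y \<partial>hyperplane_measure n c)
    = (\<integral>\<^sup>+x. indicator {x. 0 \<le> n \<bullet> x - c \<and> n \<bullet> x - c \<le> 1} x * f (hit n c n x) \<partial>lborel)"
  unfolding hyperplane_measure_def
  by (subst nn_integral_distr, simp, simp, subst nn_integral_density) auto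

text \<open>
  Oblique cylinders over a part of a hyperplane: the factor is the cosine of the angle
  between the normal and the direction, times the length of the direction.
\<close>

lemma nn_integral_hit:
  fixes n :: "'a::euclidean_space"
  assumes n: "norm n = 1" and v: "n \<bullet> v \<noteq> 0" and f[measurable]: "f \<in> borel_measurable borel"
  shows "(\<integral>\<^sup>+x. indicator {x. 0 \<le> hitting_time n c v x \<and> hitting_time n c v x \<le> 1} x * f (hit n c v x) \<partial>lborel)
    = ennreal \<bar>n \<bullet> v\<bar> * (\<integral>\<^sup>+y. f y \<partial>hyperplane_measure n c)"
proof -
  have nn: "n \<bullet> n = 1" using n by (simp add: dot_square_norm)
  \<comment> \<open>The affine map \<open>x \<mapsto> ?a + ?S x\<close> keeps the hyperplane fixed and sends \<open>n\<close> to \<open>- v\<close>, so it maps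
    the cylinder in direction \<open>n\<close> to the one that reaches the hyperplane along \<open>v\<close> in unit time.\<close>
  let ?S = "shear n (- (n + v))" and ?a = "c *\<^sub>R (n + v)"
  define g where "g y = indicator {x. 0 \<le> hitting_time n c v x \<and> hitting_time n c v x \<le> 1} y * f (hit n c v y)" for y
  have [measurable]: "g \<in> borel_measurable borel" unfolding g_def by measurable
  have \<Phi>: "?a + ?S x = hit n c n x - (n \<bullet> x - c) *\<^sub>R v" for x
    by (simp add: shear_def hit_def hitting_time_def nn algebra_simps)
  have nh: "n \<bullet> hit n c n x = c" for x by (rule hit_in_hyperplane) (simp add: nn)
  have t: "hitting_time n c v (?a + ?S x) = n \<bullet> x - c" for x
    unfolding \<Phi> using v by (simp add: hitting_time_def inner_diff_right nh)
  have h: "hit n c v (?a + ?S x) = hit n c n x" for x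
    unfolding hit_def[of n c v] t unfolding \<Phi> by simp
  have "(\<integral>\<^sup>+y. f y \<partial>hyperplane_measure n c) = (\<integral>\<^sup>+x. g (?a + ?S x) \<partial>lborel)"
    unfolding nn_integral_hyperplane_measure[OF f] g_def h indicator_def mem_Collect_eq t ..
  also have "\<dots> = ennreal (1 / \<bar>1 + n \<bullet> (- (n + v))\<bar>) * (\<integral>\<^sup>+x. g (?a + x) \<partial>lborel)"
    by (rule rescalesD[OF rescales_shear[OF n]]) (use v in \<open>auto simp: inner_simps nn\<close>)
  also have "\<bar>1 + n \<bullet> (- (n + v))\<bar> = \<bar>n \<bullet> v\<bar>"
    by (simp add: inner_simps nn)
  also have "(\<integral>\<^sup>+x. g (?a + x) \<partial>lborel) = (\<integral>\<^sup>+x. g x \<partial>lborel)"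
    by (subst (2) lborel_distr_plus[of ?a, symmetric], subst nn_integral_distr) auto
  finally have "ennreal \<bar>n \<bullet> v\<bar> * (\<integral>\<^sup>+y. f y \<partial>hyperplane_measure n c)
      = (ennreal \<bar>n \<bullet> v\<bar> * ennreal (1 / \<bar>n \<bullet> v\<bar>)) * (\<integral>\<^sup>+x. g x \<partial>lborel)"
    by (simp add: ac_simps)
  also have "ennreal \<bar>n \<bullet> v\<bar> * ennreal (1 / \<bar>n \<bullet> v\<bar>) = 1"
    using v by (simp flip: ennreal_mult)
  finally show ?thesis by (simp add: g_def)
qed

lemma
  fixes n :: "'a::euclidean_space" and f :: "'a \<Rightarrow> real"
  assumes n: "norm n = 1" and v: "n \<bullet> v \<noteq> 0" and f: "integrable (hyperplane_measure n c) f"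
  shows integrable_hit:
      "integrable lborel (\<lambda>x. indicator {x. 0 \<le> hitting_time n c v x \<and> hitting_time n c v x \<le> 1} x * f (hit n c v x))"
    and integral_hit:
      "(\<integral>x. indicator {x. 0 \<le> hitting_time n c v x \<and> hitting_time n c v x \<le> 1} x * f (hit n c v x) \<partial>lborel)
        = \<bar>n \<bullet> v\<bar> * (\<integral>y. f y \<partial>hyperplane_measure n c)"
proof -
  let ?T = "{x. 0 \<le> hitting_time n c v x \<and> hitting_time n c v x \<le> 1}"
  have [measurable]: "f \<in> borel_measurable borel"
    using borel_measurable_integrable[OF f] by measurable
  let ?D = "density lborel (\<lambda>x. ennreal (indicator ?T x))"
  have eq: "distr ?D borel (hit n c v) = density (hyperplane_measure n c) (\<lambda>_. ennreal \<bar>n \<bullet> v\<bar>)" (is "?L = ?R")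
  proof (rule measure_eqI)
    fix A assume "A \<in> sets ?L"
    then have A[measurable]: "A \<in> sets borel" by simp
    have "emeasure ?L A = (\<integral>\<^sup>+x. indicator ?T x * indicator A (hit n c v x) \<partial>lborel)"
    proof -
      have [measurable]: "hit n c v -` A \<in> sets borel"
        by (rule measurable_sets_borel[OF borel_measurable_hit(2) A])
      have "emeasure ?L A = emeasure ?D (hit n c v -` A)"
        by (subst emeasure_distr) auto
      also have "\<dots> = (\<integral>\<^sup>+x. ennreal (indicator ?T x) * indicator (hit n c v -` A) x \<partial>lborel)"
        by (rule emeasure_density) measurable
      finally show ?thesis by (simp add: ennreal_indicator indicator_vimage comp_def)
    qed
    also have "\<dots> = ennreal \<bar>n \<bullet> v\<bar> * (\<integral>\<^sup>+y. indicator A y \<partial>hyperplane_measure n c)"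
      by (rule nn_integral_hit[OF n v]) measurable
    also have "\<dots> = emeasure ?R A"
      by (simp add: emeasure_density nn_integral_cmult)
    finally show "emeasure ?L A = emeasure ?R A" .
  qed simp
  have "integrable ?R f"
    using f by (subst integrable_density) auto
  then have "integrable ?L f" unfolding eq .
  then have "integrable ?D (\<lambda>x. f (hit n c v x))"
    by (subst (asm) integrable_distr_eq) auto
  then show "integrable lborel (\<lambda>x. indicator ?T x * f (hit n c v x))"
    by (subst (asm) integrable_density) auto
  have "(\<integral>y. f y \<partial>?L) = \<bar>n \<bullet> v\<bar> * (\<integral>y. f y \<partial>hyperplane_measure n c)"
    unfolding eq by (subst integral_density) auto
  also have "(\<integral>y. f y \<partial>?L) = (\<integral>x. f (hit n c v x) \<partial>?D)"
    by (subst integral_distr) auto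
  also have "\<dots> = (\<integral>x. indicator ?T x * f (hit n c v x) \<partial>lborel)"
    by (subst integral_density) auto
  finally show "(\<integral>x. indicator ?T x * f (hit n c v x) \<partial>lborel) = \<bar>n \<bullet> v\<bar> * (\<integral>y. f y \<partial>hyperplane_measure n c)" .
qed

lemma hyperplane_measure_uminus: "norm n = 1 \<Longrightarrow> hyperplane_measure (- n) (- c) = hyperplane_measure n c"
proof (rule measure_eqI)
  fix A assume n: "norm n = 1" and "A \<in> sets (hyperplane_measure (- n) (- c))"
  then have A[measurable]: "A \<in> sets borel" by simp
  have nn: "n \<bullet> n = 1" using n by (simp add: dot_square_norm)
  have "emeasure (hyperplane_measure (- n) (- c)) A = (\<integral>\<^sup>+y. indicator A y \<partial>hyperplane_measure (- n) (- c))"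
    by simp
  also have "\<dots> = (\<integral>\<^sup>+x. indicator {x. 0 \<le> hitting_time n c n x \<and> hitting_time n c n x \<le> 1} x * indicator A (hit n c n x) \<partial>lborel)"
    by (subst nn_integral_hyperplane_measure)
       (auto simp: hit_def hitting_time_def nn indicator_def algebra_simps intro!: nn_integral_cong)
  also have "\<dots> = ennreal \<bar>n \<bullet> n\<bar> * (\<integral>\<^sup>+y. indicator A y \<partial>hyperplane_measure n c)"
    by (rule nn_integral_hit[OF n]) (auto simp: nn)
  finally show "emeasure (hyperplane_measure (- n) (- c)) A = emeasure (hyperplane_measure n c) A"
    by (simp add: nn)
qed simp

lemma cylinder_eq:
  assumes n: "norm n = 1" and B: "B \<subseteq> {y. n \<bullet> y = c}"
  shows "cylinder n B = {x. 0 \<le> n \<bullet> x - c \<and> n \<bullet> x - c \<le> 1 \<and> hit n c n x \<in> B}"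
proof -
  have nn: "n \<bullet> n = 1" using n by (simp add: dot_square_norm)
  have "x \<in> cylinder n B" if "0 \<le> n \<bullet> x - c" "n \<bullet> x - c \<le> 1" "hit n c n x \<in> B" for x
  proof -
    have "x = hit n c n x + (n \<bullet> x - c) *\<^sub>R n"
      by (simp add: hit_def hitting_time_def nn algebra_simps)
    then show ?thesis using that unfolding cylinder_def by blast
  qed
  moreover have "0 \<le> n \<bullet> x - c \<and> n \<bullet> x - c \<le> 1 \<and> hit n c n x \<in> B" if x: "x \<in> cylinder n B" for x
  proof -
    obtain y s where y: "x = y + s *\<^sub>R n" "y \<in> B" "0 \<le> s" "s \<le> 1"
      using x unfolding cylinder_def by blast
    then have "n \<bullet> x - c = s" using B by (auto simp: inner_simps nn)
    then show ?thesis using y by (auto simp: hit_def hitting_time_def nn algebra_simps)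
  qed
  ultimately show ?thesis by blast
qed

lemma sets_cylinder:
  assumes n: "norm n = 1" and B: "B \<subseteq> {y. n \<bullet> y = c}" and [measurable]: "B \<in> sets borel"
  shows "cylinder n B \<in> sets borel"
  unfolding cylinder_eq[OF n B] by measurable

lemma emeasure_hyperplane_measure:
  assumes n: "norm n = 1" and B: "B \<subseteq> {y. n \<bullet> y = c}" and [measurable]: "B \<in> sets borel"
  shows "emeasure (hyperplane_measure n c) B = emeasure lborel (cylinder n B)"
proof -
  have "emeasure (hyperplane_measure n c) B = (\<integral>\<^sup>+y. indicator B y \<partial>hyperplane_measure n c)"
    by simp
  also have "\<dots> = (\<integral>\<^sup>+x. indicator (cylinder n B) x \<partial>lborel)"
    by (subst nn_integral_hyperplane_measure, simp, intro nn_integral_cong)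
       (auto simp: cylinder_eq[OF n B] split: split_indicator)
  finally show ?thesis by (simp add: sets_cylinder[OF n B])
qed

text \<open>
  A set with two independent normals has codimension two.
\<close>

lemma negligible_cylinder_two_normals:
  assumes n: "unit_normal S n" and n': "unit_normal S n'" and ne: "n' \<noteq> n" "n' \<noteq> - n"
  shows "negligible (cylinder n S)"
proof (cases "S = {}")
  case True then show ?thesis by (simp add: cylinder_def)
next
  case False
  then obtain y0 where y0: "y0 \<in> S" by blast
  have nn: "n \<bullet> n = 1" "n' \<bullet> n' = 1" using n n' by (auto simp: unit_normal_def dot_square_norm)
  \<comment> \<open>\<open>m\<close> is orthogonal to \<open>n\<close>, so it is constant on the cylinder, which is thus flat.\<close>
  define m where "m = n' - (n \<bullet> n') *\<^sub>R n"
  have "m \<noteq> 0"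
  proof
    assume "m = 0"
    then have e: "n' = (n \<bullet> n') *\<^sub>R n" by (simp add: m_def)
    then have "norm n' = \<bar>n \<bullet> n'\<bar> * norm n" by (metis norm_scaleR)
    then have "\<bar>n \<bullet> n'\<bar> = 1" using n n' by (simp add: unit_normal_def)
    then have "n \<bullet> n' = 1 \<or> n \<bullet> n' = -1" by linarith
    then show False using e ne by (metis scaleR_minus_left scaleR_one)
  qed
  then have "negligible {x. m \<bullet> x = m \<bullet> y0}" by (intro negligible_hyperplane) auto
  moreover have "cylinder n S \<subseteq> {x. m \<bullet> x = m \<bullet> y0}"
  proof
    fix x assume "x \<in> cylinder n S"
    then obtain y s where y: "x = y + s *\<^sub>R n" "y \<in> S" by (auto simp: cylinder_def)
    have "n \<bullet> (y - y0) = 0" "n' \<bullet> (y - y0) = 0" using n n' y y0 by (auto simp: unit_normal_def)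
    then have "m \<bullet> (y - y0) = 0" by (simp add: m_def inner_diff_left)
    moreover have "m \<bullet> n = 0" by (simp add: m_def inner_simps nn inner_commute)
    ultimately show "x \<in> {x. m \<bullet> x = m \<bullet> y0}" by (simp add: y inner_simps)
  qed
  ultimately show ?thesis by (rule negligible_subset)
qed

text \<open>
  Exceptional points of area zero on a hyperplane are met by the lines through almost no
  point. Integer translates of the cylinder cover the full orthogonal tube, and an affine
  bijection maps that tube to the oblique one.
\<close>

lemma negligible_hit_preimage:
  fixes n :: "'a::euclidean_space"
  assumes n: "norm n = 1" and v: "n \<bullet> v \<noteq> 0" and B: "B \<subseteq> {y. n \<bullet> y = c}"
    and neg: "negligible (cylinder n B)"
  shows "negligible {x. hit n c v x \<in> B}"
proof -
  have nn: "n \<bullet> n = 1" using n by (simp add: dot_square_norm)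
  let ?P = "{x. hit n c n x \<in> B}"
  have "?P \<subseteq> (\<Union>k\<in>(UNIV::int set). (+) (of_int k *\<^sub>R n) ` cylinder n B)"
  proof
    fix x assume x: "x \<in> ?P"
    define k where "k = \<lfloor>n \<bullet> x - c\<rfloor>"
    have "x - of_int k *\<^sub>R n \<in> cylinder n B"
    proof -
      have "n \<bullet> (x - of_int k *\<^sub>R n) - c = frac (n \<bullet> x - c)"
        by (simp add: inner_simps nn k_def frac_def)
      moreover have "hit n c n (x - of_int k *\<^sub>R n) = hit n c n x"
        by (simp add: hit_def hitting_time_def inner_simps nn algebra_simps)
      ultimately show ?thesis using x frac_lt_1[of "n \<bullet> x - c"] frac_ge_0[of "n \<bullet> x - c"]
        unfolding cylinder_eq[OF n B] mem_Collect_eq by (smt (verit))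
    qed
    then show "x \<in> (\<Union>k\<in>(UNIV::int set). (+) (of_int k *\<^sub>R n) ` cylinder n B)"
      by (intro UN_I[of k]) (auto simp: image_iff intro!: bexI[of _ "x - of_int k *\<^sub>R n"])
  qed
  moreover have "negligible (\<Union>k\<in>(UNIV::int set). (+) (of_int k *\<^sub>R n) ` cylinder n B)"
    by (intro negligible_countable_Union) (auto intro: negligible_translation neg)
  ultimately have P: "negligible ?P" by (rule negligible_subset[rotated])
  let ?\<Phi> = "\<lambda>x. hit n c n x - (n \<bullet> x - c) *\<^sub>R v"
  have "negligible (?\<Phi> ` ?P)"
    by (rule negligible_differentiable_image_negligible[OF order_refl P])
       (auto simp: differentiable_on_def hit_def hitting_time_def nn intro!: derivative_intros)
  moreover have "{x. hit n c v x \<in> B} \<subseteq> ?\<Phi> ` ?P"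
  proof
    fix x assume x: "x \<in> {x. hit n c v x \<in> B}"
    let ?x' = "hit n c v x + hitting_time n c v x *\<^sub>R n"
    have 1: "n \<bullet> ?x' - c = hitting_time n c v x"
      using v by (simp add: inner_simps nn hit_in_hyperplane)
    have 2: "hit n c n ?x' = hit n c v x"
      using 1 by (simp add: hit_def[of n c n] hitting_time_def[of n c n] nn algebra_simps)
    show "x \<in> ?\<Phi> ` ?P"
      using x by (intro image_eqI[of _ _ ?x']) (auto simp: 1 2, simp add: hit_def)
  qed
  ultimately show ?thesis by (rule negligible_subset)
qed

section \<open>Polyhedral sets along lines\<close>

lemma polyhedral_borel: "polyhedral S \<Longrightarrow> S \<in> sets borel"
proof (induction rule: polyhedral.induct)
  case (half_space a b)
  then show ?case by measurable
qed (auto simp: Compl_eq_Diff_UNIV)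

text \<open>
  Membership in a polyhedral set only depends on the position relative to finitely many
  hyperplanes.
\<close>

definition separated_by :: "('a::euclidean_space \<times> real) set \<Rightarrow> 'a set \<Rightarrow> bool" where
  "separated_by H S \<longleftrightarrow> finite H \<and> (\<forall>(a,b)\<in>H. a \<noteq> 0) \<and>
     (\<forall>x y. (\<forall>(a,b)\<in>H. a \<bullet> x \<le> b \<longleftrightarrow> a \<bullet> y \<le> b) \<longrightarrow> (x \<in> S \<longleftrightarrow> y \<in> S))"

lemma polyhedral_separated: "polyhedral S \<Longrightarrow> \<exists>H. separated_by H S"
proof (induction rule: polyhedral.induct)
  case (half_space a b)
  then show ?case
    by (cases "a = 0") (auto simp: separated_by_def intro: exI[of _ "{}"] exI[of _ "{(a,b)}"])
next
  case (compl S)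
  then show ?case by (auto simp: separated_by_def)
next
  case (inter S S')
  then obtain H H' where H: "separated_by H S" "separated_by H' S'" by blast
  have "separated_by (H \<union> H') (S \<inter> S')"
    unfolding separated_by_def
  proof (intro conjI allI impI)
    fix x y assume *: "\<forall>(a,b)\<in>H \<union> H'. a \<bullet> x \<le> b \<longleftrightarrow> a \<bullet> y \<le> b"
    have "x \<in> S \<longleftrightarrow> y \<in> S" using H(1) * unfolding separated_by_def by blast
    moreover have "x \<in> S' \<longleftrightarrow> y \<in> S'" using H(2) * unfolding separated_by_def by blast
    ultimately show "(x \<in> S \<inter> S') = (y \<in> S \<inter> S')" by blast
  qed (use H in \<open>auto simp: separated_by_def\<close>)
  then show ?case by blast
qed

lemma eventually_halfspace_ray:
  fixes a y v :: "'a::euclidean_space"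
  shows "\<forall>\<^sub>F r in at_right 0. a \<bullet> (y + r *\<^sub>R v) \<le> b \<longleftrightarrow> a \<bullet> y < b \<or> a \<bullet> y = b \<and> a \<bullet> v \<le> 0"
proof -
  have t: "((\<lambda>r. a \<bullet> (y + r *\<^sub>R v)) \<longlongrightarrow> a \<bullet> (y + 0 *\<^sub>R v)) (at_right 0)"
    by (intro tendsto_intros)
  consider "a \<bullet> y < b" | "a \<bullet> y > b" | "a \<bullet> y = b" by linarith
  then show ?thesis
  proof cases
    case 1
    then have "\<forall>\<^sub>F r in at_right 0. a \<bullet> (y + r *\<^sub>R v) < b"
      using order_tendstoD(2)[OF t] by simp
    then show ?thesis using 1 by (auto elim: eventually_mono)
  next
    case 2
    then have "\<forall>\<^sub>F r in at_right 0. a \<bullet> (y + r *\<^sub>R v) > b"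
      using order_tendstoD(1)[OF t] by simp
    then show ?thesis using 2 by (auto elim: eventually_mono)
  next
    case 3
    have "\<forall>\<^sub>F r::real in at_right 0. 0 < r" by (simp add: eventually_at_right_less)
    then show ?thesis
      by eventually_elim (use 3 in \<open>auto simp: inner_simps mult_le_0_iff\<close>)
  qed
qed

lemma polyhedral_eventually_ray:
  assumes "polyhedral S"
  shows "(\<forall>\<^sub>F r in at_right 0. y + r *\<^sub>R v \<in> S) \<or> (\<forall>\<^sub>F r in at_right 0. y + r *\<^sub>R v \<notin> S)"
  using assms
proof (induction rule: polyhedral.induct)
  case (half_space a b)
  show ?case
    using eventually_halfspace_ray[of a y v b]
    by (cases "a \<bullet> y < b \<or> a \<bullet> y = b \<and> a \<bullet> v \<le> 0") (auto elim: eventually_mono)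
next
  case (compl S)
  then show ?case by auto
next
  case (inter S S')
  then consider "\<forall>\<^sub>F r in at_right 0. y + r *\<^sub>R v \<in> S" "\<forall>\<^sub>F r in at_right 0. y + r *\<^sub>R v \<in> S'"
    | "\<forall>\<^sub>F r in at_right 0. y + r *\<^sub>R v \<notin> S" | "\<forall>\<^sub>F r in at_right 0. y + r *\<^sub>R v \<notin> S'"
    by blast
  then show ?case
  proof cases
    case 1
    then show ?thesis by (simp add: eventually_conj_iff)
  next
    case 2
    then have "\<forall>\<^sub>F r in at_right 0. y + r *\<^sub>R v \<notin> S \<inter> S'" by (rule eventually_mono) blast
    then show ?thesis ..
  next
    case 3
    then have "\<forall>\<^sub>F r in at_right 0. y + r *\<^sub>R v \<notin> S \<inter> S'" by (rule eventually_mono) blast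
    then show ?thesis ..
  qed
qed

text \<open>
  The one-sided limit at \<open>y\<close>, in direction \<open>v\<close>, of the indicator
  function; it exists for polyhedral sets.
\<close>

definition trace :: "'a::euclidean_space set \<Rightarrow> 'a \<Rightarrow> 'a \<Rightarrow> real" where
  "trace S y v = of_bool (\<forall>\<^sub>F r in at_right 0. y + r *\<^sub>R v \<in> S)"

lemma eventually_trace:
  "polyhedral S \<Longrightarrow> \<forall>\<^sub>F r in at_right 0. indicator S (y + r *\<^sub>R v) = trace S y v"
  using polyhedral_eventually_ray[of S y v]
  by (auto simp: trace_def indicator_def elim: eventually_mono)

lemma traceI:
  assumes "polyhedral S" "\<forall>\<^sub>F r in at_right 0. indicator S (y + r *\<^sub>R v) = c"
  shows "trace S y v = c"
proof -
  have "\<forall>\<^sub>F r in at_right (0::real). trace S y v = c"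
    using eventually_trace[OF assms(1), of y v] assms(2) by eventually_elim simp
  then show ?thesis by simp
qed

text \<open>
  Near \<open>y\<close> only the hyperplanes through \<open>y\<close> matter, and of these
  only the side to which the direction points.
\<close>

lemma trace_cong_direction:
  assumes S: "polyhedral S" and H: "separated_by H S"
    and same: "\<And>a b. (a,b) \<in> H \<Longrightarrow> a \<bullet> y = b \<Longrightarrow> a \<bullet> v \<le> 0 \<longleftrightarrow> a \<bullet> v' \<le> 0"
  shows "trace S y v = trace S y v'"
proof (rule traceI[OF S])
  have fin: "finite H" using H by (simp add: separated_by_def)
  have "\<forall>\<^sub>F r in at_right (0::real). \<forall>h\<in>H. fst h \<bullet> (y + r *\<^sub>R v) \<le> snd h \<longleftrightarrow> fst h \<bullet> (y + r *\<^sub>R v') \<le> snd h"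
  proof (rule eventually_ball_finite[OF fin], rule ballI)
    fix h assume h: "h \<in> H"
    show "\<forall>\<^sub>F r in at_right (0::real). fst h \<bullet> (y + r *\<^sub>R v) \<le> snd h \<longleftrightarrow> fst h \<bullet> (y + r *\<^sub>R v') \<le> snd h"
      using eventually_halfspace_ray[of "fst h" y v "snd h"] eventually_halfspace_ray[of "fst h" y v' "snd h"]
      by eventually_elim (use same[of "fst h" "snd h"] h in auto)
  qed
  moreover have "\<forall>\<^sub>F r in at_right 0. indicator S (y + r *\<^sub>R v') = trace S y v'"
    by (rule eventually_trace[OF S])
  ultimately show "\<forall>\<^sub>F r in at_right 0. indicator S (y + r *\<^sub>R v) = trace S y v'"
  proof eventually_elim
    case (elim r)
    have "y + r *\<^sub>R v \<in> S \<longleftrightarrow> y + r *\<^sub>R v' \<in> S"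
      using H elim(1) unfolding separated_by_def by (auto simp: case_prod_beta)
    then show ?case using elim(2) by (simp add: indicator_def)
  qed
qed

lemma trace_zero_direction: "trace S y 0 = indicator S y"
  by (simp add: trace_def indicator_def)

lemma trace_off_hyperplanes:
  assumes "polyhedral S" "separated_by H S" "\<And>a b. (a,b) \<in> H \<Longrightarrow> a \<bullet> y \<noteq> b"
  shows "trace S y v = indicator S y"
  using trace_cong_direction[OF assms(1,2), of y v 0] assms(3) by (simp add: trace_zero_direction)

lemma trace_interior:
  assumes "polyhedral S" "y \<notin> frontier S"
  shows "trace S y v = indicator S y"
proof (rule traceI[OF assms(1)])
  have t: "((\<lambda>r. y + r *\<^sub>R v) \<longlongrightarrow> y + 0 *\<^sub>R v) (at_right 0)"
    by (intro tendsto_intros)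
  show "\<forall>\<^sub>F r in at_right 0. indicator S (y + r *\<^sub>R v) = indicator S y"
  proof (cases "y \<in> S")
    case True
    then have "y \<in> interior S" using assms(2) closure_subset by (auto simp: frontier_def)
    then have "\<forall>\<^sub>F r in at_right 0. y + r *\<^sub>R v \<in> interior S"
      using topological_tendstoD[OF t open_interior] by simp
    then show ?thesis
      by eventually_elim (use True interior_subset in \<open>auto simp: indicator_def\<close>)
  next
    case False
    then have "y \<in> - closure S" using assms(2) interior_subset by (auto simp: frontier_def)
    then have "\<forall>\<^sub>F r in at_right 0. y + r *\<^sub>R v \<in> - closure S"
      by (intro topological_tendstoD[OF t]) auto
    then show ?thesis
      by eventually_elim (use False closure_subset in \<open>auto simp: indicator_def\<close>)
  qed
qed

lemma trace_at_left_right: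
  assumes "polyhedral S"
  shows "\<forall>\<^sub>F r in at_right s. indicator S (x + r *\<^sub>R w) = trace S (x + s *\<^sub>R w) w"
    and "\<forall>\<^sub>F r in at_left s. indicator S (x + r *\<^sub>R w) = trace S (x + s *\<^sub>R w) (- w)"
proof -
  show "\<forall>\<^sub>F r in at_right s. indicator S (x + r *\<^sub>R w) = trace S (x + s *\<^sub>R w) w"
    using eventually_trace[OF assms, of "x + s *\<^sub>R w" w]
    by (subst eventually_at_right_to_0) (simp add: algebra_simps)
  have "\<forall>\<^sub>F r in at_right (- s). indicator S (x + (- r) *\<^sub>R w) = trace S (x + s *\<^sub>R w) (- w)"
    using eventually_trace[OF assms, of "x + s *\<^sub>R w" "- w"]
    by (subst eventually_at_right_to_0) (simp add: algebra_simps)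
  then show "\<forall>\<^sub>F r in at_left s. indicator S (x + r *\<^sub>R w) = trace S (x + s *\<^sub>R w) (- w)"
    by (subst eventually_at_left_to_right) simp
qed

text \<open>
  The one-dimensional divergence theorem with jumps: split at the points of
  \<open>Z\<close>. The one-sided limits of the factor, rather than its values, enter
  because its values at the jumps are irrelevant.
\<close>

lemma piecewise_constant_has_integral:
  fixes k km kp G G' :: "real \<Rightarrow> real"
  assumes "finite Z" "a < b" "Z \<subseteq> {a<..<b}"
    and const: "\<And>s s'. a < s \<Longrightarrow> s \<le> s' \<Longrightarrow> s' < b \<Longrightarrow> Z \<inter> {s..s'} = {} \<Longrightarrow> k s = k s'"
    and km: "\<And>s. \<forall>\<^sub>F r in at_left s. k r = km s"
    and kp: "\<And>s. \<forall>\<^sub>F r in at_right s. k r = kp s"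
    and G: "\<And>s. (G has_real_derivative G' s) (at s)"
  shows "((\<lambda>s. k s * G' s) has_integral (km b * G b - kp a * G a - (\<Sum>z\<in>Z. (kp z - km z) * G z))) {a..b}"
  using assms(1-4)
proof (induction "card Z" arbitrary: Z a b rule: less_induct)
  case less
  show ?case
  proof (cases "Z = {}")
    case True
    define m where "m = (a + b) / 2"
    have m: "a < m" "m < b" using less.prems by (auto simp: m_def)
    have k: "k s = k m" if "a < s" "s < b" for s
    proof (cases "s \<le> m")
      case False
      then show ?thesis by (intro less.prems(4)[of m s, symmetric]) (use that m True in auto)
    qed (intro less.prems(4), use that m True in auto)
    have "\<forall>\<^sub>F r in at_left b. km b = k m"
      using km[of b] eventually_at_left_real[OF less.prems(2)]
      by eventually_elim (metis k greaterThanLessThan_iff)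
    then have 1: "km b = k m" by simp
    have "\<forall>\<^sub>F r in at_right a. kp a = k m"
      using kp[of a] eventually_at_right_real[OF less.prems(2)]
      by eventually_elim (metis k greaterThanLessThan_iff)
    then have 2: "kp a = k m" by simp
    have "(G' has_integral (G b - G a)) {a..b}"
      using G less.prems(2)
      by (intro fundamental_theorem_of_calculus)
         (auto simp: has_real_derivative_iff_has_vector_derivative intro: has_vector_derivative_at_within)
    then have "((\<lambda>s. k m * G' s) has_integral (k m * (G b - G a))) {a..b}"
      by (rule has_integral_mult_right)
    then have "((\<lambda>s. k s * G' s) has_integral (k m * (G b - G a))) {a..b}"
    proof (rule has_integral_spike_finite[of "{a,b}", rotated 2])
      fix s assume "s \<in> {a..b} - {a,b}"
      then have "k s = k m" by (intro k) auto
      then show "k s * G' s = k m * G' s" by simp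
    qed simp
    then show ?thesis using True by (simp add: 1 2 algebra_simps)
  next
    case False
    then obtain z where z: "z \<in> Z" by blast
    then have ab: "a < z" "z < b" using less.prems by auto
    let ?A = "{x\<in>Z. x < z}" and ?B = "{x\<in>Z. z < x}"
    have card: "card ?A < card Z" "card ?B < card Z"
      using z less.prems(1) by (auto intro!: psubset_card_mono)
    have "((\<lambda>s. k s * G' s) has_integral (km z * G z - kp a * G a - (\<Sum>z\<in>?A. (kp z - km z) * G z))) {a..z}"
    proof (rule less.hyps[OF card(1)])
      show "k s = k s'" if "a < s" "s \<le> s'" "s' < z" "?A \<inter> {s..s'} = {}" for s s'
        using that ab by (intro less.prems(4)) (auto simp: set_eq_iff)
    qed (use less.prems ab in auto)
    moreover have "((\<lambda>s. k s * G' s) has_integral (km b * G b - kp z * G z - (\<Sum>z\<in>?B. (kp z - km z) * G z))) {z..b}"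
    proof (rule less.hyps[OF card(2)])
      show "k s = k s'" if "z < s" "s \<le> s'" "s' < b" "?B \<inter> {s..s'} = {}" for s s'
        using that ab by (intro less.prems(4)) (auto simp: set_eq_iff)
    qed (use less.prems ab in auto)
    ultimately have "((\<lambda>s. k s * G' s) has_integral
        (km z * G z - kp a * G a - (\<Sum>z\<in>?A. (kp z - km z) * G z)
        + (km b * G b - kp z * G z - (\<Sum>z\<in>?B. (kp z - km z) * G z)))) {a..b}"
      using ab by (intro has_integral_combine[of a z b]) auto
    moreover have "(\<Sum>z\<in>Z. (kp z - km z) * G z) = (\<Sum>z\<in>?A. (kp z - km z) * G z) + (kp z - km z) * G z + (\<Sum>z\<in>?B. (kp z - km z) * G z)"
    proof -
      have "Z = insert z (?A \<union> ?B)" using z by auto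
      then have "(\<Sum>z\<in>Z. (kp z - km z) * G z) = (\<Sum>z\<in>insert z (?A \<union> ?B). (kp z - km z) * G z)" by simp
      also have "\<dots> = (kp z - km z) * G z + (\<Sum>z\<in>?A \<union> ?B. (kp z - km z) * G z)"
        using less.prems(1) by (intro sum.insert) auto
      also have "(\<Sum>z\<in>?A \<union> ?B. (kp z - km z) * G z) = (\<Sum>z\<in>?A. (kp z - km z) * G z) + (\<Sum>z\<in>?B. (kp z - km z) * G z)"
        using less.prems(1) by (intro sum.union_disjoint) auto
      finally show ?thesis by simp
    qed
    then have "km z * G z - kp a * G a - (\<Sum>z\<in>?A. (kp z - km z) * G z)
        + (km b * G b - kp z * G z - (\<Sum>z\<in>?B. (kp z - km z) * G z))
      = km b * G b - kp a * G a - (\<Sum>z\<in>Z. (kp z - km z) * G z)"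
      by (simp add: left_diff_distrib)
    ultimately show ?thesis by simp
  qed
qed

lemma line_jump_formula:
  fixes K :: "'a::euclidean_space set" and g :: "'a \<Rightarrow> real"
  assumes K: "polyhedral K" and H: "separated_by H K"
    and off: "\<And>a b. (a,b) \<in> H \<Longrightarrow> a \<bullet> x \<noteq> b" "\<And>a b. (a,b) \<in> H \<Longrightarrow> a \<bullet> (x + w) \<noteq> b"
    and g: "\<And>y. (g has_derivative g' y) (at y)"
  defines "Z \<equiv> {s. 0 < s \<and> s < 1 \<and> (\<exists>(a,b)\<in>H. a \<bullet> (x + s *\<^sub>R w) = b)}"
  shows "finite Z"
    and "((\<lambda>s. indicator K (x + s *\<^sub>R w) * g' (x + s *\<^sub>R w) w) has_integral
      (indicator K (x + w) * g (x + w) - indicator K x * g x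
        - (\<Sum>z\<in>Z. (trace K (x + z *\<^sub>R w) w - trace K (x + z *\<^sub>R w) (- w)) * g (x + z *\<^sub>R w)))) {0..1}"
proof -
  have finH: "finite H" using H by (simp add: separated_by_def)
  have "Z \<subseteq> (\<lambda>(a,b). (b - a \<bullet> x) / (a \<bullet> w)) ` H"
  proof
    fix s assume "s \<in> Z"
    then obtain a b where ab: "(a,b) \<in> H" "a \<bullet> (x + s *\<^sub>R w) = b" by (auto simp: Z_def)
    have "a \<bullet> w \<noteq> 0" using off(1)[OF ab(1)] ab(2) by (auto simp: inner_simps)
    then have "s = (b - a \<bullet> x) / (a \<bullet> w)" using ab(2) by (auto simp: inner_simps field_simps)
    then show "s \<in> (\<lambda>(a,b). (b - a \<bullet> x) / (a \<bullet> w)) ` H" using ab(1) by force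
  qed
  then show fin: "finite Z" using finH finite_surj by blast
  have "((\<lambda>s. indicator K (x + s *\<^sub>R w) * g' (x + s *\<^sub>R w) w) has_integral
      (trace K (x + 1 *\<^sub>R w) (- w) * g (x + 1 *\<^sub>R w) - trace K (x + 0 *\<^sub>R w) w * g (x + 0 *\<^sub>R w)
        - (\<Sum>z\<in>Z. (trace K (x + z *\<^sub>R w) w - trace K (x + z *\<^sub>R w) (- w)) * g (x + z *\<^sub>R w)))) {0..1}"
  proof (rule piecewise_constant_has_integral[OF fin])
    show "Z \<subseteq> {0<..<1}" by (auto simp: Z_def)
    show "\<forall>\<^sub>F r in at_left s. indicator K (x + r *\<^sub>R w) = trace K (x + s *\<^sub>R w) (- w)" for s
      by (rule trace_at_left_right[OF K])
    show "\<forall>\<^sub>F r in at_right s. indicator K (x + r *\<^sub>R w) = trace K (x + s *\<^sub>R w) w" for s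
      by (rule trace_at_left_right[OF K])
    show "((\<lambda>s. g (x + s *\<^sub>R w)) has_real_derivative g' (x + s *\<^sub>R w) w) (at s)" for s
    proof -
      have l: "((\<lambda>s. x + s *\<^sub>R w) has_derivative (\<lambda>r. r *\<^sub>R w)) (at s)"
        by (auto intro!: derivative_eq_intros)
      have "((\<lambda>s. g (x + s *\<^sub>R w)) has_derivative (\<lambda>r. g' (x + s *\<^sub>R w) (r *\<^sub>R w))) (at s)"
        using has_derivative_compose[OF l g] .
      moreover have "(\<lambda>r. g' (x + s *\<^sub>R w) (r *\<^sub>R w)) = (*) (g' (x + s *\<^sub>R w) w)"
        by (rule ext) (simp add: linear_cmul[OF has_derivative_linear[OF g]])
      ultimately show ?thesis by (simp add: has_field_derivative_def)
    qed
    fix s s' :: real assume s: "0 < s" "s \<le> s'" "s' < 1" "Z \<inter> {s..s'} = {}"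
    have "\<forall>(a,b)\<in>H. a \<bullet> (x + s *\<^sub>R w) \<le> b \<longleftrightarrow> a \<bullet> (x + s' *\<^sub>R w) \<le> b"
    proof (clarify, rule ccontr)
      fix a b assume ab: "(a,b) \<in> H" and "(a \<bullet> (x + s *\<^sub>R w) \<le> b) \<noteq> (a \<bullet> (x + s' *\<^sub>R w) \<le> b)"
      then have "\<exists>r. s \<le> r \<and> r \<le> s' \<and> a \<bullet> (x + r *\<^sub>R w) = b"
        using IVT'[of "\<lambda>r. a \<bullet> (x + r *\<^sub>R w)" s b s'] IVT2'[of "\<lambda>r. a \<bullet> (x + r *\<^sub>R w)" s' b s] s
        by (fastforce intro!: continuous_intros)
      then obtain r where r: "s \<le> r" "r \<le> s'" "a \<bullet> (x + r *\<^sub>R w) = b" by blast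
      then have "r \<in> Z" using s ab by (auto simp: Z_def)
      then show False using r s by auto
    qed
    then have "x + s *\<^sub>R w \<in> K \<longleftrightarrow> x + s' *\<^sub>R w \<in> K"
      using H unfolding separated_by_def by blast
    then show "indicator K (x + s *\<^sub>R w) = (indicator K (x + s' *\<^sub>R w) :: real)"
      by (simp add: indicator_def)
  qed simp
  then show "((\<lambda>s. indicator K (x + s *\<^sub>R w) * g' (x + s *\<^sub>R w) w) has_integral
      (indicator K (x + w) * g (x + w) - indicator K x * g x
        - (\<Sum>z\<in>Z. (trace K (x + z *\<^sub>R w) w - trace K (x + z *\<^sub>R w) (- w)) * g (x + z *\<^sub>R w)))) {0..1}"
    using trace_off_hyperplanes[OF K H off(1), of w] trace_off_hyperplanes[OF K H off(2), of "- w"] by simp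
qed

text \<open>
  At a point that lies on hyperplanes with normal \<open>n\<close> only, all directions on
  the same side of the hyperplane see the same trace, so the outward normal determines the
  jump along \<open>w\<close>.
\<close>

lemma jump_at_face:
  assumes K: "polyhedral K" and H: "separated_by H K" and n: "norm n = 1" and nw: "n \<bullet> w \<noteq> 0"
    and e: "e > 0" "\<forall>s. 0 < s \<and> s < e \<longrightarrow> y - s *\<^sub>R n \<in> K \<and> y + s *\<^sub>R n \<notin> K"
    and par: "\<And>a b. (a,b) \<in> H \<Longrightarrow> a \<bullet> y = b \<Longrightarrow> \<exists>l. a = l *\<^sub>R n"
  shows "trace K y w - trace K y (- w) = - sgn (n \<bullet> w)"
proof -
  have nn: "n \<bullet> n = 1" using n by (simp add: dot_square_norm)
  have ev: "\<forall>\<^sub>F r in at_right 0. 0 < r \<and> r < e"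
    using eventually_at_right_real[OF e(1)] by simp
  have out: "trace K y n = 0"
    by (rule traceI[OF K], rule eventually_mono[OF ev]) (use e in auto)
  have inn: "trace K y (- n) = 1"
    by (rule traceI[OF K], rule eventually_mono[OF ev]) (use e in auto)
  have cong: "trace K y v = trace K y v'" if "sgn (n \<bullet> v) = sgn (n \<bullet> v')" for v v'
  proof (rule trace_cong_direction[OF K H])
    fix a b assume ab: "(a,b) \<in> H" "a \<bullet> y = b"
    then obtain l where "a = l *\<^sub>R n" using par by blast
    then show "(a \<bullet> v \<le> 0) = (a \<bullet> v' \<le> 0)"
      using that by (auto simp: mult_le_0_iff sgn_if split: if_splits)
  qed
  show ?thesis
  proof (cases "n \<bullet> w > 0")
    case True
    then have "trace K y w = trace K y n" "trace K y (- w) = trace K y (- n)"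
      by (auto intro!: cong simp: nn)
    then show ?thesis using True out inn by simp
  next
    case False
    then have "n \<bullet> w < 0" using nw by simp
    then have "trace K y w = trace K y (- n)" "trace K y (- w) = trace K y n"
      by (auto intro!: cong simp: nn)
    then show ?thesis using \<open>n \<bullet> w < 0\<close> out inn by simp
  qed
qed

text \<open>
  The jumps along a generic line correspond one to one to the transversal faces that it
  meets: jumps occur on the frontier, which is covered by the faces, and at a good point of
  a face there is a jump. The sign of the jump is opposite to that of the normal component
  of the direction.
\<close>

lemma sum_jumps_eq_sum_faces:
  fixes K :: "'a::euclidean_space set" and g :: "'a \<Rightarrow> real"
  assumes K: "polyhedral K" and H: "separated_by H K" and E: "finite E" "frontier K = \<Union>E"
    and n: "\<And>\<sigma>. \<sigma> \<in> E \<Longrightarrow> norm (n \<sigma>) = 1"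
    and c: "\<And>\<sigma> y. \<sigma> \<in> E \<Longrightarrow> y \<in> \<sigma> \<Longrightarrow> n \<sigma> \<bullet> y = c \<sigma>"
    and offH: "\<And>a b. (a,b) \<in> H \<Longrightarrow> a \<bullet> x \<noteq> b"
    and offE: "\<And>\<sigma>. \<sigma> \<in> E \<Longrightarrow> n \<sigma> \<bullet> x \<noteq> c \<sigma>" "\<And>\<sigma>. \<sigma> \<in> E \<Longrightarrow> n \<sigma> \<bullet> (x + w) \<noteq> c \<sigma>"
    and good: "\<And>\<sigma>. \<sigma> \<in> E \<Longrightarrow> n \<sigma> \<bullet> w \<noteq> 0 \<Longrightarrow> hit (n \<sigma>) (c \<sigma>) w x \<in> \<sigma> \<Longrightarrow>
      \<exists>e>0. \<forall>s. 0 < s \<and> s < e \<longrightarrow> hit (n \<sigma>) (c \<sigma>) w x - s *\<^sub>R n \<sigma> \<in> K \<and> hit (n \<sigma>) (c \<sigma>) w x + s *\<^sub>R n \<sigma> \<notin> K"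
    and disj: "\<And>\<sigma> \<tau>. \<sigma> \<in> E \<Longrightarrow> \<tau> \<in> E \<Longrightarrow> \<sigma> \<noteq> \<tau> \<Longrightarrow> n \<sigma> \<bullet> w \<noteq> 0 \<Longrightarrow> hit (n \<sigma>) (c \<sigma>) w x \<notin> \<sigma> \<inter> \<tau>"
    and par: "\<And>\<sigma> a b. \<sigma> \<in> E \<Longrightarrow> n \<sigma> \<bullet> w \<noteq> 0 \<Longrightarrow> (a,b) \<in> H \<Longrightarrow> a \<bullet> hit (n \<sigma>) (c \<sigma>) w x = b \<Longrightarrow> \<exists>l. a = l *\<^sub>R n \<sigma>"
  defines "Z \<equiv> {s. 0 < s \<and> s < 1 \<and> (\<exists>(a,b)\<in>H. a \<bullet> (x + s *\<^sub>R w) = b)}"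
  assumes finZ: "finite Z"
  shows "(\<Sum>z\<in>Z. (trace K (x + z *\<^sub>R w) w - trace K (x + z *\<^sub>R w) (- w)) * g (x + z *\<^sub>R w))
    = (\<Sum>\<sigma>\<in>{\<sigma>\<in>E. n \<sigma> \<bullet> w \<noteq> 0}. - sgn (n \<sigma> \<bullet> w) *
        (indicator {x. 0 \<le> hitting_time (n \<sigma>) (c \<sigma>) w x \<and> hitting_time (n \<sigma>) (c \<sigma>) w x \<le> 1} x *
         (indicator \<sigma> (hit (n \<sigma>) (c \<sigma>) w x) * g (hit (n \<sigma>) (c \<sigma>) w x))))"
proof -
  let ?t = "\<lambda>\<sigma>. hitting_time (n \<sigma>) (c \<sigma>) w x" and ?y = "\<lambda>\<sigma>. hit (n \<sigma>) (c \<sigma>) w x"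
  let ?J = "\<lambda>y. trace K y w - trace K y (- w)"
  define P where "P = {\<sigma>\<in>E. n \<sigma> \<bullet> w \<noteq> 0 \<and> 0 \<le> ?t \<sigma> \<and> ?t \<sigma> \<le> 1 \<and> ?y \<sigma> \<in> \<sigma>}"
  have yt: "?y \<sigma> = x + ?t \<sigma> *\<^sub>R w" for \<sigma> by (simp add: hit_def)
  have jump: "?J (?y \<sigma>) = - sgn (n \<sigma> \<bullet> w)" if "\<sigma> \<in> P" for \<sigma>
  proof -
    have s: "\<sigma> \<in> E" "n \<sigma> \<bullet> w \<noteq> 0" "?y \<sigma> \<in> \<sigma>" using that by (auto simp: P_def)
    obtain e where "e > 0" "\<forall>s. 0 < s \<and> s < e \<longrightarrow> ?y \<sigma> - s *\<^sub>R n \<sigma> \<in> K \<and> ?y \<sigma> + s *\<^sub>R n \<sigma> \<notin> K"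
      using good[OF s] by blast
    then show ?thesis
      using par[OF s(1,2)] by (intro jump_at_face[OF K H n[OF s(1)] s(2)]) auto
  qed
  have inZ: "?t \<sigma> \<in> Z" if "\<sigma> \<in> P" for \<sigma>
  proof -
    have s: "\<sigma> \<in> E" "n \<sigma> \<bullet> w \<noteq> 0" "?y \<sigma> \<in> \<sigma>" "0 \<le> ?t \<sigma>" "?t \<sigma> \<le> 1" using that by (auto simp: P_def)
    have "?t \<sigma> \<noteq> 0" using offE(1)[OF s(1)] s(2) by (auto simp: hitting_time_def)
    moreover have "?t \<sigma> \<noteq> 1" using offE(2)[OF s(1)] s(2) by (auto simp: hitting_time_def inner_simps field_simps)
    moreover have "\<exists>(a,b)\<in>H. a \<bullet> ?y \<sigma> = b"
    proof (rule ccontr)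
      assume "\<not> (\<exists>(a,b)\<in>H. a \<bullet> ?y \<sigma> = b)"
      then have "\<And>a b. (a,b) \<in> H \<Longrightarrow> a \<bullet> ?y \<sigma> \<noteq> b" by blast
      from trace_off_hyperplanes[OF K H this] have "?J (?y \<sigma>) = 0" by simp
      then show False using jump[OF that] s(2) by (simp add: sgn_zero_iff)
    qed
    ultimately show ?thesis using s unfolding Z_def yt by auto
  qed
  have inj: "inj_on ?t P"
  proof (rule inj_onI, rule ccontr)
    fix \<sigma> \<tau> assume st: "\<sigma> \<in> P" "\<tau> \<in> P" "?t \<sigma> = ?t \<tau>" "\<sigma> \<noteq> \<tau>"
    then have "?y \<sigma> = ?y \<tau>" by (simp add: yt)
    then have "?y \<sigma> \<in> \<sigma> \<inter> \<tau>" using st by (auto simp: P_def)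
    then show False using disj[of \<sigma> \<tau>] st by (auto simp: P_def)
  qed
  have cover: "z \<in> ?t ` P" if z: "z \<in> Z" and J: "?J (x + z *\<^sub>R w) \<noteq> 0" for z
  proof -
    have "x + z *\<^sub>R w \<in> frontier K"
      using trace_interior[OF K, of "x + z *\<^sub>R w"] J by force
    then obtain \<sigma> where s: "\<sigma> \<in> E" "x + z *\<^sub>R w \<in> \<sigma>" using E by blast
    have eq: "n \<sigma> \<bullet> x + z * (n \<sigma> \<bullet> w) = c \<sigma>"
      using c[OF s] by (simp add: inner_simps)
    have nw: "n \<sigma> \<bullet> w \<noteq> 0" using eq offE(1)[OF s(1)] by auto
    then have "?t \<sigma> = z" using eq by (simp add: hitting_time_def field_simps)
    then show ?thesis
      using s nw z by (intro image_eqI[of _ _ \<sigma>]) (auto simp: P_def yt Z_def)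
  qed
  have "(\<Sum>z\<in>Z. ?J (x + z *\<^sub>R w) * g (x + z *\<^sub>R w)) = (\<Sum>z\<in>?t ` P. ?J (x + z *\<^sub>R w) * g (x + z *\<^sub>R w))"
    using finZ inZ cover by (intro sum.mono_neutral_right) auto
  also have "\<dots> = (\<Sum>\<sigma>\<in>P. ?J (?y \<sigma>) * g (?y \<sigma>))"
    using inj by (simp add: sum.reindex yt)
  also have "\<dots> = (\<Sum>\<sigma>\<in>P. - sgn (n \<sigma> \<bullet> w) * (indicator {x. 0 \<le> hitting_time (n \<sigma>) (c \<sigma>) w x \<and> hitting_time (n \<sigma>) (c \<sigma>) w x \<le> 1} x *
         (indicator \<sigma> (?y \<sigma>) * g (?y \<sigma>))))"
    by (rule sum.cong) (simp_all add: jump, simp add: P_def)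
  also have "\<dots> = (\<Sum>\<sigma>\<in>{\<sigma>\<in>E. n \<sigma> \<bullet> w \<noteq> 0}. - sgn (n \<sigma> \<bullet> w) * (indicator {x. 0 \<le> hitting_time (n \<sigma>) (c \<sigma>) w x \<and> hitting_time (n \<sigma>) (c \<sigma>) w x \<le> 1} x *
         (indicator \<sigma> (?y \<sigma>) * g (?y \<sigma>))))"
    using E by (intro sum.mono_neutral_left) (auto simp: P_def indicator_def)
  finally show ?thesis .
qed

section \<open>The divergence theorem on a polyhedral cell\<close>

lemma AE_lborel_notin_negligible: "negligible N \<Longrightarrow> AE x in lborel. x \<notin> N"
  by (auto simp: negligible_iff_null_sets null_sets_completion_iff2 intro!: AE_I')

lemma integral_lborel_translate:
  fixes f :: "'a::euclidean_space \<Rightarrow> real"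
  assumes "f \<in> borel_measurable borel"
  shows "(\<integral>x. f (x + v) \<partial>lborel) = (\<integral>x. f x \<partial>lborel)"
    and "integrable lborel (\<lambda>x. f (x + v)) \<longleftrightarrow> integrable lborel f"
  using assms
  by (simp_all add: lborel_distr_plus[of v] integral_distr[of "(+) v" lborel borel f, symmetric]
        integrable_distr_eq[of "(+) v" lborel borel f, symmetric] add.commute[of _ v])

text \<open>
  This replaces a decomposition of the space into lines, which would need coordinates
  adapted to \<open>v\<close>.
\<close>

lemma integral_lborel_average_along:
  fixes f :: "'a::euclidean_space \<Rightarrow> real"
  assumes f: "integrable lborel f"
  shows "(\<integral>x. f x \<partial>lborel) = (\<integral>x. (\<integral>s. indicator {0..1} s * f (x + s *\<^sub>R v) \<partial>lborel) \<partial>lborel)"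
    and "AE x in lborel. integrable lborel (\<lambda>s::real. indicator {0..1} s * f (x + s *\<^sub>R v))"
proof -
  have [measurable]: "f \<in> borel_measurable borel"
    using borel_measurable_integrable[OF f] by simp
  have int: "integrable (lborel \<Otimes>\<^sub>M lborel) (\<lambda>(s::real, x). indicator {0..1} s * f (x + s *\<^sub>R v))"
  proof (rule lborel_pair.Fubini_integrable)
    have "integrable lborel (\<lambda>x. \<bar>f (x + s *\<^sub>R v)\<bar>)" for s
      using f integral_lborel_translate(2)[of f "s *\<^sub>R v"] by auto
    then show "AE s in lborel. integrable lborel (\<lambda>y. case (s, y) of (s::real, x) \<Rightarrow> indicator {0..1} s * f (x + s *\<^sub>R v))"
      using f integral_lborel_translate(2)[of f] by auto
    have "(\<integral>y. norm (indicator {0..1} s * f (y + s *\<^sub>R v)) \<partial>lborel) = indicator {0..1} s * (\<integral>y. \<bar>f y\<bar> \<partial>lborel)" for s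
      using integral_lborel_translate(1)[of "\<lambda>y. \<bar>f y\<bar>" "s *\<^sub>R v"] by (simp add: abs_mult indicator_def)
    then show "integrable lborel (\<lambda>s. \<integral>y. norm (case (s, y) of (s::real, x) \<Rightarrow> indicator {0..1} s * f (x + s *\<^sub>R v)) \<partial>lborel)"
      by simp
  qed measurable
  have "(\<integral>x. (\<integral>s. indicator {0..1} s * f (x + s *\<^sub>R v) \<partial>lborel) \<partial>lborel)
      = (\<integral>s. (\<integral>x. indicator {0..1} s * f (x + s *\<^sub>R v) \<partial>lborel) \<partial>lborel)"
    using lborel_pair.Fubini_integral[OF int] by simp
  also have "\<dots> = (\<integral>s. indicator {0..1::real} s * (\<integral>x. f x \<partial>lborel) \<partial>lborel)"
    using integral_lborel_translate(1)[of f] by simp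
  also have "\<dots> = (\<integral>x. f x \<partial>lborel)" by simp
  finally show "(\<integral>x. f x \<partial>lborel) = (\<integral>x. (\<integral>s. indicator {0..1} s * f (x + s *\<^sub>R v) \<partial>lborel) \<partial>lborel)" ..
  show "AE x in lborel. integrable lborel (\<lambda>s::real. indicator {0..1} s * f (x + s *\<^sub>R v))"
    using lborel_pair.AE_integrable_snd[OF int] by simp
qed

lemma integral_derivative_along_eq_0:
  fixes q q' :: "'a::euclidean_space \<Rightarrow> real"
  assumes q: "integrable lborel q" and q': "integrable lborel q'"
    and d: "\<And>x s. ((\<lambda>r. q (x + r *\<^sub>R v)) has_real_derivative q' (x + s *\<^sub>R v)) (at s)"
  shows "(\<integral>x. q' x \<partial>lborel) = 0"
proof -
  have [measurable]: "q \<in> borel_measurable borel" "q' \<in> borel_measurable borel"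
    using borel_measurable_integrable[OF q] borel_measurable_integrable[OF q'] by simp_all
  have "(\<integral>x. q' x \<partial>lborel) = (\<integral>x. (\<integral>s. indicator {0..1} s * q' (x + s *\<^sub>R v) \<partial>lborel) \<partial>lborel)"
    by (rule integral_lborel_average_along[OF q'])
  also have "\<dots> = (\<integral>x. q (x + v) - q x \<partial>lborel)"
  proof (rule integral_cong_AE)
    show "AE x in lborel. (\<integral>s. indicator {0..1} s * q' (x + s *\<^sub>R v) \<partial>lborel) = q (x + v) - q x"
      using integral_lborel_average_along(2)[OF q', of v]
    proof eventually_elim
      case (elim x)
      have "((\<lambda>s. q' (x + s *\<^sub>R v)) has_integral (q (x + 1 *\<^sub>R v) - q (x + 0 *\<^sub>R v))) {0..1}"
        using d by (intro fundamental_theorem_of_calculus)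
          (auto simp: has_real_derivative_iff_has_vector_derivative[symmetric] intro: has_field_derivative_at_within)
      then have "integral {0..1} (\<lambda>s. q' (x + s *\<^sub>R v)) = q (x + v) - q x"
        by (simp add: integral_unique)
      then show ?case
        using set_borel_integral_eq_integral(2)[of "{0..1}" "\<lambda>s. q' (x + s *\<^sub>R v)"] elim
        by (simp add: set_integrable_def set_lebesgue_integral_def)
    qed
  qed measurable
  also have "\<dots> = 0"
    using q integral_lborel_translate[of q v] by simp
  finally show ?thesis .
qed

text \<open>
  The normal is chosen in the same way as in the definition of the surface measure.
\<close>

definition face_integral :: "'a::euclidean_space set \<Rightarrow> ('a \<Rightarrow> real) \<Rightarrow> real" where
  "face_integral \<sigma> g = (let n = (SOME n. unit_normal \<sigma> n) in
     \<integral>y. indicator \<sigma> y * g y \<partial>hyperplane_measure n (n \<bullet> (SOME y. y \<in> \<sigma>)))"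

lemma unit_normal_norm: "unit_normal S n \<Longrightarrow> norm n = 1"
  by (simp add: unit_normal_def)

lemma unit_normal_inner_eq: "unit_normal S n \<Longrightarrow> x \<in> S \<Longrightarrow> y \<in> S \<Longrightarrow> n \<bullet> x = n \<bullet> y"
  unfolding unit_normal_def by (metis inner_diff_right right_minus_eq)

lemma unit_normal_hyperplane:
  assumes "unit_normal S n"
  obtains c where "S \<subseteq> {y. n \<bullet> y = c}"
proof (cases "S = {}")
  case False
  then obtain y where "y \<in> S" by blast
  then show thesis using unit_normal_inner_eq[OF assms] by (intro that[of "n \<bullet> y"]) blast
qed (use that in auto)

lemma bounded_cylinder: "bounded S \<Longrightarrow> bounded (cylinder n S)"
proof -
  assume S: "bounded S"
  have "bounded ((\<lambda>s. s *\<^sub>R n) ` {0..1::real})"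
    by (intro compact_imp_bounded compact_continuous_image continuous_intros) auto
  then have "bounded (\<Union>x\<in>S. \<Union>y\<in>(\<lambda>s. s *\<^sub>R n) ` {0..1::real}. {x + y})"
    by (rule bounded_sums[OF S])
  then show ?thesis
    by (rule bounded_subset) (fastforce simp: cylinder_def)
qed

lemma emeasure_face_finite:
  assumes "norm n = 1" "\<sigma> \<subseteq> {y. n \<bullet> y = c}" "\<sigma> \<in> sets borel" "bounded \<sigma>"
  shows "emeasure (hyperplane_measure n c) \<sigma> < \<infinity>"
  unfolding emeasure_hyperplane_measure[OF assms(1-3)]
  by (intro emeasure_bounded_finite bounded_cylinder assms)

lemma emeasure_face_zero_iff:
  assumes n: "norm n = 1" "\<sigma> \<subseteq> {y. n \<bullet> y = c}" "\<sigma> \<in> sets borel"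
  shows "emeasure (hyperplane_measure n c) \<sigma> = 0 \<longleftrightarrow> negligible (cylinder n \<sigma>)"
proof -
  have "cylinder n \<sigma> \<in> sets borel" by (rule sets_cylinder[OF n])
  then show ?thesis
    unfolding emeasure_hyperplane_measure[OF n] by (auto simp: negligible_iff_emeasure0)
qed

text \<open>
  The choice of the normal does not matter: a different normal is either the opposite one,
  which gives the same hyperplane measure, or the set is null for both.
\<close>

lemma face_integral_eq:
  fixes \<sigma> :: "'a::euclidean_space set"
  assumes \<sigma>[measurable]: "\<sigma> \<in> sets borel"
    and n: "unit_normal \<sigma> n" and c: "\<sigma> \<subseteq> {y. n \<bullet> y = c}" and g[measurable]: "g \<in> borel_measurable borel"
  shows "face_integral \<sigma> g = (\<integral>y. indicator \<sigma> y * g y \<partial>hyperplane_measure n c)"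
proof (cases "\<sigma> = {}")
  case True
  then show ?thesis by (simp add: face_integral_def)
next
  case False
  define n0 where "n0 = (SOME n. unit_normal \<sigma> n)"
  define c0 where "c0 = n0 \<bullet> (SOME y. y \<in> \<sigma>)"
  have n0: "unit_normal \<sigma> n0" unfolding n0_def using n by (rule someI)
  have y0: "(SOME y. y \<in> \<sigma>) \<in> \<sigma>" using False by (simp add: some_in_eq)
  have c0: "\<sigma> \<subseteq> {y. n0 \<bullet> y = c0}"
    using unit_normal_inner_eq[OF n0 _ y0] by (auto simp: c0_def)
  have f: "face_integral \<sigma> g = (\<integral>y. indicator \<sigma> y * g y \<partial>hyperplane_measure n0 c0)"
    by (simp add: face_integral_def n0_def c0_def Let_def)
  consider "n = n0" | "n = - n0" | "n \<noteq> n0" "n \<noteq> - n0" by blast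
  then show ?thesis
  proof cases
    case 1
    then have "c = c0" using c c0 y0 by auto
    then show ?thesis using f 1 by simp
  next
    case 2
    then have "c = - c0" using c c0 y0 by auto
    then show ?thesis using f 2 hyperplane_measure_uminus[of n0 c0] unit_normal_norm[OF n0] by simp
  next
    case 3
    have zero: "(\<integral>y. indicator \<sigma> y * g y \<partial>hyperplane_measure m d) = 0"
      if m: "unit_normal \<sigma> m" "\<sigma> \<subseteq> {y. m \<bullet> y = d}" "negligible (cylinder m \<sigma>)" for m d
    proof -
      have "\<sigma> \<in> null_sets (hyperplane_measure m d)"
        using emeasure_face_zero_iff[OF unit_normal_norm[OF m(1)] m(2) \<sigma>] m(3) \<sigma> by auto
      then have "AE y in hyperplane_measure m d. indicator \<sigma> y * g y = 0"
        by (auto dest!: AE_not_in elim: eventually_mono)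
      then show ?thesis by (rule integral_eq_zero_AE)
    qed
    have "negligible (cylinder n \<sigma>)"
      by (rule negligible_cylinder_two_normals[OF n n0]) (use 3 in auto)
    moreover have "negligible (cylinder n0 \<sigma>)"
      by (rule negligible_cylinder_two_normals[OF n0 n]) (use 3 in auto)
    ultimately show ?thesis using f zero[OF n c] zero[OF n0 c0] by simp
  qed
qed

lemma surface_measure_eq_face_integral:
  assumes "\<sigma> \<in> sets borel" "unit_normal \<sigma> n"
  shows "surface_measure \<sigma> = face_integral \<sigma> (\<lambda>_. 1)"
proof (cases "\<sigma> = {}")
  case True
  then show ?thesis by (simp add: face_integral_def surface_measure_def cylinder_def)
next
  case False
  define n0 where "n0 = (SOME n. unit_normal \<sigma> n)"
  define y0 where "y0 = (SOME y. y \<in> \<sigma>)"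
  have n0: "unit_normal \<sigma> n0" unfolding n0_def using assms(2) by (rule someI)
  have y0: "y0 \<in> \<sigma>" unfolding y0_def using False by (simp add: some_in_eq)
  have sub: "\<sigma> \<subseteq> {y. n0 \<bullet> y = n0 \<bullet> y0}"
    using unit_normal_inner_eq[OF n0 _ y0] by blast
  note e = emeasure_hyperplane_measure[OF unit_normal_norm[OF n0] sub assms(1)]
  have "face_integral \<sigma> (\<lambda>_. 1) = measure (hyperplane_measure n0 (n0 \<bullet> y0)) \<sigma>"
    using assms(1) by (simp add: face_integral_def n0_def[symmetric] y0_def[symmetric] Let_def)
  also have "\<dots> = measure lborel (cylinder n0 \<sigma>)"
    using e by (simp add: measure_def)
  also have "\<dots> = surface_measure \<sigma>"
    using sets_cylinder[OF unit_normal_norm[OF n0] sub assms(1)] by (simp add: surface_measure_def n0_def[symmetric])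
  finally show ?thesis by simp
qed

lemma surface_measure_eq:
  assumes \<sigma>: "\<sigma> \<in> sets borel" and n: "unit_normal \<sigma> n" and c: "\<sigma> \<subseteq> {y. n \<bullet> y = c}"
  shows "surface_measure \<sigma> = measure (hyperplane_measure n c) \<sigma>"
  using assms by (simp add: surface_measure_eq_face_integral[OF \<sigma> n] face_integral_eq[OF \<sigma> n c])

lemma surface_measure_zero_iff:
  assumes \<sigma>: "\<sigma> \<in> sets borel" and n: "unit_normal \<sigma> n" and b: "bounded \<sigma>"
  shows "surface_measure \<sigma> = 0 \<longleftrightarrow> negligible (cylinder n \<sigma>)"
proof -
  obtain c where c: "\<sigma> \<subseteq> {y. n \<bullet> y = c}" by (rule unit_normal_hyperplane[OF n])
  note nn = unit_normal_norm[OF n]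
  show ?thesis
    using emeasure_face_finite[OF nn c \<sigma> b] emeasure_face_zero_iff[OF nn c \<sigma>]
    by (auto simp: surface_measure_eq[OF \<sigma> n c] measure_def enn2real_eq_0_iff)
qed

lemma surface_measure_nonneg: "0 \<le> surface_measure \<sigma>"
  by (simp add: surface_measure_def)

lemma integrable_on_face:
  fixes g :: "'a::euclidean_space \<Rightarrow> real"
  assumes "norm n = 1" "\<sigma> \<subseteq> {y. n \<bullet> y = c}" "\<sigma> \<in> sets borel" "bounded \<sigma>"
    and "g \<in> borel_measurable borel" "\<And>y. y \<in> \<sigma> \<Longrightarrow> \<bar>g y\<bar> \<le> B"
  shows "integrable (hyperplane_measure n c) (\<lambda>y. indicator \<sigma> y * g y)"
proof (rule integrableI_bounded_set[where A=\<sigma> and B=B])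
  show "emeasure (hyperplane_measure n c) \<sigma> < \<infinity>"
    by (rule emeasure_face_finite[OF assms(1-4)])
qed (use assms in auto)

lemma face_integral_diff_const:
  fixes g :: "'a::euclidean_space \<Rightarrow> real"
  assumes \<sigma>: "\<sigma> \<in> sets borel" and n: "unit_normal \<sigma> n" and b: "bounded \<sigma>"
    and g: "g \<in> borel_measurable borel" and d: "\<And>y. y \<in> \<sigma> \<Longrightarrow> \<bar>g y - \<gamma>\<bar> \<le> \<delta>"
  shows "\<bar>face_integral \<sigma> g - surface_measure \<sigma> * \<gamma>\<bar> \<le> surface_measure \<sigma> * \<delta>"
proof -
  obtain c where c: "\<sigma> \<subseteq> {y. n \<bullet> y = c}" by (rule unit_normal_hyperplane[OF n])
  note nn = unit_normal_norm[OF n]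
  let ?M = "hyperplane_measure n c"
  have i1: "integrable ?M (\<lambda>y. indicator \<sigma> y * g y)"
    by (rule integrable_on_face[OF nn c \<sigma> b g, of "\<bar>\<gamma>\<bar> + \<delta>"]) (use d in force)
  have i2: "integrable ?M (\<lambda>y. indicator \<sigma> y * k)" for k :: real
    by (rule integrable_on_face[OF nn c \<sigma> b, of "\<lambda>_. k" "\<bar>k\<bar>"]) auto
  have k: "(\<integral>y. indicator \<sigma> y * k \<partial>?M) = surface_measure \<sigma> * k" for k :: real
    unfolding surface_measure_eq[OF \<sigma> n c] using \<sigma> by simp
  have "face_integral \<sigma> g - surface_measure \<sigma> * \<gamma> = (\<integral>y. indicator \<sigma> y * g y - indicator \<sigma> y * \<gamma> \<partial>?M)"
    using i1 i2 unfolding face_integral_eq[OF \<sigma> n c g] k[symmetric] by (intro Bochner_Integration.integral_diff[symmetric])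
  also have "\<bar>\<dots>\<bar> \<le> (\<integral>y. \<bar>indicator \<sigma> y * g y - indicator \<sigma> y * \<gamma>\<bar> \<partial>?M)"
    by (rule integral_abs_bound)
  also have "\<dots> \<le> (\<integral>y. indicator \<sigma> y * \<delta> \<partial>?M)"
    using i1 i2 d by (intro integral_mono integrable_abs Bochner_Integration.integrable_diff)
      (auto simp: indicator_def)
  finally show ?thesis unfolding k .
qed

lemma integrable_bounded_borel:
  fixes f :: "'a::euclidean_space \<Rightarrow> 'b::{banach, second_countable_topology}"
  assumes "f \<in> borel_measurable borel" "S \<in> sets borel" "bounded S"
    and "\<And>x. x \<in> S \<Longrightarrow> norm (f x) \<le> B" "\<And>x. x \<notin> S \<Longrightarrow> f x = 0"
  shows "integrable lborel f"
  by (rule integrableI_bounded_set[where A=S and B=B])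
     (use assms emeasure_bounded_finite[OF assms(3)] in auto)

lemma continuous_bounded_on_bounded:
  fixes f :: "'a::euclidean_space \<Rightarrow> 'b::real_normed_vector"
  assumes "continuous_on UNIV f" "bounded S"
  obtains B where "\<And>x. x \<in> S \<Longrightarrow> norm (f x) \<le> B"
proof -
  have "compact (f ` closure S)"
    using assms by (intro compact_continuous_image) (auto intro: continuous_on_subset)
  then obtain B where "\<forall>y\<in>f ` closure S. norm y \<le> B"
    using compact_imp_bounded bounded_iff by blast
  then show thesis using closure_subset by (intro that[of B]) blast
qed

text \<open>
  Integrate the derivative of \<open>g\<close> along \<open>w\<close> over almost every
  line. The contributions of the end points of the segments cancel by translation
  invariance, and the contribution of a face is the area integral weighted by the normal
  component of \<open>w\<close>. Faces parallel to \<open>w\<close> are met by almost no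
  line and have weight zero.
\<close>

theorem cell_divergence:
  fixes K :: "'a::euclidean_space set" and g :: "'a \<Rightarrow> real"
  assumes cell: "is_cell K E" and bK: "bounded K"
    and g: "\<And>y. (g has_derivative g' y) (at y)" and g': "continuous_on UNIV (\<lambda>x. g' x w)"
  shows "(\<integral>x. indicator K x * g' x w \<partial>lborel) = (\<Sum>\<sigma>\<in>E. (normal K \<sigma> \<bullet> w) * face_integral \<sigma> g)"
proof -
  note cell' = cell[unfolded is_cell_def]
  have K: "polyhedral K" using cell' by (rule conjunct1)
  have E: "finite E" "frontier K = \<Union>E"
    using cell'[THEN conjunct2, THEN conjunct2] by (rule conjunct1, rule conjunct1[OF conjunct2])
  have bor: "\<sigma> \<in> sets borel" and ex: "\<exists>n. outward_unit_normal K \<sigma> n" if "\<sigma> \<in> E" for \<sigma>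
    using cell' that by (meson bspec)+
  have ov: "surface_measure (\<sigma> \<inter> \<tau>) = 0" if "\<sigma> \<in> E" "\<tau> \<in> E" "\<sigma> \<noteq> \<tau>" for \<sigma> \<tau>
    using cell' that by (meson bspec)
  have [measurable]: "K \<in> sets borel" by (rule polyhedral_borel[OF K])
  obtain H where H: "separated_by H K" using polyhedral_separated[OF K] by blast
  have finH: "finite H" and H0: "\<And>a b. (a,b) \<in> H \<Longrightarrow> a \<noteq> 0" using H by (auto simp: separated_by_def)
  define n where "n \<sigma> = normal K \<sigma>" for \<sigma>
  define c where "c \<sigma> = n \<sigma> \<bullet> (SOME y. y \<in> \<sigma>)" for \<sigma>
  have out: "outward_unit_normal K \<sigma> (n \<sigma>)" if "\<sigma> \<in> E" for \<sigma>
    unfolding n_def normal_def using ex[OF that] by (rule someI_ex)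
  then have un: "unit_normal \<sigma> (n \<sigma>)" if "\<sigma> \<in> E" for \<sigma>
    using that by (auto simp: outward_unit_normal_def)
  have n1: "norm (n \<sigma>) = 1" if "\<sigma> \<in> E" for \<sigma> by (rule unit_normal_norm[OF un[OF that]])
  have c: "n \<sigma> \<bullet> y = c \<sigma>" if "\<sigma> \<in> E" "y \<in> \<sigma>" for \<sigma> y
  proof -
    have "(SOME y. y \<in> \<sigma>) \<in> \<sigma>" using that(2) by (rule someI)
    then show ?thesis unfolding c_def by (rule unit_normal_inner_eq[OF un[OF that(1)] that(2)])
  qed
  have sub: "\<sigma> \<subseteq> {y. n \<sigma> \<bullet> y = c \<sigma>}" if "\<sigma> \<in> E" for \<sigma> using c that by auto
  have bE: "bounded \<sigma>" if "\<sigma> \<in> E" for \<sigma>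
  proof -
    have "\<sigma> \<subseteq> closure K" using that E by (auto simp: frontier_def)
    then show ?thesis using bK bounded_closure bounded_subset by blast
  qed
  define bad where "bad \<sigma> = {y \<in> \<sigma>. \<not> (\<exists>e>0. \<forall>s. 0 < s \<and> s < e \<longrightarrow> y - s *\<^sub>R n \<sigma> \<in> K \<and> y + s *\<^sub>R n \<sigma> \<notin> K)}" for \<sigma>
  let ?ind = "\<lambda>\<sigma>. {x. 0 \<le> hitting_time (n \<sigma>) (c \<sigma>) w x \<and> hitting_time (n \<sigma>) (c \<sigma>) w x \<le> 1}"
  let ?fl = "\<lambda>\<sigma> x. indicator (?ind \<sigma>) x * (indicator \<sigma> (hit (n \<sigma>) (c \<sigma>) w x) * g (hit (n \<sigma>) (c \<sigma>) w x))"
  let ?ET = "{\<sigma>\<in>E. n \<sigma> \<bullet> w \<noteq> 0}"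
  let ?f = "\<lambda>x. indicator K x * g' x w"

  \<comment> \<open>The line through almost every \<open>x\<close> avoids all exceptional points: its end points lie off the
    hyperplanes, and it meets the transversal faces only at points where the outward normal is
    effective, where a single face passes, and which lie on no hyperplane of other direction.\<close>
  have aeH: "AE x in lborel. \<forall>(a,b)\<in>H. a \<bullet> x \<noteq> b \<and> a \<bullet> (x + w) \<noteq> b"
  proof -
    have "AE x in lborel. \<forall>h\<in>H. x \<notin> {x. fst h \<bullet> x = snd h} \<and> x \<notin> {x. fst h \<bullet> x = snd h - fst h \<bullet> w}"
    proof (rule AE_finite_allI[OF finH])
      fix h assume "h \<in> H"
      then have "fst h \<noteq> 0" using H0 by (metis prod.collapse)
      then show "AE x in lborel. x \<notin> {x. fst h \<bullet> x = snd h} \<and> x \<notin> {x. fst h \<bullet> x = snd h - fst h \<bullet> w}"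
        by (intro AE_conjI AE_lborel_notin_negligible negligible_hyperplane) auto
    qed
    then show ?thesis by (rule eventually_mono) (auto simp: inner_simps algebra_simps)
  qed
  have aeE: "AE x in lborel. \<forall>\<sigma>\<in>E. n \<sigma> \<bullet> x \<noteq> c \<sigma> \<and> n \<sigma> \<bullet> (x + w) \<noteq> c \<sigma>"
  proof (rule AE_finite_allI[OF E(1)])
    fix \<sigma> assume "\<sigma> \<in> E"
    then have "n \<sigma> \<noteq> 0" using n1 by fastforce
    then have "AE x in lborel. x \<notin> {x. n \<sigma> \<bullet> x = c \<sigma>} \<and> x \<notin> {x. n \<sigma> \<bullet> x = c \<sigma> - n \<sigma> \<bullet> w}"
      by (intro AE_conjI AE_lborel_notin_negligible negligible_hyperplane) auto
    then show "AE x in lborel. n \<sigma> \<bullet> x \<noteq> c \<sigma> \<and> n \<sigma> \<bullet> (x + w) \<noteq> c \<sigma>"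
      by (rule eventually_mono) (auto simp: inner_simps algebra_simps)
  qed
  have aebad: "AE x in lborel. \<forall>\<sigma>\<in>?ET. hit (n \<sigma>) (c \<sigma>) w x \<notin> bad \<sigma>"
  proof (rule AE_finite_allI)
    fix \<sigma> assume s: "\<sigma> \<in> ?ET"
    have "negligible {x. hit (n \<sigma>) (c \<sigma>) w x \<in> bad \<sigma>}"
      using s out sub by (intro negligible_hit_preimage[OF n1]) (auto simp: bad_def outward_unit_normal_def)
    then show "AE x in lborel. hit (n \<sigma>) (c \<sigma>) w x \<notin> bad \<sigma>"
      using AE_lborel_notin_negligible by fastforce
  qed (use E in auto)
  have aeov: "AE x in lborel. \<forall>\<sigma>\<in>?ET. \<forall>\<tau>\<in>E. \<sigma> \<noteq> \<tau> \<longrightarrow> hit (n \<sigma>) (c \<sigma>) w x \<notin> \<sigma> \<inter> \<tau>"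
  proof (intro AE_finite_allI)
    fix \<sigma> \<tau> assume s: "\<sigma> \<in> ?ET" "\<tau> \<in> E"
    show "AE x in lborel. \<sigma> \<noteq> \<tau> \<longrightarrow> hit (n \<sigma>) (c \<sigma>) w x \<notin> \<sigma> \<inter> \<tau>"
    proof (cases "\<sigma> = \<tau>")
      case False
      have "unit_normal (\<sigma> \<inter> \<tau>) (n \<sigma>)" using un s by (auto simp: unit_normal_def)
      then have "negligible (cylinder (n \<sigma>) (\<sigma> \<inter> \<tau>))"
        using surface_measure_zero_iff[of "\<sigma> \<inter> \<tau>" "n \<sigma>"] ov[of \<sigma> \<tau>] s False bE bor by (auto simp: bounded_Int)
      then have "negligible {x. hit (n \<sigma>) (c \<sigma>) w x \<in> \<sigma> \<inter> \<tau>}"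
        using s sub by (intro negligible_hit_preimage[OF n1]) auto
      then show ?thesis
        using AE_lborel_notin_negligible by fastforce
    qed auto
  qed (use E in auto)
  have aepar: "AE x in lborel. \<forall>\<sigma>\<in>?ET. \<forall>h\<in>H. fst h \<bullet> hit (n \<sigma>) (c \<sigma>) w x = snd h \<longrightarrow> (\<exists>l. fst h = l *\<^sub>R n \<sigma>)"
  proof (intro AE_finite_allI)
    fix \<sigma> h assume s: "\<sigma> \<in> ?ET" "h \<in> H"
    let ?a = "fst h" and ?l = "(fst h \<bullet> w) / (n \<sigma> \<bullet> w)"
    show "AE x in lborel. ?a \<bullet> hit (n \<sigma>) (c \<sigma>) w x = snd h \<longrightarrow> (\<exists>l. ?a = l *\<^sub>R n \<sigma>)"
    proof (cases "\<exists>l. ?a = l *\<^sub>R n \<sigma>")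
      case False
      then have "?a - ?l *\<^sub>R n \<sigma> \<noteq> 0" by auto
      then have "AE x in lborel. x \<notin> {x. (?a - ?l *\<^sub>R n \<sigma>) \<bullet> x = snd h - ?l * c \<sigma>}"
        by (intro AE_lborel_notin_negligible negligible_hyperplane) auto
      then show ?thesis
      proof eventually_elim
        case (elim x)
        have "?a \<bullet> hit (n \<sigma>) (c \<sigma>) w x = ?a \<bullet> x + ?l * (c \<sigma> - n \<sigma> \<bullet> x)"
          by (simp add: hit_def hitting_time_def inner_simps)
        then show ?case using elim by (auto simp: inner_simps algebra_simps diff_divide_distrib)
      qed
    qed auto
  qed (use E finH in auto)

  have cg: "continuous_on UNIV g"
    using g by (intro has_derivative_continuous_on) auto
  have [measurable]: "g \<in> borel_measurable borel" "(\<lambda>x. g' x w) \<in> borel_measurable borel"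
    using cg g' by (auto intro: borel_measurable_continuous_onI)
  obtain B' where B': "\<And>x. x \<in> K \<Longrightarrow> norm (g' x w) \<le> B'"
    using continuous_bounded_on_bounded[OF g' bK] by blast
  have intf: "integrable lborel ?f"
    by (rule integrable_bounded_borel[of _ K B']) (use B' bK in \<open>auto simp: indicator_def\<close>)
  obtain B0 where B0: "\<And>x. x \<in> K \<Longrightarrow> norm (g x) \<le> B0"
    using continuous_bounded_on_bounded[OF cg bK] by blast
  have intKg: "integrable lborel (\<lambda>x. indicator K x * g x)"
    by (rule integrable_bounded_borel[of _ K B0]) (use B0 bK in \<open>auto simp: indicator_def\<close>)
  have intface: "integrable (hyperplane_measure (n \<sigma>) (c \<sigma>)) (\<lambda>y. indicator \<sigma> y * g y)" if s: "\<sigma> \<in> E" for \<sigma>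
  proof -
    obtain B where "\<And>x. x \<in> \<sigma> \<Longrightarrow> norm (g x) \<le> B"
      using continuous_bounded_on_bounded[OF cg bE[OF s]] by blast
    then show ?thesis
      using s bor bE sub by (intro integrable_on_face[where B=B] n1) auto
  qed

  have "(\<integral>x. ?f x \<partial>lborel) = (\<integral>x. (\<integral>s. indicator {0..1} s * ?f (x + s *\<^sub>R w) \<partial>lborel) \<partial>lborel)"
    by (rule integral_lborel_average_along(1)[OF intf])
  also have "\<dots> = (\<integral>x. (indicator K (x + w) * g (x + w) - indicator K x * g x) + (\<Sum>\<sigma>\<in>?ET. sgn (n \<sigma> \<bullet> w) * ?fl \<sigma> x) \<partial>lborel)"
  proof (rule integral_cong_AE)
    have [measurable]: "\<sigma> \<in> sets borel" if "\<sigma> \<in> ?ET" for \<sigma> using bor that by auto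
    show "(\<lambda>x. (indicator K (x + w) * g (x + w) - indicator K x * g x) + (\<Sum>\<sigma>\<in>?ET. sgn (n \<sigma> \<bullet> w) * ?fl \<sigma> x)) \<in> borel_measurable lborel"
      by measurable
    show "AE x in lborel. (\<integral>s. indicator {0..1} s * ?f (x + s *\<^sub>R w) \<partial>lborel)
      = (indicator K (x + w) * g (x + w) - indicator K x * g x) + (\<Sum>\<sigma>\<in>?ET. sgn (n \<sigma> \<bullet> w) * ?fl \<sigma> x)"
      using integral_lborel_average_along(2)[OF intf, of w] aeH aeE aebad aeov aepar
    proof eventually_elim
      case (elim x)
      define Z where "Z = {s. 0 < s \<and> s < 1 \<and> (\<exists>(a,b)\<in>H. a \<bullet> (x + s *\<^sub>R w) = b)}"
      have off: "\<And>a b. (a,b) \<in> H \<Longrightarrow> a \<bullet> x \<noteq> b" "\<And>a b. (a,b) \<in> H \<Longrightarrow> a \<bullet> (x + w) \<noteq> b"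
        using elim(2) by auto
      have finZ: "finite Z" unfolding Z_def by (rule line_jump_formula(1)[OF K H off g])
      have "((\<lambda>s. ?f (x + s *\<^sub>R w)) has_integral
        (indicator K (x + w) * g (x + w) - indicator K x * g x
        - (\<Sum>z\<in>Z. (trace K (x + z *\<^sub>R w) w - trace K (x + z *\<^sub>R w) (- w)) * g (x + z *\<^sub>R w)))) {0..1}"
        unfolding Z_def by (rule line_jump_formula(2)[OF K H off g])
      moreover have "(\<integral>s. indicator {0..1} s * ?f (x + s *\<^sub>R w) \<partial>lborel) = integral {0..1} (\<lambda>s. ?f (x + s *\<^sub>R w))"
        using set_borel_integral_eq_integral(2)[of "{0..1}" "\<lambda>s. ?f (x + s *\<^sub>R w)"] elim(1)
        by (simp add: set_integrable_def set_lebesgue_integral_def)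
      moreover have "(\<Sum>z\<in>Z. (trace K (x + z *\<^sub>R w) w - trace K (x + z *\<^sub>R w) (- w)) * g (x + z *\<^sub>R w))
          = (\<Sum>\<sigma>\<in>?ET. - sgn (n \<sigma> \<bullet> w) * ?fl \<sigma> x)"
        unfolding Z_def
      proof (rule sum_jumps_eq_sum_faces[OF K H E n1 c off(1)])
        show "finite {s. 0 < s \<and> s < 1 \<and> (\<exists>(a,b)\<in>H. a \<bullet> (x + s *\<^sub>R w) = b)}"
          using finZ by (simp add: Z_def)
        fix \<sigma> assume s: "\<sigma> \<in> E"
        show "n \<sigma> \<bullet> x \<noteq> c \<sigma>" "n \<sigma> \<bullet> (x + w) \<noteq> c \<sigma>"
          using elim(3) s by blast+
        assume nw: "n \<sigma> \<bullet> w \<noteq> 0"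
        have sT: "\<sigma> \<in> ?ET" using s nw by blast
        show "\<exists>e>0. \<forall>s. 0 < s \<and> s < e \<longrightarrow> hit (n \<sigma>) (c \<sigma>) w x - s *\<^sub>R n \<sigma> \<in> K \<and> hit (n \<sigma>) (c \<sigma>) w x + s *\<^sub>R n \<sigma> \<notin> K"
          if "hit (n \<sigma>) (c \<sigma>) w x \<in> \<sigma>"
          using bspec[OF elim(4) sT] that unfolding bad_def by blast
        show "hit (n \<sigma>) (c \<sigma>) w x \<notin> \<sigma> \<inter> \<tau>" if "\<tau> \<in> E" "\<sigma> \<noteq> \<tau>" for \<tau>
          using bspec[OF elim(5) sT] that by blast
        show "\<exists>l. a = l *\<^sub>R n \<sigma>" if "(a, b) \<in> H" "a \<bullet> hit (n \<sigma>) (c \<sigma>) w x = b" for a b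
          using bspec[OF bspec[OF elim(6) sT] that(1)] that(2) by simp
      qed
      ultimately show ?case
        by (simp add: integral_unique sum_negf)
    qed
  qed measurable
  also have "\<dots> = (\<integral>x. indicator K (x + w) * g (x + w) - indicator K x * g x \<partial>lborel) + (\<Sum>\<sigma>\<in>?ET. sgn (n \<sigma> \<bullet> w) * (\<integral>x. ?fl \<sigma> x \<partial>lborel))"
  proof -
    have "integrable lborel (\<lambda>x. ?fl \<sigma> x)" if "\<sigma> \<in> ?ET" for \<sigma>
      using that by (intro integrable_hit[OF n1 _ intface]) auto
    moreover have "integrable lborel (\<lambda>x. indicator K (x + w) * g (x + w) - indicator K x * g x)"
      using intKg integral_lborel_translate(2)[of "\<lambda>x. indicator K x * g x" w] by auto
    ultimately show ?thesis
      by (subst Bochner_Integration.integral_add) (auto intro!: integrable_sum integrable_mult_right simp: integral_sum)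
  qed
  also have "(\<integral>x. indicator K (x + w) * g (x + w) - indicator K x * g x \<partial>lborel) = 0"
    using intKg integral_lborel_translate[of "\<lambda>x. indicator K x * g x" w] by simp
  also have "(\<Sum>\<sigma>\<in>?ET. sgn (n \<sigma> \<bullet> w) * (\<integral>x. ?fl \<sigma> x \<partial>lborel)) = (\<Sum>\<sigma>\<in>?ET. (n \<sigma> \<bullet> w) * face_integral \<sigma> g)"
  proof (rule sum.cong)
    fix \<sigma> assume s: "\<sigma> \<in> ?ET"
    then have "(\<integral>x. ?fl \<sigma> x \<partial>lborel) = \<bar>n \<sigma> \<bullet> w\<bar> * (\<integral>y. indicator \<sigma> y * g y \<partial>hyperplane_measure (n \<sigma>) (c \<sigma>))"
      by (intro integral_hit[OF n1 _ intface]) auto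
    also have "(\<integral>y. indicator \<sigma> y * g y \<partial>hyperplane_measure (n \<sigma>) (c \<sigma>)) = face_integral \<sigma> g"
      using s bor un sub by (intro face_integral_eq[symmetric]) auto
    finally show "sgn (n \<sigma> \<bullet> w) * (\<integral>x. ?fl \<sigma> x \<partial>lborel) = (n \<sigma> \<bullet> w) * face_integral \<sigma> g"
      by (simp add: mult.assoc[symmetric] sgn_mult_abs)
  qed simp
  also have "0 + (\<Sum>\<sigma>\<in>?ET. (n \<sigma> \<bullet> w) * face_integral \<sigma> g) = (\<Sum>\<sigma>\<in>E. (n \<sigma> \<bullet> w) * face_integral \<sigma> g)"
    using E(1) by (simp, intro sum.mono_neutral_left) auto
  finally show ?thesis by (simp add: n_def)
qed

section \<open>Density of polynomials in \<open>L\<^sup>1\<close>\<close>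

lemma set_integrable_continuous_bounded:
  fixes g :: "'b::euclidean_space \<Rightarrow> 'c::euclidean_space"
  assumes "bounded Q" "Q \<in> sets borel" "continuous_on UNIV g"
  shows "set_integrable lborel Q g"
proof -
  obtain B where B: "\<And>x. x \<in> Q \<Longrightarrow> norm (g x) \<le> B"
    using continuous_bounded_on_bounded[OF assms(3,1)] by blast
  have [measurable]: "g \<in> borel_measurable borel"
    using assms(3) by (rule borel_measurable_continuous_onI)
  show ?thesis
    unfolding set_integrable_def
    by (rule integrable_bounded_borel[of _ Q B]) (use B assms in auto)
qed

lemma L1_approx_indicator:
  fixes A :: "'b::euclidean_space set"
  assumes A: "A \<in> sets borel" and e: "e > 0"
  obtains f :: "'b \<Rightarrow> real" where "continuous_on UNIV f" "(\<integral>\<^sup>+x. ennreal \<bar>indicator A x - f x\<bar> \<partial>lborel) < ennreal e"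
proof -
  have AL: "A \<in> sets lebesgue" using A by simp
  obtain U where U: "open U" "A \<subseteq> U" "U - A \<in> lmeasurable" "emeasure lebesgue (U - A) < ennreal (e/2)"
    using sets_lebesgue_outer_open[OF AL, of "e/2"] e by auto
  obtain C where C: "closed C" "C \<subseteq> A" "A - C \<in> lmeasurable" "emeasure lebesgue (A - C) < ennreal (e/2)"
    using sets_lebesgue_inner_closed[OF AL, of "e/2"] e by auto
  have "closed (- U)" "C \<inter> - U = {}" using U C by auto
  then obtain f :: "'b \<Rightarrow> real" where f: "continuous_on UNIV f" "\<And>x. f x \<in> closed_segment 1 0"
      "\<And>x. x \<in> C \<Longrightarrow> f x = 1" "\<And>x. x \<in> - U \<Longrightarrow> f x = 0"
    using Urysohn[OF C(1), of "- U" "1::real" 0] by metis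
  have f01: "0 \<le> f x" "f x \<le> 1" for x using f(2)[of x] by (auto simp: closed_segment_eq_real_ivl)
  have "(\<integral>\<^sup>+x. ennreal \<bar>indicator A x - f x\<bar> \<partial>lborel) \<le> (\<integral>\<^sup>+x. indicator (U - C) x \<partial>lborel)"
  proof (rule nn_integral_mono)
    fix x
    have "\<bar>indicator A x - f x\<bar> \<le> indicator (U - C) x"
      using f(3,4)[of x] f01[of x] C(2) U(2) by (auto simp: indicator_def)
    then show "ennreal \<bar>indicator A x - f x\<bar> \<le> indicator (U - C) x"
      by (metis ennreal_indicator ennreal_leI)
  qed
  also have "\<dots> = emeasure lborel (U - C)"
    using U C by simp
  also have "U - C = (U - A) \<union> (A - C)" using U C by blast
  also have "emeasure lborel ((U - A) \<union> (A - C)) \<le> emeasure lborel (U - A) + emeasure lborel (A - C)"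
    using U C A by (intro emeasure_subadditive) auto
  also have "\<dots> < ennreal (e/2) + ennreal (e/2)"
    using U C A by (intro add_strict_mono) auto
  also have "\<dots> = ennreal e" using e by (simp flip: ennreal_plus)
  finally show thesis using f(1) by (rule that[rotated])
qed

lemma L1_approx_continuous:
  fixes f :: "'b::euclidean_space \<Rightarrow> 'c::euclidean_space"
  assumes "integrable lborel f" and e: "e > 0"
  shows "\<exists>g. continuous_on UNIV g \<and> (\<integral>\<^sup>+x. ennreal (norm (f x - g x)) \<partial>lborel) < ennreal e"
  using assms
proof (induction arbitrary: e rule: integrable_induct)
  case (base A c)
  then have "e / (norm c + 1) > 0" by (simp add: add_nonneg_pos)
  then obtain h where h: "continuous_on UNIV h"
      "(\<integral>\<^sup>+x. ennreal \<bar>indicator A x - h x\<bar> \<partial>lborel) < ennreal (e / (norm c + 1))"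
    using L1_approx_indicator[of A] base by (metis sets_lborel)
  then have [measurable]: "h \<in> borel_measurable borel" "A \<in> sets borel"
    using base by (auto intro: borel_measurable_continuous_onI)
  have "(\<integral>\<^sup>+x. ennreal (norm (indicator A x *\<^sub>R c - h x *\<^sub>R c)) \<partial>lborel)
      = (\<integral>\<^sup>+x. ennreal (norm c) * ennreal \<bar>indicator A x - h x\<bar> \<partial>lborel)"
    by (simp add: scaleR_diff_left[symmetric] ennreal_mult' mult.commute)
  also have "\<dots> = ennreal (norm c) * (\<integral>\<^sup>+x. ennreal \<bar>indicator A x - h x\<bar> \<partial>lborel)"
    by (rule nn_integral_cmult) measurable
  also have "\<dots> \<le> ennreal (norm c) * ennreal (e / (norm c + 1))"
    using h(2) by (intro mult_left_mono) auto
  also have "\<dots> = ennreal (norm c * (e / (norm c + 1)))"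
    by (rule ennreal_mult[symmetric]) (use base in auto)
  also have "\<dots> < ennreal e"
    using base by (intro ennreal_lessI) (auto simp: field_simps add_pos_nonneg)
  finally show ?case
    using h(1) by (intro exI[of _ "\<lambda>x. h x *\<^sub>R c"]) (auto intro!: continuous_intros)
next
  case (add f g)
  have e2: "e / 2 > 0" using add.prems by simp
  obtain f' where f': "continuous_on UNIV f'" "(\<integral>\<^sup>+x. ennreal (norm (f x - f' x)) \<partial>lborel) < ennreal (e/2)"
    using add(3)[OF e2] by blast
  obtain g' where g': "continuous_on UNIV g'" "(\<integral>\<^sup>+x. ennreal (norm (g x - g' x)) \<partial>lborel) < ennreal (e/2)"
    using add(4)[OF e2] by blast
  have [measurable]: "f' \<in> borel_measurable borel" "g' \<in> borel_measurable borel" "f \<in> borel_measurable borel" "g \<in> borel_measurable borel"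
    using f' g' borel_measurable_integrable[OF add(1)] borel_measurable_integrable[OF add(2)]
    by (auto intro: borel_measurable_continuous_onI)
  have "(\<integral>\<^sup>+x. ennreal (norm (f x + g x - (f' x + g' x))) \<partial>lborel)
     \<le> (\<integral>\<^sup>+x. ennreal (norm (f x - f' x)) + ennreal (norm (g x - g' x)) \<partial>lborel)"
    by (intro nn_integral_mono) (simp add: ennreal_leI norm_diff_triangle_ineq flip: ennreal_plus)
  also have "\<dots> = (\<integral>\<^sup>+x. ennreal (norm (f x - f' x)) \<partial>lborel) + (\<integral>\<^sup>+x. ennreal (norm (g x - g' x)) \<partial>lborel)"
    by (rule nn_integral_add) measurable
  also have "\<dots> < ennreal (e/2) + ennreal (e/2)"
    using f' g' by (intro add_strict_mono) auto
  also have "\<dots> = ennreal e" using add.prems by (simp flip: ennreal_plus)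
  finally show ?case
    using f'(1) g'(1) by (intro exI[of _ "\<lambda>x. f' x + g' x"]) (auto intro!: continuous_intros)
next
  case (lim f s)
  have e2: "e / 2 > 0" using lim.prems by simp
  have [measurable]: "f \<in> borel_measurable borel" "s i \<in> borel_measurable borel" for i
    using borel_measurable_integrable[OF lim(4)] borel_measurable_integrable[OF lim(1)] by auto
  have "(\<lambda>i. \<integral>\<^sup>+x. ennreal (norm (f x - s i x)) \<partial>lborel) \<longlonglongrightarrow> 0"
  proof (rule Bochner_Integration.nn_integral_dominated_convergence_norm)
    show "AE x in lborel. norm (s j x) \<le> 2 * norm (f x)" for j
      using lim(3) by auto
    show "AE x in lborel. (\<lambda>i. s i x) \<longlonglongrightarrow> f x" using lim(2) by auto
    have "integrable lborel (\<lambda>x. 2 * norm (f x))" using lim(4) by auto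
    then show "(\<integral>\<^sup>+x. ennreal (2 * norm (f x)) \<partial>lborel) < \<infinity>"
      unfolding integrable_iff_bounded by simp
  qed measurable
  then have "\<forall>\<^sub>F i in sequentially. (\<integral>\<^sup>+x. ennreal (norm (f x - s i x)) \<partial>lborel) < ennreal (e/2)"
    using e2 by (intro order_tendstoD) auto
  then obtain i where i: "(\<integral>\<^sup>+x. ennreal (norm (f x - s i x)) \<partial>lborel) < ennreal (e/2)"
    by (auto simp: eventually_sequentially)
  obtain g where g: "continuous_on UNIV g" "(\<integral>\<^sup>+x. ennreal (norm (s i x - g x)) \<partial>lborel) < ennreal (e/2)"
    using lim(5)[OF e2] by blast
  have [measurable]: "g \<in> borel_measurable borel" using g by (auto intro: borel_measurable_continuous_onI)
  have "(\<integral>\<^sup>+x. ennreal (norm (f x - g x)) \<partial>lborel)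
     \<le> (\<integral>\<^sup>+x. ennreal (norm (f x - s i x)) + ennreal (norm (s i x - g x)) \<partial>lborel)"
  proof (intro nn_integral_mono)
    fix x
    show "ennreal (norm (f x - g x)) \<le> ennreal (norm (f x - s i x)) + ennreal (norm (s i x - g x))"
      using norm_triangle_ineq[of "f x - s i x" "s i x - g x"] by (simp add: ennreal_leI flip: ennreal_plus)
  qed
  also have "\<dots> = (\<integral>\<^sup>+x. ennreal (norm (f x - s i x)) \<partial>lborel) + (\<integral>\<^sup>+x. ennreal (norm (s i x - g x)) \<partial>lborel)"
    by (rule nn_integral_add) measurable
  also have "\<dots> < ennreal (e/2) + ennreal (e/2)"
    using i g by (intro add_strict_mono) auto
  also have "\<dots> = ennreal e" using lim.prems by (simp flip: ennreal_plus)
  finally show ?case using g(1) by blast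
qed

text \<open>
  Lusin-type approximation by continuous functions, followed by the Stone-Weierstrass
  theorem on the closure of the bounded set.
\<close>

lemma L1_approx_polynomial:
  fixes f :: "'b::euclidean_space \<Rightarrow> 'c::euclidean_space"
  assumes Q: "bounded Q" "Q \<in> sets borel" and f: "set_integrable lborel Q f" and e: "e > 0"
  obtains p where "polynomial_function p" "(LINT z:Q|lborel. norm (f z - p z)) < e"
proof -
  have e2: "e / 2 > 0" using e by simp
  obtain g where g: "continuous_on UNIV g"
      "(\<integral>\<^sup>+x. ennreal (norm (indicator Q x *\<^sub>R f x - g x)) \<partial>lborel) < ennreal (e/2)"
    using L1_approx_continuous[OF f[unfolded set_integrable_def] e2] by blast
  define V where "V = measure lborel Q"
  have V: "V \<ge> 0" by (simp add: V_def)
  have "e / 2 / (V + 1) > 0" using e V by (simp add: add_nonneg_pos)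
  then obtain p where p: "polynomial_function p" "\<And>x. x \<in> closure Q \<Longrightarrow> norm (g x - p x) < e / 2 / (V + 1)"
    using Stone_Weierstrass_polynomial_function[of "closure Q" g] Q g(1)
    by (metis compact_closure continuous_on_subset subset_UNIV)
  have cp: "continuous_on UNIV p"
    using p(1) by (simp add: continuous_on_polymonial_function)
  have sg: "set_integrable lborel Q g" "set_integrable lborel Q p"
    using set_integrable_continuous_bounded[OF Q] g cp by auto
  have [simp]: "set_integrable lborel Q (\<lambda>_. c::real)" for c
    by (intro set_integrable_continuous_bounded[OF Q] continuous_intros)
  have i1: "set_integrable lborel Q (\<lambda>z. norm (f z - g z))"
    using f sg by (intro set_integrable_norm set_integral_diff)
  have "(LINT z:Q|lborel. norm (f z - p z)) \<le> (LINT z:Q|lborel. norm (f z - g z) + e / 2 / (V + 1))"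
  proof (rule set_integral_mono)
    show "set_integrable lborel Q (\<lambda>z. norm (f z - p z))"
      using f sg by (intro set_integrable_norm set_integral_diff)
    show "set_integrable lborel Q (\<lambda>z. norm (f z - g z) + e / 2 / (V + 1))"
      using i1 by (intro set_integral_add) auto
    fix z assume "z \<in> Q"
    then have "norm (g z - p z) < e / 2 / (V + 1)" using p(2) closure_subset by blast
    then show "norm (f z - p z) \<le> norm (f z - g z) + e / 2 / (V + 1)"
      using norm_triangle_ineq[of "f z - g z" "g z - p z"] by simp
  qed
  also have "\<dots> = (LINT z:Q|lborel. norm (f z - g z)) + (LINT z:Q|lborel. e / 2 / (V + 1))"
    using i1 by (intro set_integral_add) auto
  also have "(LINT z:Q|lborel. e / 2 / (V + 1)) = V * (e / 2 / (V + 1))"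
    using Q(2) by (simp add: set_lebesgue_integral_def V_def)
  also have "(LINT z:Q|lborel. norm (f z - g z)) < e / 2"
  proof -
    have "ennreal (LINT z:Q|lborel. norm (f z - g z)) = (\<integral>\<^sup>+x. ennreal (indicator Q x * norm (f x - g x)) \<partial>lborel)"
      using i1 unfolding set_lebesgue_integral_def set_integrable_def
      by (subst nn_integral_eq_integral) auto
    also have "\<dots> \<le> (\<integral>\<^sup>+x. ennreal (norm (indicator Q x *\<^sub>R f x - g x)) \<partial>lborel)"
      by (intro nn_integral_mono ennreal_leI) (simp add: indicator_def)
    also have "\<dots> < ennreal (e/2)" by (rule g)
    finally show ?thesis using e by (simp add: ennreal_less_iff set_lebesgue_integral_def integral_nonneg)
  qed
  also have "V * (e / 2 / (V + 1)) \<le> e / 2"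
    using V e by (simp add: field_simps)
  finally show thesis using p(1) by (intro that) auto
qed

text \<open>
  Smoothness is the reason for using polynomials: continuous partial derivatives suffice for
  the divergence theorem.
\<close>

lemma real_polynomial_function_derivative:
  fixes p :: "'b::euclidean_space \<Rightarrow> real"
  assumes "real_polynomial_function p"
  shows "\<exists>p'. (\<forall>x. (p has_derivative p' x) (at x)) \<and> (\<forall>v. continuous_on UNIV (\<lambda>x. p' x v))"
  using assms
proof (induction rule: real_polynomial_function.induct)
  case (linear f)
  then show ?case
    by (intro exI[of _ "\<lambda>x. f"]) (auto intro: bounded_linear_imp_has_derivative)
next
  case (const c)
  then show ?case by (intro exI[of _ "\<lambda>x v. 0"]) auto
next
  case (add f g)
  then obtain f' g' where "\<forall>x. (f has_derivative f' x) (at x)" "\<forall>v. continuous_on UNIV (\<lambda>x. f' x v)"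
     "\<forall>x. (g has_derivative g' x) (at x)" "\<forall>v. continuous_on UNIV (\<lambda>x. g' x v)" by blast
  then show ?case
    by (intro exI[of _ "\<lambda>x v. f' x v + g' x v"]) (auto intro!: derivative_intros continuous_intros)
next
  case (mult f g)
  then obtain f' g' where *: "\<forall>x. (f has_derivative f' x) (at x)" "\<forall>v. continuous_on UNIV (\<lambda>x. f' x v)"
     "\<forall>x. (g has_derivative g' x) (at x)" "\<forall>v. continuous_on UNIV (\<lambda>x. g' x v)" by blast
  have "continuous_on UNIV f" "continuous_on UNIV g"
    using mult.hyps by (auto simp: continuous_on_polymonial_function real_polynomial_function_eq)
  then show ?case
    using * by (intro exI[of _ "\<lambda>x v. f x * g' x v + f' x v * g x"]) (auto intro!: has_derivative_mult continuous_intros)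
qed

section \<open>Partitions of a space-time cylinder\<close>

definition slab :: "(nat \<Rightarrow> real) \<Rightarrow> nat \<Rightarrow> real set" where
  "slab t n = {t n<..t (Suc n)}"

lemma sets_slab_borel[measurable, simp]: "slab t n \<in> sets borel"
  by (simp add: slab_def)

lemma time_discretization_mono:
  assumes "time_discretization T N t" "i \<le> j" "j \<le> N"
  shows "t i \<le> t j"
  using assms(2,3)
proof (induction j rule: dec_induct)
  case (step m)
  then have "t m < t (Suc m)" using assms(1) by (simp add: time_discretization_def)
  then show ?case using step by simp
qed simp

lemma time_step_pos: "time_discretization T N t \<Longrightarrow> n < N \<Longrightarrow> t n < t (Suc n)"
  by (simp add: time_discretization_def)

lemma time_bounds:
  assumes "time_discretization T N t" "n \<le> N"
  shows "0 \<le> t n" "t n \<le> T"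
  using time_discretization_mono[OF assms(1), of 0 n] time_discretization_mono[OF assms(1), of n N] assms
  by (auto simp: time_discretization_def)

lemma slab_unique:
  assumes td: "time_discretization T N t" and s: "0 < s" "s \<le> T"
  shows "\<exists>!n. n < N \<and> s \<in> slab t n"
proof -
  have tN: "s \<le> t N" and t0: "t 0 = 0" using td s by (auto simp: time_discretization_def)
  define m where "m = (LEAST m. s \<le> t m)"
  have m: "s \<le> t m" unfolding m_def using tN by (rule LeastI)
  have mN: "m \<le> N" unfolding m_def using tN by (rule Least_le)
  have "m \<noteq> 0" using m t0 s by (metis not_less)
  then obtain n where n: "m = Suc n" by (cases m) auto
  have "\<not> s \<le> t n" using not_less_Least[of n "\<lambda>m. s \<le> t m"] n by (simp add: m_def[symmetric])
  then have ex: "n < N \<and> s \<in> slab t n" using m mN n by (auto simp: slab_def)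
  have un: "i = j" if "i < N \<and> s \<in> slab t i" "j < N \<and> s \<in> slab t j" for i j
  proof (rule ccontr)
    assume "i \<noteq> j"
    then consider "Suc i \<le> j" | "Suc j \<le> i" by linarith
    then show False
    proof cases
      case 1
      then have "t (Suc i) \<le> t j" using time_discretization_mono[OF td, of "Suc i" j] that by auto
      then show False using that by (auto simp: slab_def)
    next
      case 2
      then have "t (Suc j) \<le> t i" using time_discretization_mono[OF td, of "Suc j" i] that by auto
      then show False using that by (auto simp: slab_def)
    qed
  qed
  show ?thesis using ex un by blast
qed

lemma AE_lborel_fst:
  assumes "AE x in lborel. P (x::'a::euclidean_space)"
  shows "AE z in (lborel :: ('a \<times> 'b::euclidean_space) measure). P (fst z)"
proof -
  obtain S where S: "{x. \<not> P x} \<subseteq> S" "S \<in> null_sets lborel" using assms by (auto elim!: AE_E3 simp: eventually_ae_filter)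
  then have "S \<times> UNIV \<in> null_sets (lborel \<Otimes>\<^sub>M (lborel :: 'b measure))"
    using lborel.emeasure_pair_measure_Times[of S lborel UNIV] null_setsD1[OF S(2)] null_setsD2[OF S(2)]
    by (intro null_setsI) auto
  then have "S \<times> (UNIV :: 'b set) \<in> null_sets lborel" by (simp only: lborel_prod)
  then show ?thesis by (rule AE_I') (use S in auto)
qed

lemma AE_lborel_snd:
  assumes "AE x in lborel. P (x::'b::euclidean_space)"
  shows "AE z in (lborel :: ('a::euclidean_space \<times> 'b) measure). P (snd z)"
proof -
  obtain S where S: "{x. \<not> P x} \<subseteq> S" "S \<in> null_sets lborel" using assms by (auto elim!: AE_E3 simp: eventually_ae_filter)
  then have "UNIV \<times> S \<in> null_sets ((lborel :: 'a measure) \<Otimes>\<^sub>M lborel)"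
    using lborel.emeasure_pair_measure_Times[of UNIV lborel S] null_setsD1[OF S(2)] null_setsD2[OF S(2)]
    by (intro null_setsI) auto
  then have "(UNIV :: 'a set) \<times> S \<in> null_sets lborel" by (simp only: lborel_prod)
  then show ?thesis by (rule AE_I') (use S in auto)
qed

lemma ae_partition_AE:
  assumes "ae_partition \<Omega> I A"
  shows "AE x in lborel. (x \<in> \<Omega> \<longleftrightarrow> (\<exists>i\<in>I. x \<in> A i)) \<and> (\<forall>i\<in>I. \<forall>j\<in>I. i \<noteq> j \<longrightarrow> x \<notin> A i \<inter> A j)"
proof -
  have fin: "finite I" and neg: "negligible (sym_diff \<Omega> (\<Union>i\<in>I. A i))"
    and dj: "\<And>i j. i \<in> I \<Longrightarrow> j \<in> I \<Longrightarrow> i \<noteq> j \<Longrightarrow> negligible (A i \<inter> A j)"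
    using assms unfolding ae_partition_def by blast+
  have "AE x in lborel. x \<notin> sym_diff \<Omega> (\<Union>i\<in>I. A i)"
    by (rule AE_lborel_notin_negligible[OF neg])
  moreover have "AE x in lborel. \<forall>i\<in>I. \<forall>j\<in>I. i \<noteq> j \<longrightarrow> x \<notin> A i \<inter> A j"
  proof (intro AE_finite_allI[OF fin])
    fix i j assume "i \<in> I" "j \<in> I"
    then show "AE x in lborel. i \<noteq> j \<longrightarrow> x \<notin> A i \<inter> A j"
      using AE_lborel_notin_negligible[OF dj] by (cases "i = j") auto
  qed
  ultimately show ?thesis
    by eventually_elim blast
qed

lemma sum_single:
  assumes "finite I" "i \<in> I" "\<And>j. j \<in> I \<Longrightarrow> j \<noteq> i \<Longrightarrow> f j = 0"
  shows "sum f I = (f i :: real)"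
  using sum.mono_neutral_right[of I "{i}" f] assms by auto

lemma integral_ae_partition_space:
  fixes h :: "'a::euclidean_space \<Rightarrow> real"
  assumes part: "ae_partition \<Omega> I A" and A: "\<And>i. i \<in> I \<Longrightarrow> A i \<in> sets borel"
    and h: "integrable lborel h" "\<And>x. x \<notin> \<Omega> \<Longrightarrow> h x = 0"
  shows "(\<integral>x. h x \<partial>lborel) = (\<Sum>i\<in>I. \<integral>x. indicator (A i) x * h x \<partial>lborel)"
proof -
  have fin: "finite I" using part by (simp add: ae_partition_def)
  have int: "integrable lborel (\<lambda>x. indicator (A i) x * h x)" if "i \<in> I" for i
    using integrable_mult_indicator[OF _ h(1), of "A i"] A[OF that] by simp
  have "(\<integral>x. h x \<partial>lborel) = (\<integral>x. (\<Sum>i\<in>I. indicator (A i) x * h x) \<partial>lborel)"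
  proof (rule integral_cong_AE)
    show "AE x in lborel. h x = (\<Sum>i\<in>I. indicator (A i) x * h x)"
      using ae_partition_AE[OF part]
    proof eventually_elim
      case (elim x)
      show ?case
      proof (cases "x \<in> \<Omega>")
        case True
        then obtain i where i: "i \<in> I" "x \<in> A i" using elim by (meson)
        have "(\<Sum>i\<in>I. indicator (A i) x * h x) = indicator (A i) x * h x"
          using elim i by (intro sum_single[OF fin i(1)]) (auto simp: indicator_def)
        then show ?thesis using i by simp
      qed (simp add: h)
    qed
    show "(\<lambda>x. \<Sum>i\<in>I. indicator (A i) x * h x) \<in> borel_measurable lborel"
      using int by (intro borel_measurable_sum) (auto intro: borel_measurable_integrable)
  qed (use h in auto)
  also have "\<dots> = (\<Sum>i\<in>I. \<integral>x. indicator (A i) x * h x \<partial>lborel)"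
    by (rule Bochner_Integration.integral_sum[OF int])
  finally show ?thesis .
qed

lemma slab_partition:
  assumes "time_discretization T N t"
  shows "ae_partition {0<..<T} {..<N} (slab t)"
  unfolding ae_partition_def
proof (intro conjI ballI impI)
  fix i j assume ij: "i \<in> {..<N}" "j \<in> {..<N}" "i \<noteq> j"
  have "slab t i \<inter> slab t j = {}"
  proof (rule ccontr)
    assume "slab t i \<inter> slab t j \<noteq> {}"
    then obtain s where s: "s \<in> slab t i" "s \<in> slab t j" by blast
    then have "0 < s" "s \<le> T"
      using time_bounds[OF assms, of i] time_bounds[OF assms, of "Suc i"] ij by (auto simp: slab_def)
    then show False using slab_unique[OF assms] s ij by blast
  qed
  then show "negligible (slab t i \<inter> slab t j)" by simp
next
  have "sym_diff {0<..<T} (\<Union>i\<in>{..<N}. slab t i) \<subseteq> {T}"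
  proof
    fix s assume "s \<in> sym_diff {0<..<T} (\<Union>i\<in>{..<N}. slab t i)"
    then consider "0 < s" "s < T" "\<forall>n<N. s \<notin> slab t n" | n where "n < N" "s \<in> slab t n" "s \<le> 0 \<or> s \<ge> T"
      by fastforce
    then show "s \<in> {T}"
    proof cases
      case 1
      then show ?thesis using slab_unique[OF assms, of s] by auto
    next
      case 2
      then show ?thesis
        using time_bounds[OF assms, of n] time_bounds[OF assms, of "Suc n"] by (auto simp: slab_def)
    qed
  qed
  then show "negligible (sym_diff {0<..<T} (\<Union>i\<in>{..<N}. slab t i))"
    by (rule negligible_subset[OF negligible_sing])
qed auto

text \<open>
  The cells times the time slabs form a partition of the same kind, so the spatial
  statements apply to space-time.
\<close>

lemma ae_partition_product:
  fixes A :: "'i \<Rightarrow> 'a::euclidean_space set" and B :: "'j \<Rightarrow> 'b::euclidean_space set"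
  assumes A: "ae_partition \<Omega> I A" "\<And>i. i \<in> I \<Longrightarrow> A i \<in> sets borel" and B: "ae_partition \<Omega>' J B" "\<And>j. j \<in> J \<Longrightarrow> B j \<in> sets borel"
  shows "ae_partition (\<Omega> \<times> \<Omega>') (J \<times> I) (\<lambda>(j,i). A i \<times> B j)"
proof -
  have neg: "negligible S" if "AE z in lborel. z \<notin> S" for S :: "('a \<times> 'b) set"
  proof -
    have "\<exists>N. {z. \<not> z \<notin> S} \<subseteq> N \<and> N \<in> null_sets lborel"
      using that by (auto simp: eventually_ae_filter)
    then show ?thesis
      by (metis (no_types, lifting) mem_Collect_eq negligible_iff_null_sets null_sets_completion_iff2 subset_iff)
  qed
  note aeA = AE_lborel_fst[OF ae_partition_AE[OF A(1)], where 'b='b]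
  note aeB = AE_lborel_snd[OF ae_partition_AE[OF B(1)], where 'a='a]
  show ?thesis
    unfolding ae_partition_def
  proof (intro conjI ballI impI)
    show "finite (J \<times> I)" using A B by (auto simp: ae_partition_def)
    fix p assume p: "p \<in> J \<times> I"
    then have "A (snd p) \<times> B (fst p) \<in> sets borel" using A(2) B(2) by (intro borel_Times) auto
    then show "(case p of (j, i) \<Rightarrow> A i \<times> B j) \<in> sets lebesgue" by (auto simp: case_prod_beta)
    fix q assume q: "q \<in> J \<times> I" "p \<noteq> q"
    have "AE z in lborel. z \<notin> (A (snd p) \<times> B (fst p)) \<inter> (A (snd q) \<times> B (fst q))"
      using aeA aeB
    proof eventually_elim
      case (elim z)
      have pq: "fst p \<in> J" "snd p \<in> I" "fst q \<in> J" "snd q \<in> I" using p q(1) by (simp_all add: mem_Times_iff)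
      show ?case
      proof (cases "fst p = fst q")
        case True
        then have "snd p \<noteq> snd q" using q(2) by (simp add: prod_eq_iff)
        then have "fst z \<notin> A (snd p) \<inter> A (snd q)" using elim(1) pq by simp
        then show ?thesis unfolding Int_iff mem_Times_iff by blast
      next
        case False
        then have "snd z \<notin> B (fst p) \<inter> B (fst q)" using elim(2) pq by simp
        then show ?thesis unfolding Int_iff mem_Times_iff by blast
      qed
    qed
    then show "negligible ((case p of (j, i) \<Rightarrow> A i \<times> B j) \<inter> (case q of (j, i) \<Rightarrow> A i \<times> B j))"
      by (intro neg) (simp add: case_prod_beta)
  next
    have "AE z in lborel. z \<notin> sym_diff (\<Omega> \<times> \<Omega>') (\<Union>p\<in>J \<times> I. A (snd p) \<times> B (fst p))"
      using aeA aeB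
    proof eventually_elim
      case (elim z)
      have 1: "fst z \<in> \<Omega> \<longleftrightarrow> (\<exists>i\<in>I. fst z \<in> A i)" using elim(1) by (rule conjunct1)
      have 2: "snd z \<in> \<Omega>' \<longleftrightarrow> (\<exists>j\<in>J. snd z \<in> B j)" using elim(2) by (rule conjunct1)
      have "z \<in> \<Omega> \<times> \<Omega>' \<longleftrightarrow> (\<exists>i\<in>I. fst z \<in> A i) \<and> (\<exists>j\<in>J. snd z \<in> B j)"
        unfolding mem_Times_iff 1 2 ..
      also have "\<dots> \<longleftrightarrow> z \<in> (\<Union>p\<in>J \<times> I. A (snd p) \<times> B (fst p))"
        by (auto simp: mem_Times_iff)
      finally show ?case by blast
    qed
    then show "negligible (sym_diff (\<Omega> \<times> \<Omega>') (\<Union>p\<in>J \<times> I. case p of (j, i) \<Rightarrow> A i \<times> B j))"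
      by (intro neg) (simp add: case_prod_beta)
  qed
qed

lemma measure_times_slab:
  fixes A :: "'a::euclidean_space set"
  assumes td: "time_discretization T N t" and n: "n < N" and A: "A \<in> sets borel" "bounded A"
  shows "measure lborel (A \<times> slab t n) = measure lborel A * (t (Suc n) - t n)"
proof -
  have "emeasure (lborel \<Otimes>\<^sub>M lborel) (A \<times> slab t n) = emeasure lborel A * emeasure lborel (slab t n)"
    using A by (intro lborel.emeasure_pair_measure_Times) auto
  then have "emeasure lborel (A \<times> slab t n) = emeasure lborel A * emeasure lborel (slab t n)"
    by (simp only: lborel_prod)
  then show ?thesis
    using time_step_pos[OF td n] by (simp add: measure_def enn2real_mult slab_def)
qed

text \<open>
  All discretization errors below are of this form, with \<open>B\<close> a cell or a dual
  cell times a time slab.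
\<close>

lemma integral_nearly_constant:
  fixes \<phi> :: "'b::euclidean_space \<Rightarrow> real"
  assumes B: "B \<in> sets borel" "bounded B" and \<phi>: "integrable lborel (\<lambda>z. indicator B z * \<phi> z)"
    and ae: "AE z in lborel. z \<in> B \<longrightarrow> \<bar>\<phi> z - \<gamma>\<bar> \<le> \<omega>"
  shows "\<bar>(\<integral>z. indicator B z * \<phi> z \<partial>lborel) - measure lborel B * \<gamma>\<bar> \<le> measure lborel B * \<omega>"
proof -
  have ind: "integrable lborel (\<lambda>z. indicator B z * k)" for k :: real
    by (rule integrable_bounded_borel[OF _ B, of _ "\<bar>k\<bar>"]) (use B in auto)
  have k: "(\<integral>z. indicator B z * k \<partial>lborel) = measure lborel B * k" for k :: real
    using B by simp
  have "(\<integral>z. indicator B z * \<phi> z \<partial>lborel) - measure lborel B * \<gamma> = (\<integral>z. indicator B z * \<phi> z - indicator B z * \<gamma> \<partial>lborel)"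
    unfolding k[symmetric] using \<phi> ind by (intro Bochner_Integration.integral_diff[symmetric])
  also have "\<bar>\<dots>\<bar> \<le> (\<integral>z. \<bar>indicator B z * \<phi> z - indicator B z * \<gamma>\<bar> \<partial>lborel)"
    by (rule integral_abs_bound)
  also have "\<dots> \<le> (\<integral>z. indicator B z * \<omega> \<partial>lborel)"
  proof (rule integral_mono_AE)
    show "AE z in lborel. \<bar>indicator B z * \<phi> z - indicator B z * \<gamma>\<bar> \<le> indicator B z * \<omega>"
      using ae by eventually_elim (auto simp: indicator_def)
  qed (use \<phi> ind in \<open>auto intro!: integrable_abs\<close>)
  finally show ?thesis unfolding k .
qed

text \<open>
  A bound for the modulus of continuity at one scale.
\<close>

definition osc_le :: "'b::metric_space set \<Rightarrow> ('b \<Rightarrow> 'c::real_normed_vector) \<Rightarrow> real \<Rightarrow> real \<Rightarrow> bool" where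
  "osc_le S f r \<omega> \<longleftrightarrow> (\<forall>x\<in>S. \<forall>y\<in>S. dist x y \<le> r \<longrightarrow> norm (f x - f y) \<le> \<omega>)"

lemma osc_leD: "osc_le S f r \<omega> \<Longrightarrow> x \<in> S \<Longrightarrow> y \<in> S \<Longrightarrow> dist x y \<le> r \<Longrightarrow> norm (f x - f y) \<le> \<omega>"
  by (auto simp: osc_le_def)

lemma osc_le_mono: "osc_le S f r \<omega> \<Longrightarrow> r' \<le> r \<Longrightarrow> osc_le S f r' \<omega>"
  by (auto simp: osc_le_def)

lemma dist_Pair_le: "dist (a, b) (c, d) \<le> dist a c + dist b d"
  by (simp add: dist_Pair_Pair sqrt_sum_squares_le_sum)

locale space_time_partition =
  fixes \<Omega> :: "'a::euclidean_space set" and I :: "'i set" and A :: "'i \<Rightarrow> 'a set" and T :: real and N :: nat and t :: "nat \<Rightarrow> real"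
  assumes part: "ae_partition \<Omega> I A" and A_borel: "\<And>i. i \<in> I \<Longrightarrow> A i \<in> sets borel"
    and td: "time_discretization T N t"
begin

lemma finite_I: "finite I" using part by (simp add: ae_partition_def)

lemma st_part: "ae_partition (\<Omega> \<times> {0<..<T}) ({..<N} \<times> I) (\<lambda>(n,i). A i \<times> slab t n)"
  by (rule ae_partition_product[OF part A_borel slab_partition[OF td]]) auto

lemma st_borel: "i \<in> I \<Longrightarrow> A i \<times> slab t n \<in> sets borel"
  using A_borel by (intro borel_Times) auto

lemma st_AE: "AE z in lborel. (z \<in> \<Omega> \<times> {0<..<T} \<longleftrightarrow> (\<exists>n<N. \<exists>i\<in>I. z \<in> A i \<times> slab t n)) \<and>
   (\<forall>n<N. \<forall>i\<in>I. \<forall>n'<N. \<forall>i'\<in>I. z \<in> A i \<times> slab t n \<longrightarrow> z \<in> A i' \<times> slab t n' \<longrightarrow> n = n' \<and> i = i')"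
  using ae_partition_AE[OF st_part]
proof eventually_elim
  case (elim z)
  have 1: "z \<in> \<Omega> \<times> {0<..<T} \<longleftrightarrow> (\<exists>p\<in>{..<N} \<times> I. z \<in> A (snd p) \<times> slab t (fst p))"
    using elim[THEN conjunct1] by (simp only: case_prod_beta)
  have 2: "p = q" if "p \<in> {..<N} \<times> I" "q \<in> {..<N} \<times> I" "z \<in> A (snd p) \<times> slab t (fst p)" "z \<in> A (snd q) \<times> slab t (fst q)" for p q
    using elim[THEN conjunct2, rule_format, OF that(1,2)] that(3,4) unfolding case_prod_beta by blast
  show ?case
  proof (intro conjI allI ballI impI)
    show "z \<in> \<Omega> \<times> {0<..<T} \<longleftrightarrow> (\<exists>n<N. \<exists>i\<in>I. z \<in> A i \<times> slab t n)"
      unfolding 1 by auto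
    fix n i n' i' assume *: "n < N" "i \<in> I" "n' < N" "i' \<in> I" "z \<in> A i \<times> slab t n" "z \<in> A i' \<times> slab t n'"
    have "(n, i) = (n', i')"
      by (rule 2) (simp_all only: fst_conv snd_conv * mem_Sigma_iff lessThan_iff simp_thms)
    then show "n = n'" "i = i'" by auto
  qed
qed

lemma st_AE_domain: "n < N \<Longrightarrow> i \<in> I \<Longrightarrow> AE z in lborel. z \<in> A i \<times> slab t n \<longrightarrow> z \<in> \<Omega> \<times> {0<..<T}"
  using st_AE by eventually_elim blast

lemma st_integral:
  fixes h :: "'a \<times> real \<Rightarrow> real"
  assumes "integrable lborel h" "\<And>z. z \<notin> \<Omega> \<times> {0<..<T} \<Longrightarrow> h z = 0"
  shows "(\<integral>z. h z \<partial>lborel) = (\<Sum>n<N. \<Sum>i\<in>I. \<integral>z. indicator (A i \<times> slab t n) z * h z \<partial>lborel)"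
proof -
  have "(\<integral>z. h z \<partial>lborel) = (\<Sum>p\<in>{..<N} \<times> I. \<integral>z. indicator ((\<lambda>(n,i). A i \<times> slab t n) p) z * h z \<partial>lborel)"
    by (rule integral_ae_partition_space[OF st_part _ assms]) (use st_borel in auto)
  also have "\<dots> = (\<Sum>n<N. \<Sum>i\<in>I. \<integral>z. indicator (A i \<times> slab t n) z * h z \<partial>lborel)"
    by (subst sum.cartesian_product) (simp add: case_prod_beta)
  finally show ?thesis .
qed

lemma st_integrable_ind:
  fixes h :: "'a \<times> real \<Rightarrow> real"
  assumes "integrable lborel h" "i \<in> I"
  shows "integrable lborel (\<lambda>z. indicator (A i \<times> slab t n) z * h z)"
  using integrable_mult_indicator[OF _ assms(1), of "A i \<times> slab t n"] st_borel[OF assms(2)] by simp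

lemma st_sum_le_integral:
  fixes h :: "'a \<times> real \<Rightarrow> real"
  assumes h: "integrable lborel h" "\<And>z. z \<notin> \<Omega> \<times> {0<..<T} \<Longrightarrow> h z = 0" "\<And>z. 0 \<le> h z" and J: "J \<subseteq> I"
  shows "(\<Sum>n<N. \<Sum>i\<in>J. \<integral>z. indicator (A i \<times> slab t n) z * h z \<partial>lborel) \<le> (\<integral>z. h z \<partial>lborel)"
proof -
  have "(\<integral>z. h z \<partial>lborel) = (\<Sum>n<N. \<Sum>i\<in>I. \<integral>z. indicator (A i \<times> slab t n) z * h z \<partial>lborel)"
    by (rule st_integral[OF h(1)]) (rule h(2))
  then show ?thesis
    by (simp only:) (intro sum_mono sum_mono2 finite_I J integral_nonneg_AE; auto simp: h(3))
qed

lemma st_sum_measure_le: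
  assumes \<Omega>: "bounded \<Omega>" "\<Omega> \<in> sets borel" and J: "J \<subseteq> I"
  shows "(\<Sum>n<N. \<Sum>i\<in>J. measure lborel (A i \<times> slab t n)) \<le> measure lborel (\<Omega> \<times> {0<..<T})"
proof -
  let ?Q = "\<Omega> \<times> {0<..<T}"
  have Q: "?Q \<in> sets borel" "bounded ?Q" using \<Omega> by (auto intro!: borel_Times bounded_Times)
  have int: "integrable lborel (indicator ?Q :: _ \<Rightarrow> real)"
    by (rule integrable_bounded_borel[OF _ Q, of _ 1]) (use Q in auto)
  have "measure lborel (A i \<times> slab t n) = (\<integral>z. indicator (A i \<times> slab t n) z * indicator ?Q z \<partial>lborel)"
    if "n < N" "i \<in> J" for n i
  proof -
    have i: "i \<in> I" using that J by blast
    have "measure lborel (A i \<times> slab t n) = (\<integral>z. indicator (A i \<times> slab t n) z \<partial>lborel)"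
      using st_borel[OF i] by simp
    also have "\<dots> = (\<integral>z. indicator (A i \<times> slab t n) z * indicator ?Q z \<partial>lborel)"
    proof (rule integral_cong_AE)
      show "AE z in lborel. indicator (A i \<times> slab t n) z = (indicator (A i \<times> slab t n) z * indicator ?Q z :: real)"
        using st_AE_domain[OF that(1) i] by eventually_elim (auto simp: indicator_def)
    qed (use st_borel[OF i] Q in auto)
    finally show ?thesis .
  qed
  then have "(\<Sum>n<N. \<Sum>i\<in>J. measure lborel (A i \<times> slab t n)) = (\<Sum>n<N. \<Sum>i\<in>J. \<integral>z. indicator (A i \<times> slab t n) z * indicator ?Q z \<partial>lborel)"
    by simp
  also have "\<dots> \<le> (\<integral>z. indicator ?Q z \<partial>lborel)"
    by (rule st_sum_le_integral[OF int _ _ J]) auto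
  also have "\<dots> = measure lborel ?Q" using Q by simp
  finally show ?thesis .
qed

end

section \<open>Cells, faces and dual cells\<close>

lemma cylinder_eq_image: "cylinder n S = (\<lambda>(x, s). x + s *\<^sub>R n) ` (S \<times> {0..1})"
  by (force simp: cylinder_def)

lemma cylinder_mono: "S \<subseteq> S' \<Longrightarrow> cylinder n S \<subseteq> cylinder n S'"
  unfolding cylinder_eq_image by blast

lemma cylinder_Un: "cylinder n (S \<union> S') = cylinder n S \<union> cylinder n S'"
  unfolding cylinder_eq_image by (simp add: Sigma_Un_distrib1 image_Un)

lemma cylinder_UN: "cylinder n (\<Union>i\<in>I. S i) = (\<Union>i\<in>I. cylinder n (S i))"
  unfolding cylinder_eq_image by blast

text \<open>
  Two cells that lie on the same side of a face overlap in a layer of positive thickness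
  above almost every point of the face; since the overlap is null, the face must be null.
\<close>

lemma negligible_face_same_normal:
  assumes K: "outward_unit_normal K \<sigma> n" and L: "outward_unit_normal L \<sigma> n" and neg: "negligible (K \<inter> L)"
  shows "negligible (cylinder n \<sigma>)"
proof -
  let ?P = "\<lambda>A y e. \<forall>s. 0 < s \<and> s < e \<longrightarrow> y - s *\<^sub>R n \<in> A \<and> y + s *\<^sub>R n \<notin> A"
  let ?bad = "\<lambda>A. {y \<in> \<sigma>. \<not> (\<exists>e>0. ?P A y e)}"
  define S where "S k = {y \<in> \<sigma>. \<forall>s. 0 < s \<and> s < 1 / real (Suc k) \<longrightarrow> y - s *\<^sub>R n \<in> K \<inter> L}" for k
  have S: "negligible (cylinder n (S k))" for k
  proof -
    (* From any point of the cylinder, a move along - n by a suitable multiple of h ends at most h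
       below the base, in both K and L: countably many translates of their null intersection cover it. *)
    define h where "h = 1 / (2 * real (Suc k))"
    have h: "h > 0" "h < 1 / real (Suc k)" by (auto simp: h_def field_simps)
    have "cylinder n (S k) \<subseteq> (\<Union>j\<in>(UNIV::int set). (+) ((of_int j * h) *\<^sub>R n) ` (K \<inter> L))"
    proof
      fix x assume "x \<in> cylinder n (S k)"
      then obtain y s where y: "x = y + s *\<^sub>R n" "y \<in> S k" by (auto simp: cylinder_def)
      define j where "j = \<lfloor>s / h\<rfloor> + 1"
      define r where "r = of_int j * h - s"
      have "of_int \<lfloor>s / h\<rfloor> * h \<le> s" "s < (of_int \<lfloor>s / h\<rfloor> + 1) * h"
        using floor_divide_lower[OF h(1)] floor_divide_upper[OF h(1)] by blast+
      then have "0 < r" "r \<le> h" by (auto simp: r_def j_def algebra_simps)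
      then have "y - r *\<^sub>R n \<in> K \<inter> L" using y(2) h unfolding S_def by auto
      moreover have "x = (of_int j * h) *\<^sub>R n + (y - r *\<^sub>R n)"
        by (simp add: y(1) r_def algebra_simps)
      ultimately show "x \<in> (\<Union>j\<in>(UNIV::int set). (+) ((of_int j * h) *\<^sub>R n) ` (K \<inter> L))" by blast
    qed
    moreover have "negligible (\<Union>j\<in>(UNIV::int set). (+) ((of_int j * h) *\<^sub>R n) ` (K \<inter> L))"
      by (intro negligible_countable_Union) (auto intro: negligible_translation neg)
    ultimately show ?thesis by (rule negligible_subset[rotated])
  qed
  have "\<sigma> \<subseteq> ?bad K \<union> ?bad L \<union> (\<Union>k. S k)"
  proof
    fix y assume y: "y \<in> \<sigma>"
    show "y \<in> ?bad K \<union> ?bad L \<union> (\<Union>k. S k)"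
    proof (cases "y \<in> ?bad K \<or> y \<in> ?bad L")
      case False
      then obtain e e' where e: "e > 0" "?P K y e" "e' > 0" "?P L y e'" using y by blast
      have "0 < min e e'" using e by simp
      then obtain k where k: "inverse (real (Suc k)) < min e e'" using reals_Archimedean by blast
      have "y - s *\<^sub>R n \<in> K \<inter> L" if "0 < s" "s < 1 / real (Suc k)" for s
      proof -
        have "s < e" "s < e'" using that k by (simp_all add: inverse_eq_divide)
        then show ?thesis using e(2,4) that(1) by blast
      qed
      then have "y \<in> S k" using y unfolding S_def by blast
      then show ?thesis by blast
    qed blast
  qed
  then have "cylinder n \<sigma> \<subseteq> cylinder n (?bad K) \<union> cylinder n (?bad L) \<union> (\<Union>k. cylinder n (S k))"
    unfolding cylinder_Un[symmetric] cylinder_UN[symmetric] by (rule cylinder_mono)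
  moreover have "negligible (cylinder n (?bad K) \<union> cylinder n (?bad L) \<union> (\<Union>k. cylinder n (S k)))"
    using K L S by (intro negligible_Un negligible_countable_Union) (auto simp: outward_unit_normal_def)
  ultimately show ?thesis by (rule negligible_subset[rotated])
qed

locale mesh_time =
  fixes \<Omega> :: "'a::euclidean_space set" and M :: "'a mesh" and T :: real and N :: nat and t :: "nat \<Rightarrow> real"
  assumes bounded_domain: "bounded \<Omega>" and open_domain: "open \<Omega>"
    and mesh: "is_mesh \<Omega> M" and time: "time_discretization T N t"
begin

lemma cells_partition: "ae_partition \<Omega> (cells M) (\<lambda>K. K)"
  using mesh unfolding is_mesh_def by (rule conjunct1)

lemma finite_cells[simp]: "finite (cells M)"
  using cells_partition by (simp add: ae_partition_def)

lemma dual_partition: "ae_partition \<Omega> (all_faces M) (dual M)"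
  using mesh[unfolded is_mesh_def, THEN conjunct2, THEN conjunct2, THEN conjunct2] by (rule conjunct1)

lemma finite_all_faces[simp]: "finite (all_faces M)"
  using dual_partition by (simp add: ae_partition_def)

lemma shared_dual:
  "shared_face M K L \<sigma> \<Longrightarrow> dual M \<sigma> \<subseteq> K \<union> L" "shared_face M K L \<sigma> \<Longrightarrow> 0 < measure lebesgue (dual M \<sigma>)"
  using mesh[unfolded is_mesh_def, THEN conjunct2, THEN conjunct2, THEN conjunct2, THEN conjunct2] by blast+

lemma exterior_frontier: "\<sigma> \<in> exterior_faces M \<Longrightarrow> \<sigma> \<subseteq> frontier \<Omega>"
  using mesh[unfolded is_mesh_def, THEN conjunct2, THEN conjunct2, THEN conjunct1] by blast

context
  fixes K assumes K: "K \<in> cells M"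
begin

lemma cell_facts: "K \<subseteq> closure \<Omega>" "is_cell K (faces M K)" "point M K \<in> K"
  using mesh[unfolded is_mesh_def, THEN conjunct2, THEN conjunct1] K by blast+

lemma cell_borel[measurable]: "K \<in> sets borel"
  using cell_facts(2) unfolding is_cell_def by (intro polyhedral_borel) (rule conjunct1)

lemma cell_bounded: "bounded K"
  using cell_facts(1) bounded_domain bounded_closure bounded_subset by blast

lemma cell_measure_pos: "0 < measure lborel K"
  using cell_facts(2)[unfolded is_cell_def, THEN conjunct2, THEN conjunct1] cell_borel by simp

lemma frontier_cell: "frontier K = \<Union>(faces M K)"
  using cell_facts(2)[unfolded is_cell_def, THEN conjunct2, THEN conjunct2, THEN conjunct2] by (rule conjunct1)

context
  fixes \<sigma> assumes s: "\<sigma> \<in> faces M K"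
begin

lemma face_borel[measurable]: "\<sigma> \<in> sets borel"
  using cell_facts(2)[unfolded is_cell_def, THEN conjunct2, THEN conjunct2, THEN conjunct2, THEN conjunct2, THEN conjunct1] s
  by blast

lemma face_normal: "outward_unit_normal K \<sigma> (normal K \<sigma>)"
proof -
  have "\<exists>n. outward_unit_normal K \<sigma> n"
    using cell_facts(2)[unfolded is_cell_def, THEN conjunct2, THEN conjunct2, THEN conjunct2, THEN conjunct2, THEN conjunct1] s
    by blast
  then show ?thesis unfolding normal_def by (rule someI_ex)
qed

lemma face_unit_normal: "unit_normal \<sigma> (normal K \<sigma>)"
  using face_normal by (simp add: outward_unit_normal_def)

lemma norm_normal: "norm (normal K \<sigma>) = 1"
  using face_unit_normal by (rule unit_normal_norm)

lemma face_subset: "\<sigma> \<subseteq> frontier K"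
  using s frontier_cell by blast

lemma face_bounded: "bounded \<sigma>"
  using face_subset bounded_subset[OF bounded_closure[OF cell_bounded]] unfolding frontier_def by blast

lemma face_in_all_faces: "\<sigma> \<in> all_faces M"
  using K s by (auto simp: all_faces_def)

end

end

text \<open>
  Conservativity of the scheme rests on this: the shared numerical flux enters the balances
  of the two cells with opposite signs.
\<close>

lemma opposite_normals:
  assumes sh: "shared_face M K L \<sigma>" and pos: "0 < surface_measure \<sigma>"
  shows "normal L \<sigma> = - normal K \<sigma>"
proof -
  have K: "K \<in> cells M" "\<sigma> \<in> faces M K" and L: "L \<in> cells M" "\<sigma> \<in> faces M L" and KL: "K \<noteq> L"
    using sh by (auto simp: shared_face_def)
  have nn: "\<not> negligible (cylinder (normal K \<sigma>) \<sigma>)"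
    using surface_measure_zero_iff[OF face_borel[OF K] face_unit_normal[OF K] face_bounded[OF K]] pos by simp
  have "negligible (K \<inter> L)"
    using cells_partition K L KL by (auto simp: ae_partition_def)
  then have "normal L \<sigma> \<noteq> normal K \<sigma>"
    using negligible_face_same_normal[OF face_normal[OF K]] face_normal[OF L] nn by metis
  then show ?thesis
    using negligible_cylinder_two_normals[OF face_unit_normal[OF K] face_unit_normal[OF L]] nn by blast
qed

text \<open>
  A third cell would have a normal opposite to two vectors that are themselves opposite.
\<close>

lemma cells_of_interior_face:
  assumes sh: "shared_face M K L \<sigma>" and pos: "0 < surface_measure \<sigma>"
  shows "{J \<in> cells M. \<sigma> \<in> faces M J} = {K, L}"
proof -
  have K: "K \<in> cells M" "\<sigma> \<in> faces M K" and L: "L \<in> cells M" "\<sigma> \<in> faces M L"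
    using sh by (auto simp: shared_face_def)
  have "J = K \<or> J = L" if J: "J \<in> cells M" "\<sigma> \<in> faces M J" for J
  proof (rule ccontr)
    assume "\<not> (J = K \<or> J = L)"
    then have "shared_face M K J \<sigma>" "shared_face M L J \<sigma>" using J K L by (auto simp: shared_face_def)
    then have "normal J \<sigma> = - normal K \<sigma>" "normal J \<sigma> = - normal L \<sigma>" "normal L \<sigma> = - normal K \<sigma>"
      using opposite_normals pos sh by blast+
    then have "normal K \<sigma> + normal K \<sigma> = 0" by (metis add.inverse_inverse add.right_inverse)
    then have "2 *\<^sub>R normal K \<sigma> = 0" by (simp only: scaleR_2)
    then have "normal K \<sigma> = 0" by simp
    then show False using norm_normal[OF K] by simp
  qed
  then show ?thesis using K L by blast
qed

text \<open>
  For a face shared by two cells this is the difference of the cell values times the normal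
  vector, that is, a discrete gradient without its weight.
\<close>

definition face_difference :: "('a set \<Rightarrow> real) \<Rightarrow> 'a set \<Rightarrow> 'a" where
  "face_difference \<phi> \<sigma> = (\<Sum>J\<in>{J \<in> cells M. \<sigma> \<in> faces M J}. \<phi> J *\<^sub>R normal J \<sigma>)"

lemma face_difference_interior:
  assumes "shared_face M K L \<sigma>" and "0 < surface_measure \<sigma>"
  shows "face_difference \<phi> \<sigma> = (\<phi> K - \<phi> L) *\<^sub>R normal K \<sigma>"
  using assms(1) unfolding face_difference_def cells_of_interior_face[OF assms]
  by (simp add: shared_face_def opposite_normals[OF assms] scaleR_diff_left)

lemma sum_over_faces:
  fixes W :: "'a set \<Rightarrow> 'a"
  shows "(\<Sum>K\<in>cells M. \<phi> K * (\<Sum>\<sigma>\<in>faces M K. W \<sigma> \<bullet> normal K \<sigma>)) = (\<Sum>\<sigma>\<in>all_faces M. W \<sigma> \<bullet> face_difference \<phi> \<sigma>)"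
proof -
  have "(\<Sum>K\<in>cells M. \<phi> K * (\<Sum>\<sigma>\<in>faces M K. W \<sigma> \<bullet> normal K \<sigma>))
    = (\<Sum>K\<in>cells M. \<Sum>\<sigma>\<in>{\<sigma>\<in>all_faces M. \<sigma> \<in> faces M K}. \<phi> K * (W \<sigma> \<bullet> normal K \<sigma>))"
    unfolding sum_distrib_left
    by (intro sum.cong refl) (auto simp: all_faces_def)
  also have "\<dots> = (\<Sum>\<sigma>\<in>all_faces M. \<Sum>K\<in>{K\<in>cells M. \<sigma> \<in> faces M K}. \<phi> K * (W \<sigma> \<bullet> normal K \<sigma>))"
    by (rule sum.swap_restrict) auto
  also have "\<dots> = (\<Sum>\<sigma>\<in>all_faces M. W \<sigma> \<bullet> face_difference \<phi> \<sigma>)"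
    by (simp add: face_difference_def inner_sum_right)
  finally show ?thesis .
qed

text \<open>
  Faces of zero area carry no flux, and only for faces of positive area are the adjacent
  cells and their normals determined.
\<close>

definition flux_faces :: "'a set set" where
  "flux_faces = {\<sigma> \<in> interior_faces M. 0 < surface_measure \<sigma>}"

lemma flux_faces_subset: "flux_faces \<subseteq> all_faces M"
  by (auto simp: flux_faces_def interior_faces_def shared_face_def all_faces_def)

lemma finite_flux_faces[simp]: "finite flux_faces"
  using flux_faces_subset finite_all_faces by (rule finite_subset)

text \<open>
  Discrete integration by parts.
\<close>

lemma sum_over_flux_faces:
  fixes W :: "'a set \<Rightarrow> 'a"
  assumes W: "\<And>\<sigma>. \<sigma> \<in> all_faces M \<Longrightarrow> surface_measure \<sigma> = 0 \<Longrightarrow> W \<sigma> = 0"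
    and ext: "\<And>K \<sigma>. K \<in> cells M \<Longrightarrow> \<sigma> \<in> faces M K \<Longrightarrow> \<sigma> \<in> exterior_faces M \<Longrightarrow> 0 < surface_measure \<sigma> \<Longrightarrow> \<phi> K = 0"
  shows "(\<Sum>K\<in>cells M. \<phi> K * (\<Sum>\<sigma>\<in>faces M K. W \<sigma> \<bullet> normal K \<sigma>)) = (\<Sum>\<sigma>\<in>flux_faces. W \<sigma> \<bullet> face_difference \<phi> \<sigma>)"
  unfolding sum_over_faces
proof (rule sum.mono_neutral_right)
  show "\<forall>\<sigma>\<in>all_faces M - flux_faces. W \<sigma> \<bullet> face_difference \<phi> \<sigma> = 0"
  proof
    fix \<sigma> assume s: "\<sigma> \<in> all_faces M - flux_faces"
    show "W \<sigma> \<bullet> face_difference \<phi> \<sigma> = 0"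
    proof (cases "surface_measure \<sigma> = 0")
      case False
      then have pos: "0 < surface_measure \<sigma>" using surface_measure_nonneg[of \<sigma>] by simp
      then have "\<sigma> \<in> exterior_faces M" using s by (auto simp: flux_faces_def exterior_faces_def)
      then have "face_difference \<phi> \<sigma> = 0"
        unfolding face_difference_def using ext pos by (intro sum.neutral) auto
      then show ?thesis by simp
    qed (use W s in simp)
  qed
qed (use flux_faces_subset in auto)

text \<open>
  Dual cells are only Lebesgue measurable; a Borel set of full measure inside them keeps all
  products with time slabs Borel.
\<close>

definition dual_core :: "'a set \<Rightarrow> 'a set" where
  "dual_core \<sigma> = main_part lborel (dual M \<sigma>)"

lemma dual_lebesgue: "\<sigma> \<in> all_faces M \<Longrightarrow> dual M \<sigma> \<in> sets lebesgue"
  using dual_partition by (simp add: ae_partition_def)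

lemma dual_core_borel[measurable]: "\<sigma> \<in> all_faces M \<Longrightarrow> dual_core \<sigma> \<in> sets borel"
  using main_part_sets[OF dual_lebesgue] by (simp add: dual_core_def)

lemma dual_core_subset: "\<sigma> \<in> all_faces M \<Longrightarrow> dual_core \<sigma> \<subseteq> dual M \<sigma>"
  using main_part_null_part_Un[OF dual_lebesgue] by (auto simp: dual_core_def)

lemma dual_core_negligible: "\<sigma> \<in> all_faces M \<Longrightarrow> negligible (dual M \<sigma> - dual_core \<sigma>)"
proof -
  assume s: "\<sigma> \<in> all_faces M"
  obtain N where "N \<in> null_sets lborel" "null_part lborel (dual M \<sigma>) \<subseteq> N"
    using null_part[OF dual_lebesgue[OF s]] by blast
  then have "negligible (null_part lborel (dual M \<sigma>))"
    by (auto simp: negligible_iff_null_sets null_sets_completion_iff2)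
  then show ?thesis
    by (rule negligible_subset) (use main_part_null_part_Un[OF dual_lebesgue[OF s]] in \<open>auto simp: dual_core_def\<close>)
qed

lemma measure_dual_core: "\<sigma> \<in> all_faces M \<Longrightarrow> measure lborel (dual_core \<sigma>) = measure lebesgue (dual M \<sigma>)"
  by (simp add: measure_def dual_core_def emeasure_completion dual_lebesgue)

lemma dual_core_partition: "ae_partition \<Omega> (all_faces M) dual_core"
  unfolding ae_partition_def
proof (intro conjI ballI impI)
  fix \<sigma> \<tau> assume st: "\<sigma> \<in> all_faces M" "\<tau> \<in> all_faces M" "\<sigma> \<noteq> \<tau>"
  then have "negligible (dual M \<sigma> \<inter> dual M \<tau>)" using dual_partition by (simp add: ae_partition_def)
  then show "negligible (dual_core \<sigma> \<inter> dual_core \<tau>)"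
    by (rule negligible_subset) (use dual_core_subset st in blast)
next
  have "negligible (sym_diff \<Omega> (\<Union>i\<in>all_faces M. dual M i) \<union> (\<Union>\<sigma>\<in>all_faces M. dual M \<sigma> - dual_core \<sigma>))"
    using dual_partition dual_core_negligible by (intro negligible_Un negligible_Union) (auto simp: ae_partition_def)
  then show "negligible (sym_diff \<Omega> (\<Union>i\<in>all_faces M. dual_core i))"
    by (rule negligible_subset) (use dual_core_subset in blast)
qed (use dual_core_borel in auto)

end

context mesh_time
begin

sublocale cell: space_time_partition \<Omega> "cells M" "\<lambda>K. K" T N t
  by standard (use cells_partition cell_borel time in auto)

sublocale dual: space_time_partition \<Omega> "all_faces M" dual_core T N t
  by standard (use dual_core_partition dual_core_borel time in auto)

abbreviation Q :: "('a \<times> real) set" where "Q \<equiv> \<Omega> \<times> {0<..<T}"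
abbreviation cQ :: "('a \<times> real) set" where "cQ \<equiv> closure \<Omega> \<times> {0..T}"

lemma domain_borel[measurable]: "\<Omega> \<in> sets borel" using open_domain by simp

lemma Q_borel[measurable]: "Q \<in> sets borel" by (intro borel_Times) auto

lemma Q_bounded: "bounded Q" using bounded_domain by (intro bounded_Times) auto

lemma step_function_AE:
  assumes n: "n < N" and K: "K \<in> cells M"
  shows "AE z in lborel. z \<in> K \<times> slab t n \<longrightarrow> step_function M N t u z = u n K"
  using cell.st_AE
proof eventually_elim
  case (elim z)
  show ?case
  proof
    assume z: "z \<in> K \<times> slab t n"
    have un: "n' = n \<and> K' = K" if "n' < N" "K' \<in> cells M" "z \<in> K' \<times> slab t n'" for n' K'
      using elim[THEN conjunct2, rule_format, OF that(1,2) n K that(3) z] .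
    have "step_function M N t u z = (\<Sum>p\<in>{..<N} \<times> cells M. u (fst p) (snd p) * indicator (snd p \<times> slab t (fst p)) z)"
      unfolding step_function_def slab_def[symmetric] sum.cartesian_product by (simp add: case_prod_beta)
    also have "\<dots> = u (fst (n,K)) (snd (n,K)) * indicator (snd (n,K) \<times> slab t (fst (n,K))) z"
    proof (rule sum_single)
      fix p assume p: "p \<in> {..<N} \<times> cells M" "p \<noteq> (n, K)"
      then have "z \<notin> snd p \<times> slab t (fst p)"
        using un[of "fst p" "snd p"] by (metis SigmaE fst_conv lessThan_iff snd_conv)
      then show "u (fst p) (snd p) * indicator (snd p \<times> slab t (fst p)) z = 0" by simp
    qed (use n K in auto)
    finally show "step_function M N t u z = u n K" using z by simp
  qed
qed

lemma step_function_borel[measurable]: "step_function M N t u \<in> borel_measurable borel"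
  unfolding step_function_def slab_def[symmetric]
  using cell.st_borel by (intro borel_measurable_sum borel_measurable_times borel_measurable_indicator) auto

definition side1 :: "'a set \<Rightarrow> 'a set" where "side1 \<sigma> = fst (SOME p. shared_face M (fst p) (snd p) \<sigma>)"
definition side2 :: "'a set \<Rightarrow> 'a set" where "side2 \<sigma> = snd (SOME p. shared_face M (fst p) (snd p) \<sigma>)"

lemma flux_face_sides:
  assumes "\<sigma> \<in> flux_faces"
  shows "shared_face M (side1 \<sigma>) (side2 \<sigma>) \<sigma>" "0 < surface_measure \<sigma>" "dual_core \<sigma> \<subseteq> side1 \<sigma> \<union> side2 \<sigma>"
    "0 < measure lborel (dual_core \<sigma>)" "bounded (dual_core \<sigma>)" "dual_core \<sigma> \<in> sets borel"
    "side1 \<sigma> \<in> cells M" "\<sigma> \<in> faces M (side1 \<sigma>)" "side2 \<sigma> \<in> cells M" "\<sigma> \<in> faces M (side2 \<sigma>)"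
proof -
  have "\<exists>p. shared_face M (fst p) (snd p) \<sigma>"
    using assms by (auto simp: flux_faces_def interior_faces_def)
  then show sh: "shared_face M (side1 \<sigma>) (side2 \<sigma>) \<sigma>"
    unfolding side1_def side2_def by (rule someI_ex)
  show pos: "0 < surface_measure \<sigma>" using assms by (simp add: flux_faces_def)
  have a: "\<sigma> \<in> all_faces M" using assms flux_faces_subset by blast
  show "dual_core \<sigma> \<subseteq> side1 \<sigma> \<union> side2 \<sigma>" using dual_core_subset[OF a] shared_dual(1)[OF sh] by blast
  then show "bounded (dual_core \<sigma>)"
    using sh cell_bounded bounded_subset by (metis bounded_Un shared_face_def)
  show "0 < measure lborel (dual_core \<sigma>)" using shared_dual(2)[OF sh] measure_dual_core[OF a] by simp
  show "dual_core \<sigma> \<in> sets borel" by (rule dual_core_borel[OF a])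
  show "side1 \<sigma> \<in> cells M" "\<sigma> \<in> faces M (side1 \<sigma>)" "side2 \<sigma> \<in> cells M" "\<sigma> \<in> faces M (side2 \<sigma>)"
    using sh by (auto simp: shared_face_def)
qed

definition jump :: "('a set \<Rightarrow> real) \<Rightarrow> 'a set \<Rightarrow> real" where
  "jump v \<sigma> = \<bar>v (side1 \<sigma>) - v (side2 \<sigma>)\<bar>"

text \<open>
  The space-time point at which the test function is evaluated for the step from
  \<open>n\<close> to \<open>Suc n\<close>.
\<close>

definition anchor :: "nat \<Rightarrow> 'a set \<Rightarrow> 'a \<times> real" where
  "anchor n K = (point M K, t (Suc n))"

end

text \<open>
  The numbers \<open>h\<close> and \<open>k\<close> bound the mesh size and the time step.
\<close>

locale fine_mesh = mesh_time +
  fixes h k :: real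
  assumes diam: "\<And>K. K \<in> cells M \<Longrightarrow> diameter K \<le> h" and dt: "\<And>n. n < N \<Longrightarrow> t (Suc n) - t n \<le> k"
    and h0: "0 \<le> h" and k0: "0 \<le> k"
begin

lemma cell_dist: "K \<in> cells M \<Longrightarrow> x \<in> closure K \<Longrightarrow> y \<in> closure K \<Longrightarrow> dist x y \<le> h"
  using diameter_bounded_bound[of "closure K" x y] diam[of K] cell_bounded[of K] diameter_closure[of K]
  by (simp add: bounded_closure)

lemma anchor_in: "K \<in> cells M \<Longrightarrow> n < N \<Longrightarrow> anchor n K \<in> cQ"
  using cell_facts[of K] time_bounds[OF time, of "Suc n"] by (auto simp: anchor_def)

lemma slab_time: "n < N \<Longrightarrow> s \<in> slab t n \<Longrightarrow> s \<in> {0..T} \<and> dist s (t (Suc n)) \<le> k"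
  using time_bounds[OF time, of "Suc n"] time_bounds[OF time, of n] dt[of n]
  by (auto simp: slab_def dist_real_def)

lemma cell_anchor:
  assumes "K \<in> cells M" "n < N" "z \<in> K \<times> slab t n"
  shows "z \<in> cQ" "dist z (anchor n K) \<le> h + k"
proof -
  obtain x s where z: "z = (x, s)" "x \<in> K" "s \<in> slab t n" using assms(3) by auto
  show "z \<in> cQ" using z cell_facts(1)[OF assms(1)] slab_time[OF assms(2) z(3)] by auto
  have "dist x (point M K) \<le> h"
    using cell_dist[OF assms(1)] z(2) cell_facts(3)[OF assms(1)] closure_subset by blast
  then show "dist z (anchor n K) \<le> h + k"
    using slab_time[OF assms(2) z(3)] dist_Pair_le[of x s "point M K" "t (Suc n)"] by (simp add: z(1) anchor_def)
qed

lemma flux_face_point: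
  assumes "\<sigma> \<in> flux_faces"
  obtains y where "y \<in> \<sigma>"
proof -
  have "\<sigma> \<noteq> {}"
    using flux_face_sides(2)[OF assms] by (auto simp: surface_measure_def cylinder_def)
  then show thesis using that by blast
qed

lemma face_closure: "K \<in> cells M \<Longrightarrow> \<sigma> \<in> faces M K \<Longrightarrow> y \<in> \<sigma> \<Longrightarrow> y \<in> closure K"
  using face_subset[of K \<sigma>] by (auto simp: frontier_def)

lemma face_anchor:
  assumes "K \<in> cells M" "\<sigma> \<in> faces M K" "n < N" "y \<in> \<sigma>"
  shows "(y, t (Suc n)) \<in> cQ" "dist (y, t (Suc n)) (anchor n K) \<le> h"
proof -
  have y: "y \<in> closure K" by (rule face_closure[OF assms(1,2,4)])
  have "closure K \<subseteq> closure \<Omega>" using cell_facts(1)[OF assms(1)] by (simp add: closure_minimal)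
  then show "(y, t (Suc n)) \<in> cQ" using y time_bounds[OF time, of "Suc n"] assms(3) by auto
  show "dist (y, t (Suc n)) (anchor n K) \<le> h"
    using cell_dist[OF assms(1) y, of "point M K"] cell_facts(3)[OF assms(1)] closure_subset
    by (auto simp: anchor_def dist_Pair_Pair)
qed

text \<open>
  The two sides of a face have a common boundary point, so their union has diameter at most
  twice the mesh size.
\<close>

lemma side_dist:
  assumes s: "\<sigma> \<in> flux_faces" and x: "x \<in> closure (side1 \<sigma>) \<union> closure (side2 \<sigma>)"
  shows "dist x (point M (side1 \<sigma>)) \<le> 2 * h"
proof -
  note f = flux_face_sides[OF s]
  obtain y where y: "y \<in> \<sigma>" by (rule flux_face_point[OF s])
  have y1: "y \<in> closure (side1 \<sigma>)" "y \<in> closure (side2 \<sigma>)" using face_closure f y by blast+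
  have p: "point M (side1 \<sigma>) \<in> closure (side1 \<sigma>)" using cell_facts(3)[OF f(7)] closure_subset by blast
  from x show ?thesis
  proof
    assume "x \<in> closure (side1 \<sigma>)"
    then show ?thesis using cell_dist[OF f(7) _ p] h0 by (smt (verit))
  next
    assume "x \<in> closure (side2 \<sigma>)"
    then have "dist x y \<le> h" using cell_dist[OF f(9) _ y1(2)] by blast
    moreover have "dist y (point M (side1 \<sigma>)) \<le> h" by (rule cell_dist[OF f(7) y1(1) p])
    ultimately show ?thesis using dist_triangle[of x "point M (side1 \<sigma>)" y] by linarith
  qed
qed

lemma dual_anchor:
  assumes "\<sigma> \<in> flux_faces" "n < N" "z \<in> dual_core \<sigma> \<times> slab t n"
  shows "z \<in> cQ" "dist z (anchor n (side1 \<sigma>)) \<le> 2 * h + k"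
proof -
  note f = flux_face_sides[OF assms(1)]
  obtain x s where z: "z = (x, s)" "x \<in> dual_core \<sigma>" "s \<in> slab t n" using assms(3) by auto
  have x: "x \<in> side1 \<sigma> \<union> side2 \<sigma>" using z f(3) by blast
  show "z \<in> cQ" using z x cell_facts(1)[OF f(7)] cell_facts(1)[OF f(9)] slab_time[OF assms(2) z(3)] by auto
  have "dist x (point M (side1 \<sigma>)) \<le> 2 * h"
    using x closure_subset by (intro side_dist[OF assms(1)]) blast
  then show "dist z (anchor n (side1 \<sigma>)) \<le> 2 * h + k"
    using slab_time[OF assms(2) z(3)] dist_Pair_le[of x s "point M (side1 \<sigma>)" "t (Suc n)"] by (simp add: z(1) anchor_def)
qed

lemma anchors_dist:
  assumes "\<sigma> \<in> flux_faces"
  shows "dist (anchor n (side1 \<sigma>)) (anchor n (side2 \<sigma>)) \<le> 2 * h"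
proof -
  have "point M (side2 \<sigma>) \<in> closure (side2 \<sigma>)"
    using cell_facts(3)[OF flux_face_sides(9)[OF assms]] closure_subset by blast
  then show ?thesis
    using side_dist[OF assms, of "point M (side2 \<sigma>)"] by (simp add: anchor_def dist_Pair_Pair dist_commute)
qed

end

section \<open>The discrete gradient\<close>

context fine_mesh
begin

lemma cell_slab_borel_bounded:
  "K \<in> cells M \<Longrightarrow> K \<times> slab t n \<in> sets borel" "K \<in> cells M \<Longrightarrow> bounded (K \<times> slab t n)"
  using cell.st_borel cell_bounded by (auto intro!: bounded_Times simp: slab_def)

lemma cell_sum_nearly_constant:
  fixes \<phi> :: "'a \<times> real \<Rightarrow> real"
  assumes \<phi>: "integrable lborel \<phi>" "\<And>z. z \<notin> Q \<Longrightarrow> \<phi> z = 0"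
    and ae: "\<And>n K. n < N \<Longrightarrow> K \<in> cells M \<Longrightarrow> AE z in lborel. z \<in> K \<times> slab t n \<longrightarrow> z \<in> Q \<longrightarrow> \<bar>\<phi> z - \<gamma> n K\<bar> \<le> \<omega> n K"
  shows "\<bar>(\<integral>z. \<phi> z \<partial>lborel) - (\<Sum>n<N. \<Sum>K\<in>cells M. measure lborel (K \<times> slab t n) * \<gamma> n K)\<bar>
    \<le> (\<Sum>n<N. \<Sum>K\<in>cells M. measure lborel (K \<times> slab t n) * \<omega> n K)"
proof -
  have "(\<integral>z. \<phi> z \<partial>lborel) = (\<Sum>n<N. \<Sum>K\<in>cells M. \<integral>z. indicator (K \<times> slab t n) z * \<phi> z \<partial>lborel)"
    by (rule cell.st_integral[OF \<phi>(1)]) (rule \<phi>(2))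
  then have "\<bar>(\<integral>z. \<phi> z \<partial>lborel) - (\<Sum>n<N. \<Sum>K\<in>cells M. measure lborel (K \<times> slab t n) * \<gamma> n K)\<bar>
     = \<bar>\<Sum>n<N. \<Sum>K\<in>cells M. (\<integral>z. indicator (K \<times> slab t n) z * \<phi> z \<partial>lborel) - measure lborel (K \<times> slab t n) * \<gamma> n K\<bar>"
    by (simp add: sum_subtractf)
  also have "\<dots> \<le> (\<Sum>n<N. \<Sum>K\<in>cells M. \<bar>(\<integral>z. indicator (K \<times> slab t n) z * \<phi> z \<partial>lborel) - measure lborel (K \<times> slab t n) * \<gamma> n K\<bar>)"
    by (intro order_trans[OF sum_abs] sum_mono order_refl)
  also have "\<dots> \<le> (\<Sum>n<N. \<Sum>K\<in>cells M. measure lborel (K \<times> slab t n) * \<omega> n K)"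
  proof (intro sum_mono integral_nearly_constant)
    fix n K assume "n \<in> {..<N}" and K: "K \<in> cells M"
    then have n: "n < N" by simp
    show "AE z in lborel. z \<in> K \<times> slab t n \<longrightarrow> \<bar>\<phi> z - \<gamma> n K\<bar> \<le> \<omega> n K"
      using cell.st_AE_domain[OF n K] ae[OF n K] by eventually_elim blast
    show "integrable lborel (\<lambda>z. indicator (K \<times> slab t n) z * \<phi> z)"
      by (rule cell.st_integrable_ind[OF \<phi>(1) K])
  qed (use cell_slab_borel_bounded in auto)
  finally show ?thesis .
qed

lemma cell_deviation_le:
  fixes g :: "'a \<times> real \<Rightarrow> real"
  assumes u: "integrable lborel (\<lambda>z. indicator Q z * step_function M N t u z)"
    and g: "continuous_on UNIV g" and osc: "osc_le cQ g (h + k) \<omega>" and \<omega>: "0 \<le> \<omega>"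
  shows "(\<Sum>n<N. \<Sum>K\<in>cells M. measure lborel (K \<times> slab t n) * \<bar>u n K - g (anchor n K)\<bar>)
    \<le> (\<integral>z. indicator Q z * \<bar>step_function M N t u z - g z\<bar> \<partial>lborel) + \<omega> * measure lborel Q"
proof -
  let ?\<phi> = "\<lambda>z. indicator Q z * \<bar>step_function M N t u z - g z\<bar>"
  have "integrable lborel (\<lambda>z. indicator Q z * g z)"
    using set_integrable_continuous_bounded[OF Q_bounded Q_borel g] by (simp add: set_integrable_def)
  then have "integrable lborel (\<lambda>z. \<bar>indicator Q z * step_function M N t u z - indicator Q z * g z\<bar>)"
    using u by (intro integrable_abs Bochner_Integration.integrable_diff)
  then have int: "integrable lborel ?\<phi>"
    by (simp add: abs_mult flip: right_diff_distrib)
  have "\<bar>(\<integral>z. ?\<phi> z \<partial>lborel) - (\<Sum>n<N. \<Sum>K\<in>cells M. measure lborel (K \<times> slab t n) * \<bar>u n K - g (anchor n K)\<bar>)\<bar>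
    \<le> (\<Sum>n<N. \<Sum>K\<in>cells M. measure lborel (K \<times> slab t n) * \<omega>)"
  proof (rule cell_sum_nearly_constant[OF int])
    fix n K assume n: "n < N" and K: "K \<in> cells M"
    show "AE z in lborel. z \<in> K \<times> slab t n \<longrightarrow> z \<in> Q \<longrightarrow> \<bar>?\<phi> z - \<bar>u n K - g (anchor n K)\<bar>\<bar> \<le> \<omega>"
      using step_function_AE[OF n K, of u]
    proof eventually_elim
      case (elim z)
      show ?case
      proof (intro impI)
        assume z: "z \<in> K \<times> slab t n" "z \<in> Q"
        have "\<bar>g z - g (anchor n K)\<bar> \<le> \<omega>"
          using osc_leD[OF osc cell_anchor(1)[OF K n z(1)] anchor_in[OF K n] cell_anchor(2)[OF K n z(1)]] by simp
        then show "\<bar>?\<phi> z - \<bar>u n K - g (anchor n K)\<bar>\<bar> \<le> \<omega>" using elim z by simp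
      qed
    qed
  qed simp
  also have "\<dots> = \<omega> * (\<Sum>n<N. \<Sum>K\<in>cells M. measure lborel (K \<times> slab t n))"
    by (simp add: sum_distrib_left mult.commute)
  also have "\<dots> \<le> \<omega> * measure lborel Q"
    using \<omega> cell.st_sum_measure_le[OF bounded_domain domain_borel order_refl] by (intro mult_left_mono)
  finally show ?thesis by linarith
qed

text \<open>
  The jumps of the cell values are compared with those of a continuous function
  \<open>g\<close>, which are small on neighbouring cells. The deviation of a cell value
  from \<open>g\<close> is counted once for each face of the cell, with weight at most
  \<open>\<theta>\<close> times the volume of the cell, hence at most \<open>NE *
  \<theta>\<close> times in total.
\<close>

lemma jumps_le:
  fixes g :: "'a \<times> real \<Rightarrow> real"
  assumes u: "integrable lborel (\<lambda>z. indicator Q z * step_function M N t u z)"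
    and g: "continuous_on UNIV g" and osc: "osc_le cQ g (2 * h + k) \<omega>" and \<omega>: "0 \<le> \<omega>"
    and \<theta>: "0 \<le> \<theta>" "\<And>K \<sigma>. K \<in> cells M \<Longrightarrow> \<sigma> \<in> faces M K \<Longrightarrow> measure lborel (dual_core \<sigma>) \<le> \<theta> * measure lborel K"
    and NE: "\<And>K. K \<in> cells M \<Longrightarrow> card (faces M K) \<le> NE"
  shows "(\<Sum>n<N. \<Sum>\<sigma>\<in>flux_faces. measure lborel (dual_core \<sigma> \<times> slab t n) * jump (u n) \<sigma>)
    \<le> real NE * \<theta> * ((\<integral>z. indicator Q z * \<bar>step_function M N t u z - g z\<bar> \<partial>lborel) + \<omega> * measure lborel Q) + \<omega> * measure lborel Q"
proof -
  define c where "c n K = \<bar>u n K - g (anchor n K)\<bar>" for n K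
  have c0: "0 \<le> c n K" for n K by (simp add: c_def)
  have jump: "jump (u n) \<sigma> \<le> c n (side1 \<sigma>) + c n (side2 \<sigma>) + \<omega>" if n: "n < N" and s: "\<sigma> \<in> flux_faces" for n \<sigma>
  proof -
    have "\<bar>g (anchor n (side1 \<sigma>)) - g (anchor n (side2 \<sigma>))\<bar> \<le> \<omega>"
      using osc_leD[OF osc anchor_in[OF flux_face_sides(7)[OF s] n] anchor_in[OF flux_face_sides(9)[OF s] n]]
        anchors_dist[OF s, of n] k0 by simp
    then show ?thesis by (simp add: jump_def c_def)
  qed
  have step: "(\<Sum>\<sigma>\<in>flux_faces. measure lborel (dual_core \<sigma> \<times> slab t n) * (c n (side1 \<sigma>) + c n (side2 \<sigma>)))
      \<le> real NE * \<theta> * (\<Sum>K\<in>cells M. measure lborel (K \<times> slab t n) * c n K)" if n: "n < N" for n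
  proof -
    let ?\<delta> = "t (Suc n) - t n" and ?m = "\<lambda>\<sigma>. measure lborel (dual_core \<sigma>)"
    have \<delta>: "0 \<le> ?\<delta>" using time_step_pos[OF time n] by simp
    have "(\<Sum>\<sigma>\<in>flux_faces. measure lborel (dual_core \<sigma> \<times> slab t n) * (c n (side1 \<sigma>) + c n (side2 \<sigma>)))
       = (\<Sum>\<sigma>\<in>flux_faces. \<Sum>K\<in>{K\<in>cells M. \<sigma> \<in> faces M K}. ?\<delta> * ?m \<sigma> * c n K)"
    proof (rule sum.cong)
      fix \<sigma> assume s: "\<sigma> \<in> flux_faces"
      note f = flux_face_sides[OF s]
      have ne: "side1 \<sigma> \<noteq> side2 \<sigma>" using f(1) by (simp add: shared_face_def)
      have "(\<Sum>K\<in>{K\<in>cells M. \<sigma> \<in> faces M K}. ?\<delta> * ?m \<sigma> * c n K) = ?\<delta> * ?m \<sigma> * c n (side1 \<sigma>) + ?\<delta> * ?m \<sigma> * c n (side2 \<sigma>)"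
        unfolding cells_of_interior_face[OF f(1,2)] using ne by simp
      then show "measure lborel (dual_core \<sigma> \<times> slab t n) * (c n (side1 \<sigma>) + c n (side2 \<sigma>))
          = (\<Sum>K\<in>{K\<in>cells M. \<sigma> \<in> faces M K}. ?\<delta> * ?m \<sigma> * c n K)"
        by (simp add: measure_times_slab[OF time n f(6,5)] algebra_simps)
    qed simp
    also have "\<dots> \<le> (\<Sum>\<sigma>\<in>all_faces M. \<Sum>K\<in>{K\<in>cells M. \<sigma> \<in> faces M K}. ?\<delta> * ?m \<sigma> * c n K)"
      using flux_faces_subset \<delta> c0 by (intro sum_mono2 sum_nonneg mult_nonneg_nonneg) auto
    also have "\<dots> = (\<Sum>K\<in>cells M. \<Sum>\<sigma>\<in>{\<sigma>\<in>all_faces M. \<sigma> \<in> faces M K}. ?\<delta> * ?m \<sigma> * c n K)"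
      by (rule sum.swap_restrict) auto
    also have "\<dots> = (\<Sum>K\<in>cells M. \<Sum>\<sigma>\<in>faces M K. ?\<delta> * ?m \<sigma> * c n K)"
      by (intro sum.cong refl) (auto simp: all_faces_def)
    also have "\<dots> \<le> (\<Sum>K\<in>cells M. \<Sum>\<sigma>\<in>faces M K. ?\<delta> * (\<theta> * measure lborel K) * c n K)"
      using \<theta> \<delta> c0 by (intro sum_mono mult_right_mono mult_left_mono) auto
    also have "\<dots> = (\<Sum>K\<in>cells M. real (card (faces M K)) * (\<theta> * (measure lborel (K \<times> slab t n) * c n K)))"
      by (intro sum.cong refl) (simp add: measure_times_slab[OF time n cell_borel cell_bounded])
    also have "\<dots> \<le> (\<Sum>K\<in>cells M. real NE * (\<theta> * (measure lborel (K \<times> slab t n) * c n K)))"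
      using NE \<theta>(1) c0 by (intro sum_mono mult_right_mono) auto
    finally show ?thesis by (simp add: sum_distrib_left mult.assoc)
  qed
  have "(\<Sum>n<N. \<Sum>\<sigma>\<in>flux_faces. measure lborel (dual_core \<sigma> \<times> slab t n) * jump (u n) \<sigma>)
     \<le> (\<Sum>n<N. \<Sum>\<sigma>\<in>flux_faces. measure lborel (dual_core \<sigma> \<times> slab t n) * (c n (side1 \<sigma>) + c n (side2 \<sigma>) + \<omega>))"
    using jump by (intro sum_mono mult_left_mono) auto
  also have "\<dots> = (\<Sum>n<N. \<Sum>\<sigma>\<in>flux_faces. measure lborel (dual_core \<sigma> \<times> slab t n) * (c n (side1 \<sigma>) + c n (side2 \<sigma>)))
      + \<omega> * (\<Sum>n<N. \<Sum>\<sigma>\<in>flux_faces. measure lborel (dual_core \<sigma> \<times> slab t n))"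
    by (simp add: distrib_left sum.distrib sum_distrib_left mult.commute)
  also have "\<dots> \<le> (\<Sum>n<N. real NE * \<theta> * (\<Sum>K\<in>cells M. measure lborel (K \<times> slab t n) * c n K)) + \<omega> * measure lborel Q"
    using step \<omega> dual.st_sum_measure_le[OF bounded_domain domain_borel flux_faces_subset]
    by (intro add_mono sum_mono mult_left_mono) auto
  also have "(\<Sum>n<N. real NE * \<theta> * (\<Sum>K\<in>cells M. measure lborel (K \<times> slab t n) * c n K))
      = real NE * \<theta> * (\<Sum>n<N. \<Sum>K\<in>cells M. measure lborel (K \<times> slab t n) * c n K)"
    by (simp add: sum_distrib_left)
  also have "\<dots> \<le> real NE * \<theta> * ((\<integral>z. indicator Q z * \<bar>step_function M N t u z - g z\<bar> \<partial>lborel) + \<omega> * measure lborel Q)"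
    unfolding c_def using \<theta>(1) k0 h0
    by (intro mult_left_mono cell_deviation_le[OF u g osc_le_mono[OF osc] \<omega>]) auto
  finally show ?thesis by simp
qed

text \<open>
  The integral of the scalar product of \<open>H\<close> with minus the discrete gradient of
  \<open>\<phi>\<close>, which is constant on each dual cell and time slab.
\<close>

definition grad_pairing :: "(nat \<Rightarrow> 'a set \<Rightarrow> real) \<Rightarrow> ('a \<times> real \<Rightarrow> 'a) \<Rightarrow> real" where
  "grad_pairing \<phi> H = (\<Sum>n<N. \<Sum>\<sigma>\<in>flux_faces. surface_measure \<sigma> / measure lborel (dual_core \<sigma>) *
     (\<integral>z. indicator (dual_core \<sigma> \<times> slab t n) z * (H z \<bullet> face_difference (\<phi> n) \<sigma>) \<partial>lborel))"

lemma dual_integrable_inner: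
  fixes H :: "'a \<times> real \<Rightarrow> 'a"
  assumes "integrable lborel H" "\<sigma> \<in> flux_faces"
  shows "integrable lborel (\<lambda>z. indicator (dual_core \<sigma> \<times> slab t n) z * (H z \<bullet> d))"
  using assms flux_faces_subset by (intro dual.st_integrable_ind integrable_inner_left) auto

lemma grad_pairing_diff:
  assumes "integrable lborel H" "integrable lborel H'"
  shows "grad_pairing \<phi> (\<lambda>z. H z - H' z) = grad_pairing \<phi> H - grad_pairing \<phi> H'"
  unfolding grad_pairing_def sum_subtractf[symmetric]
proof (intro sum.cong refl)
  fix n \<sigma> assume s: "\<sigma> \<in> flux_faces"
  let ?d = "face_difference (\<phi> n) \<sigma>" and ?i = "\<lambda>z. indicator (dual_core \<sigma> \<times> slab t n) z :: real"
  have "(\<integral>z. ?i z * ((H z - H' z) \<bullet> ?d) \<partial>lborel) = (\<integral>z. ?i z * (H z \<bullet> ?d) - ?i z * (H' z \<bullet> ?d) \<partial>lborel)"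
    by (simp add: inner_diff_left right_diff_distrib)
  also have "\<dots> = (\<integral>z. ?i z * (H z \<bullet> ?d) \<partial>lborel) - (\<integral>z. ?i z * (H' z \<bullet> ?d) \<partial>lborel)"
    using dual_integrable_inner assms s by (intro Bochner_Integration.integral_diff) auto
  finally show "surface_measure \<sigma> / measure lborel (dual_core \<sigma>) * (\<integral>z. ?i z * ((H z - H' z) \<bullet> ?d) \<partial>lborel)
    = surface_measure \<sigma> / measure lborel (dual_core \<sigma>) * (\<integral>z. ?i z * (H z \<bullet> ?d) \<partial>lborel)
    - surface_measure \<sigma> / measure lborel (dual_core \<sigma>) * (\<integral>z. ?i z * (H' z \<bullet> ?d) \<partial>lborel)"
    by (simp add: right_diff_distrib)
qed

text \<open>
  The hypothesis on \<open>G\<close> says that the discrete gradient is bounded by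
  \<open>G\<close>.
\<close>

lemma grad_pairing_le:
  assumes H: "integrable lborel H" "\<And>z. z \<notin> Q \<Longrightarrow> H z = 0"
    and G: "0 \<le> G" "\<And>n \<sigma>. n < N \<Longrightarrow> \<sigma> \<in> flux_faces \<Longrightarrow> surface_measure \<sigma> * norm (face_difference (\<phi> n) \<sigma>) \<le> G * measure lborel (dual_core \<sigma>)"
  shows "\<bar>grad_pairing \<phi> H\<bar> \<le> G * (\<integral>z. norm (H z) \<partial>lborel)"
proof -
  have "\<bar>grad_pairing \<phi> H\<bar> \<le> (\<Sum>n<N. \<Sum>\<sigma>\<in>flux_faces. \<bar>surface_measure \<sigma> / measure lborel (dual_core \<sigma>) *
     (\<integral>z. indicator (dual_core \<sigma> \<times> slab t n) z * (H z \<bullet> face_difference (\<phi> n) \<sigma>) \<partial>lborel)\<bar>)"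
    unfolding grad_pairing_def by (intro order_trans[OF sum_abs] sum_mono order_refl)
  also have "\<dots> \<le> (\<Sum>n<N. \<Sum>\<sigma>\<in>flux_faces. G * (\<integral>z. indicator (dual_core \<sigma> \<times> slab t n) z * norm (H z) \<partial>lborel))"
  proof (intro sum_mono)
    fix n \<sigma> assume "n \<in> {..<N}" and s: "\<sigma> \<in> flux_faces"
    then have n: "n < N" by simp
    note f = flux_face_sides[OF s]
    let ?d = "face_difference (\<phi> n) \<sigma>" and ?i = "\<lambda>z. indicator (dual_core \<sigma> \<times> slab t n) z :: real"
    have sa: "\<sigma> \<in> all_faces M" using s flux_faces_subset by blast
    have intn: "integrable lborel (\<lambda>z. ?i z * norm (H z))"
      using H(1) sa by (intro dual.st_integrable_ind) auto
    have "\<bar>\<integral>z. ?i z * (H z \<bullet> ?d) \<partial>lborel\<bar> \<le> (\<integral>z. \<bar>?i z * (H z \<bullet> ?d)\<bar> \<partial>lborel)"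
      by (rule integral_abs_bound)
    also have "\<dots> \<le> (\<integral>z. norm ?d * (?i z * norm (H z)) \<partial>lborel)"
    proof (rule integral_mono)
      show "\<bar>?i z * (H z \<bullet> ?d)\<bar> \<le> norm ?d * (?i z * norm (H z))" for z
        using Cauchy_Schwarz_ineq2[of "H z" ?d] by (auto simp: indicator_def mult.commute)
    qed (use dual_integrable_inner[OF H(1) s] intn in \<open>auto intro!: integrable_abs\<close>)
    finally have "\<bar>\<integral>z. ?i z * (H z \<bullet> ?d) \<partial>lborel\<bar> \<le> norm ?d * (\<integral>z. ?i z * norm (H z) \<partial>lborel)"
      by simp
    then have "surface_measure \<sigma> / measure lborel (dual_core \<sigma>) * \<bar>\<integral>z. ?i z * (H z \<bullet> ?d) \<partial>lborel\<bar>
       \<le> surface_measure \<sigma> / measure lborel (dual_core \<sigma>) * (norm ?d * (\<integral>z. ?i z * norm (H z) \<partial>lborel))"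
      using f(2) by (intro mult_left_mono) auto
    also have "\<dots> = (surface_measure \<sigma> * norm ?d) / measure lborel (dual_core \<sigma>) * (\<integral>z. ?i z * norm (H z) \<partial>lborel)"
      by simp
    also have "\<dots> \<le> G * (\<integral>z. ?i z * norm (H z) \<partial>lborel)"
      using G(2)[OF n s] f(4) by (intro mult_right_mono integral_nonneg_AE) (auto simp: field_simps)
    finally show "\<bar>surface_measure \<sigma> / measure lborel (dual_core \<sigma>) * (\<integral>z. ?i z * (H z \<bullet> ?d) \<partial>lborel)\<bar>
      \<le> G * (\<integral>z. ?i z * norm (H z) \<partial>lborel)"
      using f(2) by (simp add: abs_mult)
  qed
  also have "\<dots> = G * (\<Sum>n<N. \<Sum>\<sigma>\<in>flux_faces. (\<integral>z. indicator (dual_core \<sigma> \<times> slab t n) z * norm (H z) \<partial>lborel))"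
    by (simp add: sum_distrib_left)
  also have "\<dots> \<le> G * (\<integral>z. norm (H z) \<partial>lborel)"
    using G(1) H flux_faces_subset by (intro mult_left_mono dual.st_sum_le_integral) auto
  finally show ?thesis .
qed

text \<open>
  Face sums are pairings with a field that is constant on the dual cells. The estimate
  serves both for the numerical fluxes and for smooth fields.
\<close>

lemma grad_pairing_nearly_constant:
  assumes H: "integrable lborel H" "\<And>z. z \<notin> Q \<Longrightarrow> H z = 0"
    and G: "0 \<le> G" "\<And>n \<sigma>. n < N \<Longrightarrow> \<sigma> \<in> flux_faces \<Longrightarrow> surface_measure \<sigma> * norm (face_difference (\<phi> n) \<sigma>) \<le> G * measure lborel (dual_core \<sigma>)"
    and ae: "\<And>n \<sigma>. n < N \<Longrightarrow> \<sigma> \<in> flux_faces \<Longrightarrow>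
      AE z in lborel. z \<in> dual_core \<sigma> \<times> slab t n \<longrightarrow> z \<in> Q \<longrightarrow> norm (H z - \<Gamma> n \<sigma>) \<le> \<omega> n \<sigma>"
    and \<omega>: "\<And>n \<sigma>. 0 \<le> \<omega> n \<sigma>"
  shows "\<bar>grad_pairing \<phi> H - (\<Sum>n<N. (t (Suc n) - t n) * (\<Sum>\<sigma>\<in>flux_faces. surface_measure \<sigma> * (\<Gamma> n \<sigma> \<bullet> face_difference (\<phi> n) \<sigma>)))\<bar>
    \<le> G * (\<Sum>n<N. \<Sum>\<sigma>\<in>flux_faces. measure lborel (dual_core \<sigma> \<times> slab t n) * \<omega> n \<sigma>)"
proof -
  let ?m = "\<lambda>\<sigma>. measure lborel (dual_core \<sigma>)" and ?d = "\<lambda>n. face_difference (\<phi> n)"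
  let ?I = "\<lambda>n \<sigma>. \<integral>z. indicator (dual_core \<sigma> \<times> slab t n) z * (H z \<bullet> ?d n \<sigma>) \<partial>lborel"
  have each: "\<bar>surface_measure \<sigma> / ?m \<sigma> * ?I n \<sigma> - (t (Suc n) - t n) * (surface_measure \<sigma> * (\<Gamma> n \<sigma> \<bullet> ?d n \<sigma>))\<bar>
      \<le> G * (measure lborel (dual_core \<sigma> \<times> slab t n) * \<omega> n \<sigma>)" if n: "n < N" and s: "\<sigma> \<in> flux_faces" for n \<sigma>
  proof -
    note f = flux_face_sides[OF s]
    have sa: "\<sigma> \<in> all_faces M" using s flux_faces_subset by blast
    let ?B = "dual_core \<sigma> \<times> slab t n"
    have mB: "measure lborel ?B = ?m \<sigma> * (t (Suc n) - t n)" by (rule measure_times_slab[OF time n f(6,5)])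
    have "\<bar>?I n \<sigma> - measure lborel ?B * (\<Gamma> n \<sigma> \<bullet> ?d n \<sigma>)\<bar> \<le> measure lborel ?B * (\<omega> n \<sigma> * norm (?d n \<sigma>))"
    proof (rule integral_nearly_constant)
      show "?B \<in> sets borel" by (rule dual.st_borel[OF sa])
      show "bounded ?B" using f(5) by (intro bounded_Times) (auto simp: slab_def)
      show "integrable lborel (\<lambda>z. indicator ?B z * (H z \<bullet> ?d n \<sigma>))" by (rule dual_integrable_inner[OF H(1) s])
      show "AE z in lborel. z \<in> ?B \<longrightarrow> \<bar>H z \<bullet> ?d n \<sigma> - \<Gamma> n \<sigma> \<bullet> ?d n \<sigma>\<bar> \<le> \<omega> n \<sigma> * norm (?d n \<sigma>)"
        using ae[OF n s] dual.st_AE_domain[OF n sa]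
      proof eventually_elim
        case (elim z)
        show ?case
        proof
          assume "z \<in> ?B"
          then have "norm (H z - \<Gamma> n \<sigma>) \<le> \<omega> n \<sigma>" using elim by blast
          then have "norm (H z - \<Gamma> n \<sigma>) * norm (?d n \<sigma>) \<le> \<omega> n \<sigma> * norm (?d n \<sigma>)" by (intro mult_right_mono) auto
          then show "\<bar>H z \<bullet> ?d n \<sigma> - \<Gamma> n \<sigma> \<bullet> ?d n \<sigma>\<bar> \<le> \<omega> n \<sigma> * norm (?d n \<sigma>)"
            using Cauchy_Schwarz_ineq2[of "H z - \<Gamma> n \<sigma>" "?d n \<sigma>"] by (simp add: inner_diff_left)
        qed
      qed
    qed
    then have "surface_measure \<sigma> / ?m \<sigma> * \<bar>?I n \<sigma> - measure lborel ?B * (\<Gamma> n \<sigma> \<bullet> ?d n \<sigma>)\<bar>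
        \<le> surface_measure \<sigma> / ?m \<sigma> * (measure lborel ?B * (\<omega> n \<sigma> * norm (?d n \<sigma>)))"
      using f(2) by (intro mult_left_mono) auto
    also have "\<dots> = (surface_measure \<sigma> * norm (?d n \<sigma>)) / ?m \<sigma> * (measure lborel ?B * \<omega> n \<sigma>)"
      by simp
    also have "\<dots> \<le> G * (measure lborel ?B * \<omega> n \<sigma>)"
      using G(2)[OF n s] f(4) \<omega> by (intro mult_right_mono) (auto simp: field_simps)
    finally have le: "surface_measure \<sigma> / ?m \<sigma> * \<bar>?I n \<sigma> - measure lborel ?B * (\<Gamma> n \<sigma> \<bullet> ?d n \<sigma>)\<bar> \<le> G * (measure lborel ?B * \<omega> n \<sigma>)" .
    have e: "surface_measure \<sigma> / ?m \<sigma> * measure lborel ?B = (t (Suc n) - t n) * surface_measure \<sigma>"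
      unfolding mB using f(4) by simp
    have "surface_measure \<sigma> / ?m \<sigma> * ?I n \<sigma> - (t (Suc n) - t n) * (surface_measure \<sigma> * (\<Gamma> n \<sigma> \<bullet> ?d n \<sigma>))
       = surface_measure \<sigma> / ?m \<sigma> * (?I n \<sigma> - measure lborel ?B * (\<Gamma> n \<sigma> \<bullet> ?d n \<sigma>))"
      by (simp only: right_diff_distrib mult.assoc[symmetric] e)
    then show ?thesis using le f(2) f(4) by (simp only: abs_mult) simp
  qed
  have "grad_pairing \<phi> H - (\<Sum>n<N. (t (Suc n) - t n) * (\<Sum>\<sigma>\<in>flux_faces. surface_measure \<sigma> * (\<Gamma> n \<sigma> \<bullet> ?d n \<sigma>)))
     = (\<Sum>n<N. \<Sum>\<sigma>\<in>flux_faces. surface_measure \<sigma> / ?m \<sigma> * ?I n \<sigma> - (t (Suc n) - t n) * (surface_measure \<sigma> * (\<Gamma> n \<sigma> \<bullet> ?d n \<sigma>)))"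
    by (simp add: grad_pairing_def sum_subtractf sum_distrib_left)
  also have "\<bar>\<dots>\<bar> \<le> (\<Sum>n<N. \<Sum>\<sigma>\<in>flux_faces. G * (measure lborel (dual_core \<sigma> \<times> slab t n) * \<omega> n \<sigma>))"
    using each by (intro order_trans[OF sum_abs] sum_mono order_refl) auto
  also have "\<dots> = G * (\<Sum>n<N. \<Sum>\<sigma>\<in>flux_faces. measure lborel (dual_core \<sigma> \<times> slab t n) * \<omega> n \<sigma>)"
    by (simp add: sum_distrib_left)
  finally show ?thesis .
qed

end

section \<open>Weak consistency of the fluxes\<close>

context fine_mesh
begin

lemma integrable_on_Q:
  fixes g :: "'a \<times> real \<Rightarrow> 'c::euclidean_space"
  assumes "continuous_on UNIV g"
  shows "integrable lborel (\<lambda>z. indicator Q z *\<^sub>R g z)"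
  using set_integrable_continuous_bounded[OF Q_bounded Q_borel assms] by (simp add: set_integrable_def)

text \<open>
  On the dual cell of a face the approximate solution only takes the values of the two
  adjacent cells, since the dual cell is contained in their union.
\<close>

lemma numerical_flux_near_average:
  fixes F :: "real \<Rightarrow> 'a" and Fl :: "nat \<Rightarrow> 'a set \<Rightarrow> 'a"
  assumes F: "integrable lborel (\<lambda>z. indicator Q z *\<^sub>R F (step_function M N t u z))"
    and G: "0 \<le> G" "\<And>n \<sigma>. n < N \<Longrightarrow> \<sigma> \<in> flux_faces \<Longrightarrow> surface_measure \<sigma> * norm (face_difference (\<phi> n) \<sigma>) \<le> G * measure lborel (dual_core \<sigma>)"
    and C: "0 \<le> C" "\<And>n \<sigma>. n < N \<Longrightarrow> \<sigma> \<in> flux_faces \<Longrightarrow> norm (Fl n \<sigma> - F (u n (side1 \<sigma>))) \<le> C * jump (u n) \<sigma>"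
      "\<And>n \<sigma>. n < N \<Longrightarrow> \<sigma> \<in> flux_faces \<Longrightarrow> norm (Fl n \<sigma> - F (u n (side2 \<sigma>))) \<le> C * jump (u n) \<sigma>"
  shows "\<bar>grad_pairing \<phi> (\<lambda>z. indicator Q z *\<^sub>R F (step_function M N t u z))
      - (\<Sum>n<N. (t (Suc n) - t n) * (\<Sum>\<sigma>\<in>flux_faces. surface_measure \<sigma> * (Fl n \<sigma> \<bullet> face_difference (\<phi> n) \<sigma>)))\<bar>
    \<le> G * (C * (\<Sum>n<N. \<Sum>\<sigma>\<in>flux_faces. measure lborel (dual_core \<sigma> \<times> slab t n) * jump (u n) \<sigma>))"
proof -
  have "\<bar>grad_pairing \<phi> (\<lambda>z. indicator Q z *\<^sub>R F (step_function M N t u z))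
      - (\<Sum>n<N. (t (Suc n) - t n) * (\<Sum>\<sigma>\<in>flux_faces. surface_measure \<sigma> * (Fl n \<sigma> \<bullet> face_difference (\<phi> n) \<sigma>)))\<bar>
    \<le> G * (\<Sum>n<N. \<Sum>\<sigma>\<in>flux_faces. measure lborel (dual_core \<sigma> \<times> slab t n) * (C * jump (u n) \<sigma>))"
  proof (rule grad_pairing_nearly_constant[OF F _ G])
    fix n \<sigma> assume n: "n < N" and s: "\<sigma> \<in> flux_faces"
    note f = flux_face_sides[OF s]
    show "AE z in lborel. z \<in> dual_core \<sigma> \<times> slab t n \<longrightarrow> z \<in> Q \<longrightarrow>
        norm (indicator Q z *\<^sub>R F (step_function M N t u z) - Fl n \<sigma>) \<le> C * jump (u n) \<sigma>"
      using step_function_AE[OF n f(7), of u] step_function_AE[OF n f(9), of u]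
    proof eventually_elim
      case (elim z)
      show ?case
      proof (intro impI)
        assume z: "z \<in> dual_core \<sigma> \<times> slab t n" "z \<in> Q"
        then have "z \<in> side1 \<sigma> \<times> slab t n \<or> z \<in> side2 \<sigma> \<times> slab t n" using f(3) by blast
        then have "step_function M N t u z = u n (side1 \<sigma>) \<or> step_function M N t u z = u n (side2 \<sigma>)"
          using elim by blast
        then show "norm (indicator Q z *\<^sub>R F (step_function M N t u z) - Fl n \<sigma>) \<le> C * jump (u n) \<sigma>"
          using C(2)[OF n s] C(3)[OF n s] z(2) by (auto simp: norm_minus_commute)
      qed
    qed
  qed (use C(1) in \<open>auto simp: jump_def\<close>)
  then show ?thesis by (simp add: sum_distrib_left mult.left_commute)
qed

text \<open>
  The integral of the vector field \<open>p\<close> over the face, at the new time.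
\<close>

definition face_vector :: "('a \<times> real \<Rightarrow> 'a) \<Rightarrow> nat \<Rightarrow> 'a set \<Rightarrow> 'a" where
  "face_vector p n \<sigma> = (\<Sum>b\<in>Basis. face_integral \<sigma> (\<lambda>y. p (y, t (Suc n)) \<bullet> b) *\<^sub>R b)"

lemma inner_slice_borel:
  fixes p :: "'a \<times> real \<Rightarrow> 'a"
  assumes "continuous_on UNIV p"
  shows "(\<lambda>y. p (y, s) \<bullet> b) \<in> borel_measurable borel"
proof -
  have "continuous_on UNIV (\<lambda>y. p (y, s))"
    by (rule continuous_on_compose2[OF assms]) (auto intro!: continuous_intros)
  then show ?thesis by (intro borel_measurable_continuous_onI continuous_intros)
qed

lemma face_vector_near:
  assumes p: "continuous_on UNIV p" and osc: "osc_le cQ p h \<omega>" and K: "K \<in> cells M" "\<sigma> \<in> faces M K" and n: "n < N"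
  shows "norm (face_vector p n \<sigma> - surface_measure \<sigma> *\<^sub>R p (anchor n K)) \<le> real DIM('a) * (surface_measure \<sigma> * \<omega>)"
proof -
  let ?x = "face_vector p n \<sigma> - surface_measure \<sigma> *\<^sub>R p (anchor n K)"
  have "\<bar>?x \<bullet> b\<bar> \<le> surface_measure \<sigma> * \<omega>" if b: "b \<in> Basis" for b
  proof -
    have "face_vector p n \<sigma> \<bullet> b = face_integral \<sigma> (\<lambda>y. p (y, t (Suc n)) \<bullet> b)"
      using b by (simp add: face_vector_def inner_sum_left inner_Basis if_distrib cong: if_cong)
    moreover have "\<bar>face_integral \<sigma> (\<lambda>y. p (y, t (Suc n)) \<bullet> b) - surface_measure \<sigma> * (p (anchor n K) \<bullet> b)\<bar> \<le> surface_measure \<sigma> * \<omega>"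
    proof (rule face_integral_diff_const[OF face_borel[OF K] face_unit_normal[OF K] face_bounded[OF K] inner_slice_borel[OF p]])
      fix y assume y: "y \<in> \<sigma>"
      have "norm (p (y, t (Suc n)) - p (anchor n K)) \<le> \<omega>"
        using osc_leD[OF osc face_anchor(1)[OF K n y] anchor_in[OF K(1) n] face_anchor(2)[OF K n y]] .
      then show "\<bar>p (y, t (Suc n)) \<bullet> b - p (anchor n K) \<bullet> b\<bar> \<le> \<omega>"
        using Basis_le_norm[OF b, of "p (y, t (Suc n)) - p (anchor n K)"] by (simp add: inner_diff_left)
    qed
    ultimately show ?thesis by (simp add: inner_diff_left)
  qed
  then have "(\<Sum>b\<in>Basis. \<bar>?x \<bullet> b\<bar>) \<le> (\<Sum>b\<in>(Basis::'a set). surface_measure \<sigma> * \<omega>)"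
    by (rule sum_mono)
  then show ?thesis using norm_le_l1[of ?x] by simp
qed

lemma face_vector_zero:
  assumes p: "continuous_on UNIV p" and s: "\<sigma> \<in> all_faces M" and z: "surface_measure \<sigma> = 0"
  shows "face_vector p n \<sigma> = 0"
proof -
  obtain K where K: "K \<in> cells M" "\<sigma> \<in> faces M K" using s by (auto simp: all_faces_def)
  have "face_integral \<sigma> (\<lambda>y. p (y, t (Suc n)) \<bullet> b) = 0" for b
  proof -
    have "continuous_on UNIV (\<lambda>y. p (y, t (Suc n)) \<bullet> b)"
      by (intro continuous_on_inner continuous_on_compose2[OF p]) (auto intro!: continuous_intros)
    then obtain B where B: "\<And>y. y \<in> \<sigma> \<Longrightarrow> norm (p (y, t (Suc n)) \<bullet> b) \<le> B"
      using continuous_bounded_on_bounded[OF _ face_bounded[OF K]] by blast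
    have "\<bar>face_integral \<sigma> (\<lambda>y. p (y, t (Suc n)) \<bullet> b) - surface_measure \<sigma> * 0\<bar> \<le> surface_measure \<sigma> * B"
      by (rule face_integral_diff_const[OF face_borel[OF K] face_unit_normal[OF K] face_bounded[OF K] inner_slice_borel[OF p]])
         (use B in simp)
    then show ?thesis by (simp add: z)
  qed
  then show ?thesis by (simp add: face_vector_def)
qed

lemma face_vectors_near_average:
  assumes p: "continuous_on UNIV p" and osc: "osc_le cQ p (2 * h + k) \<omega>" and \<omega>: "0 \<le> \<omega>"
    and G: "0 \<le> G" "\<And>n \<sigma>. n < N \<Longrightarrow> \<sigma> \<in> flux_faces \<Longrightarrow> surface_measure \<sigma> * norm (face_difference (\<phi> n) \<sigma>) \<le> G * measure lborel (dual_core \<sigma>)"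
  shows "\<bar>grad_pairing \<phi> (\<lambda>z. indicator Q z *\<^sub>R p z)
      - (\<Sum>n<N. (t (Suc n) - t n) * (\<Sum>\<sigma>\<in>flux_faces. face_vector p n \<sigma> \<bullet> face_difference (\<phi> n) \<sigma>))\<bar>
    \<le> G * ((1 + real DIM('a)) * (\<omega> * measure lborel Q))"
proof -
  let ?d = "\<lambda>n. face_difference (\<phi> n)" and ?a = "\<lambda>n \<sigma>. p (anchor n (side1 \<sigma>))" and ?\<delta> = "\<lambda>n. t (Suc n) - t n"
  let ?m = "\<lambda>n \<sigma>. measure lborel (dual_core \<sigma> \<times> slab t n)"
  have tot: "(\<Sum>n<N. \<Sum>\<sigma>\<in>flux_faces. ?m n \<sigma>) \<le> measure lborel Q"
    by (rule dual.st_sum_measure_le[OF bounded_domain domain_borel flux_faces_subset])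
  have 1: "\<bar>grad_pairing \<phi> (\<lambda>z. indicator Q z *\<^sub>R p z)
      - (\<Sum>n<N. ?\<delta> n * (\<Sum>\<sigma>\<in>flux_faces. surface_measure \<sigma> * (?a n \<sigma> \<bullet> ?d n \<sigma>)))\<bar>
     \<le> G * (\<Sum>n<N. \<Sum>\<sigma>\<in>flux_faces. ?m n \<sigma> * \<omega>)"
  proof (rule grad_pairing_nearly_constant[OF integrable_on_Q[OF p] _ G])
    fix n \<sigma> assume n: "n < N" and s: "\<sigma> \<in> flux_faces"
    show "AE z in lborel. z \<in> dual_core \<sigma> \<times> slab t n \<longrightarrow> z \<in> Q \<longrightarrow> norm (indicator Q z *\<^sub>R p z - ?a n \<sigma>) \<le> \<omega>"
    proof (intro AE_I2 impI)
      fix z assume z: "z \<in> dual_core \<sigma> \<times> slab t n" "z \<in> Q"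
      have "norm (p z - ?a n \<sigma>) \<le> \<omega>"
        by (rule osc_leD[OF osc dual_anchor(1)[OF s n z(1)] anchor_in[OF flux_face_sides(7)[OF s] n] dual_anchor(2)[OF s n z(1)]])
      then show "norm (indicator Q z *\<^sub>R p z - ?a n \<sigma>) \<le> \<omega>" using z(2) by simp
    qed
  qed (use \<omega> in auto)
  have "\<bar>(\<Sum>n<N. ?\<delta> n * (\<Sum>\<sigma>\<in>flux_faces. surface_measure \<sigma> * (?a n \<sigma> \<bullet> ?d n \<sigma>)))
      - (\<Sum>n<N. ?\<delta> n * (\<Sum>\<sigma>\<in>flux_faces. face_vector p n \<sigma> \<bullet> ?d n \<sigma>))\<bar>
     = \<bar>\<Sum>n<N. \<Sum>\<sigma>\<in>flux_faces. ?\<delta> n * ((surface_measure \<sigma> *\<^sub>R ?a n \<sigma> - face_vector p n \<sigma>) \<bullet> ?d n \<sigma>)\<bar>"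
    by (simp add: sum_distrib_left sum_subtractf inner_diff_left right_diff_distrib)
  also have "\<dots> \<le> (\<Sum>n<N. \<Sum>\<sigma>\<in>flux_faces. \<bar>?\<delta> n * ((surface_measure \<sigma> *\<^sub>R ?a n \<sigma> - face_vector p n \<sigma>) \<bullet> ?d n \<sigma>)\<bar>)"
    by (intro order_trans[OF sum_abs] sum_mono order_refl)
  also have "\<dots> \<le> (\<Sum>n<N. \<Sum>\<sigma>\<in>flux_faces. real DIM('a) * \<omega> * G * ?m n \<sigma>)"
  proof (intro sum_mono)
    fix n \<sigma> assume "n \<in> {..<N}" and s: "\<sigma> \<in> flux_faces"
    then have n: "n < N" by simp
    note f = flux_face_sides[OF s]
    have \<delta>: "0 \<le> ?\<delta> n" using time_step_pos[OF time n] by simp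
    have osc': "osc_le cQ p h \<omega>" by (rule osc_le_mono[OF osc]) (use h0 k0 in simp)
    have "\<bar>(surface_measure \<sigma> *\<^sub>R ?a n \<sigma> - face_vector p n \<sigma>) \<bullet> ?d n \<sigma>\<bar>
       \<le> norm (surface_measure \<sigma> *\<^sub>R ?a n \<sigma> - face_vector p n \<sigma>) * norm (?d n \<sigma>)"
      by (rule Cauchy_Schwarz_ineq2)
    also have "\<dots> \<le> (real DIM('a) * (surface_measure \<sigma> * \<omega>)) * norm (?d n \<sigma>)"
      using face_vector_near[OF p osc' f(7,8) n] by (intro mult_right_mono) (auto simp: norm_minus_commute)
    also have "\<dots> = real DIM('a) * \<omega> * (surface_measure \<sigma> * norm (?d n \<sigma>))" by simp
    also have "\<dots> \<le> real DIM('a) * \<omega> * (G * measure lborel (dual_core \<sigma>))"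
      using G(2)[OF n s] \<omega> by (intro mult_left_mono) auto
    finally have "?\<delta> n * \<bar>(surface_measure \<sigma> *\<^sub>R ?a n \<sigma> - face_vector p n \<sigma>) \<bullet> ?d n \<sigma>\<bar>
       \<le> ?\<delta> n * (real DIM('a) * \<omega> * (G * measure lborel (dual_core \<sigma>)))"
      using \<delta> by (intro mult_left_mono)
    also have "\<dots> = real DIM('a) * \<omega> * G * ?m n \<sigma>"
      by (simp add: measure_times_slab[OF time n f(6,5)])
    finally show "\<bar>?\<delta> n * ((surface_measure \<sigma> *\<^sub>R ?a n \<sigma> - face_vector p n \<sigma>) \<bullet> ?d n \<sigma>)\<bar> \<le> real DIM('a) * \<omega> * G * ?m n \<sigma>"
      using \<delta> by (simp add: abs_mult)
  qed
  also have "\<dots> = real DIM('a) * \<omega> * G * (\<Sum>n<N. \<Sum>\<sigma>\<in>flux_faces. ?m n \<sigma>)"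
    by (simp add: sum_distrib_left)
  also have "\<dots> \<le> real DIM('a) * \<omega> * G * measure lborel Q"
    using tot \<omega> G(1) by (intro mult_left_mono) auto
  finally have 2: "\<bar>(\<Sum>n<N. ?\<delta> n * (\<Sum>\<sigma>\<in>flux_faces. surface_measure \<sigma> * (?a n \<sigma> \<bullet> ?d n \<sigma>)))
      - (\<Sum>n<N. ?\<delta> n * (\<Sum>\<sigma>\<in>flux_faces. face_vector p n \<sigma> \<bullet> ?d n \<sigma>))\<bar> \<le> real DIM('a) * \<omega> * G * measure lborel Q" .
  have "G * (\<Sum>n<N. \<Sum>\<sigma>\<in>flux_faces. ?m n \<sigma> * \<omega>) = G * (\<omega> * (\<Sum>n<N. \<Sum>\<sigma>\<in>flux_faces. ?m n \<sigma>))"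
    by (simp add: sum_distrib_left mult.commute)
  also have "\<dots> \<le> G * (\<omega> * measure lborel Q)"
    using tot \<omega> G(1) by (intro mult_left_mono) auto
  finally have 3: "G * (\<Sum>n<N. \<Sum>\<sigma>\<in>flux_faces. ?m n \<sigma> * \<omega>) \<le> G * (\<omega> * measure lborel Q)" .
  have "G * ((1 + real DIM('a)) * (\<omega> * measure lborel Q)) = G * (\<omega> * measure lborel Q) + real DIM('a) * \<omega> * G * measure lborel Q"
    by (simp add: algebra_simps)
  then show ?thesis using 1 2 3 by linarith
qed

text \<open>
  The divergence theorem, applied to each component of the field.
\<close>

lemma face_vectors_divergence:
  fixes p :: "'a \<times> real \<Rightarrow> 'a" and p' :: "'a \<Rightarrow> 'a \<times> real \<Rightarrow> 'a \<times> real \<Rightarrow> real"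
  assumes p': "\<And>b z. b \<in> Basis \<Longrightarrow> ((\<lambda>z. p z \<bullet> b) has_derivative p' b z) (at z)"
    and c': "\<And>b v. b \<in> Basis \<Longrightarrow> continuous_on UNIV (\<lambda>z. p' b z v)" and K: "K \<in> cells M"
  shows "(\<Sum>\<sigma>\<in>faces M K. face_vector p n \<sigma> \<bullet> normal K \<sigma>) = (\<integral>x. indicator K x * (\<Sum>b\<in>Basis. p' b (x, t (Suc n)) (b, 0)) \<partial>lborel)"
proof -
  let ?s = "t (Suc n)"
  have cs: "continuous_on UNIV (\<lambda>x. p' b (x, ?s) v)" if "b \<in> Basis" for b v
    by (rule continuous_on_compose2[OF c'[OF that]]) (auto intro!: continuous_intros)
  have int: "integrable lborel (\<lambda>x. indicator K x * p' b (x, ?s) (b, 0))" if "b \<in> Basis" for b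
    using set_integrable_continuous_bounded[OF cell_bounded[OF K] cell_borel[OF K] cs[OF that]] by (simp add: set_integrable_def)
  have "(\<Sum>\<sigma>\<in>faces M K. face_vector p n \<sigma> \<bullet> normal K \<sigma>)
     = (\<Sum>b\<in>Basis. \<Sum>\<sigma>\<in>faces M K. (normal K \<sigma> \<bullet> b) * face_integral \<sigma> (\<lambda>y. p (y, ?s) \<bullet> b))"
    unfolding face_vector_def inner_sum_left
    by (subst sum.swap) (simp add: inner_commute mult.commute)
  also have "\<dots> = (\<Sum>b\<in>Basis. \<integral>x. indicator K x * p' b (x, ?s) (b, 0) \<partial>lborel)"
  proof (rule sum.cong)
    fix b :: 'a assume b: "b \<in> Basis"
    have l: "((\<lambda>y. (y, ?s)) has_derivative (\<lambda>v. (v, 0))) (at y)" for y :: 'a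
      by (auto intro!: derivative_eq_intros)
    have d: "((\<lambda>y. p (y, ?s) \<bullet> b) has_derivative (\<lambda>v. p' b (y, ?s) (v, 0))) (at y)" for y
      using has_derivative_compose[OF l p'[OF b]] .
    show "(\<Sum>\<sigma>\<in>faces M K. (normal K \<sigma> \<bullet> b) * face_integral \<sigma> (\<lambda>y. p (y, ?s) \<bullet> b))
        = (\<integral>x. indicator K x * p' b (x, ?s) (b, 0) \<partial>lborel)"
      by (rule cell_divergence[OF cell_facts(2)[OF K] cell_bounded[OF K] d cs[OF b], symmetric])
  qed simp
  also have "\<dots> = (\<integral>x. (\<Sum>b\<in>Basis. indicator K x * p' b (x, ?s) (b, 0)) \<partial>lborel)"
    by (rule Bochner_Integration.integral_sum[OF int, symmetric])
  finally show ?thesis by (simp add: sum_distrib_left)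
qed

lemma divergence_sum_near_integral:
  fixes f dv :: "'a \<times> real \<Rightarrow> real"
  assumes f: "f \<in> borel_measurable borel" and Bf: "\<And>z. \<bar>f z\<bar> \<le> Bf" and dv: "continuous_on UNIV dv"
    and osc1: "osc_le cQ (\<lambda>z. f z * dv z) (h + k) \<omega>1" and osc2: "osc_le cQ dv (h + k) \<omega>2" and \<omega>: "0 \<le> \<omega>1" "0 \<le> \<omega>2"
  shows "\<bar>(\<integral>z. indicator Q z * (f z * dv z) \<partial>lborel)
      - (\<Sum>n<N. (t (Suc n) - t n) * (\<Sum>K\<in>cells M. f (anchor n K) * (\<integral>x. indicator K x * dv (x, t (Suc n)) \<partial>lborel)))\<bar>
    \<le> (\<omega>1 + Bf * \<omega>2) * measure lborel Q"
proof -
  have Bf0: "0 \<le> Bf" using Bf[of undefined] by linarith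
  let ?m = "\<lambda>n K. measure lborel (K \<times> slab t n)" and ?\<delta> = "\<lambda>n. t (Suc n) - t n"
  have tot: "(\<Sum>n<N. \<Sum>K\<in>cells M. ?m n K) \<le> measure lborel Q"
    by (rule cell.st_sum_measure_le[OF bounded_domain domain_borel order_refl])
  have [measurable]: "dv \<in> borel_measurable borel" using dv by (rule borel_measurable_continuous_onI)
  obtain D where D: "\<And>z. z \<in> Q \<Longrightarrow> norm (dv z) \<le> D"
    using continuous_bounded_on_bounded[OF dv Q_bounded] by blast
  have int: "integrable lborel (\<lambda>z. indicator Q z * (f z * dv z))"
  proof (rule integrable_bounded_borel[OF _ Q_borel Q_bounded, of _ "Bf * D"])
    show "norm (indicator Q z * (f z * dv z)) \<le> Bf * D" if "z \<in> Q" for z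
      using that Bf[of z] D[OF that] Bf0 by (auto simp: abs_mult intro!: mult_mono)
  qed (use f in auto)
  have 1: "\<bar>(\<integral>z. indicator Q z * (f z * dv z) \<partial>lborel) - (\<Sum>n<N. \<Sum>K\<in>cells M. ?m n K * (f (anchor n K) * dv (anchor n K)))\<bar>
     \<le> (\<Sum>n<N. \<Sum>K\<in>cells M. ?m n K * \<omega>1)"
  proof (rule cell_sum_nearly_constant[OF int])
    fix n K assume n: "n < N" and K: "K \<in> cells M"
    show "AE z in lborel. z \<in> K \<times> slab t n \<longrightarrow> z \<in> Q \<longrightarrow> \<bar>indicator Q z * (f z * dv z) - f (anchor n K) * dv (anchor n K)\<bar> \<le> \<omega>1"
    proof (intro AE_I2 impI)
      fix z assume z: "z \<in> K \<times> slab t n" "z \<in> Q"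
      show "\<bar>indicator Q z * (f z * dv z) - f (anchor n K) * dv (anchor n K)\<bar> \<le> \<omega>1"
        using osc_leD[OF osc1 cell_anchor(1)[OF K n z(1)] anchor_in[OF K n] cell_anchor(2)[OF K n z(1)]] z(2) by simp
    qed
  qed simp
  have "\<bar>(\<Sum>n<N. \<Sum>K\<in>cells M. ?m n K * (f (anchor n K) * dv (anchor n K)))
      - (\<Sum>n<N. ?\<delta> n * (\<Sum>K\<in>cells M. f (anchor n K) * (\<integral>x. indicator K x * dv (x, t (Suc n)) \<partial>lborel)))\<bar>
    = \<bar>\<Sum>n<N. \<Sum>K\<in>cells M. ?\<delta> n * f (anchor n K) * (measure lborel K * dv (anchor n K) - (\<integral>x. indicator K x * dv (x, t (Suc n)) \<partial>lborel))\<bar>"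
  proof -
    have "(\<Sum>n<N. \<Sum>K\<in>cells M. ?m n K * (f (anchor n K) * dv (anchor n K)))
      - (\<Sum>n<N. ?\<delta> n * (\<Sum>K\<in>cells M. f (anchor n K) * (\<integral>x. indicator K x * dv (x, t (Suc n)) \<partial>lborel)))
      = (\<Sum>n<N. \<Sum>K\<in>cells M. ?m n K * (f (anchor n K) * dv (anchor n K)) - ?\<delta> n * (f (anchor n K) * (\<integral>x. indicator K x * dv (x, t (Suc n)) \<partial>lborel)))"
      by (simp only: sum_subtractf sum_distrib_left)
    also have "\<dots> = (\<Sum>n<N. \<Sum>K\<in>cells M. ?\<delta> n * f (anchor n K) * (measure lborel K * dv (anchor n K) - (\<integral>x. indicator K x * dv (x, t (Suc n)) \<partial>lborel)))"
      by (intro sum.cong refl) (simp add: measure_times_slab[OF time _ cell_borel cell_bounded] algebra_simps)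
    finally show ?thesis by simp
  qed
  also have "\<dots> \<le> (\<Sum>n<N. \<Sum>K\<in>cells M. \<bar>?\<delta> n * f (anchor n K) * (measure lborel K * dv (anchor n K) - (\<integral>x. indicator K x * dv (x, t (Suc n)) \<partial>lborel))\<bar>)"
    by (intro order_trans[OF sum_abs] sum_mono order_refl)
  also have "\<dots> \<le> (\<Sum>n<N. \<Sum>K\<in>cells M. ?m n K * (Bf * \<omega>2))"
  proof (intro sum_mono)
    fix n K assume "n \<in> {..<N}" and K: "K \<in> cells M"
    then have n: "n < N" by simp
    have \<delta>: "0 \<le> ?\<delta> n" using time_step_pos[OF time n] by simp
    have cs: "continuous_on UNIV (\<lambda>x. dv (x, t (Suc n)))"
      by (rule continuous_on_compose2[OF dv]) (auto intro!: continuous_intros)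
    have "\<bar>(\<integral>x. indicator K x * dv (x, t (Suc n)) \<partial>lborel) - measure lborel K * dv (anchor n K)\<bar> \<le> measure lborel K * \<omega>2"
    proof (rule integral_nearly_constant[OF cell_borel[OF K] cell_bounded[OF K]])
      show "integrable lborel (\<lambda>x. indicator K x * dv (x, t (Suc n)))"
        using set_integrable_continuous_bounded[OF cell_bounded[OF K] cell_borel[OF K] cs] by (simp add: set_integrable_def)
      show "AE x in lborel. x \<in> K \<longrightarrow> \<bar>dv (x, t (Suc n)) - dv (anchor n K)\<bar> \<le> \<omega>2"
      proof (intro AE_I2 impI)
        fix x assume x: "x \<in> K"
        have z: "(x, t (Suc n)) \<in> K \<times> slab t n" using x time_step_pos[OF time n] by (simp add: slab_def)
        show "\<bar>dv (x, t (Suc n)) - dv (anchor n K)\<bar> \<le> \<omega>2"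
          using osc_leD[OF osc2 cell_anchor(1)[OF K n z] anchor_in[OF K n] cell_anchor(2)[OF K n z]] by simp
      qed
    qed
    then have "\<bar>f (anchor n K)\<bar> * \<bar>measure lborel K * dv (anchor n K) - (\<integral>x. indicator K x * dv (x, t (Suc n)) \<partial>lborel)\<bar> \<le> Bf * (measure lborel K * \<omega>2)"
      using Bf Bf0 by (intro mult_mono) (auto simp: abs_minus_commute)
    then have "?\<delta> n * (\<bar>f (anchor n K)\<bar> * \<bar>measure lborel K * dv (anchor n K) - (\<integral>x. indicator K x * dv (x, t (Suc n)) \<partial>lborel)\<bar>) \<le> ?\<delta> n * (Bf * (measure lborel K * \<omega>2))"
      using \<delta> by (rule mult_left_mono)
    also have "\<dots> = ?m n K * (Bf * \<omega>2)"
      by (simp add: measure_times_slab[OF time n cell_borel[OF K] cell_bounded[OF K]])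
    finally show "\<bar>?\<delta> n * f (anchor n K) * (measure lborel K * dv (anchor n K) - (\<integral>x. indicator K x * dv (x, t (Suc n)) \<partial>lborel))\<bar> \<le> ?m n K * (Bf * \<omega>2)"
      using \<delta> by (simp add: abs_mult mult.assoc)
  qed
  finally have 2: "\<bar>(\<Sum>n<N. \<Sum>K\<in>cells M. ?m n K * (f (anchor n K) * dv (anchor n K)))
      - (\<Sum>n<N. ?\<delta> n * (\<Sum>K\<in>cells M. f (anchor n K) * (\<integral>x. indicator K x * dv (x, t (Suc n)) \<partial>lborel)))\<bar>
    \<le> (\<Sum>n<N. \<Sum>K\<in>cells M. ?m n K * (Bf * \<omega>2))" .
  have 3: "(\<Sum>n<N. \<Sum>K\<in>cells M. ?m n K * c) \<le> c * measure lborel Q" if "0 \<le> c" for c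
  proof -
    have "(\<Sum>n<N. \<Sum>K\<in>cells M. ?m n K * c) = c * (\<Sum>n<N. \<Sum>K\<in>cells M. ?m n K)"
      by (simp add: sum_distrib_left mult.commute)
    also have "\<dots> \<le> c * measure lborel Q" using tot that by (rule mult_left_mono)
    finally show ?thesis .
  qed
  have "(\<omega>1 + Bf * \<omega>2) * measure lborel Q = \<omega>1 * measure lborel Q + (Bf * \<omega>2) * measure lborel Q"
    by (simp add: distrib_right)
  moreover have "0 \<le> Bf * \<omega>2" using Bf0 \<omega> by simp
  ultimately show ?thesis using 1 2 3[OF \<omega>(1)] 3[of "Bf * \<omega>2"] by linarith
qed

end

section \<open>The terms of the summed scheme\<close>

context fine_mesh
begin

text \<open>
  Four comparisons: numerical fluxes with the flux of the approximate solution, this flux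
  with the smooth field \<open>p\<close>, dual means of \<open>p\<close> with face means,
  and the resulting sum of cell divergences with the integral.
\<close>

lemma flux_term_near:
  fixes F :: "real \<Rightarrow> 'a" and Fl :: "nat \<Rightarrow> 'a set \<Rightarrow> 'a" and f :: "'a \<times> real \<Rightarrow> real"
    and p :: "'a \<times> real \<Rightarrow> 'a" and p' :: "'a \<Rightarrow> 'a \<times> real \<Rightarrow> 'a \<times> real \<Rightarrow> real"
  defines "dv \<equiv> \<lambda>z. \<Sum>b\<in>Basis. p' b z (b, 0)" and "\<phi> \<equiv> \<lambda>n K. f (anchor n K)"
  assumes F: "integrable lborel (\<lambda>z. indicator Q z *\<^sub>R F (step_function M N t u z))"
    and G: "0 \<le> G" "\<And>n \<sigma>. n < N \<Longrightarrow> \<sigma> \<in> flux_faces \<Longrightarrow> surface_measure \<sigma> * norm (face_difference (\<phi> n) \<sigma>) \<le> G * measure lborel (dual_core \<sigma>)"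
    and C: "0 \<le> C" "\<And>n \<sigma>. n < N \<Longrightarrow> \<sigma> \<in> flux_faces \<Longrightarrow> norm (Fl n \<sigma> - F (u n (side1 \<sigma>))) \<le> C * jump (u n) \<sigma>"
      "\<And>n \<sigma>. n < N \<Longrightarrow> \<sigma> \<in> flux_faces \<Longrightarrow> norm (Fl n \<sigma> - F (u n (side2 \<sigma>))) \<le> C * jump (u n) \<sigma>"
    and ext: "\<And>n K \<sigma>. n < N \<Longrightarrow> K \<in> cells M \<Longrightarrow> \<sigma> \<in> faces M K \<Longrightarrow> \<sigma> \<in> exterior_faces M \<Longrightarrow> 0 < surface_measure \<sigma> \<Longrightarrow> \<phi> n K = 0"
    and p: "continuous_on UNIV p" "osc_le cQ p (2 * h + k) \<omega>" "0 \<le> \<omega>"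
    and p': "\<And>b z. b \<in> Basis \<Longrightarrow> ((\<lambda>z. p z \<bullet> b) has_derivative p' b z) (at z)"
      "\<And>b v. b \<in> Basis \<Longrightarrow> continuous_on UNIV (\<lambda>z. p' b z v)"
    and f: "f \<in> borel_measurable borel" "\<And>z. \<bar>f z\<bar> \<le> Bf"
    and osc: "osc_le cQ (\<lambda>z. f z * dv z) (h + k) \<omega>1" "osc_le cQ dv (h + k) \<omega>2" "0 \<le> \<omega>1" "0 \<le> \<omega>2"
  shows "\<bar>(\<Sum>n<N. (t (Suc n) - t n) * (\<Sum>K\<in>cells M. \<phi> n K * (\<Sum>\<sigma>\<in>faces M K. surface_measure \<sigma> * (Fl n \<sigma> \<bullet> normal K \<sigma>))))
      - (\<integral>z. indicator Q z * (f z * dv z) \<partial>lborel)\<bar>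
    \<le> G * (C * (\<Sum>n<N. \<Sum>\<sigma>\<in>flux_faces. measure lborel (dual_core \<sigma> \<times> slab t n) * jump (u n) \<sigma>))
      + G * (\<integral>z. norm (indicator Q z *\<^sub>R (F (step_function M N t u z) - p z)) \<partial>lborel)
      + G * ((1 + real DIM('a)) * (\<omega> * measure lborel Q)) + (\<omega>1 + Bf * \<omega>2) * measure lborel Q"
proof -
  let ?\<delta> = "\<lambda>n. t (Suc n) - t n" and ?U = "\<lambda>z. indicator Q z *\<^sub>R F (step_function M N t u z)" and ?P = "\<lambda>z. indicator Q z *\<^sub>R p z"
  let ?X = "\<Sum>n<N. ?\<delta> n * (\<Sum>K\<in>cells M. \<phi> n K * (\<Sum>\<sigma>\<in>faces M K. surface_measure \<sigma> * (Fl n \<sigma> \<bullet> normal K \<sigma>)))"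
  have X: "?X = (\<Sum>n<N. ?\<delta> n * (\<Sum>\<sigma>\<in>flux_faces. surface_measure \<sigma> * (Fl n \<sigma> \<bullet> face_difference (\<phi> n) \<sigma>)))"
  proof (rule sum.cong[OF refl], rule arg_cong2[where f="(*)", OF refl])
    fix n assume "n \<in> {..<N}"
    then show "(\<Sum>K\<in>cells M. \<phi> n K * (\<Sum>\<sigma>\<in>faces M K. surface_measure \<sigma> * (Fl n \<sigma> \<bullet> normal K \<sigma>)))
        = (\<Sum>\<sigma>\<in>flux_faces. surface_measure \<sigma> * (Fl n \<sigma> \<bullet> face_difference (\<phi> n) \<sigma>))"
      using sum_over_flux_faces[of "\<lambda>\<sigma>. surface_measure \<sigma> *\<^sub>R Fl n \<sigma>" "\<phi> n"] ext[of n] by simp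
  qed
  have A: "(\<Sum>n<N. ?\<delta> n * (\<Sum>K\<in>cells M. f (anchor n K) * (\<integral>x. indicator K x * dv (x, t (Suc n)) \<partial>lborel)))
      = (\<Sum>n<N. ?\<delta> n * (\<Sum>\<sigma>\<in>flux_faces. face_vector p n \<sigma> \<bullet> face_difference (\<phi> n) \<sigma>))"
  proof (rule sum.cong[OF refl], rule arg_cong2[where f="(*)", OF refl])
    fix n assume "n \<in> {..<N}"
    then have n: "n < N" by simp
    have "(\<Sum>K\<in>cells M. f (anchor n K) * (\<integral>x. indicator K x * dv (x, t (Suc n)) \<partial>lborel))
        = (\<Sum>K\<in>cells M. \<phi> n K * (\<Sum>\<sigma>\<in>faces M K. face_vector p n \<sigma> \<bullet> normal K \<sigma>))"
      unfolding dv_def \<phi>_def by (intro sum.cong refl) (simp only: face_vectors_divergence[OF p'])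
    also have "\<dots> = (\<Sum>\<sigma>\<in>flux_faces. face_vector p n \<sigma> \<bullet> face_difference (\<phi> n) \<sigma>)"
      using face_vector_zero[OF p(1)] ext[OF n] by (intro sum_over_flux_faces) auto
    finally show "(\<Sum>K\<in>cells M. f (anchor n K) * (\<integral>x. indicator K x * dv (x, t (Suc n)) \<partial>lborel))
        = (\<Sum>\<sigma>\<in>flux_faces. face_vector p n \<sigma> \<bullet> face_difference (\<phi> n) \<sigma>)" .
  qed
  have dv: "continuous_on UNIV dv" unfolding dv_def by (intro continuous_on_sum p'(2)) 
  note P = integrable_on_Q[OF p(1)]
  have 1: "\<bar>grad_pairing \<phi> ?U - ?X\<bar> \<le> G * (C * (\<Sum>n<N. \<Sum>\<sigma>\<in>flux_faces. measure lborel (dual_core \<sigma> \<times> slab t n) * jump (u n) \<sigma>))"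
    unfolding X by (rule numerical_flux_near_average[OF F G C])
  have "\<bar>grad_pairing \<phi> (\<lambda>z. ?U z - ?P z)\<bar> \<le> G * (\<integral>z. norm (?U z - ?P z) \<partial>lborel)"
    by (rule grad_pairing_le[OF Bochner_Integration.integrable_diff[OF F P] _ G]) auto
  then have 2: "\<bar>grad_pairing \<phi> ?U - grad_pairing \<phi> ?P\<bar> \<le> G * (\<integral>z. norm (indicator Q z *\<^sub>R (F (step_function M N t u z) - p z)) \<partial>lborel)"
    by (simp only: grad_pairing_diff[OF F P] scaleR_diff_right)
  have 3: "\<bar>grad_pairing \<phi> ?P - (\<Sum>n<N. ?\<delta> n * (\<Sum>\<sigma>\<in>flux_faces. face_vector p n \<sigma> \<bullet> face_difference (\<phi> n) \<sigma>))\<bar>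
      \<le> G * ((1 + real DIM('a)) * (\<omega> * measure lborel Q))"
    by (rule face_vectors_near_average[OF p G])
  have 4: "\<bar>(\<integral>z. indicator Q z * (f z * dv z) \<partial>lborel) - (\<Sum>n<N. ?\<delta> n * (\<Sum>\<sigma>\<in>flux_faces. face_vector p n \<sigma> \<bullet> face_difference (\<phi> n) \<sigma>))\<bar>
      \<le> (\<omega>1 + Bf * \<omega>2) * measure lborel Q"
    unfolding A[symmetric] by (rule divergence_sum_near_integral[OF f dv osc])
  show ?thesis using 1 2 3 4 by linarith
qed

text \<open>
  By the mean value theorem the difference quotient of the test function over a slab is a
  value of its time derivative at a point close to the cell.
\<close>

lemma time_term_near:
  fixes f e :: "'a \<times> real \<Rightarrow> real"
  assumes u: "integrable lborel (\<lambda>z. indicator Q z * step_function M N t u z)"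
    and e: "e \<in> borel_measurable borel" "\<And>z. \<bar>e z\<bar> \<le> Be" "osc_le cQ e (h + k) \<omega>" "0 \<le> \<omega>"
    and f: "\<And>x s. x \<in> closure \<Omega> \<Longrightarrow> 0 < s \<Longrightarrow> s < T \<Longrightarrow> ((\<lambda>s. f (x, s)) has_real_derivative e (x, s)) (at s)"
      "\<And>x. x \<in> closure \<Omega> \<Longrightarrow> continuous_on {0..T} (\<lambda>s. f (x, s))"
  shows "\<bar>(\<integral>z. indicator Q z * (step_function M N t u z * e z) \<partial>lborel)
      - (\<Sum>n<N. \<Sum>K\<in>cells M. measure lborel K * (u n K * (f (point M K, t (Suc n)) - f (point M K, t n))))\<bar>
    \<le> \<omega> * (\<integral>z. indicator Q z * \<bar>step_function M N t u z\<bar> \<partial>lborel)"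
proof -
  let ?u = "step_function M N t u" and ?m = "\<lambda>n K. measure lborel (K \<times> slab t n)"
  let ?q = "\<lambda>n K. (f (point M K, t (Suc n)) - f (point M K, t n)) / (t (Suc n) - t n)"
  have absu: "integrable lborel (\<lambda>z. indicator Q z * \<bar>?u z\<bar>)"
  proof -
    have "integrable lborel (\<lambda>z. \<bar>indicator Q z * ?u z\<bar>)" by (rule integrable_abs[OF u])
    then show ?thesis by (simp add: abs_mult)
  qed
  have int: "integrable lborel (\<lambda>z. indicator Q z * (?u z * e z))"
  proof (rule Bochner_Integration.integrable_bound[of _ "\<lambda>z. Be * (indicator Q z * \<bar>?u z\<bar>)"])
    show "integrable lborel (\<lambda>z. Be * (indicator Q z * \<bar>?u z\<bar>))" using absu by (rule integrable_mult_right)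
    show "(\<lambda>z. indicator Q z * (?u z * e z)) \<in> borel_measurable lborel" using e(1) by simp
    show "AE z in lborel. norm (indicator Q z * (?u z * e z)) \<le> norm (Be * (indicator Q z * \<bar>?u z\<bar>))"
    proof (rule AE_I2)
      fix z
      have "0 \<le> Be" using e(2)[of z] by linarith
      then show "norm (indicator Q z * (?u z * e z)) \<le> norm (Be * (indicator Q z * \<bar>?u z\<bar>))"
        using e(2)[of z] by (auto simp: abs_mult indicator_def mult.commute[of Be] intro!: mult_left_mono)
    qed
  qed
  have "\<bar>(\<integral>z. indicator Q z * (?u z * e z) \<partial>lborel) - (\<Sum>n<N. \<Sum>K\<in>cells M. ?m n K * (u n K * ?q n K))\<bar>
      \<le> (\<Sum>n<N. \<Sum>K\<in>cells M. ?m n K * (\<bar>u n K\<bar> * \<omega>))"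
  proof (rule cell_sum_nearly_constant[OF int])
    fix n K assume n: "n < N" and K: "K \<in> cells M"
    have tt: "t n < t (Suc n)" "0 \<le> t n" "t (Suc n) \<le> T"
      using time_step_pos[OF time n] time_bounds[OF time, of n] time_bounds[OF time, of "Suc n"] n by auto
    have pK: "point M K \<in> closure \<Omega>" using cell_facts[OF K] by blast
    obtain \<xi> where \<xi>: "t n < \<xi>" "\<xi> < t (Suc n)" "f (point M K, t (Suc n)) - f (point M K, t n) = (t (Suc n) - t n) * e (point M K, \<xi>)"
    proof -
      have "\<exists>l z. t n < z \<and> z < t (Suc n) \<and> ((\<lambda>s. f (point M K, s)) has_real_derivative l) (at z)
          \<and> f (point M K, t (Suc n)) - f (point M K, t n) = (t (Suc n) - t n) * l"
      proof (rule MVT[OF tt(1)])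
        show "continuous_on {t n..t (Suc n)} (\<lambda>s. f (point M K, s))"
          by (rule continuous_on_subset[OF f(2)[OF pK]]) (use tt in auto)
        show "(\<lambda>s. f (point M K, s)) differentiable (at x)" if "t n < x" "x < t (Suc n)" for x
          using f(1)[OF pK, of x] that tt real_differentiable_def by force
      qed
      then obtain l z where lz: "t n < z" "z < t (Suc n)" "((\<lambda>s. f (point M K, s)) has_real_derivative l) (at z)"
          "f (point M K, t (Suc n)) - f (point M K, t n) = (t (Suc n) - t n) * l" by blast
      moreover have "l = e (point M K, z)"
        by (rule DERIV_unique[OF lz(3) f(1)[OF pK]]) (use lz tt in auto)
      ultimately show thesis using that by blast
    qed
    have q: "?q n K = e (point M K, \<xi>)" using \<xi>(3) tt by simp
    have \<xi>Q: "(point M K, \<xi>) \<in> cQ" using pK \<xi> tt by auto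
    show "AE z in lborel. z \<in> K \<times> slab t n \<longrightarrow> z \<in> Q \<longrightarrow> \<bar>indicator Q z * (?u z * e z) - u n K * ?q n K\<bar> \<le> \<bar>u n K\<bar> * \<omega>"
      using step_function_AE[OF n K, of u]
    proof eventually_elim
      case (elim z)
      show ?case
      proof (intro impI)
        assume z: "z \<in> K \<times> slab t n" "z \<in> Q"
        obtain x s where xs: "z = (x, s)" "x \<in> K" "s \<in> slab t n" using z by auto
        have "dist x (point M K) \<le> h"
          using cell_dist[OF K] xs(2) cell_facts(3)[OF K] closure_subset by blast
        moreover have "dist s \<xi> \<le> k" using xs(3) \<xi> dt[OF n] by (auto simp: slab_def dist_real_def)
        ultimately have "dist z (point M K, \<xi>) \<le> h + k"
          using dist_Pair_le[of x s "point M K" \<xi>] by (simp add: xs(1))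
        then have "\<bar>e z - e (point M K, \<xi>)\<bar> \<le> \<omega>"
          using osc_leD[OF e(3) cell_anchor(1)[OF K n z(1)] \<xi>Q] by simp
        then have "\<bar>u n K\<bar> * \<bar>e z - e (point M K, \<xi>)\<bar> \<le> \<bar>u n K\<bar> * \<omega>" by (rule mult_left_mono) simp
        moreover have "indicator Q z * (?u z * e z) - u n K * ?q n K = u n K * (e z - e (point M K, \<xi>))"
          using elim z unfolding q by (simp add: right_diff_distrib)
        ultimately show "\<bar>indicator Q z * (?u z * e z) - u n K * ?q n K\<bar> \<le> \<bar>u n K\<bar> * \<omega>"
          by (simp add: abs_mult)
      qed
    qed
  qed simp
  also have "(\<Sum>n<N. \<Sum>K\<in>cells M. ?m n K * (u n K * ?q n K))
     = (\<Sum>n<N. \<Sum>K\<in>cells M. measure lborel K * (u n K * (f (point M K, t (Suc n)) - f (point M K, t n))))"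
  proof (intro sum.cong refl)
    fix n K assume "n \<in> {..<N}" and K: "K \<in> cells M"
    then have n: "n < N" by simp
    have "t (Suc n) - t n \<noteq> 0" using time_step_pos[OF time n] by simp
    then show "?m n K * (u n K * ?q n K) = measure lborel K * (u n K * (f (point M K, t (Suc n)) - f (point M K, t n)))"
      by (simp add: measure_times_slab[OF time n cell_borel[OF K] cell_bounded[OF K]])
  qed
  also have "(\<Sum>n<N. \<Sum>K\<in>cells M. ?m n K * (\<bar>u n K\<bar> * \<omega>)) = \<omega> * (\<Sum>n<N. \<Sum>K\<in>cells M. ?m n K * \<bar>u n K\<bar>)"
    by (simp add: sum_distrib_left mult_ac)
  also have "(\<Sum>n<N. \<Sum>K\<in>cells M. ?m n K * \<bar>u n K\<bar>) = (\<integral>z. indicator Q z * \<bar>?u z\<bar> \<partial>lborel)"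
  proof -
    have "\<bar>(\<integral>z. indicator Q z * \<bar>?u z\<bar> \<partial>lborel) - (\<Sum>n<N. \<Sum>K\<in>cells M. ?m n K * \<bar>u n K\<bar>)\<bar> \<le> (\<Sum>n<N. \<Sum>K\<in>cells M. ?m n K * 0)"
    proof (rule cell_sum_nearly_constant[OF absu])
      fix n K assume n: "n < N" and K: "K \<in> cells M"
      show "AE z in lborel. z \<in> K \<times> slab t n \<longrightarrow> z \<in> Q \<longrightarrow> \<bar>indicator Q z * \<bar>?u z\<bar> - \<bar>u n K\<bar>\<bar> \<le> 0"
        using step_function_AE[OF n K, of u] by eventually_elim simp
    qed simp
    then show ?thesis by simp
  qed
  finally show ?thesis .
qed

lemma initial_term_near:
  fixes f :: "'a \<times> real \<Rightarrow> real" and v :: "'a \<Rightarrow> real"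
  assumes v: "integrable lborel v" "\<And>x. x \<notin> \<Omega> \<Longrightarrow> v x = 0"
    and init: "\<And>K. K \<in> cells M \<Longrightarrow> measure lborel K * u 0 K = (\<integral>x. indicator K x * v x \<partial>lborel)"
    and f: "f \<in> borel_measurable borel" "\<And>z. \<bar>f z\<bar> \<le> Bf" "osc_le cQ f h \<omega>" and T: "0 \<le> T"
  shows "\<bar>(\<integral>x. v x * f (x, 0) \<partial>lborel) - (\<Sum>K\<in>cells M. measure lborel K * (u 0 K * f (point M K, 0)))\<bar>
    \<le> \<omega> * (\<integral>x. \<bar>v x\<bar> \<partial>lborel)"
proof -
  have [measurable]: "v \<in> borel_measurable borel" using borel_measurable_integrable[OF v(1)] by simp
  have [measurable]: "(\<lambda>x. f (x, 0)) \<in> borel_measurable borel"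
    using f(1) by (rule measurable_compose[rotated]) (intro borel_measurable_continuous_onI continuous_intros)
  have int: "integrable lborel (\<lambda>x. v x * f (x, 0))"
  proof (rule Bochner_Integration.integrable_bound[of _ "\<lambda>x. Bf * v x"])
    show "integrable lborel (\<lambda>x. Bf * v x)" using v(1) by (rule integrable_mult_right)
    show "AE x in lborel. norm (v x * f (x, 0)) \<le> norm (Bf * v x)"
    proof (rule AE_I2)
      fix x
      have "\<bar>f (x, 0)\<bar> \<le> \<bar>Bf\<bar>" using f(2)[of "(x, 0)"] by linarith
      then show "norm (v x * f (x, 0)) \<le> norm (Bf * v x)"
        by (auto simp: abs_mult mult.commute[of "\<bar>Bf\<bar>"] intro!: mult_left_mono)
    qed
  qed measurable
  have ind: "integrable lborel (\<lambda>x. indicator K x * g x)" if "K \<in> cells M" "integrable lborel g" for K and g :: "'a \<Rightarrow> real"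
    using integrable_mult_indicator[OF _ that(2), of K] cell_borel[OF that(1)] by simp
  have "(\<integral>x. v x * f (x, 0) \<partial>lborel) = (\<Sum>K\<in>cells M. \<integral>x. indicator K x * (v x * f (x, 0)) \<partial>lborel)"
    by (rule integral_ae_partition_space[OF cells_partition _ int]) (use cell_borel v(2) in auto)
  then have "\<bar>(\<integral>x. v x * f (x, 0) \<partial>lborel) - (\<Sum>K\<in>cells M. measure lborel K * (u 0 K * f (point M K, 0)))\<bar>
     = \<bar>\<Sum>K\<in>cells M. (\<integral>x. indicator K x * (v x * f (x, 0)) \<partial>lborel) - (\<integral>x. indicator K x * v x \<partial>lborel) * f (point M K, 0)\<bar>"
    by (simp add: sum_subtractf mult.assoc[symmetric] init)
  also have "\<dots> \<le> (\<Sum>K\<in>cells M. \<bar>(\<integral>x. indicator K x * (v x * f (x, 0)) \<partial>lborel) - (\<integral>x. indicator K x * v x \<partial>lborel) * f (point M K, 0)\<bar>)"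
    by (rule sum_abs)
  also have "\<dots> \<le> (\<Sum>K\<in>cells M. \<integral>x. indicator K x * (\<omega> * \<bar>v x\<bar>) \<partial>lborel)"
  proof (intro sum_mono)
    fix K assume K: "K \<in> cells M"
    let ?c = "f (point M K, 0)"
    have "(\<integral>x. indicator K x * (v x * f (x, 0)) \<partial>lborel) - (\<integral>x. indicator K x * v x \<partial>lborel) * ?c
       = (\<integral>x. indicator K x * (v x * f (x, 0)) - indicator K x * v x * ?c \<partial>lborel)"
      using ind[OF K int] ind[OF K v(1)] by simp
    also have "\<bar>\<dots>\<bar> \<le> (\<integral>x. \<bar>indicator K x * (v x * f (x, 0)) - indicator K x * v x * ?c\<bar> \<partial>lborel)"
      by (rule integral_abs_bound)
    also have "\<dots> \<le> (\<integral>x. indicator K x * (\<omega> * \<bar>v x\<bar>) \<partial>lborel)"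
    proof (rule integral_mono)
      show "integrable lborel (\<lambda>x. \<bar>indicator K x * (v x * f (x, 0)) - indicator K x * v x * ?c\<bar>)"
        using ind[OF K int] ind[OF K v(1)] by auto
      show "integrable lborel (\<lambda>x. indicator K x * (\<omega> * \<bar>v x\<bar>))"
        using v(1) by (intro ind[OF K] integrable_mult_right integrable_abs)
      fix x
      show "\<bar>indicator K x * (v x * f (x, 0)) - indicator K x * v x * ?c\<bar> \<le> indicator K x * (\<omega> * \<bar>v x\<bar>)"
      proof (cases "x \<in> K")
        case True
        have "dist (x, 0::real) (point M K, 0) \<le> h"
          using cell_dist[OF K, of x "point M K"] True cell_facts(3)[OF K] closure_subset by (auto simp: dist_Pair_Pair)
        moreover have "(x, 0) \<in> cQ" "(point M K, 0) \<in> cQ" using True cell_facts[OF K] T by auto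
        ultimately have "\<bar>f (x, 0) - ?c\<bar> \<le> \<omega>" using osc_leD[OF f(3)] by fastforce
        then have "\<bar>v x\<bar> * \<bar>f (x, 0) - ?c\<bar> \<le> \<bar>v x\<bar> * \<omega>" by (rule mult_left_mono) simp
        then show ?thesis using True by (simp add: abs_mult[symmetric] right_diff_distrib mult.commute)
      qed simp
    qed
    finally show "\<bar>(\<integral>x. indicator K x * (v x * f (x, 0)) \<partial>lborel) - (\<integral>x. indicator K x * v x \<partial>lborel) * ?c\<bar> \<le> (\<integral>x. indicator K x * (\<omega> * \<bar>v x\<bar>) \<partial>lborel)" .
  qed
  also have "\<dots> = (\<integral>x. \<omega> * \<bar>v x\<bar> \<partial>lborel)"
    by (rule integral_ae_partition_space[OF cells_partition, symmetric]) (use cell_borel v in auto)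
  finally show ?thesis by simp
qed

text \<open>
  Abel summation in time; the final value disappears because the test function vanishes at
  time \<open>T\<close>.
\<close>

lemma scheme_summed:
  fixes f :: "'a \<times> real \<Rightarrow> real" and Fl :: "nat \<Rightarrow> 'a set \<Rightarrow> 'a"
  assumes scheme: "\<And>K n. K \<in> cells M \<Longrightarrow> n < N \<Longrightarrow>
      measure lborel K / (t (Suc n) - t n) * (u (Suc n) K - u n K)
        + (\<Sum>\<sigma>\<in>faces M K. surface_measure \<sigma> * (Fl n \<sigma> \<bullet> normal K \<sigma>)) = 0"
    and f: "\<And>x. f (x, T) = 0"
  shows "(\<Sum>n<N. \<Sum>K\<in>cells M. measure lborel K * (u n K * (f (point M K, t (Suc n)) - f (point M K, t n))))
      + (\<Sum>K\<in>cells M. measure lborel K * (u 0 K * f (point M K, 0)))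
    = (\<Sum>n<N. (t (Suc n) - t n) * (\<Sum>K\<in>cells M. f (anchor n K) * (\<Sum>\<sigma>\<in>faces M K. surface_measure \<sigma> * (Fl n \<sigma> \<bullet> normal K \<sigma>))))"
proof -
  have t0: "t 0 = 0" "t N = T" using time by (auto simp: time_discretization_def)
  let ?g = "\<lambda>n K. measure lborel K * (u n K * f (point M K, t n))"
  have "(t (Suc n) - t n) * (f (anchor n K) * (\<Sum>\<sigma>\<in>faces M K. surface_measure \<sigma> * (Fl n \<sigma> \<bullet> normal K \<sigma>)))
     = measure lborel K * (u n K * (f (point M K, t (Suc n)) - f (point M K, t n))) + (?g n K - ?g (Suc n) K)"
    if n: "n < N" and K: "K \<in> cells M" for n K
  proof -
    have "t (Suc n) - t n \<noteq> 0" using time_step_pos[OF time n] by simp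
    then have "(t (Suc n) - t n) * (\<Sum>\<sigma>\<in>faces M K. surface_measure \<sigma> * (Fl n \<sigma> \<bullet> normal K \<sigma>))
        = - (measure lborel K * (u (Suc n) K - u n K))"
      using scheme[OF K n] by (simp add: field_simps)
    then have "f (anchor n K) * ((t (Suc n) - t n) * (\<Sum>\<sigma>\<in>faces M K. surface_measure \<sigma> * (Fl n \<sigma> \<bullet> normal K \<sigma>)))
        = f (anchor n K) * (- (measure lborel K * (u (Suc n) K - u n K)))" by (rule arg_cong)
    then show ?thesis by (simp add: anchor_def algebra_simps)
  qed
  then have "(\<Sum>n<N. (t (Suc n) - t n) * (\<Sum>K\<in>cells M. f (anchor n K) * (\<Sum>\<sigma>\<in>faces M K. surface_measure \<sigma> * (Fl n \<sigma> \<bullet> normal K \<sigma>))))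
     = (\<Sum>n<N. \<Sum>K\<in>cells M. measure lborel K * (u n K * (f (point M K, t (Suc n)) - f (point M K, t n))) + (?g n K - ?g (Suc n) K))"
    unfolding sum_distrib_left by (intro sum.cong refl) (simp add: sum_distrib_left)
  also have "\<dots> = (\<Sum>n<N. \<Sum>K\<in>cells M. measure lborel K * (u n K * (f (point M K, t (Suc n)) - f (point M K, t n))))
      + (\<Sum>K\<in>cells M. \<Sum>n<N. ?g n K - ?g (Suc n) K)"
    unfolding sum.distrib by (subst (3) sum.swap) (rule refl)
  also have "(\<Sum>K\<in>cells M. \<Sum>n<N. ?g n K - ?g (Suc n) K) = (\<Sum>K\<in>cells M. ?g 0 K)"
    by (intro sum.cong refl) (subst sum_lessThan_telescope', simp add: t0 f)
  finally show ?thesis by (simp add: t0)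
qed

end

section \<open>Passage to the limit\<close>

lemma osc_le_compact:
  fixes g :: "'b::euclidean_space \<Rightarrow> 'c::euclidean_space"
  assumes "compact S" "continuous_on S g" "0 < \<omega>"
  obtains r where "0 < r" "osc_le S g r \<omega>"
proof -
  have "uniformly_continuous_on S g" by (rule compact_uniformly_continuous[OF assms(2,1)])
  then obtain r where r: "r > 0" "\<forall>x\<in>S. \<forall>y\<in>S. dist y x < r \<longrightarrow> dist (g y) (g x) < \<omega>"
    using assms(3) unfolding uniformly_continuous_on_def by blast
  show thesis
  proof
    show "0 < r / 2" using r by simp
    show "osc_le S g (r / 2) \<omega>"
      unfolding osc_le_def
    proof (intro ballI impI)
      fix x y assume "x \<in> S" "y \<in> S" "dist x y \<le> r / 2"
      then have "dist (g x) (g y) < \<omega>" using r by simp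
      then show "norm (g x - g y) \<le> \<omega>" by (simp add: dist_norm)
    qed
  qed
qed

lemma eventually_osc_le:
  fixes g :: "'b::euclidean_space \<Rightarrow> 'c::euclidean_space"
  assumes "compact S" "continuous_on S g" "0 < \<omega>" "r \<longlonglongrightarrow> 0"
  shows "\<forall>\<^sub>F m in sequentially. osc_le S g (r m) \<omega>"
proof -
  obtain \<rho> where \<rho>: "0 < \<rho>" "osc_le S g \<rho> \<omega>" using osc_le_compact[OF assms(1-3)] .
  have "\<forall>\<^sub>F m in sequentially. r m < \<rho>" using order_tendstoD(2)[OF assms(4) \<rho>(1)] .
  then show ?thesis by eventually_elim (rule osc_le_mono[OF \<rho>(2)], simp)
qed

lemma LIMSEQ_I_eventually_le:
  fixes a :: "nat \<Rightarrow> real"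
  assumes C: "0 \<le> C" and ev: "\<And>\<epsilon>. 0 < \<epsilon> \<Longrightarrow> \<forall>\<^sub>F m in sequentially. \<bar>a m - l\<bar> \<le> \<epsilon> * C"
  shows "a \<longlonglongrightarrow> l"
proof (rule tendstoI)
  fix r :: real assume r: "0 < r"
  have "0 < r / (C + 1)" using r C by simp
  from ev[OF this] show "\<forall>\<^sub>F m in sequentially. dist (a m) l < r"
  proof eventually_elim
    case (elim m)
    have "r / (C + 1) * C < r" using r C by (simp add: field_simps)
    then show ?case using elim by (simp add: dist_real_def)
  qed
qed

text \<open>
  A test function \<open>f\<close>, extended by zero, with its time derivative
  \<open>e\<close> and its spatial gradient \<open>d\<close>. At time zero it need not
  vanish, and its derivatives there are one-sided; this is why the properties are stated on
  the closed cylinder instead of for a smooth function on the whole space.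
\<close>

locale test_function =
  fixes \<Omega> :: "'a::euclidean_space set" and T :: real and f e :: "'a \<times> real \<Rightarrow> real" and d :: "'a \<times> real \<Rightarrow> 'a" and B \<eta> :: real
  assumes bounded_domain: "bounded \<Omega>" and open_domain: "open \<Omega>" and T: "0 < T"
    and borel: "f \<in> borel_measurable borel" "e \<in> borel_measurable borel" "d \<in> borel_measurable borel"
    and bounds: "\<And>z. \<bar>f z\<bar> \<le> B" "\<And>z. \<bar>e z\<bar> \<le> B" "\<And>z. norm (d z) \<le> B"
    and cont: "continuous_on (closure \<Omega> \<times> {0..T}) f" "continuous_on (closure \<Omega> \<times> {0..T}) e"
    and zero: "\<And>x s. x \<notin> \<Omega> \<Longrightarrow> f (x, s) = 0" "\<And>x. f (x, T) = 0"
    and near_boundary: "0 < \<eta>" "\<And>x y s. y \<in> frontier \<Omega> \<Longrightarrow> dist x y \<le> \<eta> \<Longrightarrow> 0 \<le> s \<Longrightarrow> s \<le> T \<Longrightarrow> f (x, s) = 0"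
    and space: "\<And>x s. 0 \<le> s \<Longrightarrow> s \<le> T \<Longrightarrow> ((\<lambda>y. f (y, s)) has_derivative (\<lambda>v. d (x, s) \<bullet> v)) (at x)"
    and time: "\<And>x s. x \<in> closure \<Omega> \<Longrightarrow> 0 < s \<Longrightarrow> s < T \<Longrightarrow> ((\<lambda>s. f (x, s)) has_real_derivative e (x, s)) (at s)"
begin

abbreviation Q :: "('a \<times> real) set" where "Q \<equiv> \<Omega> \<times> {0<..<T}"
abbreviation cQ :: "('a \<times> real) set" where "cQ \<equiv> closure \<Omega> \<times> {0..T}"

lemma Q_borel: "Q \<in> sets borel" using open_domain by (intro borel_Times) auto
lemma Q_bounded: "bounded Q" using bounded_domain by (intro bounded_Times) auto
lemma cQ_compact: "compact cQ" using bounded_domain by (intro compact_Times) auto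
lemma B_nonneg: "0 \<le> B" using bounds(1)[of undefined] by linarith

lemma d_zero: "x \<notin> \<Omega> \<Longrightarrow> 0 \<le> s \<Longrightarrow> s \<le> T \<Longrightarrow> d (x, s) = 0"
proof -
  assume x: "x \<notin> \<Omega>" and s: "0 \<le> s" "s \<le> T"
  have "((\<lambda>y. f (y, s)) has_derivative (\<lambda>v. 0)) (at x)"
  proof (cases "x \<in> frontier \<Omega>")
    case True
    have "f (y, s) = 0" if "y \<in> ball x \<eta>" for y
      using near_boundary(2)[OF True, of y s] that s by (simp add: dist_commute)
    then show ?thesis
      by (intro has_derivative_transform_within_open[OF has_derivative_const open_ball[of x \<eta>]])
         (use near_boundary(1) in auto)
  next
    case False
    then have "x \<in> - closure \<Omega>" using x open_domain by (simp add: frontier_def interior_open)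
    have op: "open (- closure \<Omega>)" by (intro open_Compl closed_closure)
    show ?thesis
    proof (rule has_derivative_transform_within_open[OF has_derivative_const op])
      show "x \<in> - closure \<Omega>" by fact
      show "0 = f (y, s)" if "y \<in> - closure \<Omega>" for y
        using zero(1)[of y s] that closure_subset[of \<Omega>] by auto
    qed
  qed
  from fun_cong[OF has_derivative_unique[OF this space[OF s]], of "d (x, s)"]
  have "d (x, s) \<bullet> d (x, s) = 0" by simp
  then show "d (x, s) = 0" by simp
qed

text \<open>
  The extension by zero makes this hold for any two points, whereas the segment between the
  points of two neighbouring cells may leave the domain.
\<close>

lemma lipschitz: "0 \<le> s \<Longrightarrow> s \<le> T \<Longrightarrow> \<bar>f (x, s) - f (y, s)\<bar> \<le> B * norm (x - y)"
proof -
  assume s: "0 \<le> s" "s \<le> T"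
  have "norm (f (x, s) - f (y, s)) \<le> B * norm (x - y)"
  proof (rule differentiable_bound[of UNIV "\<lambda>y. f (y, s)" "\<lambda>x v. d (x, s) \<bullet> v"])
    show "onorm (\<lambda>v. d (x, s) \<bullet> v) \<le> B" for x
    proof (rule onorm_le)
      fix v
      have "\<bar>d (x, s) \<bullet> v\<bar> \<le> norm (d (x, s)) * norm v" by (rule Cauchy_Schwarz_ineq2)
      also have "\<dots> \<le> B * norm v" using bounds(3) by (intro mult_right_mono) auto
      finally show "norm (d (x, s) \<bullet> v) \<le> B * norm v" by simp
    qed
  qed (use space[OF s] in auto)
  then show ?thesis by simp
qed

text \<open>
  For each component, a function of compact support is differentiated along a coordinate
  direction, so the integral vanishes by averaging along that direction.
\<close>

lemma integration_by_parts:
  fixes p :: "'a \<times> real \<Rightarrow> 'a" and p' :: "'a \<Rightarrow> 'a \<times> real \<Rightarrow> 'a \<times> real \<Rightarrow> real"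
  assumes p: "continuous_on UNIV p"
    and p': "\<And>b z. b \<in> Basis \<Longrightarrow> ((\<lambda>z. p z \<bullet> b) has_derivative p' b z) (at z)"
      "\<And>b v. b \<in> Basis \<Longrightarrow> continuous_on UNIV (\<lambda>z. p' b z v)"
  shows "(\<integral>z. indicator Q z * (f z * (\<Sum>b\<in>Basis. p' b z (b, 0))) \<partial>lborel) = - (\<integral>z. indicator Q z * (d z \<bullet> p z) \<partial>lborel)"
proof -
  note [measurable] = borel Q_borel
  have [measurable]: "p \<in> borel_measurable borel" using p by (rule borel_measurable_continuous_onI)
  have [measurable]: "(\<lambda>z. p' b z (b, 0)) \<in> borel_measurable borel" if "b \<in> Basis" for b
    using p'(2)[OF that] by (rule borel_measurable_continuous_onI)
  obtain P where P: "\<And>z. z \<in> Q \<Longrightarrow> norm (p z) \<le> P" using continuous_bounded_on_bounded[OF p Q_bounded] by blast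
  have i1: "integrable lborel (\<lambda>z. indicator Q z * (f z * (p z \<bullet> b)))" if b: "b \<in> Basis" for b
  proof (rule integrable_bounded_borel[OF _ Q_borel Q_bounded, of _ "B * P"])
    show "norm (indicator Q z * (f z * (p z \<bullet> b))) \<le> B * P" if "z \<in> Q" for z
    proof -
      have "\<bar>p z \<bullet> b\<bar> \<le> P" using Basis_le_norm[OF b, of "p z"] P[OF that] by linarith
      then show ?thesis using that bounds(1)[of z] B_nonneg by (auto simp: abs_mult intro!: mult_mono)
    qed
  qed auto
  have i2: "integrable lborel (\<lambda>z. indicator Q z * ((d z \<bullet> b) * (p z \<bullet> b)))" if b: "b \<in> Basis" for b
  proof (rule integrable_bounded_borel[OF _ Q_borel Q_bounded, of _ "B * P"])
    show "norm (indicator Q z * ((d z \<bullet> b) * (p z \<bullet> b))) \<le> B * P" if "z \<in> Q" for z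
    proof -
      have "\<bar>p z \<bullet> b\<bar> \<le> P" using Basis_le_norm[OF b, of "p z"] P[OF that] by linarith
      moreover have "\<bar>d z \<bullet> b\<bar> \<le> B" using Basis_le_norm[OF b, of "d z"] bounds(3)[of z] by linarith
      ultimately show ?thesis using that B_nonneg by (auto simp: abs_mult intro!: mult_mono)
    qed
  qed auto
  have i3: "integrable lborel (\<lambda>z. indicator Q z * (f z * p' b z (b, 0)))" if b: "b \<in> Basis" for b
  proof -
    obtain P' where P': "\<And>z. z \<in> Q \<Longrightarrow> norm (p' b z (b, 0)) \<le> P'"
      using continuous_bounded_on_bounded[OF p'(2)[OF b] Q_bounded] by blast
    show ?thesis
    proof (rule integrable_bounded_borel[OF _ Q_borel Q_bounded, of _ "B * P'"])
      show "norm (indicator Q z * (f z * p' b z (b, 0))) \<le> B * P'" if "z \<in> Q" for z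
        using that bounds(1)[of z] P'[OF that] B_nonneg by (auto simp: abs_mult intro!: mult_mono)
    qed (use b in auto)
  qed
  have each: "(\<integral>z. indicator Q z * ((d z \<bullet> b) * (p z \<bullet> b)) + indicator Q z * (f z * p' b z (b, 0)) \<partial>lborel) = 0" if b: "b \<in> Basis" for b
  proof (rule integral_derivative_along_eq_0[OF i1[OF b] Bochner_Integration.integrable_add[OF i2[OF b] i3[OF b]], of "(b, 0)"])
    fix z :: "'a \<times> real" and s :: real
    obtain x r where z: "z = (x, r)" by fastforce
    show "((\<lambda>s. indicator Q (z + s *\<^sub>R (b, 0)) * (f (z + s *\<^sub>R (b, 0)) * (p (z + s *\<^sub>R (b, 0)) \<bullet> b))) has_real_derivative
       (indicator Q (z + s *\<^sub>R (b, 0)) * ((d (z + s *\<^sub>R (b, 0)) \<bullet> b) * (p (z + s *\<^sub>R (b, 0)) \<bullet> b))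
       + indicator Q (z + s *\<^sub>R (b, 0)) * (f (z + s *\<^sub>R (b, 0)) * p' b (z + s *\<^sub>R (b, 0)) (b, 0)))) (at s)"
    proof (cases "0 < r \<and> r < T")
      case False
      then have "indicator Q (x + s *\<^sub>R b, r) = (0::real)" for s by (auto simp: indicator_def)
      then show ?thesis by (simp add: z)
    next
      case True
      have r: "0 \<le> r" "r \<le> T" using True by auto
      have l1: "((\<lambda>s. x + s *\<^sub>R b) has_derivative (\<lambda>s. s *\<^sub>R b)) (at s)"
        by (auto intro!: derivative_eq_intros)
      have l2: "((\<lambda>s. (x + s *\<^sub>R b, r)) has_derivative (\<lambda>s. s *\<^sub>R (b, 0))) (at s)"
        by (auto intro!: derivative_eq_intros)
      have df: "((\<lambda>s. f (x + s *\<^sub>R b, r)) has_real_derivative d (x + s *\<^sub>R b, r) \<bullet> b) (at s)"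
        using has_derivative_compose[OF l1 space[OF r]] by (simp add: has_field_derivative_def mult_commute_abs)
      have dp: "((\<lambda>s. p (x + s *\<^sub>R b, r) \<bullet> b) has_real_derivative p' b (x + s *\<^sub>R b, r) (b, 0)) (at s)"
      proof -
        have "p' b (x + s *\<^sub>R b, r) (q *\<^sub>R b, 0) = q * p' b (x + s *\<^sub>R b, r) (b, 0)" for q
        proof -
          have "(q *\<^sub>R b, 0) = q *\<^sub>R (b, 0::real)" by simp
          then show ?thesis by (simp only: linear_cmul[OF has_derivative_linear[OF p'(1)[OF b]]] real_scaleR_def)
        qed
        then show ?thesis
          using has_derivative_compose[OF l2 p'(1)[OF b]] by (simp add: has_field_derivative_def mult_commute_abs)
      qed
      have fz: "indicator Q (y, r) * (f (y, r) * c) = f (y, r) * c" for y c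
        using zero(1)[of y r] True by (cases "y \<in> \<Omega>") auto
      have dz: "indicator Q (y, r) * ((d (y, r) \<bullet> b) * c) = (d (y, r) \<bullet> b) * c" for y c
        using d_zero[of y r] True by (cases "y \<in> \<Omega>") auto
      have "((\<lambda>s. f (x + s *\<^sub>R b, r) * (p (x + s *\<^sub>R b, r) \<bullet> b)) has_real_derivative
          (d (x + s *\<^sub>R b, r) \<bullet> b) * (p (x + s *\<^sub>R b, r) \<bullet> b) + f (x + s *\<^sub>R b, r) * p' b (x + s *\<^sub>R b, r) (b, 0)) (at s)"
        using DERIV_mult[OF df dp] by (simp add: mult_ac)
      then show ?thesis by (simp add: z fz dz)
    qed
  qed
  have "0 = (\<Sum>b\<in>Basis. (\<integral>z. indicator Q z * ((d z \<bullet> b) * (p z \<bullet> b)) + indicator Q z * (f z * p' b z (b, 0)) \<partial>lborel))"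
    using each by simp
  also have "\<dots> = (\<Sum>b\<in>Basis. \<integral>z. indicator Q z * ((d z \<bullet> b) * (p z \<bullet> b)) \<partial>lborel) + (\<Sum>b\<in>Basis. \<integral>z. indicator Q z * (f z * p' b z (b, 0)) \<partial>lborel)"
    using i2 i3 by (simp add: sum.distrib)
  also have "(\<Sum>b\<in>Basis. \<integral>z. indicator Q z * ((d z \<bullet> b) * (p z \<bullet> b)) \<partial>lborel) = (\<integral>z. (\<Sum>b\<in>Basis. indicator Q z * ((d z \<bullet> b) * (p z \<bullet> b))) \<partial>lborel)"
    by (rule Bochner_Integration.integral_sum[OF i2, symmetric])
  also have "(\<lambda>z. \<Sum>b\<in>Basis. indicator Q z * ((d z \<bullet> b) * (p z \<bullet> b))) = (\<lambda>z. indicator Q z * (d z \<bullet> p z))"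
    by (simp add: sum_distrib_left[symmetric] euclidean_inner[of "d _" "p _"])
  also have "(\<Sum>b\<in>Basis. \<integral>z. indicator Q z * (f z * p' b z (b, 0)) \<partial>lborel) = (\<integral>z. (\<Sum>b\<in>Basis. indicator Q z * (f z * p' b z (b, 0))) \<partial>lborel)"
    by (rule Bochner_Integration.integral_sum[OF i3, symmetric])
  also have "(\<lambda>z. \<Sum>b\<in>Basis. indicator Q z * (f z * p' b z (b, 0))) = (\<lambda>z. indicator Q z * (f z * (\<Sum>b\<in>Basis. p' b z (b, 0))))"
    by (simp add: sum_distrib_left)
  finally show ?thesis by linarith
qed

end

lemma fine_mesh_sizes:
  assumes "bounded \<Omega>" "open \<Omega>" "is_mesh \<Omega> M" "time_discretization T N t"
  shows "fine_mesh \<Omega> M T N t \<bar>mesh_size M\<bar> \<bar>time_step N t\<bar>"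
proof -
  interpret mesh_time \<Omega> M T N t by standard fact+
  show ?thesis
  proof
    fix K assume "K \<in> cells M"
    then have "diameter K \<le> mesh_size M" unfolding mesh_size_def by (intro Max_ge) auto
    then show "diameter K \<le> \<bar>mesh_size M\<bar>" by simp
  next
    fix n assume "n < N"
    then have "t (Suc n) - t n \<le> time_step N t" unfolding time_step_def by (intro Max_ge) auto
    then show "t (Suc n) - t n \<le> \<bar>time_step N t\<bar>" by simp
  qed auto
qed

lemma integral_diff_abs_le:
  fixes a b c :: "'b \<Rightarrow> real"
  assumes "integrable \<mu> a" "integrable \<mu> b" "integrable \<mu> c" "\<And>z. \<bar>a z - b z\<bar> \<le> c z"
  shows "\<bar>(\<integral>z. a z \<partial>\<mu>) - (\<integral>z. b z \<partial>\<mu>)\<bar> \<le> (\<integral>z. c z \<partial>\<mu>)"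
proof -
  have "\<bar>\<integral>z. a z - b z \<partial>\<mu>\<bar> \<le> (\<integral>z. \<bar>a z - b z\<bar> \<partial>\<mu>)" by (rule integral_abs_bound)
  also have "\<dots> \<le> (\<integral>z. c z \<partial>\<mu>)" using assms by (intro integral_mono integrable_abs) auto
  finally show ?thesis using assms by simp
qed

context test_function
begin

lemma integrable_mult_e:
  fixes w :: "'a \<times> real \<Rightarrow> real"
  assumes w: "integrable lborel (\<lambda>z. indicator Q z * w z)"
  shows "integrable lborel (\<lambda>z. indicator Q z * (w z * e z))"
proof (rule Bochner_Integration.integrable_bound[of _ "\<lambda>z. B * (indicator Q z * w z)"])
  note [measurable] = borel
  show "integrable lborel (\<lambda>z. B * (indicator Q z * w z))" using w by (rule integrable_mult_right)
  have "(\<lambda>z. (indicator Q z * w z) * e z) \<in> borel_measurable lborel"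
    using borel_measurable_integrable[OF w] by measurable
  then show "(\<lambda>z. indicator Q z * (w z * e z)) \<in> borel_measurable lborel" by (simp add: mult.assoc)
  show "AE z in lborel. norm (indicator Q z * (w z * e z)) \<le> norm (B * (indicator Q z * w z))"
    using bounds(2) B_nonneg by (intro AE_I2) (auto simp: abs_mult indicator_def mult.commute[of B] intro!: mult_left_mono)
qed

lemma integrable_inner_d:
  fixes w :: "'a \<times> real \<Rightarrow> 'a"
  assumes w: "integrable lborel (\<lambda>z. indicator Q z *\<^sub>R w z)"
  shows "integrable lborel (\<lambda>z. indicator Q z * (d z \<bullet> w z))"
proof (rule Bochner_Integration.integrable_bound[of _ "\<lambda>z. B *\<^sub>R (indicator Q z *\<^sub>R w z)"])
  note [measurable] = borel
  show "integrable lborel (\<lambda>z. B *\<^sub>R (indicator Q z *\<^sub>R w z))" using w by (rule integrable_scaleR_right)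
  have "(\<lambda>z. d z \<bullet> (indicator Q z *\<^sub>R w z)) \<in> borel_measurable lborel"
    using borel_measurable_integrable[OF w] by measurable
  then show "(\<lambda>z. indicator Q z * (d z \<bullet> w z)) \<in> borel_measurable lborel" by simp
  show "AE z in lborel. norm (indicator Q z * (d z \<bullet> w z)) \<le> norm (B *\<^sub>R (indicator Q z *\<^sub>R w z))"
  proof (rule AE_I2)
    fix z
    have "\<bar>d z \<bullet> w z\<bar> \<le> norm (d z) * norm (w z)" by (rule Cauchy_Schwarz_ineq2)
    also have "\<dots> \<le> B * norm (w z)" using bounds(3) by (intro mult_right_mono) auto
    finally show "norm (indicator Q z * (d z \<bullet> w z)) \<le> norm (B *\<^sub>R (indicator Q z *\<^sub>R w z))"
      using B_nonneg by (auto simp: indicator_def)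
  qed
qed

text \<open>
  The summed scheme holds for each mesh; its three terms converge separately. For the flux
  term the polynomial field is chosen first, close to the limit flux in
  \<open>L\<^sup>1\<close>, and the mesh is refined afterwards.
\<close>

lemma weak_limit:
  fixes M :: "nat \<Rightarrow> 'a mesh" and N :: "nat \<Rightarrow> nat" and t :: "nat \<Rightarrow> nat \<Rightarrow> real" and u :: "nat \<Rightarrow> nat \<Rightarrow> 'a set \<Rightarrow> real"
    and Fl :: "nat \<Rightarrow> nat \<Rightarrow> 'a set \<Rightarrow> 'a" and F :: "real \<Rightarrow> 'a" and v :: "'a \<times> real \<Rightarrow> real" and v0 :: "'a \<Rightarrow> real"
  assumes mesh: "\<And>m. is_mesh \<Omega> (M m)" and td: "\<And>m. time_discretization T (N m) (t m)"
    and hlim: "(\<lambda>m. mesh_size (M m)) \<longlonglongrightarrow> 0" and klim: "(\<lambda>m. time_step (N m) (t m)) \<longlonglongrightarrow> 0"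
    and scheme: "\<And>m K n. K \<in> cells (M m) \<Longrightarrow> n < N m \<Longrightarrow>
      measure lborel K / (t m (Suc n) - t m n) * (u m (Suc n) K - u m n K)
        + (\<Sum>\<sigma>\<in>faces (M m) K. surface_measure \<sigma> * (Fl m n \<sigma> \<bullet> normal K \<sigma>)) = 0"
    and v0: "integrable lborel v0" "\<And>x. x \<notin> \<Omega> \<Longrightarrow> v0 x = 0"
    and init: "\<And>m K. K \<in> cells (M m) \<Longrightarrow> measure lborel K * u m 0 K = (\<integral>x. indicator K x * v0 x \<partial>lborel)"
    and intu: "\<And>m. integrable lborel (\<lambda>z. indicator Q z * step_function (M m) (N m) (t m) (u m) z)"
    and intv: "integrable lborel (\<lambda>z. indicator Q z * v z)"
    and convu: "(\<lambda>m. \<integral>z. indicator Q z * \<bar>step_function (M m) (N m) (t m) (u m) z - v z\<bar> \<partial>lborel) \<longlonglongrightarrow> 0"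
    and intFu: "\<And>m. integrable lborel (\<lambda>z. indicator Q z *\<^sub>R F (step_function (M m) (N m) (t m) (u m) z))"
    and intFv: "integrable lborel (\<lambda>z. indicator Q z *\<^sub>R F (v z))"
    and convF: "(\<lambda>m. \<integral>z. norm (indicator Q z *\<^sub>R (F (step_function (M m) (N m) (t m) (u m) z) - F (v z))) \<partial>lborel) \<longlonglongrightarrow> 0"
    and \<theta>g: "0 \<le> \<theta>g" "\<And>m K L \<sigma>. shared_face (M m) K L \<sigma> \<Longrightarrow>
      surface_measure \<sigma> * norm (point (M m) L - point (M m) K) \<le> \<theta>g * measure lebesgue (dual (M m) \<sigma>)"
    and C: "0 \<le> C" "\<And>m K L \<sigma> n. shared_face (M m) K L \<sigma> \<Longrightarrow> n < N m \<Longrightarrow> norm (Fl m n \<sigma> - F (u m n K)) \<le> C * \<bar>u m n K - u m n L\<bar>"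
      "\<And>m K L \<sigma> n. shared_face (M m) K L \<sigma> \<Longrightarrow> n < N m \<Longrightarrow> norm (Fl m n \<sigma> - F (u m n L)) \<le> C * \<bar>u m n K - u m n L\<bar>"
    and \<theta>: "0 \<le> \<theta>" "\<And>m K \<sigma>. K \<in> cells (M m) \<Longrightarrow> \<sigma> \<in> faces (M m) K \<Longrightarrow> measure lebesgue (dual (M m) \<sigma>) \<le> \<theta> * measure lborel K"
    and NE: "\<And>m K. K \<in> cells (M m) \<Longrightarrow> card (faces (M m) K) \<le> NE"
  shows "(\<integral>z. indicator Q z * (v z * e z) \<partial>lborel) + (\<integral>x. v0 x * f (x, 0) \<partial>lborel) = - (\<integral>z. indicator Q z * (d z \<bullet> F (v z)) \<partial>lborel)"
proof -
  let ?u = "\<lambda>m. step_function (M m) (N m) (t m) (u m)"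
  let ?h = "\<lambda>m. \<bar>mesh_size (M m)\<bar>" and ?k = "\<lambda>m. \<bar>time_step (N m) (t m)\<bar>"
  define V where "V = measure lborel Q"
  have V0: "0 \<le> V" by (simp add: V_def)
  note [measurable] = borel Q_borel
  have fm: "fine_mesh \<Omega> (M m) T (N m) (t m) (?h m) (?k m)" for m
    by (rule fine_mesh_sizes[OF bounded_domain open_domain mesh td])
  have hk: "(\<lambda>m. ?h m) \<longlonglongrightarrow> 0" "(\<lambda>m. ?h m + ?k m) \<longlonglongrightarrow> 0" "(\<lambda>m. 2 * ?h m + ?k m) \<longlonglongrightarrow> 0"
  proof -
    show 1: "(\<lambda>m. ?h m) \<longlonglongrightarrow> 0" using hlim by (rule tendsto_rabs_zero)
    have 2: "(\<lambda>m. ?k m) \<longlonglongrightarrow> 0" using klim by (rule tendsto_rabs_zero)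
    show "(\<lambda>m. ?h m + ?k m) \<longlonglongrightarrow> 0" using tendsto_add[OF 1 2] by simp
    show "(\<lambda>m. 2 * ?h m + ?k m) \<longlonglongrightarrow> 0" using tendsto_add[OF tendsto_mult_left[OF 1, of 2] 2] by simp
  qed
  have intuv: "integrable lborel (\<lambda>z. indicator Q z * \<bar>?u m z - v z\<bar>)" for m
  proof -
    have "integrable lborel (\<lambda>z. \<bar>indicator Q z * ?u m z - indicator Q z * v z\<bar>)"
      by (intro integrable_abs Bochner_Integration.integrable_diff intu intv)
    then show ?thesis by (simp add: abs_mult flip: right_diff_distrib)
  qed
  have absQ: "integrable lborel (\<lambda>z. indicator Q z * \<bar>w z\<bar>)" if "integrable lborel (\<lambda>z. indicator Q z * w z)" for w :: "'a \<times> real \<Rightarrow> real"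
    using integrable_abs[OF that] by (simp add: abs_mult)
  \<comment> \<open>The time derivative: here strong convergence of the solutions is enough.\<close>
  define Time where "Time m = (\<Sum>n<N m. \<Sum>K\<in>cells (M m). measure lborel K * (u m n K * (f (point (M m) K, t m (Suc n)) - f (point (M m) K, t m n))))" for m
  define Iv where "Iv = (\<integral>z. indicator Q z * \<bar>v z\<bar> \<partial>lborel)"
  have Iv0: "0 \<le> Iv" by (simp add: Iv_def)
  have lim1: "Time \<longlonglongrightarrow> (\<integral>z. indicator Q z * (v z * e z) \<partial>lborel)"
  proof (rule LIMSEQ_I_eventually_le)
    show "0 \<le> Iv + 1 + B" using Iv0 B_nonneg by simp
    fix \<epsilon> :: real assume \<epsilon>: "0 < \<epsilon>"
    have m1: "0 < min \<epsilon> 1" using \<epsilon> by simp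
    have "\<forall>\<^sub>F m in sequentially. osc_le cQ e (?h m + ?k m) \<epsilon>"
      by (rule eventually_osc_le[OF cQ_compact cont(2) \<epsilon> hk(2)])
    moreover have "\<forall>\<^sub>F m in sequentially. (\<integral>z. indicator Q z * \<bar>?u m z - v z\<bar> \<partial>lborel) < min \<epsilon> 1"
      by (rule order_tendstoD(2)[OF convu m1])
    ultimately show "\<forall>\<^sub>F m in sequentially. \<bar>Time m - (\<integral>z. indicator Q z * (v z * e z) \<partial>lborel)\<bar> \<le> \<epsilon> * (Iv + 1 + B)"
    proof eventually_elim
      case (elim m)
      interpret fm: fine_mesh \<Omega> "M m" T "N m" "t m" "?h m" "?k m" by (rule fm)
      have c: "continuous_on {0..T} (\<lambda>s. f (x, s))" if "x \<in> closure \<Omega>" for x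
        by (rule continuous_on_compose2[OF cont(1)]) (use that in \<open>auto intro!: continuous_intros\<close>)
      have 1: "\<bar>(\<integral>z. indicator Q z * (?u m z * e z) \<partial>lborel) - Time m\<bar> \<le> \<epsilon> * (\<integral>z. indicator Q z * \<bar>?u m z\<bar> \<partial>lborel)"
        unfolding Time_def by (rule fm.time_term_near[where u="u m", OF intu borel(2) bounds(2) elim(1) less_imp_le[OF \<epsilon>] time c])
      have "(\<integral>z. indicator Q z * \<bar>?u m z\<bar> \<partial>lborel) \<le> (\<integral>z. indicator Q z * \<bar>v z\<bar> + indicator Q z * \<bar>?u m z - v z\<bar> \<partial>lborel)"
        using absQ[OF intu] absQ[OF intv] intuv
        by (intro integral_mono) (auto simp: indicator_def)
      also have "\<dots> = Iv + (\<integral>z. indicator Q z * \<bar>?u m z - v z\<bar> \<partial>lborel)"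
        unfolding Iv_def using absQ[OF intv] intuv by (intro Bochner_Integration.integral_add)
      finally have "(\<integral>z. indicator Q z * \<bar>?u m z\<bar> \<partial>lborel) \<le> Iv + 1" using elim(2) by simp
      then have 2: "\<epsilon> * (\<integral>z. indicator Q z * \<bar>?u m z\<bar> \<partial>lborel) \<le> \<epsilon> * (Iv + 1)" using \<epsilon> by (intro mult_left_mono) auto
      have "\<bar>(\<integral>z. indicator Q z * (?u m z * e z) \<partial>lborel) - (\<integral>z. indicator Q z * (v z * e z) \<partial>lborel)\<bar>
          \<le> (\<integral>z. B * (indicator Q z * \<bar>?u m z - v z\<bar>) \<partial>lborel)"
      proof (rule integral_diff_abs_le[OF integrable_mult_e[OF intu] integrable_mult_e[OF intv] integrable_mult_right[OF intuv]])
        fix z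
        have "\<bar>?u m z - v z\<bar> * \<bar>e z\<bar> \<le> \<bar>?u m z - v z\<bar> * B" using bounds(2) by (intro mult_left_mono) auto
        then show "\<bar>indicator Q z * (?u m z * e z) - indicator Q z * (v z * e z)\<bar> \<le> B * (indicator Q z * \<bar>?u m z - v z\<bar>)"
          by (auto simp: indicator_def mult.commute[of B] abs_mult simp flip: left_diff_distrib)
      qed
      also have "\<dots> = B * (\<integral>z. indicator Q z * \<bar>?u m z - v z\<bar> \<partial>lborel)" by simp
      also have "\<dots> \<le> B * \<epsilon>" using elim(2) B_nonneg by (intro mult_left_mono) auto
      finally have "\<bar>(\<integral>z. indicator Q z * (?u m z * e z) \<partial>lborel) - (\<integral>z. indicator Q z * (v z * e z) \<partial>lborel)\<bar> \<le> B * \<epsilon>" .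
      moreover have "\<epsilon> * (Iv + 1 + B) = \<epsilon> * (Iv + 1) + B * \<epsilon>" by (simp add: algebra_simps)
      ultimately show ?case using 1 2 by linarith
    qed
  qed

  define Init where "Init m = (\<Sum>K\<in>cells (M m). measure lborel K * (u m 0 K * f (point (M m) K, 0)))" for m
  have lim2: "Init \<longlonglongrightarrow> (\<integral>x. v0 x * f (x, 0) \<partial>lborel)"
  proof (rule LIMSEQ_I_eventually_le)
    show "0 \<le> (\<integral>x. \<bar>v0 x\<bar> \<partial>lborel)" by simp
    fix \<epsilon> :: real assume \<epsilon>: "0 < \<epsilon>"
    have "\<forall>\<^sub>F m in sequentially. osc_le cQ f (?h m) \<epsilon>"
      by (rule eventually_osc_le[OF cQ_compact cont(1) \<epsilon> hk(1)])
    then show "\<forall>\<^sub>F m in sequentially. \<bar>Init m - (\<integral>x. v0 x * f (x, 0) \<partial>lborel)\<bar> \<le> \<epsilon> * (\<integral>x. \<bar>v0 x\<bar> \<partial>lborel)"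
    proof eventually_elim
      case (elim m)
      interpret fm: fine_mesh \<Omega> "M m" T "N m" "t m" "?h m" "?k m" by (rule fm)
      have "\<bar>(\<integral>x. v0 x * f (x, 0) \<partial>lborel) - Init m\<bar> \<le> \<epsilon> * (\<integral>x. \<bar>v0 x\<bar> \<partial>lborel)"
        unfolding Init_def by (rule fm.initial_term_near[where u="u m", OF v0 init borel(1) bounds(1) elim less_imp_le[OF T]])
      then show ?case by (simp add: abs_minus_commute)
    qed
  qed

  \<comment> \<open>The fluxes. All errors are multiples of \<open>\<epsilon>\<close>; the factor \<open>tot\<close> collects them.\<close>
  define X where "X m = (\<Sum>n<N m. (t m (Suc n) - t m n) * (\<Sum>K\<in>cells (M m). f (point (M m) K, t m (Suc n)) *
      (\<Sum>\<sigma>\<in>faces (M m) K. surface_measure \<sigma> * (Fl m n \<sigma> \<bullet> normal K \<sigma>))))" for m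
  define G where "G = B * \<theta>g"
  have G0: "0 \<le> G" using B_nonneg \<theta>g(1) by (simp add: G_def)
  define I where "I = (\<integral>z. indicator Q z * (d z \<bullet> F (v z)) \<partial>lborel)"
  define J where "J = real NE * \<theta> * (2 + V) + V"
  have J0: "0 \<le> J" using V0 \<theta>(1) by (simp add: J_def)
  define tot where "tot = G * (C * J) + G * 2 + G * ((1 + real DIM('a)) * V) + 2 * V + B"
  have "0 \<le> tot" using G0 C(1) J0 V0 B_nonneg by (simp add: tot_def)
  have lim3: "X \<longlonglongrightarrow> - I"
  proof (rule LIMSEQ_I_eventually_le[OF \<open>0 \<le> tot\<close>])
    fix \<epsilon> :: real assume \<epsilon>: "0 < \<epsilon>"
    obtain p where p: "polynomial_function p" "(LINT z:Q|lborel. norm (F (v z) - p z)) < \<epsilon>"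
      using L1_approx_polynomial[OF Q_bounded Q_borel, of "\<lambda>z. F (v z)" \<epsilon>] intFv \<epsilon> by (auto simp: set_integrable_def)
    obtain g where g: "polynomial_function g" "(LINT z:Q|lborel. norm (v z - g z)) < \<epsilon>"
      using L1_approx_polynomial[OF Q_bounded Q_borel, of v \<epsilon>] intv \<epsilon> by (auto simp: set_integrable_def)
    have pc: "continuous_on UNIV p" and gc: "continuous_on UNIV g"
      using p g by (auto simp: continuous_on_polymonial_function)
    have "\<exists>p'. (\<forall>x. ((\<lambda>z. p z \<bullet> b) has_derivative p' x) (at x)) \<and> (\<forall>v. continuous_on UNIV (\<lambda>x. p' x v))" if "b \<in> Basis" for b
      using p(1) that by (intro real_polynomial_function_derivative) (simp add: polynomial_function_iff_Basis_inner)
    then obtain p' where p': "\<And>b z. b \<in> Basis \<Longrightarrow> ((\<lambda>z. p z \<bullet> b) has_derivative p' b z) (at z)"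
      "\<And>b v. b \<in> Basis \<Longrightarrow> continuous_on UNIV (\<lambda>z. p' b z v)"
      by metis
    define dv where "dv z = (\<Sum>b\<in>Basis. p' b z (b, 0))" for z
    have dvc: "continuous_on UNIV dv" unfolding dv_def by (intro continuous_on_sum p'(2))
    have intp: "integrable lborel (\<lambda>z. indicator Q z *\<^sub>R p z)" and intg: "integrable lborel (\<lambda>z. indicator Q z *\<^sub>R g z)"
      using set_integrable_continuous_bounded[OF Q_bounded Q_borel pc] set_integrable_continuous_bounded[OF Q_bounded Q_borel gc]
      unfolding set_integrable_def .
    have ip: "(\<integral>z. norm (indicator Q z *\<^sub>R (F (v z) - p z)) \<partial>lborel) \<le> \<epsilon>"
      using p(2) by (simp add: set_lebesgue_integral_def)
    have ig: "(\<integral>z. indicator Q z * \<bar>v z - g z\<bar> \<partial>lborel) \<le> \<epsilon>"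
      using g(2) by (simp add: set_lebesgue_integral_def)
    \<comment> \<open>\<open>dv\<close> is later multiplied by \<open>f\<close>, which is bounded by \<open>B\<close>.\<close>
    have \<epsilon>2: "0 < \<epsilon> / (B + 1)" using \<epsilon> B_nonneg by simp

    have close: "\<bar>(\<integral>z. indicator Q z * (f z * dv z) \<partial>lborel) - (- I)\<bar> \<le> \<epsilon> * B"
    proof -
      have by_parts: "(\<integral>z. indicator Q z * (f z * dv z) \<partial>lborel) = - (\<integral>z. indicator Q z * (d z \<bullet> p z) \<partial>lborel)"
        unfolding dv_def by (rule integration_by_parts[OF pc p'])
      have "\<bar>I - (\<integral>z. indicator Q z * (d z \<bullet> p z) \<partial>lborel)\<bar> \<le> (\<integral>z. B * norm (indicator Q z *\<^sub>R (F (v z) - p z)) \<partial>lborel)"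
        unfolding I_def
      proof (rule integral_diff_abs_le[OF integrable_inner_d[OF intFv] integrable_inner_d[OF intp]])
        have "integrable lborel (\<lambda>z. indicator Q z *\<^sub>R F (v z) - indicator Q z *\<^sub>R p z)"
          using intFv intp by (rule Bochner_Integration.integrable_diff)
        then show "integrable lborel (\<lambda>z. B * norm (indicator Q z *\<^sub>R (F (v z) - p z)))"
          unfolding scaleR_diff_right by (intro integrable_mult_right integrable_norm)
        show "\<bar>indicator Q z * (d z \<bullet> F (v z)) - indicator Q z * (d z \<bullet> p z)\<bar> \<le> B * norm (indicator Q z *\<^sub>R (F (v z) - p z))" for z
        proof -
          have "\<bar>d z \<bullet> (F (v z) - p z)\<bar> \<le> norm (d z) * norm (F (v z) - p z)" by (rule Cauchy_Schwarz_ineq2)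
          also have "\<dots> \<le> B * norm (F (v z) - p z)" using bounds(3) by (intro mult_right_mono) auto
          finally show ?thesis by (auto simp: indicator_def inner_diff_right)
        qed
      qed
      also have "\<dots> = B * (\<integral>z. norm (indicator Q z *\<^sub>R (F (v z) - p z)) \<partial>lborel)" by simp
      also have "\<dots> \<le> B * \<epsilon>" using ip B_nonneg by (rule mult_left_mono)
      finally show ?thesis unfolding by_parts using mult.commute[of B \<epsilon>] by linarith
    qed

    have "\<forall>\<^sub>F m in sequentially. osc_le cQ p (2 * ?h m + ?k m) \<epsilon>"
      by (rule eventually_osc_le[OF cQ_compact _ \<epsilon> hk(3)]) (rule continuous_on_subset[OF pc subset_UNIV])
    moreover have "\<forall>\<^sub>F m in sequentially. osc_le cQ g (2 * ?h m + ?k m) \<epsilon>"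
      by (rule eventually_osc_le[OF cQ_compact _ \<epsilon> hk(3)]) (rule continuous_on_subset[OF gc subset_UNIV])
    moreover have "\<forall>\<^sub>F m in sequentially. osc_le cQ (\<lambda>z. f z * dv z) (?h m + ?k m) \<epsilon>"
      by (rule eventually_osc_le[OF cQ_compact _ \<epsilon> hk(2)])
         (intro continuous_on_mult cont(1) continuous_on_subset[OF dvc subset_UNIV])
    moreover have "\<forall>\<^sub>F m in sequentially. osc_le cQ dv (?h m + ?k m) (\<epsilon> / (B + 1))"
      by (rule eventually_osc_le[OF cQ_compact _ \<epsilon>2 hk(2)]) (rule continuous_on_subset[OF dvc subset_UNIV])
    moreover have "\<forall>\<^sub>F m in sequentially. ?h m < \<eta>"
      by (rule order_tendstoD(2)[OF hk(1) near_boundary(1)])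
    moreover have "\<forall>\<^sub>F m in sequentially. (\<integral>z. indicator Q z * \<bar>?u m z - v z\<bar> \<partial>lborel) < \<epsilon>"
      by (rule order_tendstoD(2)[OF convu \<epsilon>])
    moreover have "\<forall>\<^sub>F m in sequentially. (\<integral>z. norm (indicator Q z *\<^sub>R (F (?u m z) - F (v z))) \<partial>lborel) < \<epsilon>"
      by (rule order_tendstoD(2)[OF convF \<epsilon>])
    ultimately show "\<forall>\<^sub>F m in sequentially. \<bar>X m - - I\<bar> \<le> \<epsilon> * tot"
    proof eventually_elim
      case (elim m)
      interpret fm: fine_mesh \<Omega> "M m" T "N m" "t m" "?h m" "?k m" by (rule fm)
      have Suc_time: "0 \<le> t m (Suc n)" "t m (Suc n) \<le> T" if "n < N m" for n
        using time_bounds[OF td, of "Suc n"] that by auto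
      have G: "surface_measure \<sigma> * norm (fm.face_difference (\<lambda>K. f (fm.anchor n K)) \<sigma>) \<le> G * measure lborel (fm.dual_core \<sigma>)"
        if n: "n < N m" and s: "\<sigma> \<in> fm.flux_faces" for n \<sigma>
      proof -
        note fs = fm.flux_face_sides[OF s]
        let ?K = "fm.side1 \<sigma>" and ?L = "fm.side2 \<sigma>"
        have "norm (fm.face_difference (\<lambda>K. f (fm.anchor n K)) \<sigma>) = \<bar>f (fm.anchor n ?K) - f (fm.anchor n ?L)\<bar>"
          unfolding fm.face_difference_interior[OF fs(1,2)] by (simp add: fm.norm_normal[OF fs(7,8)])
        also have "\<dots> \<le> B * norm (point (M m) ?L - point (M m) ?K)"
          using lipschitz[OF Suc_time[OF n]] by (simp add: fm.anchor_def norm_minus_commute)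
        finally have "surface_measure \<sigma> * norm (fm.face_difference (\<lambda>K. f (fm.anchor n K)) \<sigma>)
            \<le> surface_measure \<sigma> * (B * norm (point (M m) ?L - point (M m) ?K))"
          using fs(2) by (intro mult_left_mono) auto
        also have "\<dots> = B * (surface_measure \<sigma> * norm (point (M m) ?L - point (M m) ?K))" by simp
        also have "\<dots> \<le> B * (\<theta>g * measure lebesgue (dual (M m) \<sigma>))"
          using \<theta>g(2)[OF fs(1)] B_nonneg by (rule mult_left_mono)
        finally show ?thesis
          using s fm.flux_faces_subset by (simp add: G_def fm.measure_dual_core subset_iff)
      qed
      have ext: "f (fm.anchor n K) = 0" if n: "n < N m" and K: "K \<in> cells (M m)" "\<sigma> \<in> faces (M m) K"
        and s: "\<sigma> \<in> exterior_faces (M m)" "0 < surface_measure \<sigma>" for n K \<sigma>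
      proof -
        have "\<sigma> \<noteq> {}" using s(2) by (auto simp: surface_measure_def cylinder_def)
        then obtain y where y: "y \<in> \<sigma>" by blast
        have "dist (point (M m) K) y \<le> ?h m"
          using fm.cell_dist[OF K(1), of "point (M m) K" y] fm.face_closure[OF K y] fm.cell_facts(3)[OF K(1)] closure_subset by blast
        then show ?thesis
          unfolding fm.anchor_def using fm.exterior_frontier[OF s(1)] y elim(5) Suc_time[OF n]
          by (intro near_boundary(2)[of y]) auto
      qed
      have \<theta>': "measure lborel (fm.dual_core \<sigma>) \<le> \<theta> * measure lborel K" if "K \<in> cells (M m)" "\<sigma> \<in> faces (M m) K" for K \<sigma>
        using \<theta>(2)[OF that] fm.face_in_all_faces[OF that] by (simp add: fm.measure_dual_core)
      let ?J = "\<Sum>n<N m. \<Sum>\<sigma>\<in>fm.flux_faces. measure lborel (fm.dual_core \<sigma> \<times> slab (t m) n) * fm.jump (u m n) \<sigma>"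
      have J: "?J \<le> \<epsilon> * J"
      proof -
        have "(\<integral>z. indicator Q z * \<bar>?u m z - g z\<bar> \<partial>lborel) \<le> (\<integral>z. indicator Q z * \<bar>?u m z - v z\<bar> + indicator Q z * \<bar>v z - g z\<bar> \<partial>lborel)"
        proof (rule integral_mono)
          have *: "integrable lborel (\<lambda>z. indicator Q z * \<bar>w z - g z\<bar>)" if "integrable lborel (\<lambda>z. indicator Q z * w z)" for w
          proof -
            have "integrable lborel (\<lambda>z. \<bar>indicator Q z * w z - indicator Q z * g z\<bar>)"
              using that intg by (intro integrable_abs Bochner_Integration.integrable_diff) auto
            then show ?thesis by (simp add: abs_mult flip: right_diff_distrib)
          qed
          show "integrable lborel (\<lambda>z. indicator Q z * \<bar>?u m z - g z\<bar>)" by (rule *[OF intu])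
          show "integrable lborel (\<lambda>z. indicator Q z * \<bar>?u m z - v z\<bar> + indicator Q z * \<bar>v z - g z\<bar>)"
            by (rule Bochner_Integration.integrable_add[OF intuv *[OF intv]])
        qed (auto simp: indicator_def)
        also have "\<dots> = (\<integral>z. indicator Q z * \<bar>?u m z - v z\<bar> \<partial>lborel) + (\<integral>z. indicator Q z * \<bar>v z - g z\<bar> \<partial>lborel)"
        proof (rule Bochner_Integration.integral_add[OF intuv])
          have "integrable lborel (\<lambda>z. \<bar>indicator Q z * v z - indicator Q z * g z\<bar>)"
            using intv intg by (intro integrable_abs Bochner_Integration.integrable_diff) auto
          then show "integrable lborel (\<lambda>z. indicator Q z * \<bar>v z - g z\<bar>)" by (simp add: abs_mult flip: right_diff_distrib)
        qed
        also have "\<dots> \<le> 2 * \<epsilon>" using elim(6) ig by simp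
        finally have 1: "(\<integral>z. indicator Q z * \<bar>?u m z - g z\<bar> \<partial>lborel) \<le> 2 * \<epsilon>" .
        have "?J \<le> real NE * \<theta> * ((\<integral>z. indicator Q z * \<bar>?u m z - g z\<bar> \<partial>lborel) + \<epsilon> * V) + \<epsilon> * V"
          unfolding V_def by (rule fm.jumps_le[OF intu gc elim(2) less_imp_le[OF \<epsilon>] \<theta>(1) \<theta>' NE])
        also have "\<dots> \<le> real NE * \<theta> * (2 * \<epsilon> + \<epsilon> * V) + \<epsilon> * V"
          using 1 \<theta>(1) by (intro add_right_mono mult_left_mono) auto
        also have "\<dots> = \<epsilon> * J" by (simp add: J_def algebra_simps)
        finally show ?thesis .
      qed
      have Fp: "(\<integral>z. norm (indicator Q z *\<^sub>R (F (?u m z) - p z)) \<partial>lborel) \<le> 2 * \<epsilon>"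
      proof -
        have i: "integrable lborel (\<lambda>z. norm (indicator Q z *\<^sub>R (a z - b z)))"
          if "integrable lborel (\<lambda>z. indicator Q z *\<^sub>R a z)" "integrable lborel (\<lambda>z. indicator Q z *\<^sub>R b z)" for a b :: "'a \<times> real \<Rightarrow> 'a"
          unfolding scaleR_diff_right using that by (intro integrable_norm Bochner_Integration.integrable_diff)
        have "(\<integral>z. norm (indicator Q z *\<^sub>R (F (?u m z) - p z)) \<partial>lborel)
           \<le> (\<integral>z. norm (indicator Q z *\<^sub>R (F (?u m z) - F (v z))) + norm (indicator Q z *\<^sub>R (F (v z) - p z)) \<partial>lborel)"
        proof (rule integral_mono[OF i[OF intFu intp] Bochner_Integration.integrable_add[OF i[OF intFu intFv] i[OF intFv intp]]])
          fix z
          show "norm (indicator Q z *\<^sub>R (F (?u m z) - p z)) \<le> norm (indicator Q z *\<^sub>R (F (?u m z) - F (v z))) + norm (indicator Q z *\<^sub>R (F (v z) - p z))"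
            using norm_triangle_ineq[of "F (?u m z) - F (v z)" "F (v z) - p z"] by (auto simp: indicator_def)
        qed
        also have "\<dots> = (\<integral>z. norm (indicator Q z *\<^sub>R (F (?u m z) - F (v z))) \<partial>lborel) + (\<integral>z. norm (indicator Q z *\<^sub>R (F (v z) - p z)) \<partial>lborel)"
          by (rule Bochner_Integration.integral_add[OF i[OF intFu intFv] i[OF intFv intp]])
        also have "\<dots> \<le> 2 * \<epsilon>" using elim(7) ip by simp
        finally show ?thesis .
      qed
      have "\<bar>X m - (\<integral>z. indicator Q z * (f z * dv z) \<partial>lborel)\<bar>
        \<le> G * (C * ?J) + G * (\<integral>z. norm (indicator Q z *\<^sub>R (F (?u m z) - p z)) \<partial>lborel)
          + G * ((1 + real DIM('a)) * (\<epsilon> * V)) + (\<epsilon> + B * (\<epsilon> / (B + 1))) * V"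
        unfolding X_def V_def dv_def fm.anchor_def[symmetric]
      proof (rule fm.flux_term_near[where u="u m" and Fl="Fl m", OF intFu G0 G C(1) _ _ ext pc elim(1) less_imp_le[OF \<epsilon>] p' borel(1) bounds(1)])
        show "norm (Fl m n \<sigma> - F (u m n (fm.side1 \<sigma>))) \<le> C * fm.jump (u m n) \<sigma>" if "n < N m" "\<sigma> \<in> fm.flux_faces" for n \<sigma>
          unfolding fm.jump_def by (rule C(2)[OF fm.flux_face_sides(1)[OF that(2)] that(1)])
        show "norm (Fl m n \<sigma> - F (u m n (fm.side2 \<sigma>))) \<le> C * fm.jump (u m n) \<sigma>" if "n < N m" "\<sigma> \<in> fm.flux_faces" for n \<sigma>
          unfolding fm.jump_def by (rule C(3)[OF fm.flux_face_sides(1)[OF that(2)] that(1)])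
      qed (use elim(3,4) \<epsilon> \<epsilon>2 in \<open>simp_all add: dv_def[abs_def]\<close>)
      also have "\<dots> \<le> G * (C * (\<epsilon> * J)) + G * (2 * \<epsilon>) + G * ((1 + real DIM('a)) * (\<epsilon> * V)) + (\<epsilon> + \<epsilon>) * V"
      proof -
        have "B * (\<epsilon> / (B + 1)) \<le> \<epsilon>" using B_nonneg \<epsilon> by (simp add: field_simps)
        then have "(\<epsilon> + B * (\<epsilon> / (B + 1))) * V \<le> (\<epsilon> + \<epsilon>) * V" using V0 by (intro mult_right_mono) auto
        moreover have "G * (C * ?J) \<le> G * (C * (\<epsilon> * J))" using J G0 C(1) by (intro mult_left_mono)
        moreover have "G * (\<integral>z. norm (indicator Q z *\<^sub>R (F (?u m z) - p z)) \<partial>lborel) \<le> G * (2 * \<epsilon>)" using Fp G0 by (rule mult_left_mono)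
        ultimately show ?thesis by linarith
      qed
      finally have "\<bar>X m - - I\<bar> \<le> G * (C * (\<epsilon> * J)) + G * (2 * \<epsilon>) + G * ((1 + real DIM('a)) * (\<epsilon> * V)) + (\<epsilon> + \<epsilon>) * V + \<epsilon> * B"
        using close by linarith
      also have "\<dots> = \<epsilon> * tot" by (simp add: tot_def algebra_simps)
      finally show ?case .
    qed
  qed

  have "Time m + Init m = X m" for m
  proof -
    interpret fm: fine_mesh \<Omega> "M m" T "N m" "t m" "?h m" "?k m" by (rule fm)
    show ?thesis
      unfolding Time_def Init_def X_def
      by (rule fm.scheme_summed[where u="u m" and Fl="Fl m" and f=f, unfolded fm.anchor_def]) (use scheme zero(2) in blast)+
  qed
  then have "X \<longlonglongrightarrow> (\<integral>z. indicator Q z * (v z * e z) \<partial>lborel) + (\<integral>x. v0 x * f (x, 0) \<partial>lborel)"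
    using tendsto_add[OF lim1 lim2] by simp
  then show ?thesis
    using LIMSEQ_unique[OF lim3] by (simp add: I_def)
qed

end

section \<open>Borel versions and smooth test functions\<close>

text \<open>
  Integrals with respect to the completed measure do not involve completed products once the
  integrand is replaced by a Borel version.
\<close>

lemma integral_lebesgue_eq_lborel:
  fixes a b :: "'b::euclidean_space \<Rightarrow> 'c::euclidean_space"
  assumes b: "b \<in> borel_measurable borel" and ae: "AE x in lborel. a x = b x"
  shows "(\<integral>x. a x \<partial>lebesgue) = (\<integral>x. b x \<partial>lborel)" and "integrable lebesgue a \<longleftrightarrow> integrable lborel b"
proof -
  have bl: "b \<in> borel_measurable lborel" using b by simp
  have bL: "b \<in> borel_measurable lebesgue" using measurable_completion[OF bl] .
  have aeL: "AE x in lebesgue. b x = a x" using AE_completion[OF ae] by (auto elim: eventually_mono)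
  have aL: "a \<in> borel_measurable lebesgue" using bL aeL by (rule borel_measurable_AE)
  have aeL': "AE x in lebesgue. a x = b x" using AE_completion[OF ae] .
  show "(\<integral>x. a x \<partial>lebesgue) = (\<integral>x. b x \<partial>lborel)"
    using integral_cong_AE[OF aL bL aeL'] integral_completion[OF bl] by simp
  show "integrable lebesgue a \<longleftrightarrow> integrable lborel b"
    using integrable_cong_AE[OF aL bL aeL'] integrable_completion[OF bl] by simp
qed

lemma borel_version:
  fixes w :: "'b::euclidean_space \<Rightarrow> real"
  assumes S: "S \<in> sets borel" and w: "set_integrable lebesgue S w"
  shows "\<exists>v. v \<in> borel_measurable borel \<and> (\<forall>x. x \<notin> S \<longrightarrow> v x = 0) \<and> (AE x in lborel. x \<in> S \<longrightarrow> v x = w x)"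
proof -
  have "(\<lambda>x. indicator S x * w x) \<in> borel_measurable lebesgue"
    using borel_measurable_integrable[OF w[unfolded set_integrable_def]] by simp
  then obtain g where g: "g \<in> borel_measurable lborel" "AE x in lborel. indicator S x * w x = g x"
    using completion_ex_borel_measurable_real[of "\<lambda>x. indicator S x * w x" lborel] by blast
  show ?thesis
  proof (intro exI conjI allI impI)
    show "(\<lambda>x. indicator S x * g x) \<in> borel_measurable borel" using g(1) S by simp
    show "indicator S x * g x = 0" if "x \<notin> S" for x using that by simp
    show "AE x in lborel. x \<in> S \<longrightarrow> indicator S x * g x = w x" using g(2) by eventually_elim auto
  qed
qed

text \<open>
  For almost every time the inner integrand agrees almost everywhere with a slice of the
  Borel version, so Fubini for Borel functions applies.
\<close>

lemma iterated_lebesgue_integral: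
  fixes H :: "'a::euclidean_space \<times> real \<Rightarrow> real" and h :: "'a \<Rightarrow> real \<Rightarrow> real"
  assumes \<Omega>: "\<Omega> \<in> sets borel" and H: "integrable lborel H" "\<And>z. z \<notin> \<Omega> \<times> {0<..<T} \<Longrightarrow> H z = 0"
    and ae: "AE z in lborel. z \<in> \<Omega> \<times> {0<..<T} \<longrightarrow> h (fst z) (snd z) = H z"
  shows "(LINT s:{0<..<T}|lebesgue. LINT x:\<Omega>|lebesgue. h x s) = (\<integral>z. H z \<partial>lborel)"
proof -
  have Hp: "integrable (lborel \<Otimes>\<^sub>M lborel) (\<lambda>(x, s). H (x, s))" using H(1) by (simp add: lborel_prod)
  have [measurable]: "H \<in> borel_measurable borel" using borel_measurable_integrable[OF H(1)] by simp
  obtain N where N: "{z. \<not> (z \<in> \<Omega> \<times> {0<..<T} \<longrightarrow> h (fst z) (snd z) = H z)} \<subseteq> N" "N \<in> null_sets lborel"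
    using ae by (auto simp: eventually_ae_filter)
  have Nm: "N \<in> sets (lborel \<Otimes>\<^sub>M lborel)" using null_setsD2[OF N(2)] unfolding lborel_prod .
  have "AE z in lborel \<Otimes>\<^sub>M lborel. z \<notin> N"
    using N(2) by (simp add: lborel_prod AE_not_in)
  from lborel_pair.AE_pair[OF this] have 1: "AE x in lborel. AE s in lborel. (x, s) \<notin> N" .
  have "{z \<in> space (lborel \<Otimes>\<^sub>M lborel). (fst z, snd z) \<notin> N} = space (lborel \<Otimes>\<^sub>M lborel) - N" by auto
  then have "{z \<in> space (lborel \<Otimes>\<^sub>M lborel). (fst z, snd z) \<notin> N} \<in> sets (lborel \<Otimes>\<^sub>M lborel)"
    using sets.compl_sets[OF Nm] by (simp only:)
  from iffD1[OF lborel_pair.AE_commute[OF this] 1]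
  have aeN: "AE s in lborel. AE x in lborel. (x, s) \<notin> N" .
  have "(LINT s:{0<..<T}|lebesgue. LINT x:\<Omega>|lebesgue. h x s)
     = (\<integral>s. indicator {0<..<T} s * (\<integral>x. indicator \<Omega> x * h x s \<partial>lebesgue) \<partial>lebesgue)"
    by (simp add: set_lebesgue_integral_def)
  also have "\<dots> = (\<integral>s. (\<integral>x. H (x, s) \<partial>lborel) \<partial>lborel)"
  proof (rule integral_lebesgue_eq_lborel(1))
    show "AE s in lborel. indicator {0<..<T} s * (\<integral>x. indicator \<Omega> x * h x s \<partial>lebesgue) = (\<integral>x. H (x, s) \<partial>lborel)"
      using aeN
    proof eventually_elim
      case (elim s)
      show ?case
      proof (cases "s \<in> {0<..<T}")
        case True
        have "(\<integral>x. indicator \<Omega> x * h x s \<partial>lebesgue) = (\<integral>x. H (x, s) \<partial>lborel)"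
        proof (rule integral_lebesgue_eq_lborel(1))
          show "AE x in lborel. indicator \<Omega> x * h x s = H (x, s)"
            using elim
          proof eventually_elim
            case (elim x)
            then have "(x, s) \<in> \<Omega> \<times> {0<..<T} \<longrightarrow> h x s = H (x, s)" using N(1) by fastforce
            then show ?case using H(2)[of "(x, s)"] True by (cases "x \<in> \<Omega>") auto
          qed
        qed measurable
        then show ?thesis using True by simp
      next
        case False
        then have "\<And>x. H (x, s) = 0" by (intro H(2)) auto
        then show ?thesis using False by simp
      qed
    qed
    show "(\<lambda>s. \<integral>x. H (x, s) \<partial>lborel) \<in> borel_measurable borel"
      using lborel_pair.integrable_snd[OF Hp] by (simp add: borel_measurable_integrable flip: measurable_lborel1)
  qed
  also have "\<dots> = (\<integral>z. H z \<partial>lborel)"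
    using lborel_pair.integral_snd[OF Hp] by (simp add: lborel_prod)
  finally show ?thesis .
qed

text \<open>
  The extended function is continuous on two relatively open sets that cover the closed
  cylinder: the domain of the given function and the complement of the support.
\<close>

lemma zero_extension:
  fixes g :: "'a::euclidean_space \<times> real \<Rightarrow> real"
  assumes \<Omega>: "open \<Omega>" and C: "compact C" "C \<subseteq> \<Omega> \<times> {0..<T}"
    and g: "continuous_on (\<Omega> \<times> {0..<T}) g" "\<And>z. z \<in> \<Omega> \<times> {0..<T} - C \<Longrightarrow> g z = 0"
  defines "G \<equiv> \<lambda>z. if z \<in> \<Omega> \<times> {0..<T} then g z else 0"
  shows "continuous_on (closure \<Omega> \<times> {0..T}) G" "G \<in> borel_measurable borel" "\<exists>B. \<forall>z. \<bar>G z\<bar> \<le> B"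
proof -
  let ?S = "\<Omega> \<times> {0..<T}" and ?cQ = "closure \<Omega> \<times> {0..T}"
  have S: "?S \<in> sets borel" using \<Omega> by (intro borel_Times) auto
  have G0: "G z = 0" if "z \<notin> C" for z using g(2)[of z] that by (auto simp: G_def)
  have un: "?S \<union> (?cQ - C) = ?cQ" using C(2) closure_subset[of \<Omega>] by fastforce
  have "continuous_on (?S \<union> (?cQ - C)) G"
  proof (rule continuous_on_Un_local_open)
    have "?S = ?cQ \<inter> (\<Omega> \<times> {..<T})" using closure_subset[of \<Omega>] by auto
    moreover have "open (\<Omega> \<times> {..<T})" using \<Omega> by (intro open_Times) auto
    ultimately show "openin (top_of_set (?S \<union> (?cQ - C))) ?S" unfolding un by (metis openin_open_Int)
    have "?cQ - C = ?cQ \<inter> - C" by blast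
    moreover have "open (- C)" using compact_imp_closed[OF C(1)] by (rule open_Compl)
    ultimately show "openin (top_of_set (?S \<union> (?cQ - C))) (?cQ - C)" unfolding un by (metis openin_open_Int)
    show "continuous_on ?S G" using g(1) by (rule continuous_on_eq) (simp add: G_def)
    show "continuous_on (?cQ - C) G"
      by (rule continuous_on_eq[OF continuous_on_const[of _ 0]]) (use G0 in auto)
  qed
  then show "continuous_on ?cQ G" unfolding un .
  show "G \<in> borel_measurable borel"
    unfolding G_def using S g(1) by (intro borel_measurable_continuous_on_if) auto
  have "compact (g ` C)" using C g(1) by (intro compact_continuous_image) (auto intro: continuous_on_subset)
  then obtain B where B: "\<forall>y\<in>g ` C. norm y \<le> B" using compact_imp_bounded bounded_iff by blast
  have "\<bar>G z\<bar> \<le> \<bar>B\<bar>" for z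
  proof (cases "z \<in> C")
    case True
    then have "\<bar>g z\<bar> \<le> B" using B by auto
    then show ?thesis by (auto simp: G_def)
  qed (simp add: G0)
  then show "\<exists>B. \<forall>z. \<bar>G z\<bar> \<le> B" by blast
qed

lemma smooth_compact_support_test_function:
  fixes \<Omega> :: "'a::euclidean_space set"
  assumes \<Omega>: "bounded \<Omega>" "open \<Omega>" and T: "0 < T" and \<phi>: "\<phi> \<in> smooth_compact_support (\<Omega> \<times> {0..<T})"
  shows "\<exists>f e d B \<eta>. test_function \<Omega> T f e d B \<eta> \<and> (\<forall>x\<in>\<Omega>. f (x, 0) = \<phi> (x, 0)) \<and>
    (\<forall>x\<in>\<Omega>. \<forall>s\<in>{0<..<T}. deriv (\<lambda>r. \<phi> (x, r)) s = e (x, s) \<and> gradient (\<lambda>y. \<phi> (y, s)) x = d (x, s))"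
proof -
  let ?S = "\<Omega> \<times> {0..<T}"
  have "C_k_on (Suc 0) ?S \<phi>" using \<phi> by (simp add: smooth_compact_support_def)
  then obtain \<phi>' where \<phi>': "\<And>z. z \<in> ?S \<Longrightarrow> (\<phi> has_derivative \<phi>' z) (at z within ?S)"
    "\<And>v. continuous_on ?S (\<lambda>z. \<phi>' z v)" by auto
  obtain C where C: "compact C" "C \<subseteq> ?S" "\<And>z. z \<in> ?S - C \<Longrightarrow> \<phi> z = 0"
    using \<phi> by (auto simp: smooth_compact_support_def)
  have clC: "closed C" by (rule compact_imp_closed[OF C(1)])
  have c\<phi>: "continuous_on ?S \<phi>" using \<phi>'(1) by (rule has_derivative_continuous_on)

  \<comment> \<open>At interior points of the domain the derivative within the domain is the ordinary one, so it
    vanishes off the support; at time \<open>0\<close> this follows by continuity.\<close>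
  have int_der: "(\<phi> has_derivative \<phi>' (x, s)) (at (x, s))" if "x \<in> \<Omega>" "0 < s" "s < T" for x s
  proof -
    have op: "open (\<Omega> \<times> {0<..<T})" using \<Omega>(2) by (intro open_Times) auto
    have "(\<phi> has_derivative \<phi>' (x, s)) (at (x, s) within \<Omega> \<times> {0<..<T})"
      by (rule has_derivative_subset[OF \<phi>'(1)]) (use that in auto)
    then show ?thesis using at_within_open[OF _ op, of "(x, s)"] that by simp
  qed
  have zero_pos: "\<phi>' (x, s) v = 0" if xs: "(x, s) \<in> ?S - C" "0 < s" for x s v
  proof -
    have op: "open (\<Omega> \<times> {0<..<T} - C)" using \<Omega>(2) clC by (intro open_Diff open_Times) auto
    have d0: "(\<phi> has_derivative (\<lambda>_. 0)) (at (x, s))"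
      by (rule has_derivative_transform_within_open[OF has_derivative_const op]) (use xs C(3) in auto)
    have "\<phi>' (x, s) = (\<lambda>_. 0)"
      by (rule has_derivative_unique[OF int_der d0]) (use xs in auto)
    then show ?thesis by simp
  qed
  have zero_out: "\<phi>' z v = 0" if z: "z \<in> ?S - C" for z v
  proof (cases "0 < snd z")
    case True
    then show ?thesis using zero_pos[of "fst z" "snd z" v] z by simp
  next
    case False
    obtain x s where zx: "z = (x, s)" by fastforce
    then have z0: "z = (x, 0)" and x: "x \<in> \<Omega>" "(x, 0) \<notin> C" using False z by auto
    have op: "open ((\<lambda>s::real. (x, s)) -` (- C))"
      using clC by (intro open_vimage open_Compl continuous_intros)
    obtain r where r: "r > 0" "ball 0 r \<subseteq> (\<lambda>s::real. (x, s)) -` (- C)"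
      using openE[OF op, of 0] x(2) by auto
    have "((\<lambda>s. (x, s)) \<longlongrightarrow> (x, 0)) (at_right 0)" by (intro tendsto_intros)
    moreover have ev: "\<forall>\<^sub>F s in at_right 0. 0 < s \<and> s < min r T"
      using eventually_at_right_real[of 0 "min r T"] r(1) T by auto
    ultimately have "filterlim (\<lambda>s. (x, s)) (at (x, 0) within ?S) (at_right 0)"
      unfolding filterlim_at using x(1) by (auto elim!: eventually_mono)
    moreover have "((\<lambda>z. \<phi>' z v) \<longlongrightarrow> \<phi>' (x, 0) v) (at (x, 0) within ?S)"
      using \<phi>'(2)[of v] x(1) T by (auto simp: continuous_on_def)
    ultimately have "((\<lambda>s. \<phi>' (x, s) v) \<longlongrightarrow> \<phi>' (x, 0) v) (at_right 0)"
      by (rule filterlim_compose[rotated])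
    moreover have "\<forall>\<^sub>F s in at_right 0. \<phi>' (x, s) v = 0"
      using ev
    proof eventually_elim
      case (elim s)
      then have "s \<in> ball 0 r" by simp
      then have "(x, s) \<notin> C" using r(2) by blast
      then show ?case using elim x(1) by (intro zero_pos) auto
    qed
    then have "((\<lambda>s. \<phi>' (x, s) v) \<longlongrightarrow> 0) (at_right 0)"
      by (rule tendsto_eventually)
    ultimately show ?thesis unfolding z0 using tendsto_unique[OF trivial_limit_at_right_real] by blast
  qed

  define f where "f z = (if z \<in> ?S then \<phi> z else 0)" for z
  define e where "e z = (if z \<in> ?S then \<phi>' z (0, 1) else 0)" for z
  define D where "D b z = (if z \<in> ?S then \<phi>' z (b, 0) else 0)" for b z
  define d where "d z = (\<Sum>b\<in>Basis. D b z *\<^sub>R b)" for z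
  have zf1: "continuous_on (closure \<Omega> \<times> {0..T}) (f)"
    unfolding f_def[abs_def] by (rule zero_extension(1)[OF \<Omega>(2) C(1,2) c\<phi>]) (rule C(3))
  have zf2: "(f) \<in> borel_measurable borel"
    unfolding f_def[abs_def] by (rule zero_extension(2)[OF \<Omega>(2) C(1,2) c\<phi>]) (rule C(3))
  have zf3: "\<exists>B. \<forall>z. \<bar>(f) z\<bar> \<le> B"
    unfolding f_def[abs_def] by (rule zero_extension(3)[OF \<Omega>(2) C(1,2) c\<phi>]) (rule C(3))
  have ze1: "continuous_on (closure \<Omega> \<times> {0..T}) (e)"
    unfolding e_def[abs_def] by (rule zero_extension(1)[OF \<Omega>(2) C(1,2) \<phi>'(2)]) (rule zero_out)
  have ze2: "(e) \<in> borel_measurable borel"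
    unfolding e_def[abs_def] by (rule zero_extension(2)[OF \<Omega>(2) C(1,2) \<phi>'(2)]) (rule zero_out)
  have ze3: "\<exists>B. \<forall>z. \<bar>(e) z\<bar> \<le> B"
    unfolding e_def[abs_def] by (rule zero_extension(3)[OF \<Omega>(2) C(1,2) \<phi>'(2)]) (rule zero_out)
  have zD1: "continuous_on (closure \<Omega> \<times> {0..T}) (D b)" for b
    unfolding D_def[abs_def] by (rule zero_extension(1)[OF \<Omega>(2) C(1,2) \<phi>'(2)]) (rule zero_out)
  have zD2: "(D b) \<in> borel_measurable borel" for b
    unfolding D_def[abs_def] by (rule zero_extension(2)[OF \<Omega>(2) C(1,2) \<phi>'(2)]) (rule zero_out)
  have zD3: "\<exists>B. \<forall>z. \<bar>(D b) z\<bar> \<le> B" for b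
    unfolding D_def[abs_def] by (rule zero_extension(3)[OF \<Omega>(2) C(1,2) \<phi>'(2)]) (rule zero_out)
  obtain Bf where Bf: "\<And>z. \<bar>f z\<bar> \<le> Bf" using zf3 by blast
  obtain Be where Be: "\<And>z. \<bar>e z\<bar> \<le> Be" using ze3 by blast
  obtain BD where BD: "\<And>b z. \<bar>D b z\<bar> \<le> BD b" using zD3 by metis
  have BD0: "0 \<le> BD b" for b using BD[of b undefined] by linarith
  define B where "B = \<bar>Bf\<bar> + \<bar>Be\<bar> + (\<Sum>b\<in>Basis. BD b)"
  have sB: "0 \<le> (\<Sum>b\<in>Basis. BD b)" using BD0 by (intro sum_nonneg)
  have f0: "f z = 0" if "z \<notin> C" for z using C(3)[of z] that by (auto simp: f_def)
  have dv: "d (x, s) \<bullet> v = \<phi>' (x, s) (v, 0)" if xs: "(x, s) \<in> ?S" for x s v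
  proof -
    have lin: "linear (\<phi>' (x, s))" by (rule has_derivative_linear[OF \<phi>'(1)[OF xs]])
    have "(v, 0) = (\<Sum>b\<in>Basis. (v \<bullet> b) *\<^sub>R (b, 0::real))"
      by (simp add: prod_eq_iff fst_sum snd_sum euclidean_representation)
    then have "\<phi>' (x, s) (v, 0) = (\<Sum>b\<in>Basis. (v \<bullet> b) * \<phi>' (x, s) (b, 0))"
      by (simp only: linear_sum[OF lin] linear_cmul[OF lin] real_scaleR_def)
    then show ?thesis using xs by (simp add: d_def D_def inner_sum_left) (simp add: inner_commute mult.commute)
  qed

  have "compact (fst ` C)" using C(1) by (intro compact_continuous_image continuous_intros)
  moreover have "fst ` C \<inter> frontier \<Omega> = {}"
    using C(2) \<Omega>(2) by (auto simp: frontier_def interior_open)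
  ultimately obtain \<rho> where \<rho>: "\<rho> > 0" "\<And>x y. x \<in> fst ` C \<Longrightarrow> y \<in> frontier \<Omega> \<Longrightarrow> \<rho> \<le> dist x y"
    using separate_compact_closed[of "fst ` C" "frontier \<Omega>"] by auto
  have clfC: "closed (fst ` C)" using \<open>compact (fst ` C)\<close> by (rule compact_imp_closed)

  have space0: "((\<lambda>y. \<phi> (y, s)) has_derivative (\<lambda>v. d (x, s) \<bullet> v)) (at x)" if x: "x \<in> \<Omega>" and s: "0 \<le> s" "s < T" for x s
  proof -
    have xs: "(x, s) \<in> ?S" using x s by auto
    have l: "((\<lambda>y. (y, s)) has_derivative (\<lambda>v. (v, 0))) (at x within \<Omega>)" by (auto intro!: derivative_eq_intros)
    have "((\<lambda>y. \<phi> (y, s)) has_derivative (\<lambda>v. \<phi>' (x, s) (v, 0))) (at x within \<Omega>)"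
      by (rule has_derivative_in_compose2[OF \<phi>'(1) _ x l]) (use s in auto)
    then show ?thesis using at_within_open[OF x \<Omega>(2)] by (simp add: dv[OF xs])
  qed
  have time0: "((\<lambda>r. \<phi> (x, r)) has_real_derivative e (x, s)) (at s)" if x: "x \<in> \<Omega>" and s: "0 < s" "s < T" for x s
  proof -
    have l: "((\<lambda>r. (x, r)) has_derivative (\<lambda>v. (0, v))) (at s)" by (auto intro!: derivative_eq_intros)
    have lin: "linear (\<phi>' (x, s))" by (rule has_derivative_linear[OF int_der[OF x s]])
    have eq: "(\<lambda>v. \<phi>' (x, s) (0, v)) = (*) (\<phi>' (x, s) (0, 1))"
    proof
      fix v
      have "(0::'a, v) = v *\<^sub>R (0, 1)" by simp
      then show "\<phi>' (x, s) (0, v) = \<phi>' (x, s) (0, 1) * v"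
        by (simp only: linear_cmul[OF lin] real_scaleR_def mult.commute)
    qed
    have e: "e (x, s) = \<phi>' (x, s) (0, 1)" using x s by (simp add: e_def)
    show ?thesis
      unfolding has_field_derivative_def e eq[symmetric] by (rule has_derivative_compose[OF l int_der[OF x s]])
  qed

  have "test_function \<Omega> T f e d B (\<rho> / 2)"
  proof
    show "f \<in> borel_measurable borel" "e \<in> borel_measurable borel" using zf2 ze2 by auto
    show "d \<in> borel_measurable borel"
      unfolding d_def using zD2 by (intro borel_measurable_sum borel_measurable_scaleR) auto
    show "\<bar>f z\<bar> \<le> B" "\<bar>e z\<bar> \<le> B" for z using Bf[of z] Be[of z] sB by (auto simp: B_def)
    show "norm (d z) \<le> B" for z
    proof -
      have "norm (d z) \<le> (\<Sum>b\<in>Basis. norm (D b z *\<^sub>R b))" unfolding d_def by (rule norm_sum)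
      also have "\<dots> \<le> (\<Sum>b\<in>Basis. BD b)" using BD by (intro sum_mono) auto
      finally show ?thesis by (simp add: B_def)
    qed
    show "continuous_on (closure \<Omega> \<times> {0..T}) f" "continuous_on (closure \<Omega> \<times> {0..T}) e" using zf1 ze1 by auto
    show "f (x, s) = 0" if "x \<notin> \<Omega>" for x s using that by (simp add: f_def)
    show "f (x, T) = 0" for x by (simp add: f_def)
    show "0 < \<rho> / 2" using \<rho> by simp
    show "f (x, s) = 0" if "y \<in> frontier \<Omega>" "dist x y \<le> \<rho> / 2" for x y s
    proof (rule f0)
      show "(x, s) \<notin> C" using \<rho>(2)[of x y] \<rho>(1) that by force
    qed
    show "((\<lambda>y. f (y, s)) has_derivative (\<lambda>v. d (x, s) \<bullet> v)) (at x)" if s: "0 \<le> s" "s \<le> T" for x s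
    proof (cases "x \<in> \<Omega> \<and> s < T")
      case True
      show ?thesis
        by (rule has_derivative_transform_within_open[OF space0 \<Omega>(2)]) (use True s in \<open>auto simp: f_def\<close>)
    next
      case False
      then have "d (x, s) = 0" by (auto simp: d_def D_def)
      moreover have "((\<lambda>y. f (y, s)) has_derivative (\<lambda>v. 0)) (at x)"
      proof (cases "s < T")
        case True
        then have x: "x \<in> - fst ` C" using False C(2) by force
        have op: "open (- fst ` C)" using clfC by (rule open_Compl)
        show ?thesis
        proof (rule has_derivative_transform_within_open[OF has_derivative_const op x])
          fix y assume "y \<in> - fst ` C"
          then have "(y, s) \<notin> C" by (metis ComplD fst_conv image_eqI)
          then show "0 = f (y, s)" using f0 by simp
        qed
      next
        case False
        then have "(\<lambda>y. f (y, s)) = (\<lambda>_. 0)" by (auto simp: f_def)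
        then show ?thesis by simp
      qed
      ultimately show ?thesis by simp
    qed
    show "((\<lambda>s. f (x, s)) has_real_derivative e (x, s)) (at s)" if "x \<in> closure \<Omega>" "0 < s" "s < T" for x s
    proof (cases "x \<in> \<Omega>")
      case True
      have "open {0<..<T}" "s \<in> {0<..<T}" using that by auto
      then show ?thesis
        by (rule has_field_derivative_transform_within_open[OF time0[OF True that(2,3)]]) (use True in \<open>auto simp: f_def\<close>)
    next
      case False
      then have "(\<lambda>s. f (x, s)) = (\<lambda>_. 0)" "e (x, s) = 0" by (auto simp: f_def e_def)
      then show ?thesis by simp
    qed
  qed fact+
  moreover have "f (x, 0) = \<phi> (x, 0)" if "x \<in> \<Omega>" for x using that T by (simp add: f_def)
  moreover have "deriv (\<lambda>r. \<phi> (x, r)) s = e (x, s)" if "x \<in> \<Omega>" "0 < s" "s < T" for x s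
    using DERIV_imp_deriv[OF time0[OF that]] .
  moreover have "gradient (\<lambda>y. \<phi> (y, s)) x = d (x, s)" if "x \<in> \<Omega>" "0 < s" "s < T" for x s
  proof -
    have G: "GDERIV (\<lambda>y. \<phi> (y, s)) x :> d (x, s)"
      using space0[of x s] that by (simp add: gderiv_def inner_commute)
    have "D' = d (x, s)" if "GDERIV (\<lambda>y. \<phi> (y, s)) x :> D'" for D'
    proof -
      have "(\<lambda>h. h \<bullet> D') = (\<lambda>h. h \<bullet> d (x, s))"
        using has_derivative_unique[OF that[unfolded gderiv_def] G[unfolded gderiv_def]] .
      from fun_cong[OF this, of "D' - d (x, s)"] have "(D' - d (x, s)) \<bullet> (D' - d (x, s)) = 0"
        by (simp add: inner_diff_right)
      then show ?thesis by simp
    qed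
    then show ?thesis unfolding gradient_def using G by (rule the_equality[rotated])
  qed
  ultimately show ?thesis by (intro exI[of _ f] exI[of _ e] exI[of _ d] exI[of _ B] exI[of _ "\<rho> / 2"]) simp
qed

section \<open>Convergence to a weak solution\<close>

lemma L1_convergence_borel:
  fixes G :: "real \<Rightarrow> 'c::euclidean_space" and w :: "nat \<Rightarrow> 'b::euclidean_space \<Rightarrow> real"
  assumes conv: "L1_converges S (\<lambda>m z. G (w m z)) (\<lambda>z. G (a z))" and S: "S \<in> sets borel" and G: "continuous_on UNIV G"
    and w: "\<And>m. w m \<in> borel_measurable borel" and v: "v \<in> borel_measurable borel" "AE z in lborel. z \<in> S \<longrightarrow> v z = a z"
  shows "integrable lborel (\<lambda>z. indicator S z *\<^sub>R G (w m z))" "integrable lborel (\<lambda>z. indicator S z *\<^sub>R G (v z))"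
    "(\<lambda>m. \<integral>z. norm (indicator S z *\<^sub>R (G (w m z) - G (v z))) \<partial>lborel) \<longlonglongrightarrow> 0"
proof -
  have [measurable]: "G \<in> borel_measurable borel" using G by (rule borel_measurable_continuous_onI)
  note [measurable] = S w v(1)
  have "integrable lebesgue (\<lambda>z. indicator S z *\<^sub>R G (w m z))"
    using conv by (simp add: L1_converges_def set_integrable_def)
  then show "integrable lborel (\<lambda>z. indicator S z *\<^sub>R G (w m z))"
    by (subst (asm) integral_lebesgue_eq_lborel(2)[where b="\<lambda>z. indicator S z *\<^sub>R G (w m z)"]) auto
  have "integrable lebesgue (\<lambda>z. indicator S z *\<^sub>R G (a z))"
    using conv by (simp add: L1_converges_def set_integrable_def)
  moreover have "AE z in lborel. indicator S z *\<^sub>R G (a z) = indicator S z *\<^sub>R G (v z)"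
    using v(2) by eventually_elim (auto simp: indicator_def)
  ultimately show "integrable lborel (\<lambda>z. indicator S z *\<^sub>R G (v z))"
    by (subst (asm) integral_lebesgue_eq_lborel(2)[where b="\<lambda>z. indicator S z *\<^sub>R G (v z)"]) auto
  have "(LINT z:S|lebesgue. norm (G (w m z) - G (a z))) = (\<integral>z. norm (indicator S z *\<^sub>R (G (w m z) - G (v z))) \<partial>lborel)" for m
    unfolding set_lebesgue_integral_def
  proof (rule integral_lebesgue_eq_lborel(1))
    show "AE z in lborel. indicator S z *\<^sub>R norm (G (w m z) - G (a z)) = norm (indicator S z *\<^sub>R (G (w m z) - G (v z)))"
      using v(2) by eventually_elim (auto simp: indicator_def)
  qed measurable
  then show "(\<lambda>m. \<integral>z. norm (indicator S z *\<^sub>R (G (w m z) - G (v z))) \<partial>lborel) \<longlonglongrightarrow> 0"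
    using conv by (simp add: L1_converges_def)
qed

text \<open>
  The maximum is over a finite set, so it bounds each quotient; the dual cell of an interior
  face has positive measure.
\<close>

lemma theta_grad_bound:
  assumes "bounded \<Omega>" "open \<Omega>" "is_mesh \<Omega> M" "time_discretization T N t"
    and "theta_grad M \<le> c" and sh: "shared_face M K L \<sigma>"
  shows "surface_measure \<sigma> * norm (point M L - point M K) \<le> c * measure lebesgue (dual M \<sigma>)"
proof -
  interpret mesh_time \<Omega> M T N t by standard fact+
  let ?q = "\<lambda>K L \<sigma>. surface_measure \<sigma> * norm (point M L - point M K) / measure lebesgue (dual M \<sigma>)"
  have "{?q K L \<sigma> | K L \<sigma>. shared_face M K L \<sigma>} \<subseteq> (\<lambda>(K, L, \<sigma>). ?q K L \<sigma>) ` (cells M \<times> cells M \<times> all_faces M)"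
  proof
    fix x assume "x \<in> {?q K L \<sigma> | K L \<sigma>. shared_face M K L \<sigma>}"
    then obtain K L \<sigma> where x: "x = ?q K L \<sigma>" "shared_face M K L \<sigma>" by blast
    then have "(K, L, \<sigma>) \<in> cells M \<times> cells M \<times> all_faces M" by (auto simp: shared_face_def all_faces_def)
    then show "x \<in> (\<lambda>(K, L, \<sigma>). ?q K L \<sigma>) ` (cells M \<times> cells M \<times> all_faces M)"
      by (rule rev_image_eqI) (simp add: x(1))
  qed
  then have fin: "finite {?q K L \<sigma> | K L \<sigma>. shared_face M K L \<sigma>}" by (rule finite_subset) auto
  have "?q K L \<sigma> \<le> theta_grad M"
    unfolding theta_grad_def
  proof (rule Max_ge)
    show "finite (insert 0 {?q K L \<sigma> | K L \<sigma>. shared_face M K L \<sigma>})" using fin by (rule finite.insertI)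
    show "?q K L \<sigma> \<in> insert 0 {?q K L \<sigma> | K L \<sigma>. shared_face M K L \<sigma>}" using sh by (intro insertI2) blast
  qed
  then have "?q K L \<sigma> \<le> c" using assms(5) by simp
  then show ?thesis using shared_dual(2)[OF sh] by (simp add: field_simps)
qed

lemma theta_bound:
  assumes "bounded \<Omega>" "open \<Omega>" "is_mesh \<Omega> M" "time_discretization T N t"
    and "theta M \<le> c" and K: "K \<in> cells M" "\<sigma> \<in> faces M K"
  shows "measure lebesgue (dual M \<sigma>) \<le> c * measure lborel K"
proof -
  interpret mesh_time \<Omega> M T N t by standard fact+
  let ?q = "\<lambda>K \<sigma>. measure lebesgue (dual M \<sigma>) / measure lebesgue K"
  have "{?q K \<sigma> | K \<sigma>. K \<in> cells M \<and> \<sigma> \<in> faces M K} \<subseteq> (\<lambda>(K, \<sigma>). ?q K \<sigma>) ` (cells M \<times> all_faces M)"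
  proof
    fix x assume "x \<in> {?q K \<sigma> | K \<sigma>. K \<in> cells M \<and> \<sigma> \<in> faces M K}"
    then obtain K \<sigma> where x: "x = ?q K \<sigma>" "K \<in> cells M" "\<sigma> \<in> faces M K" by blast
    then have "(K, \<sigma>) \<in> cells M \<times> all_faces M" by (auto simp: all_faces_def)
    then show "x \<in> (\<lambda>(K, \<sigma>). ?q K \<sigma>) ` (cells M \<times> all_faces M)"
      by (rule rev_image_eqI) (simp add: x(1))
  qed
  then have fin: "finite {?q K \<sigma> | K \<sigma>. K \<in> cells M \<and> \<sigma> \<in> faces M K}" by (rule finite_subset) auto
  have "?q K \<sigma> \<le> theta M"
    unfolding theta_def
  proof (rule Max_ge)
    show "finite (insert 0 {?q K \<sigma> | K \<sigma>. K \<in> cells M \<and> \<sigma> \<in> faces M K})" using fin by (rule finite.insertI)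
    show "?q K \<sigma> \<in> insert 0 {?q K \<sigma> | K \<sigma>. K \<in> cells M \<and> \<sigma> \<in> faces M K}" using K by (intro insertI2) blast
  qed
  then have "?q K \<sigma> \<le> c" using assms(5) by simp
  moreover have "measure lebesgue K = measure lborel K" using cell_borel[OF K(1)] by simp
  ultimately show ?thesis using cell_measure_pos[OF K(1)] by (simp add: field_simps)
qed

theorem theorem5p1:
  fixes \<Omega> :: "'a::euclidean_space set"
    and T :: real
    and F :: "real \<Rightarrow> 'a"
    and u0 :: "'a \<Rightarrow> real"
    and M :: "nat \<Rightarrow> 'a mesh"
    and N :: "nat \<Rightarrow> nat"
    and t :: "nat \<Rightarrow> nat \<Rightarrow> real"
    and u :: "nat \<Rightarrow> nat \<Rightarrow> 'a set \<Rightarrow> real"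
    and flux :: "nat \<Rightarrow> nat \<Rightarrow> 'a set \<Rightarrow> 'a"
    and ubar :: "'a \<times> real \<Rightarrow> real"
  assumes "bounded \<Omega>" "open \<Omega>" "polyhedral \<Omega>"
    and "0 < T"
    and "F C1_differentiable_on UNIV"
    and "set_integrable lebesgue \<Omega> u0"
    and "\<And>m. is_mesh \<Omega> (M m)"
    and "\<And>m. time_discretization T (N m) (t m)"
    and "(\<lambda>m. mesh_size (M m)) \<longlonglongrightarrow> 0"
    and "(\<lambda>m. time_step (N m) (t m)) \<longlonglongrightarrow> 0"
    and scheme: "\<And>m K n. K \<in> cells (M m) \<Longrightarrow> n < N m \<Longrightarrow>
      measure lebesgue K / (t m (Suc n) - t m n) * (u m (Suc n) K - u m n K)
        + (\<Sum>\<sigma>\<in>faces (M m) K. surface_measure \<sigma> * (flux m n \<sigma> \<bullet> normal K \<sigma>)) = 0"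
    and initial: "\<And>m K. K \<in> cells (M m) \<Longrightarrow>
      u m 0 K = 1 / measure lebesgue K * (LINT x:K|lebesgue. u0 x)"
    and "L1_converges (\<Omega> \<times> {0<..<T}) (\<lambda>m. step_function (M m) (N m) (t m) (u m)) ubar"
    and i: "L1_converges (\<Omega> \<times> {0<..<T})
      (\<lambda>m z. F (step_function (M m) (N m) (t m) (u m) z)) (\<lambda>z. F (ubar z))"
    and ii: "\<exists>\<theta>g\<ge>0. \<forall>m. theta_grad (M m) \<le> \<theta>g"
    and iii: "\<exists>C\<^sub>F. \<forall>m K L \<sigma> n. shared_face (M m) K L \<sigma> \<longrightarrow> n < N m \<longrightarrow>
      norm (flux m n \<sigma> - F (u m n K)) \<le> C\<^sub>F * \<bar>u m n K - u m n L\<bar> \<and>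
      norm (flux m n \<sigma> - F (u m n L)) \<le> C\<^sub>F * \<bar>u m n K - u m n L\<bar>"
    and iv: "\<exists>\<theta>>0. \<exists>N\<^sub>E. \<forall>m. theta (M m) \<le> \<theta> \<and> (\<forall>K\<in>cells (M m). card (faces (M m) K) \<le> N\<^sub>E)"
  shows "\<forall>\<phi> \<in> smooth_compact_support (\<Omega> \<times> {0..<T}).
    - (LINT s:{0<..<T}|lebesgue. LINT x:\<Omega>|lebesgue.
         ubar (x, s) * deriv (\<lambda>r. \<phi> (x, r)) s
           + F (ubar (x, s)) \<bullet> gradient (\<lambda>y. \<phi> (y, s)) x)
    = (LINT x:\<Omega>|lebesgue. u0 x * \<phi> (x, 0))"
proof
  fix \<phi> assume \<phi>: "\<phi> \<in> smooth_compact_support (\<Omega> \<times> {0..<T})"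
  let ?Q = "\<Omega> \<times> {0<..<T}" and ?u = "\<lambda>m. step_function (M m) (N m) (t m) (u m)"
  note \<Omega> = \<open>bounded \<Omega>\<close> \<open>open \<Omega>\<close> and T = \<open>0 < T\<close> and mesh = assms(7) and td = assms(8)
  note hlim = assms(9) and klim = assms(10)
  have conv: "L1_converges ?Q ?u ubar" using assms(13) by simp
  obtain f e d B \<eta> where tf: "test_function \<Omega> T f e d B \<eta>" and f0: "\<forall>x\<in>\<Omega>. f (x, 0) = \<phi> (x, 0)"
    and ed: "\<forall>x\<in>\<Omega>. \<forall>s\<in>{0<..<T}. deriv (\<lambda>r. \<phi> (x, r)) s = e (x, s) \<and> gradient (\<lambda>y. \<phi> (y, s)) x = d (x, s)"
    using smooth_compact_support_test_function[OF \<Omega> T \<phi>] by blast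
  interpret tf: test_function \<Omega> T f e d B \<eta> by (rule tf)
  have \<Omega>b: "\<Omega> \<in> sets borel" using \<Omega> by simp
  have Fc: "continuous_on UNIV F"
    using C1_differentiable_imp_continuous_on[OF \<open>F C1_differentiable_on UNIV\<close>] .
  have "set_integrable lebesgue ?Q ubar" using conv by (simp add: L1_converges_def)
  then obtain v where v: "v \<in> borel_measurable borel" "\<And>z. z \<notin> ?Q \<Longrightarrow> v z = 0" "AE z in lborel. z \<in> ?Q \<longrightarrow> v z = ubar z"
    using borel_version[OF tf.Q_borel] by blast
  obtain v0 where v0: "v0 \<in> borel_measurable borel" "\<And>x. x \<notin> \<Omega> \<Longrightarrow> v0 x = 0" "AE x in lborel. x \<in> \<Omega> \<longrightarrow> v0 x = u0 x"
    using borel_version[OF \<Omega>b \<open>set_integrable lebesgue \<Omega> u0\<close>] by blast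
  have ub: "?u m \<in> borel_measurable borel" for m
  proof -
    interpret mesh_time \<Omega> "M m" T "N m" "t m" using \<Omega> mesh td by unfold_locales
    show ?thesis by (rule step_function_borel)
  qed
  have id: "continuous_on UNIV (\<lambda>x::real. x)" by (rule continuous_on_id)
  note cu = L1_convergence_borel[OF conv tf.Q_borel id ub v(1,3)]
  note cF = L1_convergence_borel[OF i tf.Q_borel Fc ub v(1,3)]
  have ae0: "AE x in lborel. indicator \<Omega> x * u0 x = v0 x"
    using v0(3) by eventually_elim (use v0(2) in \<open>auto simp: indicator_def\<close>)
  have intv0: "integrable lborel v0"
  proof -
    have "integrable lebesgue (\<lambda>x. indicator \<Omega> x * u0 x)"
      using \<open>set_integrable lebesgue \<Omega> u0\<close> by (simp add: set_integrable_def)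
    then show ?thesis using integral_lebesgue_eq_lborel(2)[OF v0(1) ae0] by simp
  qed
  have init: "measure lborel K * u m 0 K = (\<integral>x. indicator K x * v0 x \<partial>lborel)" if K: "K \<in> cells (M m)" for m K
  proof -
    interpret mesh_time \<Omega> "M m" T "N m" "t m" using \<Omega> mesh td by unfold_locales
    have [measurable]: "K \<in> sets borel" by (rule cell_borel[OF K])
    note [measurable] = v0(1)
    have "(LINT x:K|lebesgue. u0 x) = (\<integral>x. indicator K x * v0 x \<partial>lborel)"
      unfolding set_lebesgue_integral_def
    proof (rule integral_lebesgue_eq_lborel(1))
      show "AE x in lborel. indicator K x *\<^sub>R u0 x = indicator K x * v0 x"
        using ae_partition_AE[OF cells_partition] ae0
      proof eventually_elim
        case (elim x)
        have "x \<in> K \<Longrightarrow> x \<in> \<Omega>" using conjunct1[OF elim(1)] K by blast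
        then show ?case using elim(2) by (auto simp: indicator_def)
      qed
    qed measurable
    then show ?thesis
      using initial[OF K] cell_measure_pos[OF K] by simp
  qed
  have scheme': "measure lborel K / (t m (Suc n) - t m n) * (u m (Suc n) K - u m n K)
        + (\<Sum>\<sigma>\<in>faces (M m) K. surface_measure \<sigma> * (flux m n \<sigma> \<bullet> normal K \<sigma>)) = 0" if K: "K \<in> cells (M m)" and n: "n < N m" for m K n
  proof -
    interpret mesh_time \<Omega> "M m" T "N m" "t m" using \<Omega> mesh td by unfold_locales
    show ?thesis using scheme[OF K n] cell_borel[OF K] by simp
  qed
  obtain \<theta>g where \<theta>g: "0 \<le> \<theta>g" "\<And>m. theta_grad (M m) \<le> \<theta>g" using ii by blast
  obtain C where C: "\<And>m K L \<sigma> n. shared_face (M m) K L \<sigma> \<Longrightarrow> n < N m \<Longrightarrow>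
      norm (flux m n \<sigma> - F (u m n K)) \<le> C * \<bar>u m n K - u m n L\<bar> \<and>
      norm (flux m n \<sigma> - F (u m n L)) \<le> C * \<bar>u m n K - u m n L\<bar>" using iii by blast
  have C': "norm (flux m n \<sigma> - F (u m n K)) \<le> \<bar>C\<bar> * \<bar>u m n K - u m n L\<bar>"
      "norm (flux m n \<sigma> - F (u m n L)) \<le> \<bar>C\<bar> * \<bar>u m n K - u m n L\<bar>" if "shared_face (M m) K L \<sigma>" "n < N m" for m K L \<sigma> n
  proof -
    have "C * \<bar>u m n K - u m n L\<bar> \<le> \<bar>C\<bar> * \<bar>u m n K - u m n L\<bar>" by (intro mult_right_mono) auto
    then show "norm (flux m n \<sigma> - F (u m n K)) \<le> \<bar>C\<bar> * \<bar>u m n K - u m n L\<bar>"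
      "norm (flux m n \<sigma> - F (u m n L)) \<le> \<bar>C\<bar> * \<bar>u m n K - u m n L\<bar>" using C[OF that] by linarith+
  qed
  obtain \<theta> NE where \<theta>: "0 < \<theta>" "\<And>m. theta (M m) \<le> \<theta>" "\<And>m K. K \<in> cells (M m) \<Longrightarrow> card (faces (M m) K) \<le> NE"
    using iv by blast
  have intu: "integrable lborel (\<lambda>z. indicator ?Q z * ?u m z)" for m using cu(1)[of m] by simp
  have intv: "integrable lborel (\<lambda>z. indicator ?Q z * v z)" using cu(2) by simp
  have convu: "(\<lambda>m. \<integral>z. indicator ?Q z * \<bar>?u m z - v z\<bar> \<partial>lborel) \<longlonglongrightarrow> 0"
    using cu(3) by (simp add: abs_mult)
  have lim: "(\<integral>z. indicator ?Q z * (v z * e z) \<partial>lborel) + (\<integral>x. v0 x * f (x, 0) \<partial>lborel)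
      = - (\<integral>z. indicator ?Q z * (d z \<bullet> F (v z)) \<partial>lborel)"
    by (rule tf.weak_limit[OF mesh td hlim klim scheme' intv0 v0(2) init intu intv convu cF
          \<theta>g(1) theta_grad_bound[OF \<Omega> mesh td \<theta>g(2)] abs_ge_zero C' less_imp_le[OF \<theta>(1)] theta_bound[OF \<Omega> mesh td \<theta>(2)] \<theta>(3)])

  show "- (LINT s:{0<..<T}|lebesgue. LINT x:\<Omega>|lebesgue.
         ubar (x, s) * deriv (\<lambda>r. \<phi> (x, r)) s + F (ubar (x, s)) \<bullet> gradient (\<lambda>y. \<phi> (y, s)) x)
    = (LINT x:\<Omega>|lebesgue. u0 x * \<phi> (x, 0))"
  proof -
    let ?A = "\<lambda>z. indicator ?Q z * (v z * e z)" and ?I = "\<lambda>z. indicator ?Q z * (d z \<bullet> F (v z))"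
    have iA: "integrable lborel ?A" and iI: "integrable lborel ?I"
      by (rule tf.integrable_mult_e[OF intv], rule tf.integrable_inner_d[OF cF(2)])
    have "(LINT s:{0<..<T}|lebesgue. LINT x:\<Omega>|lebesgue.
         ubar (x, s) * deriv (\<lambda>r. \<phi> (x, r)) s + F (ubar (x, s)) \<bullet> gradient (\<lambda>y. \<phi> (y, s)) x) = (\<integral>z. ?A z + ?I z \<partial>lborel)"
    proof (rule iterated_lebesgue_integral[OF \<Omega>b Bochner_Integration.integrable_add[OF iA iI]])
      show "AE z in lborel. z \<in> ?Q \<longrightarrow> ubar (fst z, snd z) * deriv (\<lambda>r. \<phi> (fst z, r)) (snd z)
          + F (ubar (fst z, snd z)) \<bullet> gradient (\<lambda>y. \<phi> (y, snd z)) (fst z) = ?A z + ?I z"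
        using v(3)
      proof eventually_elim
        case (elim z)
        show ?case
        proof
          assume z: "z \<in> ?Q"
          obtain x s where xs: "z = (x, s)" "x \<in> \<Omega>" "0 < s" "s < T" using z by auto
          show "ubar (fst z, snd z) * deriv (\<lambda>r. \<phi> (fst z, r)) (snd z)
            + F (ubar (fst z, snd z)) \<bullet> gradient (\<lambda>y. \<phi> (y, snd z)) (fst z) = ?A z + ?I z"
            using elim z ed xs(2-4) by (simp add: xs(1) inner_commute)
        qed
      qed
    qed auto
    also have "\<dots> = (\<integral>z. ?A z \<partial>lborel) + (\<integral>z. ?I z \<partial>lborel)"
      by (rule Bochner_Integration.integral_add[OF iA iI])
    finally have lhs: "(LINT s:{0<..<T}|lebesgue. LINT x:\<Omega>|lebesgue.
         ubar (x, s) * deriv (\<lambda>r. \<phi> (x, r)) s + F (ubar (x, s)) \<bullet> gradient (\<lambda>y. \<phi> (y, s)) x)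
       = (\<integral>z. ?A z \<partial>lborel) + (\<integral>z. ?I z \<partial>lborel)" .
    have "(LINT x:\<Omega>|lebesgue. u0 x * \<phi> (x, 0)) = (\<integral>x. v0 x * f (x, 0) \<partial>lborel)"
      unfolding set_lebesgue_integral_def
    proof (rule integral_lebesgue_eq_lborel(1))
      have "(\<lambda>x. f (x, 0)) \<in> borel_measurable borel"
        using tf.borel(1) by (rule measurable_compose[rotated]) (intro borel_measurable_continuous_onI continuous_intros)
      then show "(\<lambda>x. v0 x * f (x, 0)) \<in> borel_measurable borel" using v0(1) by simp
      show "AE x in lborel. indicator \<Omega> x *\<^sub>R (u0 x * \<phi> (x, 0)) = v0 x * f (x, 0)"
        using ae0
      proof eventually_elim
        case (elim x)
        then show ?case using f0 v0(2)[of x] by (cases "x \<in> \<Omega>") auto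
      qed
    qed
    then show ?thesis using lim lhs by linarith
  qed
qed

end
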